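(* (Full Abstraction.) Let $\sigma$ be a closed type and let $M_1,M_2$ be closed terms of $\mathsf{pCBPV}$ with $\vdash M_1:\sigma$ and $\vdash M_2:\sigma$. If $M_1$ and $M_2$ are observationally equivalent, i.e. for every closed term $C$ with $\vdash C:!\sigma\multimap1$ one has $\mathrm{Red}^\infty_{\langle C\rangle\mathrm{stop}(M_1),()}=\mathrm{Red}^\infty_{\langle C\rangle\mathrm{stop}(M_2),()}$, then $[\![M_1]\!]=[\![M_2]\!]$ (as elements of $\mathrm P[\![\sigma]\!]$).
   Context: PROBABILISTIC COHERENCE SPACES. For a countable set $I$ and $u,u'\in[0,\infty)^I$ put $\langle u,u'\rangle=\sum_{i\in I}u_iu'_i\in[0,\infty]$; for $F\subseteq[0,\infty)^I$ put $F^\perp=\{u'\mid\forall u\in F\ \langle u,u'\rangle\le1\}$. A probabilistic coherence space (PCS) is $X=(|X|,\mathrm P X)$ with $|X|$ countable, $\mathrm PX\subseteq[0,\infty)^{|X|}$, $\mathrm PX^{\perp\perp}=\mathrm PX$, such that for every $a\in|X|$ some $u\in\mathrm PX$ has $u_a>0$ and there is $A>0$ with $u_a\le A$ for all $u\in\mathrm PX$. $X^\perp=(|X|,\mathrm PX^\perp)$. A morphism $t\in\mathbf{Pcoh}(X,Y)$ is a matrix $t\in[0,\infty)^{|X|\times|Y|}$ with $t\cdot u\in\mathrm PY$ for all $u\in\mathrm PX$, where $(t\cdot u)_b=\sum_a t_{a,b}u_a$; composition is matrix product. $1=(\{*\},[0,1])$, and $\mathbf{Pcoh}(1,X)\cong\mathrm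 PX$. Tensor: $|X\otimes Y|=|X|\times|Y|$, $\mathrm P(X\otimes Y)=\{u\otimes v\}^{\perp\perp}$ with $(u\otimes v)_{(a,b)}=u_av_b$; $(s_1\otimes s_2)_{((a_1,a_2),(b_1,b_2))}=(s_1)_{a_1,b_1}(s_2)_{a_2,b_2}$. $X\multimap Y=(X\otimes Y^\perp)^\perp$, with $\mathrm P(X\multimap Y)=\mathbf{Pcoh}(X,Y)$. Norm $\|u\|_X=\sup\{\langle u,u'\rangle\mid u'\in\mathrm PX^\perp\}$. Coproduct: $|X_\ell\oplus X_r|=\{\ell\}\times|X_\ell|\cup\{r\}\times|X_r|$, $u\in\mathrm P(X_\ell\oplus X_r)$ iff $u(i)=(u_{(i,a)})_a\in\mathrm PX_i$ and $\|u(\ell)\|+\|u(r)\|\le1$; injections $(\mathrm{in}_i)_{a',(j,a)}=\delta_{ij}\delta_{aa'}$. Exponential: $|!X|$ = finite multisets on $|X|$; $u^!=(u^b)_b$, $u^b=\prod_au_a^{b(a)}$; $\mathrm P(!X)=\{u^!\mid u\in\mathrm PX\}^{\perp\perp}$; $(!t)_{c,d}=\sum_r\frac{d!}{r!}t^r$ over multisets $r$ on $|X|\times|Y|$ with marginals $c,d$, $b!=\prod_ab(a)!$. $(\mathrm{der}_X)_{b,a}=\delta_{b,[a]}$; $(\mathrm{dig}_X)_{b,[b_1,\dots,b_n]}=\delta_{b,b_1+\dots+b_n}$. A coalgebra is $(X,h)$, $h\in\mathbf{Pcoh}(X,!X)$, $\mathrm{der}\,h=\mathrm{id}$, $\mathrm{dig}\,h=!h\,h$;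 $u$ coalgebraic if $h\cdot u=u^!$. Coalgebras: on $1$, $h_{*,k[*]}=1$; on $!X$, $\mathrm{dig}_X$; on $(X,h_X)\otimes(Y,h_Y)$, $m\circ(h_X\otimes h_Y)$ with $m$ the unique morphism $!X\otimes!Y\to!(X\otimes Y)$ with $m(u^!\otimes v^!)=(u\otimes v)^!$; on $\oplus$, the $h$ with $h\,\mathrm{in}_i=!\mathrm{in}_i\,h_i$. Substructure $X\subseteq Y$: $|X|\subseteq|Y|$, extension by zero maps $\mathrm PX$ into $\mathrm PY$ and restriction maps $\mathrm PY$ into $\mathrm PX$ (for coalgebras also compatible with $h$); directed unions exist. LANGUAGE $\mathsf{pCBPV}$. Positive types $\phi::=1\mid\,!\sigma\mid\phi\otimes\psi\mid\phi\oplus\psi\mid\zeta\mid\mu\zeta.\phi$; general types $\sigma::=\phi\mid\phi\multimap\sigma$. Terms: $x\mid()\mid\mathrm{stop}(M)\mid\langle M,N\rangle\mid\mathrm{in}_iM\mid\lambda x^\phi.M\mid\langle M\rangle N\mid\mathrm{case}(M,x_\ell\cdot N_\ell,x_r\cdot N_r)\mid\mathrm{pr}_iM\mid\mathrm{go}(M)\mid\mathrm{fix}\,x^\sigma.M\mid\mathrm{fold}(M)\mid\mathrm{unfold}(M)\mid\mathrm{coin}(p)$ ($i\in\{\ell,r\}$, $p\in[0,1]\cap\mathbb Q$). Typing in contexts of positive types: variables; $():1$; $\lambda x^\phi.M:\phi\multimap\sigma$ if $M:\sigma$ under $x:\phi$; $\langle M\rangle N:\sigma$ if $M:\phi\multimap\sigma$,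 $N:\phi$; $\mathrm{stop}(M):!\sigma$ if $M:\sigma$; $\mathrm{go}(M):\sigma$ if $M:!\sigma$; $\langle M_\ell,M_r\rangle:\phi_\ell\otimes\phi_r$; $\mathrm{in}_iM:\phi_\ell\oplus\phi_r$ if $M:\phi_i$; $\mathrm{pr}_iM:\phi_i$ if $M:\phi_\ell\otimes\phi_r$; $\mathrm{fix}\,x^\sigma.M:\sigma$ if $M:\sigma$ under $x:!\sigma$; $\mathrm{case}(M,x_\ell\cdot N_\ell,x_r\cdot N_r):\sigma$ if $M:\phi_\ell\oplus\phi_r$ and $N_i:\sigma$ under $x_i:\phi_i$; $\mathrm{coin}(p):1\oplus1$; $\mathrm{fold}:\psi[\mu\zeta.\psi/\zeta]\to\mu\zeta.\psi$, $\mathrm{unfold}$ conversely. Values $V::=x\mid()\mid\mathrm{stop}(M)\mid\langle V,W\rangle\mid\mathrm{in}_iV\mid\mathrm{fold}(V)$. Weak reduction: $\mathrm{go}(\mathrm{stop}(M))\rightsquigarrow M$; $\langle\lambda x.M\rangle V\rightsquigarrow M[V/x]$; $\mathrm{pr}_i\langle V_\ell,V_r\rangle\rightsquigarrow V_i$; $\mathrm{fix}\,x^\sigma.M\rightsquigarrow M[\mathrm{stop}(\mathrm{fix}\,x^\sigma.M)/x]$; $\mathrm{case}(\mathrm{in}_iV,\dots)\rightsquigarrow M_i[V/x_i]$; $\mathrm{unfold}(\mathrm{fold}(V))\rightsquigarrow V$. Probabilistic steps: $M\rightsquigarrow M'$ gives $M\to_1M'$; $\mathrm{coin}(p)\to_p\mathrm{in}_\ell()$,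 $\mathrm{coin}(p)\to_{1-p}\mathrm{in}_r()$; closure under evaluation contexts $\mathrm{go}(\cdot)$, $\langle\cdot\rangle V$ ($V$ value), $\langle N\rangle\cdot$, $\mathrm{pr}_i(\cdot)$, $\langle\cdot,N\rangle$, $\langle V,\cdot\rangle$, $\mathrm{in}_i(\cdot)$, $\mathrm{case}(\cdot,\dots)$, $\mathrm{fold}(\cdot)$, $\mathrm{unfold}(\cdot)$. $\mathrm{Red}_{M,M'}=p$ if $M\to_pM'$, $1$ if $M$ has no reduct and $M'=M$, $0$ otherwise; $\mathrm{Red}^\infty_{M,M'}=\sup_n(\mathrm{Red}^n)_{M,M'}$ when $M'$ has no reduct, else $0$. SEMANTICS. Closed positive types are interpreted as coalgebras $([\![\phi]\!],h_\phi)$ built from the coalgebras above, $[\![\phi\multimap\sigma]\!]=[\![\phi]\!]\multimap[\![\sigma]\!]$, and $[\![\mu\zeta.\phi]\!]$ is the $\subseteq$-least fixpoint (union of the chain $F^n(\emptyset)$), so $[\![\mu\zeta.\phi]\!]=[\![\phi[\mu\zeta.\phi/\zeta]]\!]$. For $x_1:\phi_1,\dots,x_k:\phi_k\vdash M:\sigma$, $[\![M]\!]\in\mathbf{Pcoh}(\bigotimes[\![\phi_i]\!],[\![\sigma]\!])$ is determined on $\vec u=u_1\otimes\dots\otimes u_k$ ($u_i$ coalgebraic) by: $[\![()]\!]=1$; $[\![x_i]\!](\vec u)=u_i$; $[\![\mathrm{stop}(N)]\!](\vec u)=([\![N]\!](\vec u))^!$; pairs $\mapsto$ tensor of values; $[\![\mathrm{in}_iN]\!]=\mathrm{in}_i[\![N]\!]$;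 $[\![\mathrm{go}(N)]\!]=\mathrm{der}\cdot[\![N]\!]$; $[\![\langle N\rangle R]\!](\vec u)=[\![N]\!](\vec u)\cdot[\![R]\!](\vec u)$; $[\![\lambda x.N]\!](\vec u)$ is the $t$ with $t\cdot v=[\![N]\!](\vec u\otimes v)$ for coalgebraic $v$; $[\![\mathrm{case}(N,y_\ell\cdot R_\ell,y_r\cdot R_r)]\!](\vec u)=\sum_i[\![R_i]\!](\vec u\otimes\rho_i[\![N]\!](\vec u))$, $(\rho_i)_{(j,a),b}=\delta_{ij}\delta_{ab}$; $[\![\mathrm{pr}_iN]\!]=\pi_i\cdot[\![N]\!]$ with $(\pi_\ell)_{(a,b),a'}=\delta_{aa'}(h_{\phi_r})_{b,[]}$ (symmetrically $\pi_r$); $[\![\mathrm{fix}\,x.N]\!](\vec u)=\sup_nf^n(0)$, $f(w)=[\![N]\!](\vec u\otimes w^!)$; fold/unfold are identities; $[\![\mathrm{coin}(p)]\!]=pe_{(\ell,* )}+(1-p)e_{(r,* )}$. For closed $M$, $[\![M]\!]\in\mathrm P[\![\sigma]\!]$. *)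

theory Defs
  imports "HOL-Analysis.Analysis" "HOL-Library.Multiset"
begin

section \<open>Vectors, matrices and probabilistic coherence spaces\<close>

datatype side = Lft | Rgt

primrec sel :: "side \<Rightarrow> 'a \<Rightarrow> 'a \<Rightarrow> 'a" where
  "sel Lft x y = x"
| "sel Rgt x y = y"

text \<open>All webs are subsets of one universal (countable) type of points, so that the
  substructure order and the unions interpreting recursive types can be taken literally.
  Points of \<open>X \<multimap> Y\<close> are pairs, as \<open>|X \<multimap> Y| = |X| \<times> |Y|\<close>.\<close>

datatype pt = PStar | PPair pt pt | PIn side pt | PBag "pt multiset"

text \<open>A vector of \<open>[0,\<infinity>)\<^sup>W\<close> is represented by its extension by zero to all points, see \<open>vecs\<close>;
  likewise a matrix vanishes outside the webs of its source and target. Values are taken in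
  \<open>ennreal\<close> so that sums, written as integrals for the counting measure, always exist.\<close>

type_synonym vec = "pt \<Rightarrow> ennreal"
type_synonym mat = "pt \<Rightarrow> pt \<Rightarrow> ennreal"

definition vecs :: "pt set \<Rightarrow> vec set" where
  "vecs W = {u. (\<forall>a\<in>W. u a < \<infinity>) \<and> (\<forall>a. a \<notin> W \<longrightarrow> u a = 0)}"

definition restr :: "pt set \<Rightarrow> vec \<Rightarrow> vec" where
  "restr W u = (\<lambda>a. if a \<in> W then u a else 0)"

definition basis :: "pt \<Rightarrow> vec" where
  "basis a = (\<lambda>b. if b = a then 1 else 0)"

definition pairing :: "vec \<Rightarrow> vec \<Rightarrow> ennreal" where
  "pairing u u' = (\<integral>\<^sup>+ a. u a * u' a \<partial>count_space UNIV)"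

definition orth :: "pt set \<Rightarrow> vec set \<Rightarrow> vec set" where
  "orth W F = {u' \<in> vecs W. \<forall>u\<in>F. pairing u u' \<le> 1}"

definition mapp :: "mat \<Rightarrow> vec \<Rightarrow> vec"  (infixr \<open>\<bullet>\<^sub>v\<close> 75) where
  "t \<bullet>\<^sub>v u = (\<lambda>b. \<integral>\<^sup>+ a. t a b * u a \<partial>count_space UNIV)"

definition mcomp :: "mat \<Rightarrow> mat \<Rightarrow> mat"  (infixr \<open>\<odot>\<close> 75) where
  "s \<odot> t = (\<lambda>a c. \<integral>\<^sup>+ b. t a b * s b c \<partial>count_space UNIV)"

record pcs =
  web :: "pt set"
  pts :: "vec set"

definition dual :: "pcs \<Rightarrow> pcs" where
  "dual X = \<lparr>web = web X, pts = orth (web X) (pts X)\<rparr>"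

definition pnorm :: "pcs \<Rightarrow> vec \<Rightarrow> ennreal" where
  "pnorm X u = (SUP u' \<in> pts (dual X). pairing u u')"

definition id_mat :: "pcs \<Rightarrow> mat" where
  "id_mat X = (\<lambda>a b. if a = b \<and> a \<in> web X then 1 else 0)"

definition one_pcs :: pcs where
  "one_pcs = \<lparr>web = {PStar}, pts = {u \<in> vecs {PStar}. u PStar \<le> 1}\<rparr>"

definition vtensor :: "vec \<Rightarrow> vec \<Rightarrow> vec"  (infixr \<open>\<otimes>\<^sub>v\<close> 77) where
  "u \<otimes>\<^sub>v v = (\<lambda>x. case x of PPair a b \<Rightarrow> u a * v b | _ \<Rightarrow> 0)"

definition mtensor :: "mat \<Rightarrow> mat \<Rightarrow> mat"  (infixr \<open>\<otimes>\<^sub>m\<close> 77) where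
  "s \<otimes>\<^sub>m t = (\<lambda>x y. case x of PPair a1 a2 \<Rightarrow>
      (case y of PPair b1 b2 \<Rightarrow> s a1 b1 * t a2 b2 | _ \<Rightarrow> 0) | _ \<Rightarrow> 0)"

definition tensor_pcs :: "pcs \<Rightarrow> pcs \<Rightarrow> pcs" where
  "tensor_pcs X Y = (let W = {PPair a b | a b. a \<in> web X \<and> b \<in> web Y} in
     \<lparr>web = W, pts = orth W (orth W {u \<otimes>\<^sub>v v | u v. u \<in> pts X \<and> v \<in> pts Y})\<rparr>)"

definition lolli_pcs :: "pcs \<Rightarrow> pcs \<Rightarrow> pcs" where
  "lolli_pcs X Y = dual (tensor_pcs X (dual Y))"

definition plus_pcs :: "pcs \<Rightarrow> pcs \<Rightarrow> pcs" where
  "plus_pcs X Y = (let W = PIn Lft ` web X \<union> PIn Rgt ` web Y in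
     \<lparr>web = W,
      pts = {u \<in> vecs W. (\<lambda>a. u (PIn Lft a)) \<in> pts X \<and> (\<lambda>a. u (PIn Rgt a)) \<in> pts Y
               \<and> pnorm X (\<lambda>a. u (PIn Lft a)) + pnorm Y (\<lambda>a. u (PIn Rgt a)) \<le> 1}\<rparr>)"

definition in_mat :: "pcs \<Rightarrow> side \<Rightarrow> mat" where
  "in_mat X i = (\<lambda>a b. if a \<in> web X \<and> b = PIn i a then 1 else 0)"

definition rho_mat :: "pcs \<Rightarrow> side \<Rightarrow> mat" where
  "rho_mat X i = (\<lambda>b a. if a \<in> web X \<and> b = PIn i a then 1 else 0)"


section \<open>The exponential\<close>

definition mpow :: "('a \<Rightarrow> ennreal) \<Rightarrow> 'a multiset \<Rightarrow> ennreal" where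
  "mpow u b = (\<Prod>a\<in>set_mset b. u a ^ count b a)"

definition mfact :: "'a multiset \<Rightarrow> nat" where
  "mfact b = (\<Prod>a\<in>set_mset b. fact (count b a))"

definition prom :: "vec \<Rightarrow> vec" where
  "prom u = (\<lambda>x. case x of PBag b \<Rightarrow> mpow u b | _ \<Rightarrow> 0)"

definition bang_pcs :: "pcs \<Rightarrow> pcs" where
  "bang_pcs X = (let W = {PBag b | b. set_mset b \<subseteq> web X} in
     \<lparr>web = W, pts = orth W (orth W (prom ` pts X))\<rparr>)"

definition bang_coeff :: "mat \<Rightarrow> pt multiset \<Rightarrow> pt multiset \<Rightarrow> ennreal" where
  "bang_coeff t c d =
     (\<integral>\<^sup>+ r. ennreal (real (mfact d) / real (mfact r)) * mpow (\<lambda>(a, b). t a b) r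
        \<partial>count_space {r. image_mset fst r = c \<and> image_mset snd r = d})"

definition bang_mat :: "mat \<Rightarrow> mat" where
  "bang_mat t = (\<lambda>x y. case x of PBag c \<Rightarrow>
      (case y of PBag d \<Rightarrow> bang_coeff t c d | _ \<Rightarrow> 0) | _ \<Rightarrow> 0)"

definition der_mat :: "pcs \<Rightarrow> mat" where
  "der_mat X = (\<lambda>x a. if a \<in> web X \<and> x = PBag {#a#} then 1 else 0)"

definition dig_mat :: "pcs \<Rightarrow> mat" where
  "dig_mat X = (\<lambda>x y. if \<exists>B. set_mset (\<Sum>\<^sub># B) \<subseteq> web X
      \<and> x = PBag (\<Sum>\<^sub># B) \<and> y = PBag (image_mset PBag B) then 1 else 0)"

text \<open>The morphism \<open>m\<close> from \<open>!X \<otimes> !Y\<close> to \<open>!(X \<otimes> Y)\<close>: since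
  \<open>(u \<otimes> v)\<^sup>r = u\<^sup>b v\<^sup>c\<close> with \<open>b, c\<close> the two marginals of \<open>r\<close>, the matrix of \<open>m\<close> is \<open>1\<close> at
  \<open>((b, c), r)\<close> for these \<open>b, c\<close> and \<open>0\<close> elsewhere; see \<open>mon_mat_prom\<close> below.\<close>

definition mon_mat :: "pcs \<Rightarrow> pcs \<Rightarrow> mat" where
  "mon_mat X Y = (\<lambda>x y. if \<exists>r. set_mset r \<subseteq> web X \<times> web Y
      \<and> x = PPair (PBag (image_mset fst r)) (PBag (image_mset snd r))
      \<and> y = PBag (image_mset (\<lambda>(a, b). PPair a b) r) then 1 else 0)"


section \<open>Coalgebras\<close>

record coalg =
  car :: pcs
  str :: mat

definition coalgebraic :: "coalg \<Rightarrow> vec \<Rightarrow> bool" where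
  "coalgebraic A u \<longleftrightarrow> u \<in> pts (car A) \<and> str A \<bullet>\<^sub>v u = prom u"

definition empty_coalg :: coalg where
  "empty_coalg = \<lparr>car = \<lparr>web = {}, pts = vecs {}\<rparr>, str = (\<lambda>_ _. 0)\<rparr>"

definition one_coalg :: coalg where
  "one_coalg = \<lparr>car = one_pcs,
     str = (\<lambda>a x. if a = PStar \<and> (\<exists>k. x = PBag (replicate_mset k PStar)) then 1 else 0)\<rparr>"

definition bang_coalg :: "pcs \<Rightarrow> coalg" where
  "bang_coalg X = \<lparr>car = bang_pcs X, str = dig_mat X\<rparr>"

definition tensor_coalg :: "coalg \<Rightarrow> coalg \<Rightarrow> coalg" where
  "tensor_coalg A B = \<lparr>car = tensor_pcs (car A) (car B),
     str = mon_mat (car A) (car B) \<odot> (str A \<otimes>\<^sub>m str B)\<rparr>"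

text \<open>The row of \<open>h\<close> at \<open>(i, a)\<close> is the row of \<open>h in\<^sub>i\<close> at \<open>a\<close>.\<close>

definition plus_coalg :: "coalg \<Rightarrow> coalg \<Rightarrow> coalg" where
  "plus_coalg A B = \<lparr>car = plus_pcs (car A) (car B),
     str = (\<lambda>x y. case x of
         PIn i a \<Rightarrow> (let C = sel i A B in (bang_mat (in_mat (car C) i) \<odot> str C) a y)
       | _ \<Rightarrow> 0)\<rparr>"

text \<open>Union of a chain for the substructure order. A vector belongs to the union iff all its
  restrictions belong to the components. Along the chain, an entry of the structure map at
  \<open>(a, b)\<close> is \<open>0\<close> until \<open>a\<close> enters the web and constant from then on, so the union of these
  matrices is their supremum.\<close>

definition union_coalg :: "(nat \<Rightarrow> coalg) \<Rightarrow> coalg" where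
  "union_coalg A = (let W = (\<Union>n. web (car (A n))) in
     \<lparr>car = \<lparr>web = W,
        pts = {u \<in> vecs W. \<forall>n. restr (web (car (A n))) u \<in> pts (car (A n))}\<rparr>,
      str = (\<lambda>x y. SUP n. str (A n) x y)\<rparr>)"


section \<open>Types\<close>

text \<open>Type variables are de Bruijn indices; \<open>Mu\<close> binds index \<open>0\<close>.\<close>

datatype pty = One | Bang gty | Tensor pty pty | Plus pty pty | TVar nat | Mu pty
  and gty = Pos pty | Lolli pty gty

primrec pbound :: "nat \<Rightarrow> pty \<Rightarrow> bool" and gbound :: "nat \<Rightarrow> gty \<Rightarrow> bool" where
  "pbound k One = True"
| "pbound k (Bang \<sigma>) = gbound k \<sigma>"
| "pbound k (Tensor \<phi> \<psi>) = (pbound k \<phi> \<and> pbound k \<psi>)"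
| "pbound k (Plus \<phi> \<psi>) = (pbound k \<phi> \<and> pbound k \<psi>)"
| "pbound k (TVar n) = (n < k)"
| "pbound k (Mu \<phi>) = pbound (Suc k) \<phi>"
| "gbound k (Pos \<phi>) = pbound k \<phi>"
| "gbound k (Lolli \<phi> \<sigma>) = (pbound k \<phi> \<and> gbound k \<sigma>)"

abbreviation pclosed :: "pty \<Rightarrow> bool" where "pclosed \<equiv> pbound 0"
abbreviation gclosed :: "gty \<Rightarrow> bool" where "gclosed \<equiv> gbound 0"

primrec plift :: "nat \<Rightarrow> pty \<Rightarrow> pty" and glift :: "nat \<Rightarrow> gty \<Rightarrow> gty" where
  "plift k One = One"
| "plift k (Bang \<sigma>) = Bang (glift k \<sigma>)"
| "plift k (Tensor \<phi> \<psi>) = Tensor (plift k \<phi>) (plift k \<psi>)"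
| "plift k (Plus \<phi> \<psi>) = Plus (plift k \<phi>) (plift k \<psi>)"
| "plift k (TVar n) = TVar (if n < k then n else Suc n)"
| "plift k (Mu \<phi>) = Mu (plift (Suc k) \<phi>)"
| "glift k (Pos \<phi>) = Pos (plift k \<phi>)"
| "glift k (Lolli \<phi> \<sigma>) = Lolli (plift k \<phi>) (glift k \<sigma>)"

primrec psubst :: "pty \<Rightarrow> nat \<Rightarrow> pty \<Rightarrow> pty" and gsubst :: "gty \<Rightarrow> nat \<Rightarrow> pty \<Rightarrow> gty" where
  "psubst One k \<theta> = One"
| "psubst (Bang \<sigma>) k \<theta> = Bang (gsubst \<sigma> k \<theta>)"
| "psubst (Tensor \<phi> \<psi>) k \<theta> = Tensor (psubst \<phi> k \<theta>) (psubst \<psi> k \<theta>)"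
| "psubst (Plus \<phi> \<psi>) k \<theta> = Plus (psubst \<phi> k \<theta>) (psubst \<psi> k \<theta>)"
| "psubst (TVar n) k \<theta> = (if n < k then TVar n else if n = k then \<theta> else TVar (n - 1))"
| "psubst (Mu \<phi>) k \<theta> = Mu (psubst \<phi> (Suc k) (plift 0 \<theta>))"
| "gsubst (Pos \<phi>) k \<theta> = Pos (psubst \<phi> k \<theta>)"
| "gsubst (Lolli \<phi> \<sigma>) k \<theta> = Lolli (psubst \<phi> k \<theta>) (gsubst \<sigma> k \<theta>)"

primrec pinterp :: "pty \<Rightarrow> (nat \<Rightarrow> coalg) \<Rightarrow> coalg"
    and ginterp :: "gty \<Rightarrow> (nat \<Rightarrow> coalg) \<Rightarrow> pcs" where
  "pinterp One \<rho> = one_coalg"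
| "pinterp (Bang \<sigma>) \<rho> = bang_coalg (ginterp \<sigma> \<rho>)"
| "pinterp (Tensor \<phi> \<psi>) \<rho> = tensor_coalg (pinterp \<phi> \<rho>) (pinterp \<psi> \<rho>)"
| "pinterp (Plus \<phi> \<psi>) \<rho> = plus_coalg (pinterp \<phi> \<rho>) (pinterp \<psi> \<rho>)"
| "pinterp (TVar n) \<rho> = \<rho> n"
| "pinterp (Mu \<phi>) \<rho> =
     union_coalg (\<lambda>n. ((\<lambda>A. pinterp \<phi> (case_nat A \<rho>)) ^^ n) empty_coalg)"
| "ginterp (Pos \<phi>) \<rho> = car (pinterp \<phi> \<rho>)"
| "ginterp (Lolli \<phi> \<sigma>) \<rho> = lolli_pcs (car (pinterp \<phi> \<rho>)) (ginterp \<sigma> \<rho>)"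

text \<open>Closed types do not depend on the valuation.\<close>

definition psem :: "pty \<Rightarrow> coalg" where "psem \<phi> = pinterp \<phi> (\<lambda>_. empty_coalg)"
definition gsem :: "gty \<Rightarrow> pcs" where "gsem \<sigma> = ginterp \<sigma> (\<lambda>_. empty_coalg)"


section \<open>Terms, typing and reduction\<close>

text \<open>Term variables are de Bruijn indices: \<open>Lam\<close> and \<open>Fix\<close> bind index \<open>0\<close> in their body,
  \<open>Case\<close> binds index \<open>0\<close> in each of its two branches.\<close>

datatype tm = Var nat | Unit | Stop tm | MkPair tm tm | In side tm | Lam pty tm | App tm tm
  | Case tm tm tm | Pr side tm | Go tm | Fix gty tm | Fold tm | Unfold tm | Coin rat

primrec lift :: "nat \<Rightarrow> tm \<Rightarrow> tm" where
  "lift k (Var n) = Var (if n < k then n else Suc n)"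
| "lift k Unit = Unit"
| "lift k (Stop M) = Stop (lift k M)"
| "lift k (MkPair M N) = MkPair (lift k M) (lift k N)"
| "lift k (In i M) = In i (lift k M)"
| "lift k (Lam \<phi> M) = Lam \<phi> (lift (Suc k) M)"
| "lift k (App M N) = App (lift k M) (lift k N)"
| "lift k (Case M Nl Nr) = Case (lift k M) (lift (Suc k) Nl) (lift (Suc k) Nr)"
| "lift k (Pr i M) = Pr i (lift k M)"
| "lift k (Go M) = Go (lift k M)"
| "lift k (Fix \<sigma> M) = Fix \<sigma> (lift (Suc k) M)"
| "lift k (Fold M) = Fold (lift k M)"
| "lift k (Unfold M) = Unfold (lift k M)"
| "lift k (Coin p) = Coin p"

primrec subst :: "tm \<Rightarrow> nat \<Rightarrow> tm \<Rightarrow> tm" where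
  "subst (Var n) k P = (if n < k then Var n else if n = k then P else Var (n - 1))"
| "subst Unit k P = Unit"
| "subst (Stop M) k P = Stop (subst M k P)"
| "subst (MkPair M N) k P = MkPair (subst M k P) (subst N k P)"
| "subst (In i M) k P = In i (subst M k P)"
| "subst (Lam \<phi> M) k P = Lam \<phi> (subst M (Suc k) (lift 0 P))"
| "subst (App M N) k P = App (subst M k P) (subst N k P)"
| "subst (Case M Nl Nr) k P =
     Case (subst M k P) (subst Nl (Suc k) (lift 0 P)) (subst Nr (Suc k) (lift 0 P))"
| "subst (Pr i M) k P = Pr i (subst M k P)"
| "subst (Go M) k P = Go (subst M k P)"
| "subst (Fix \<sigma> M) k P = Fix \<sigma> (subst M (Suc k) (lift 0 P))"
| "subst (Fold M) k P = Fold (subst M k P)"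
| "subst (Unfold M) k P = Unfold (subst M k P)"
| "subst (Coin p) k P = Coin p"

text \<open>Types occurring in a typing derivation are closed. The constraint on the parameter of a
  coin is imposed by its typing rule.\<close>

inductive typing :: "pty list \<Rightarrow> tm \<Rightarrow> gty \<Rightarrow> bool"  (\<open>_ \<turnstile> _ : _\<close> [51, 51, 51] 50) where
  t_var: "n < length \<Gamma> \<Longrightarrow> \<Gamma> \<turnstile> Var n : Pos (\<Gamma> ! n)"
| t_unit: "\<Gamma> \<turnstile> Unit : Pos One"
| t_stop: "\<Gamma> \<turnstile> M : \<sigma> \<Longrightarrow> \<Gamma> \<turnstile> Stop M : Pos (Bang \<sigma>)"
| t_pair: "\<Gamma> \<turnstile> M : Pos \<phi> \<Longrightarrow> \<Gamma> \<turnstile> N : Pos \<psi> \<Longrightarrow> \<Gamma> \<turnstile> MkPair M N : Pos (Tensor \<phi> \<psi>)"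
| t_in: "\<Gamma> \<turnstile> M : Pos (sel i \<phi> \<psi>) \<Longrightarrow> pclosed \<phi> \<Longrightarrow> pclosed \<psi> \<Longrightarrow> \<Gamma> \<turnstile> In i M : Pos (Plus \<phi> \<psi>)"
| t_lam: "\<phi> # \<Gamma> \<turnstile> M : \<sigma> \<Longrightarrow> pclosed \<phi> \<Longrightarrow> \<Gamma> \<turnstile> Lam \<phi> M : Lolli \<phi> \<sigma>"
| t_app: "\<Gamma> \<turnstile> M : Lolli \<phi> \<sigma> \<Longrightarrow> \<Gamma> \<turnstile> N : Pos \<phi> \<Longrightarrow> \<Gamma> \<turnstile> App M N : \<sigma>"
| t_case: "\<Gamma> \<turnstile> M : Pos (Plus \<phi> \<psi>) \<Longrightarrow> \<phi> # \<Gamma> \<turnstile> Nl : \<sigma> \<Longrightarrow> \<psi> # \<Gamma> \<turnstile> Nr : \<sigma> \<Longrightarrow>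
    \<Gamma> \<turnstile> Case M Nl Nr : \<sigma>"
| t_pr: "\<Gamma> \<turnstile> M : Pos (Tensor \<phi> \<psi>) \<Longrightarrow> \<Gamma> \<turnstile> Pr i M : Pos (sel i \<phi> \<psi>)"
| t_go: "\<Gamma> \<turnstile> M : Pos (Bang \<sigma>) \<Longrightarrow> \<Gamma> \<turnstile> Go M : \<sigma>"
| t_fix: "Bang \<sigma> # \<Gamma> \<turnstile> M : \<sigma> \<Longrightarrow> gclosed \<sigma> \<Longrightarrow> \<Gamma> \<turnstile> Fix \<sigma> M : \<sigma>"
| t_fold: "\<Gamma> \<turnstile> M : Pos (psubst \<phi> 0 (Mu \<phi>)) \<Longrightarrow> pclosed (Mu \<phi>) \<Longrightarrow> \<Gamma> \<turnstile> Fold M : Pos (Mu \<phi>)"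
| t_unfold: "\<Gamma> \<turnstile> M : Pos (Mu \<phi>) \<Longrightarrow> \<Gamma> \<turnstile> Unfold M : Pos (psubst \<phi> 0 (Mu \<phi>))"
| t_coin: "0 \<le> p \<Longrightarrow> p \<le> 1 \<Longrightarrow> \<Gamma> \<turnstile> Coin p : Pos (Plus One One)"

inductive is_value :: "tm \<Rightarrow> bool" where
  "is_value (Var n)"
| "is_value Unit"
| "is_value (Stop M)"
| "is_value V \<Longrightarrow> is_value W \<Longrightarrow> is_value (MkPair V W)"
| "is_value V \<Longrightarrow> is_value (In i V)"
| "is_value V \<Longrightarrow> is_value (Fold V)"

inductive weak_red :: "tm \<Rightarrow> tm \<Rightarrow> bool" where
  "weak_red (Go (Stop M)) M"
| "is_value V \<Longrightarrow> weak_red (App (Lam \<phi> M) V) (subst M 0 V)"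
| "is_value V \<Longrightarrow> is_value W \<Longrightarrow> weak_red (Pr i (MkPair V W)) (sel i V W)"
| "weak_red (Fix \<sigma> M) (subst M 0 (Stop (Fix \<sigma> M)))"
| "is_value V \<Longrightarrow> weak_red (Case (In i V) Nl Nr) (subst (sel i Nl Nr) 0 V)"
| "is_value V \<Longrightarrow> weak_red (Unfold (Fold V)) V"

inductive prob_step :: "tm \<Rightarrow> rat \<Rightarrow> tm \<Rightarrow> bool" where
  "weak_red M M' \<Longrightarrow> prob_step M 1 M'"
| "prob_step (Coin p) p (In Lft Unit)"
| "prob_step (Coin p) (1 - p) (In Rgt Unit)"
| "prob_step M p M' \<Longrightarrow> prob_step (Go M) p (Go M')"
| "prob_step M p M' \<Longrightarrow> is_value V \<Longrightarrow> prob_step (App M V) p (App M' V)"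
| "prob_step M p M' \<Longrightarrow> prob_step (App N M) p (App N M')"
| "prob_step M p M' \<Longrightarrow> prob_step (Pr i M) p (Pr i M')"
| "prob_step M p M' \<Longrightarrow> prob_step (MkPair M N) p (MkPair M' N)"
| "prob_step M p M' \<Longrightarrow> is_value V \<Longrightarrow> prob_step (MkPair V M) p (MkPair V M')"
| "prob_step M p M' \<Longrightarrow> prob_step (In i M) p (In i M')"
| "prob_step M p M' \<Longrightarrow> prob_step (Case M Nl Nr) p (Case M' Nl Nr)"
| "prob_step M p M' \<Longrightarrow> prob_step (Fold M) p (Fold M')"
| "prob_step M p M' \<Longrightarrow> prob_step (Unfold M) p (Unfold M')"

lemma value_no_reduct: "is_value V \<Longrightarrow> \<not> prob_step V p M'"
  by (induction V arbitrary: p M' rule: is_value.induct)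
     (auto elim!: prob_step.cases[of "Var _"] prob_step.cases[of Unit] prob_step.cases[of "Stop _"]
       prob_step.cases[of "MkPair _ _"] prob_step.cases[of "In _ _"] prob_step.cases[of "Fold _"]
       elim: weak_red.cases)

lemma Lam_no_reduct: "\<not> prob_step (Lam \<phi> M) p M'"
  by (auto elim: prob_step.cases weak_red.cases)

lemma weak_redD:
  "weak_red (Go M) N \<Longrightarrow> is_value M"
  "weak_red (Pr i M) N \<Longrightarrow> is_value M"
  "weak_red (Case M Nl Nr) N \<Longrightarrow> is_value M"
  "weak_red (Unfold M) N \<Longrightarrow> is_value M"
  "weak_red (App M V) N \<Longrightarrow> is_value V \<and> (\<exists>\<phi> M'. M = Lam \<phi> M')"
  "\<not> weak_red (MkPair V W) N" "\<not> weak_red (In i V) N" "\<not> weak_red (Fold V) N"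
  by (auto elim!: weak_red.cases intro: is_value.intros)

lemma prob_step_AppD:
  "prob_step (App M N) q (App M' N') \<Longrightarrow>
    is_value N \<and> (\<exists>\<phi> L. M = Lam \<phi> L) \<or> is_value N \<and> N' = N \<and> prob_step M q M' \<or> M' = M \<and> prob_step N q N'"
  by (erule prob_step.cases) (auto dest: weak_redD(5))

lemma prob_step_PairD:
  "prob_step (MkPair M N) q (MkPair M' N') \<Longrightarrow>
    N' = N \<and> prob_step M q M' \<or> is_value M \<and> M' = M \<and> prob_step N q N'"
  by (erule prob_step.cases) (auto simp: weak_redD(6))

lemma prob_step_unique: "prob_step M p M' \<Longrightarrow> prob_step M q M' \<Longrightarrow> p = q"
proof (induction M p M' arbitrary: q rule: prob_step.induct)
  case (1 M M')
  then show ?case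
    by (cases rule: weak_red.cases)
       (auto elim!: prob_step.cases[of "Go _"] prob_step.cases[of "App _ _"] prob_step.cases[of "Pr _ _"]
        prob_step.cases[of "Fix _ _"] prob_step.cases[of "Case _ _ _"] prob_step.cases[of "Unfold _"]
        simp: value_no_reduct Lam_no_reduct is_value.intros)
next
  case (2 p) then show ?case by (auto elim: prob_step.cases[of "Coin _"] weak_red.cases)
next
  case (3 p) then show ?case by (auto elim: prob_step.cases[of "Coin _"] weak_red.cases)
next
  case (4 M p M')
  from 4(3) show ?case
    by (cases rule: prob_step.cases)
       (use 4(1) in \<open>auto dest!: weak_redD(1-5) intro: 4(2)
          simp: value_no_reduct Lam_no_reduct weak_redD(6-8)\<close>)
next
  case (5 M p M' V)
  show ?case using 5 value_no_reduct Lam_no_reduct prob_step_AppD by metis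
next
  case (6 M p M' N)
  show ?case using 6 value_no_reduct Lam_no_reduct prob_step_AppD by metis
next
  case (7 M p M' i)
  from 7(3) show ?case
    by (cases rule: prob_step.cases)
       (use 7(1) in \<open>auto dest!: weak_redD(1-5) intro: 7(2)
          simp: value_no_reduct Lam_no_reduct weak_redD(6-8)\<close>)
next
  case (8 M p M' N)
  show ?case using 8 value_no_reduct Lam_no_reduct prob_step_PairD by metis
next
  case (9 M p M' V)
  show ?case using 9 value_no_reduct Lam_no_reduct prob_step_PairD by metis
next
  case (10 M p M' i)
  from 10(3) show ?case
    by (cases rule: prob_step.cases)
       (use 10(1) in \<open>auto dest!: weak_redD(1-5) intro: 10(2)
          simp: value_no_reduct Lam_no_reduct weak_redD(6-8)\<close>)
next
  case (11 M p M' Nl Nr)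
  from 11(3) show ?case
    by (cases rule: prob_step.cases)
       (use 11(1) in \<open>auto dest!: weak_redD(1-5) intro: 11(2)
          simp: value_no_reduct Lam_no_reduct weak_redD(6-8)\<close>)
next
  case (12 M p M')
  from 12(3) show ?case
    by (cases rule: prob_step.cases)
       (use 12(1) in \<open>auto dest!: weak_redD(1-5) intro: 12(2)
          simp: value_no_reduct Lam_no_reduct weak_redD(6-8)\<close>)
next
  case (13 M p M')
  from 13(3) show ?case
    by (cases rule: prob_step.cases)
       (use 13(1) in \<open>auto dest!: weak_redD(1-5) intro: 13(2)
          simp: value_no_reduct Lam_no_reduct weak_redD(6-8)\<close>)
qed

definition no_reduct :: "tm \<Rightarrow> bool" where
  "no_reduct M \<longleftrightarrow> \<not> (\<exists>p M'. prob_step M p M')"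

definition Red :: "tm \<Rightarrow> tm \<Rightarrow> ennreal" where
  "Red M M' =
     (if \<exists>p. prob_step M p M' then ennreal (real_of_rat (THE p. prob_step M p M'))
      else if no_reduct M \<and> M' = M then 1 else 0)"

primrec Red_pow :: "nat \<Rightarrow> tm \<Rightarrow> tm \<Rightarrow> ennreal" where
  "Red_pow 0 M M' = (if M = M' then 1 else 0)"
| "Red_pow (Suc n) M M' = (\<integral>\<^sup>+ N. Red M N * Red_pow n N M' \<partial>count_space UNIV)"

definition Red_inf :: "tm \<Rightarrow> tm \<Rightarrow> ennreal" where
  "Red_inf M M' = (if no_reduct M' then (SUP n. Red_pow n M M') else 0)"


section \<open>Interpretation of terms\<close>

primrec ctx_sem :: "pty list \<Rightarrow> coalg" where
  "ctx_sem [] = one_coalg"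
| "ctx_sem (\<phi> # \<Gamma>) = tensor_coalg (psem \<phi>) (ctx_sem \<Gamma>)"

text \<open>The operations below are the morphism parts of the semantic clauses, the coalgebra
  structure \<open>h\<close> of the context being used for discarding (\<open>a \<mapsto> h\<^sub>a\<^sub>,\<^sub>[\<^sub>]\<close>), for duplicating
  (\<open>a, (b, c) \<mapsto> h\<^sub>a\<^sub>,\<^sub>[\<^sub>b\<^sub>,\<^sub>c\<^sub>]\<close>, that is \<open>h\<close> followed by the contraction of \<open>!\<close> and two
  derelictions) and for promoting. The last section proves that they act on coalgebraic points
  as prescribed.\<close>

definition contr_mat :: "coalg \<Rightarrow> mat" where
  "contr_mat A = (\<lambda>a x. case x of PPair b c \<Rightarrow> str A a (PBag {#b, c#}) | _ \<Rightarrow> 0)"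

definition const_mat :: "coalg \<Rightarrow> vec \<Rightarrow> mat" where
  "const_mat A v = (\<lambda>a b. str A a (PBag {#}) * v b)"

definition proj_mat :: "side \<Rightarrow> coalg \<Rightarrow> coalg \<Rightarrow> mat" where
  "proj_mat i A B = (\<lambda>x c. case x of PPair a b \<Rightarrow>
       sel i (id_mat (car A) a c * str B b (PBag {#}))
             (str A a (PBag {#}) * id_mat (car B) b c) | _ \<Rightarrow> 0)"

primrec var_mat :: "pty list \<Rightarrow> nat \<Rightarrow> mat" where
  "var_mat [] n = (\<lambda>_ _. 0)"
| "var_mat (\<phi> # \<Gamma>) n = (case n of
       0 \<Rightarrow> proj_mat Lft (psem \<phi>) (ctx_sem \<Gamma>)
     | Suc k \<Rightarrow> var_mat \<Gamma> k \<odot> proj_mat Rgt (psem \<phi>) (ctx_sem \<Gamma>))"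

definition pair_mat :: "coalg \<Rightarrow> mat \<Rightarrow> mat \<Rightarrow> mat" where
  "pair_mat A s t = (s \<otimes>\<^sub>m t) \<odot> contr_mat A"

definition stop_mat :: "coalg \<Rightarrow> mat \<Rightarrow> mat" where
  "stop_mat A t = bang_mat t \<odot> str A"

definition app_mat :: "coalg \<Rightarrow> mat \<Rightarrow> mat \<Rightarrow> mat" where
  "app_mat A s t = (\<lambda>x b. if \<exists>a. x = PPair (PPair a b) a then 1 else 0) \<odot> pair_mat A s t"

definition lam_mat :: "mat \<Rightarrow> mat" where
  "lam_mat t = (\<lambda>g x. case x of PPair a b \<Rightarrow> t (PPair a g) b | _ \<Rightarrow> 0)"

definition bind_mat :: "coalg \<Rightarrow> mat \<Rightarrow> mat \<Rightarrow> mat" where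
  "bind_mat A s t = t \<odot> pair_mat A s (id_mat (car A))"

definition case_mat :: "coalg \<Rightarrow> pcs \<Rightarrow> pcs \<Rightarrow> mat \<Rightarrow> mat \<Rightarrow> mat \<Rightarrow> mat" where
  "case_mat A X Y s t1 t2 = (\<lambda>a b.
     bind_mat A (rho_mat X Lft \<odot> s) t1 a b + bind_mat A (rho_mat Y Rgt \<odot> s) t2 a b)"

definition fix_mat :: "coalg \<Rightarrow> mat \<Rightarrow> mat" where
  "fix_mat A t = (\<lambda>a b. SUP n. ((\<lambda>s. bind_mat A (stop_mat A s) t) ^^ n) (\<lambda>_ _. 0) a b)"

definition coin_vec :: "rat \<Rightarrow> vec" where
  "coin_vec p = (\<lambda>b. ennreal (real_of_rat p) * basis (PIn Lft PStar) b
                   + ennreal (real_of_rat (1 - p)) * basis (PIn Rgt PStar) b)"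

text \<open>\<open>\<Gamma> \<turnstile> M : \<sigma> \<leadsto> t\<close>: some derivation of \<open>\<Gamma> \<turnstile> M : \<sigma>\<close> has \<open>t\<close> as its interpretation. Injections
  and \<open>Fold\<close> carry no type annotation, so a judgement may have several derivations.\<close>

inductive denotes :: "pty list \<Rightarrow> tm \<Rightarrow> gty \<Rightarrow> mat \<Rightarrow> bool"
    (\<open>_ \<turnstile> _ : _ \<leadsto> _\<close> [51, 51, 51, 51] 50) where
  d_var: "n < length \<Gamma> \<Longrightarrow> \<Gamma> \<turnstile> Var n : Pos (\<Gamma> ! n) \<leadsto> var_mat \<Gamma> n"
| d_unit: "\<Gamma> \<turnstile> Unit : Pos One \<leadsto> const_mat (ctx_sem \<Gamma>) (basis PStar)"
| d_stop: "\<Gamma> \<turnstile> M : \<sigma> \<leadsto> t \<Longrightarrow> \<Gamma> \<turnstile> Stop M : Pos (Bang \<sigma>) \<leadsto> stop_mat (ctx_sem \<Gamma>) t"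
| d_pair: "\<Gamma> \<turnstile> M : Pos \<phi> \<leadsto> s \<Longrightarrow> \<Gamma> \<turnstile> N : Pos \<psi> \<leadsto> t \<Longrightarrow>
    \<Gamma> \<turnstile> MkPair M N : Pos (Tensor \<phi> \<psi>) \<leadsto> pair_mat (ctx_sem \<Gamma>) s t"
| d_in: "\<Gamma> \<turnstile> M : Pos (sel i \<phi> \<psi>) \<leadsto> t \<Longrightarrow> pclosed \<phi> \<Longrightarrow> pclosed \<psi> \<Longrightarrow>
    \<Gamma> \<turnstile> In i M : Pos (Plus \<phi> \<psi>) \<leadsto> in_mat (car (psem (sel i \<phi> \<psi>))) i \<odot> t"
| d_lam: "\<phi> # \<Gamma> \<turnstile> M : \<sigma> \<leadsto> t \<Longrightarrow> pclosed \<phi> \<Longrightarrow> \<Gamma> \<turnstile> Lam \<phi> M : Lolli \<phi> \<sigma> \<leadsto> lam_mat t"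
| d_app: "\<Gamma> \<turnstile> M : Lolli \<phi> \<sigma> \<leadsto> s \<Longrightarrow> \<Gamma> \<turnstile> N : Pos \<phi> \<leadsto> t \<Longrightarrow>
    \<Gamma> \<turnstile> App M N : \<sigma> \<leadsto> app_mat (ctx_sem \<Gamma>) s t"
| d_case: "\<Gamma> \<turnstile> M : Pos (Plus \<phi> \<psi>) \<leadsto> s \<Longrightarrow>
    \<phi> # \<Gamma> \<turnstile> Nl : \<sigma> \<leadsto> t1 \<Longrightarrow> \<psi> # \<Gamma> \<turnstile> Nr : \<sigma> \<leadsto> t2 \<Longrightarrow>
    \<Gamma> \<turnstile> Case M Nl Nr : \<sigma> \<leadsto> case_mat (ctx_sem \<Gamma>) (car (psem \<phi>)) (car (psem \<psi>)) s t1 t2"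
| d_pr: "\<Gamma> \<turnstile> M : Pos (Tensor \<phi> \<psi>) \<leadsto> t \<Longrightarrow>
    \<Gamma> \<turnstile> Pr i M : Pos (sel i \<phi> \<psi>) \<leadsto> proj_mat i (psem \<phi>) (psem \<psi>) \<odot> t"
| d_go: "\<Gamma> \<turnstile> M : Pos (Bang \<sigma>) \<leadsto> t \<Longrightarrow> \<Gamma> \<turnstile> Go M : \<sigma> \<leadsto> der_mat (gsem \<sigma>) \<odot> t"
| d_fix: "Bang \<sigma> # \<Gamma> \<turnstile> M : \<sigma> \<leadsto> t \<Longrightarrow> gclosed \<sigma> \<Longrightarrow> \<Gamma> \<turnstile> Fix \<sigma> M : \<sigma> \<leadsto> fix_mat (ctx_sem \<Gamma>) t"
| d_fold: "\<Gamma> \<turnstile> M : Pos (psubst \<phi> 0 (Mu \<phi>)) \<leadsto> t \<Longrightarrow> pclosed (Mu \<phi>) \<Longrightarrow>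
    \<Gamma> \<turnstile> Fold M : Pos (Mu \<phi>) \<leadsto> t"
| d_unfold: "\<Gamma> \<turnstile> M : Pos (Mu \<phi>) \<leadsto> t \<Longrightarrow> \<Gamma> \<turnstile> Unfold M : Pos (psubst \<phi> 0 (Mu \<phi>)) \<leadsto> t"
| d_coin: "0 \<le> p \<Longrightarrow> p \<le> 1 \<Longrightarrow>
    \<Gamma> \<turnstile> Coin p : Pos (Plus One One) \<leadsto> const_mat (ctx_sem \<Gamma>) (coin_vec p)"

lemma typing_iff_denotes: "\<Gamma> \<turnstile> M : \<sigma> \<longleftrightarrow> (\<exists>t. \<Gamma> \<turnstile> M : \<sigma> \<leadsto> t)"
proof
  assume "\<Gamma> \<turnstile> M : \<sigma>"
  then show "\<exists>t. \<Gamma> \<turnstile> M : \<sigma> \<leadsto> t"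
    by induction (blast intro: denotes.intros)+
next
  assume "\<exists>t. \<Gamma> \<turnstile> M : \<sigma> \<leadsto> t"
  then obtain t where "\<Gamma> \<turnstile> M : \<sigma> \<leadsto> t" ..
  then show "\<Gamma> \<turnstile> M : \<sigma>"
    by induction (blast intro: typing.intros)+
qed

text \<open>For closed terms, the element of \<open>P\<lbrakk>\<sigma>\<rbrakk>\<close> corresponding to a morphism from \<open>1\<close>.\<close>

definition closed_denotes :: "tm \<Rightarrow> gty \<Rightarrow> vec \<Rightarrow> bool" where
  "closed_denotes M \<sigma> u \<longleftrightarrow> (\<exists>t. [] \<turnstile> M : \<sigma> \<leadsto> t \<and> u = t \<bullet>\<^sub>v basis PStar)"


section \<open>The semantic clauses on coalgebraic points\<close>

text \<open>The de Bruijn convention puts the most recent variable first, so the point written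
  \<open>u\<^sub>1 \<otimes> \<cdots> \<otimes> u\<^sub>k \<otimes> v\<close> with named variables is \<open>v \<otimes>\<^sub>v u\<close> here. A vector \<open>w\<close> on the web of
  \<open>X \<multimap> Y\<close> is the matrix \<open>\<lambda>a b. w (PPair a b)\<close>.\<close>

lemma sum_swap:
  "(\<integral>\<^sup>+ x. \<integral>\<^sup>+ y. f x y \<partial>count_space UNIV \<partial>count_space UNIV) =
   (\<integral>\<^sup>+ y. \<integral>\<^sup>+ x. f x y \<partial>count_space UNIV \<partial>count_space UNIV)"
  using nn_integral_fst_count_space[of "\<lambda>(x, y). f x y"]
    nn_integral_snd_count_space[of "\<lambda>(x, y). f x y"] by simp

lemma sum_single:
  assumes "\<And>x. x \<noteq> a \<Longrightarrow> f x = 0"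
  shows "(\<integral>\<^sup>+ x. f x \<partial>count_space UNIV) = (f a :: ennreal)"
  using nn_integral_count_space'[of "{a}" UNIV f] assms by simp

lemma sum_reindex:
  fixes f :: "'a \<Rightarrow> ennreal"
  assumes "inj p" and "\<And>x. x \<notin> range p \<Longrightarrow> f x = 0"
  shows "(\<integral>\<^sup>+ x. f x \<partial>count_space UNIV) = (\<integral>\<^sup>+ y. f (p y) \<partial>count_space UNIV)"
proof -
  have "(\<integral>\<^sup>+ y. f (p y) \<partial>count_space UNIV) = (\<integral>\<^sup>+ x. f x \<partial>count_space (range p))"
    using assms(1) by (intro nn_integral_bij_count_space) (simp add: bij_betw_def)
  also have "\<dots> = (\<integral>\<^sup>+ x. f x * indicator (range p) x \<partial>count_space UNIV)"
    by (subst nn_integral_restrict_space[symmetric]) (auto simp: restrict_count_space)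
  also have "\<dots> = (\<integral>\<^sup>+ x. f x \<partial>count_space UNIV)"
    using assms(2) by (intro nn_integral_cong) (auto simp: indicator_def)
  finally show ?thesis by simp
qed

lemma sum_PPair:
  fixes f :: "pt \<Rightarrow> ennreal"
  assumes "\<And>x. (\<And>a b. x \<noteq> PPair a b) \<Longrightarrow> f x = 0"
  shows "(\<integral>\<^sup>+ x. f x \<partial>count_space UNIV) =
    (\<integral>\<^sup>+ a. \<integral>\<^sup>+ b. f (PPair a b) \<partial>count_space UNIV \<partial>count_space UNIV)"
proof -
  have "(\<integral>\<^sup>+ x. f x \<partial>count_space UNIV) =
      (\<integral>\<^sup>+ y. f ((\<lambda>(a, b). PPair a b) y) \<partial>count_space UNIV)"
  proof (rule sum_reindex)
    show "inj (\<lambda>(a, b). PPair a b)" by (auto simp: inj_def)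
    fix x assume "x \<notin> range (\<lambda>(a, b). PPair a b)"
    then show "f x = 0" by (intro assms) auto
  qed
  then show ?thesis
    using nn_integral_fst_count_space[of "\<lambda>y. f ((\<lambda>(a, b). PPair a b) y)"] by simp
qed

lemma sum_PBag:
  fixes f :: "pt \<Rightarrow> ennreal"
  assumes "\<And>x. (\<And>b. x \<noteq> PBag b) \<Longrightarrow> f x = 0"
  shows "(\<integral>\<^sup>+ x. f x \<partial>count_space UNIV) = (\<integral>\<^sup>+ b. f (PBag b) \<partial>count_space UNIV)"
  by (rule sum_reindex) (auto simp: inj_def intro: assms)

lemma mapp_mcomp: "(s \<odot> t) \<bullet>\<^sub>v u = s \<bullet>\<^sub>v t \<bullet>\<^sub>v u"
proof
  fix c
  have "((s \<odot> t) \<bullet>\<^sub>v u) c =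
      (\<integral>\<^sup>+ a. \<integral>\<^sup>+ b. t a b * s b c * u a \<partial>count_space UNIV \<partial>count_space UNIV)"
    by (simp add: mapp_def mcomp_def nn_integral_multc)
  also have "\<dots> = (\<integral>\<^sup>+ b. \<integral>\<^sup>+ a. t a b * s b c * u a \<partial>count_space UNIV \<partial>count_space UNIV)"
    by (rule sum_swap)
  also have "\<dots> = (s \<bullet>\<^sub>v t \<bullet>\<^sub>v u) c"
    by (simp add: mapp_def nn_integral_cmult[symmetric] mult_ac)
  finally show "((s \<odot> t) \<bullet>\<^sub>v u) c = (s \<bullet>\<^sub>v t \<bullet>\<^sub>v u) c" .
qed

lemma mapp_mtensor: "(s \<otimes>\<^sub>m t) \<bullet>\<^sub>v (u \<otimes>\<^sub>v v) = (s \<bullet>\<^sub>v u) \<otimes>\<^sub>v (t \<bullet>\<^sub>v v)"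
proof
  fix y
  show "((s \<otimes>\<^sub>m t) \<bullet>\<^sub>v (u \<otimes>\<^sub>v v)) y = ((s \<bullet>\<^sub>v u) \<otimes>\<^sub>v (t \<bullet>\<^sub>v v)) y"
  proof (cases "\<exists>b1 b2. y = PPair b1 b2")
    case True
    then obtain b1 b2 where y: "y = PPair b1 b2" by auto
    have "((s \<otimes>\<^sub>m t) \<bullet>\<^sub>v (u \<otimes>\<^sub>v v)) y =
        (\<integral>\<^sup>+ a1. \<integral>\<^sup>+ a2. (s a1 b1 * u a1) * (t a2 b2 * v a2) \<partial>count_space UNIV \<partial>count_space UNIV)"
      unfolding mapp_def
      by (subst sum_PPair) (auto simp: mtensor_def vtensor_def y mult_ac split: pt.splits)
    also have "\<dots> = ((s \<bullet>\<^sub>v u) \<otimes>\<^sub>v (t \<bullet>\<^sub>v v)) y"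
      by (simp add: mapp_def vtensor_def y nn_integral_cmult nn_integral_multc)
    finally show ?thesis .
  next
    case False
    then have "(s \<otimes>\<^sub>m t) x y = 0" "((s \<bullet>\<^sub>v u) \<otimes>\<^sub>v (t \<bullet>\<^sub>v v)) y = 0" for x
      by (auto simp: mtensor_def vtensor_def split: pt.splits)
    then show ?thesis by (simp add: mapp_def)
  qed
qed

lemma mapp_id: "u \<in> vecs (web X) \<Longrightarrow> id_mat X \<bullet>\<^sub>v u = u"
proof
  fix b assume "u \<in> vecs (web X)"
  then show "(id_mat X \<bullet>\<^sub>v u) b = u b"
    unfolding mapp_def by (subst sum_single[of b]) (auto simp: id_mat_def vecs_def)
qed

lemma mpow_mset: "mpow u b = (\<Prod>a\<in>#b. u a)"
proof (induction b)
  case (add x b)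
  show ?case
  proof (cases "x \<in># b")
    case True
    have "mpow u (add_mset x b) = (\<Prod>a\<in>set_mset b. u a ^ count b a * (if a = x then u x else 1))"
      using True by (auto simp: mpow_def insert_absorb mult_ac intro!: prod.cong)
    also have "\<dots> = mpow u b * u x"
      using True by (simp add: prod.distrib mpow_def)
    finally show ?thesis using add by (simp add: mult_ac)
  next
    case False
    then have "(\<Prod>a\<in>set_mset b. u a ^ count (add_mset x b) a) = (\<Prod>a\<in>set_mset b. u a ^ count b a)"
      by (intro prod.cong) auto
    then have "mpow u (add_mset x b) = u x ^ count (add_mset x b) x * mpow u b"
      using False by (simp add: mpow_def del: count_add_mset)
    then show ?thesis using False add by (simp add: not_in_iff)
  qed
qed (simp add: mpow_def)

lemma mfact_add: "mfact (add_mset x b) = Suc (count b x) * mfact b"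
proof (cases "x \<in># b")
  case True
  have "mfact (add_mset x b) = (\<Prod>a\<in>set_mset b. fact (count b a) * (if a = x then Suc (count b x) else 1))"
    using True unfolding mfact_def by (simp add: insert_absorb) (intro prod.cong, auto)
  also have "\<dots> = Suc (count b x) * mfact b"
    using True by (simp add: prod.distrib mfact_def)
  finally show ?thesis .
next
  case False
  then have "(\<Prod>a\<in>set_mset b. fact (count (add_mset x b) a)) = (\<Prod>a\<in>set_mset b. fact (count b a) :: nat)"
    by (intro prod.cong) auto
  then show ?thesis using False
    by (simp add: mfact_def not_in_iff)
qed

lemma mfact_pos: "0 < mfact b"
  by (simp add: mfact_def prod_pos)

lemma sum_count_snd:
  "(\<integral>\<^sup>+ a. of_nat (count r (a, b)) \<partial>count_space UNIV) = (of_nat (count (image_mset snd r) b) :: ennreal)"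
proof (induction r)
  case (add x r)
  obtain a' b' where x: "x = (a', b')" by fastforce
  have "(\<integral>\<^sup>+ a. of_nat (count (add_mset x r) (a, b)) \<partial>count_space UNIV) =
      (\<integral>\<^sup>+ a. (of_nat (count r (a, b)) + (if a = a' \<and> b = b' then 1 else 0) :: ennreal) \<partial>count_space UNIV)"
    by (intro nn_integral_cong) (auto simp: x)
  also have "\<dots> = of_nat (count (image_mset snd r) b)
      + (\<integral>\<^sup>+ a. (if a = a' \<and> b = b' then 1 else 0) \<partial>count_space UNIV)"
    by (simp add: nn_integral_add add)
  also have "(\<integral>\<^sup>+ a. (if a = a' \<and> b = b' then 1 else 0 :: ennreal) \<partial>count_space UNIV) =
      (if b = b' then 1 else 0)"
    by (subst sum_single[of a']) auto
  finally show ?case by (auto simp: x)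
qed simp

lemma multinomial:
  fixes w :: "'a \<times> 'b \<Rightarrow> ennreal"
  shows "(\<integral>\<^sup>+ r. (if image_mset snd r = d
            then ennreal (real (mfact d) / real (mfact r)) * mpow w r else 0) \<partial>count_space UNIV) =
         mpow (\<lambda>b. \<integral>\<^sup>+ a. w (a, b) \<partial>count_space UNIV) d"
proof (induction d)
  case empty
  show ?case by (subst sum_single[of "{#}"]) (auto simp: mpow_def mfact_def)
next
  case (add b d)
  let ?F = "\<lambda>d r. ennreal (real (mfact d) / real (mfact r)) * mpow w r"
  let ?G = "\<lambda>r a. if image_mset snd r = add_mset b d \<and> (a, b) \<in># r
              then w (a, b) * ?F d (r - {#(a, b)#}) else 0"
  have *: "(if image_mset snd r = add_mset b d then ?F (add_mset b d) r else 0) =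
      (\<integral>\<^sup>+ a. ?G r a \<partial>count_space UNIV)" for r
  proof (cases "image_mset snd r = add_mset b d")
    case True
    let ?c = "ennreal (real (mfact d) / real (mfact r)) * mpow w r"
    have G: "?G r a = ?c * of_nat (count r (a, b))" for a
    proof (cases "(a, b) \<in># r")
      case in_r: True
      then obtain r' where r': "r = add_mset (a, b) r'" by (meson mset_add)
      have "real (mfact d) / real (mfact r') =
          real (mfact d) / real (mfact r) * real (count r (a, b))"
        using mfact_pos[of r'] by (simp add: r' mfact_add divide_simps del: of_nat_Suc of_nat_add distrib_left distrib_right mult_Suc)
      then have "ennreal (real (mfact d) / real (mfact r')) =
          ennreal (real (mfact d) / real (mfact r)) * of_nat (count r (a, b))"
        by (simp add: ennreal_mult' ennreal_of_nat_eq_real_of_nat del: times_divide_eq_left)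
      then show ?thesis using in_r True by (simp add: r' mpow_mset mult_ac)
    next
      case False
      then have "count r (a, b) = 0" by (simp add: not_in_iff)
      then show ?thesis using False by simp
    qed
    have "(\<integral>\<^sup>+ a. ?G r a \<partial>count_space UNIV) = ?c * of_nat (Suc (count d b))"
      unfolding G using sum_count_snd[of r b] True by (simp add: nn_integral_cmult)
    also have "\<dots> = ?F (add_mset b d) r"
    proof -
      have "ennreal (real (mfact (add_mset b d)) / real (mfact r)) =
          ennreal (real (mfact d) / real (mfact r)) * of_nat (Suc (count d b))"
        unfolding ennreal_of_nat_eq_real_of_nat mfact_add
        by (subst ennreal_mult'[symmetric]) (simp_all add: algebra_simps)
      then show ?thesis by (simp add: mult_ac del: of_nat_Suc)
    qed
    finally show ?thesis using True by simp
  qed simp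
  have "(\<integral>\<^sup>+ r. (if image_mset snd r = add_mset b d then ?F (add_mset b d) r else 0) \<partial>count_space UNIV)
      = (\<integral>\<^sup>+ a. \<integral>\<^sup>+ r. ?G r a \<partial>count_space UNIV \<partial>count_space UNIV)"
    unfolding * by (rule sum_swap)
  also have "\<dots> = (\<integral>\<^sup>+ a. w (a, b) * (\<integral>\<^sup>+ r. (if image_mset snd r = d then ?F d r else 0)
      \<partial>count_space UNIV) \<partial>count_space UNIV)"
  proof (rule nn_integral_cong)
    fix a
    have "(\<integral>\<^sup>+ r. ?G r a \<partial>count_space UNIV) = (\<integral>\<^sup>+ r. ?G (add_mset (a, b) r) a \<partial>count_space UNIV)"
    proof (rule sum_reindex)
      fix r assume "r \<notin> range (add_mset (a, b))"
      then have "(a, b) \<notin># r" by (metis mset_add rangeI)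
      then show "?G r a = 0" by simp
    qed (simp add: inj_def)
    also have "\<dots> = (\<integral>\<^sup>+ r. w (a, b) * (if image_mset snd r = d then ?F d r else 0) \<partial>count_space UNIV)"
      by (intro nn_integral_cong) auto
    finally show "(\<integral>\<^sup>+ r. ?G r a \<partial>count_space UNIV) =
        w (a, b) * (\<integral>\<^sup>+ r. (if image_mset snd r = d then ?F d r else 0) \<partial>count_space UNIV)"
      by (simp add: nn_integral_cmult)
  qed
  also have "\<dots> = (\<integral>\<^sup>+ a. w (a, b) \<partial>count_space UNIV) * mpow (\<lambda>b. \<integral>\<^sup>+ a. w (a, b) \<partial>count_space UNIV) d"
    unfolding add by (simp add: nn_integral_multc)
  finally show ?case by (simp add: mpow_mset)
qed

lemma mapp_bang_prom: "bang_mat t \<bullet>\<^sub>v prom u = prom (t \<bullet>\<^sub>v u)"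
proof
  fix y
  show "(bang_mat t \<bullet>\<^sub>v prom u) y = prom (t \<bullet>\<^sub>v u) y"
  proof (cases "\<exists>d. y = PBag d")
    case True
    then obtain d where y: "y = PBag d" by auto
    let ?T = "\<lambda>r. ennreal (real (mfact d) / real (mfact r)) * mpow (\<lambda>(a, b). t a b) r"
    let ?w = "\<lambda>(a, b). t a b * u a"
    have "(bang_mat t \<bullet>\<^sub>v prom u) y = (\<integral>\<^sup>+ c. bang_coeff t c d * mpow u c \<partial>count_space UNIV)"
      unfolding mapp_def by (subst sum_PBag) (auto simp: bang_mat_def prom_def y split: pt.splits)
    also have "\<dots> = (\<integral>\<^sup>+ c. \<integral>\<^sup>+ r. (if image_mset fst r = c \<and> image_mset snd r = d
        then ?T r * mpow u c else 0) \<partial>count_space UNIV \<partial>count_space UNIV)"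
    proof (rule nn_integral_cong)
      fix c
      have "bang_coeff t c d = (\<integral>\<^sup>+ r. ?T r * indicator {r. image_mset fst r = c \<and> image_mset snd r = d} r
          \<partial>count_space UNIV)"
        unfolding bang_coeff_def
        by (subst nn_integral_restrict_space[symmetric]) (auto simp: restrict_count_space)
      then have "bang_coeff t c d * mpow u c = (\<integral>\<^sup>+ r. ?T r
          * indicator {r. image_mset fst r = c \<and> image_mset snd r = d} r * mpow u c \<partial>count_space UNIV)"
        by (simp only: nn_integral_multc borel_measurable_count_space)
      also have "\<dots> = (\<integral>\<^sup>+ r. (if image_mset fst r = c \<and> image_mset snd r = d
          then ?T r * mpow u c else 0) \<partial>count_space UNIV)"
        by (intro nn_integral_cong) (auto simp: indicator_def)
      finally show "bang_coeff t c d * mpow u c = (\<integral>\<^sup>+ r. (if image_mset fst r = c \<and> image_mset snd r = d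
          then ?T r * mpow u c else 0) \<partial>count_space UNIV)" .
    qed
    also have "\<dots> = (\<integral>\<^sup>+ r. \<integral>\<^sup>+ c. (if image_mset fst r = c \<and> image_mset snd r = d
        then ?T r * mpow u c else 0) \<partial>count_space UNIV \<partial>count_space UNIV)"
      by (rule sum_swap)
    also have "\<dots> = (\<integral>\<^sup>+ r. (if image_mset snd r = d
            then ennreal (real (mfact d) / real (mfact r)) * mpow ?w r else 0) \<partial>count_space UNIV)"
    proof (rule nn_integral_cong)
      fix r :: "(pt \<times> pt) multiset"
      have "mpow (\<lambda>(a, b). t a b) r * mpow u (image_mset fst r) = mpow ?w r"
        by (simp add: mpow_mset image_mset.compositionality comp_def prod_mset.distrib[symmetric]
            case_prod_beta)
      then show "(\<integral>\<^sup>+ c. (if image_mset fst r = c \<and> image_mset snd r = d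
          then ?T r * mpow u c else 0) \<partial>count_space UNIV) =
          (if image_mset snd r = d then ennreal (real (mfact d) / real (mfact r)) * mpow ?w r else 0)"
        by (subst sum_single[of "image_mset fst r"]) (auto simp: mult.assoc)
    qed
    also have "\<dots> = prom (t \<bullet>\<^sub>v u) y"
      unfolding multinomial by (simp add: prom_def y mapp_def)
    finally show ?thesis .
  next
    case False
    then have "bang_mat t x y = 0" "prom (t \<bullet>\<^sub>v u) y = 0" for x
      by (auto simp: bang_mat_def prom_def split: pt.splits)
    then show ?thesis by (simp add: mapp_def)
  qed
qed

lemma mon_mat_prom:
  assumes u: "u \<in> vecs (web X)" and v: "v \<in> vecs (web Y)"
  shows "mon_mat X Y \<bullet>\<^sub>v (prom u \<otimes>\<^sub>v prom v) = prom (u \<otimes>\<^sub>v v)"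
proof
  fix y
  let ?p = "\<lambda>(a, b). PPair a b"
  show "(mon_mat X Y \<bullet>\<^sub>v (prom u \<otimes>\<^sub>v prom v)) y = prom (u \<otimes>\<^sub>v v) y"
  proof (cases "\<exists>r. y = PBag (image_mset ?p r)")
    case True
    then obtain r where y: "y = PBag (image_mset ?p r)" by auto
    have injp: "inj ?p" by (auto simp: inj_def)
    have inj: "image_mset ?p r = image_mset ?p r' \<longleftrightarrow> r = r'" for r'
      using multiset.inj_map[OF injp] unfolding inj_def by blast
    let ?x = "PPair (PBag (image_mset fst r)) (PBag (image_mset snd r))"
    have m: "mon_mat X Y x y = (if set_mset r \<subseteq> web X \<times> web Y \<and> x = ?x then 1 else 0)" for x
      by (auto simp: mon_mat_def y inj)
    have "(mon_mat X Y \<bullet>\<^sub>v (prom u \<otimes>\<^sub>v prom v)) y = mon_mat X Y ?x y * (prom u \<otimes>\<^sub>v prom v) ?x"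
      unfolding mapp_def by (rule sum_single) (simp add: m)
    also have "(prom u \<otimes>\<^sub>v prom v) ?x = prom (u \<otimes>\<^sub>v v) y"
      by (simp add: prom_def vtensor_def y mpow_mset image_mset.compositionality comp_def
          prod_mset.distrib[symmetric] case_prod_beta)
    also have "mon_mat X Y ?x y * prom (u \<otimes>\<^sub>v v) y = prom (u \<otimes>\<^sub>v v) y"
    proof (cases "set_mset r \<subseteq> web X \<times> web Y")
      case False
      then obtain a b where ab: "(a, b) \<in># r" "a \<notin> web X \<or> b \<notin> web Y" by auto
      then have "(u \<otimes>\<^sub>v v) (PPair a b) = 0" using u v by (auto simp: vtensor_def vecs_def)
      then have "\<exists>x\<in>#r. (u \<otimes>\<^sub>v v) (?p x) = 0" using ab(1) by force
      then have "prom (u \<otimes>\<^sub>v v) y = 0" by (auto simp: prom_def y mpow_def)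
      then show ?thesis by simp
    qed (simp add: m)
    finally show ?thesis .
  next
    case False
    then have "mon_mat X Y x y = 0" for x by (auto simp: mon_mat_def)
    moreover have "prom (u \<otimes>\<^sub>v v) y = 0"
    proof (cases y)
      case (PBag b)
      have "\<exists>x\<in>#b. \<forall>a c. x \<noteq> PPair a c"
      proof (rule ccontr)
        assume "\<not> ?thesis"
        then have "\<forall>x\<in>#b. ?p (case x of PPair a c \<Rightarrow> (a, c) | _ \<Rightarrow> undefined) = x"
          by fastforce
        then have "image_mset ?p (image_mset (\<lambda>x. case x of PPair a c \<Rightarrow> (a, c) | _ \<Rightarrow> undefined) b) = b"
          by (simp add: image_mset.compositionality comp_def cong: image_mset_cong)
        then show False using False PBag by metis
      qed
      then obtain x where "x \<in># b" "\<forall>a c. x \<noteq> PPair a c" by blast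
      then have "x \<in># b" "(u \<otimes>\<^sub>v v) x = 0" by (auto simp: vtensor_def split: pt.splits)
      then show ?thesis by (auto simp: prom_def PBag mpow_def)
    qed (auto simp: prom_def)
    ultimately show ?thesis by (simp add: mapp_def)
  qed
qed

lemma orth_subset_vecs: "orth W F \<subseteq> vecs W"
  by (auto simp: orth_def)

lemma vtensor_vecs:
  assumes "u \<in> vecs (web X)" "v \<in> vecs (web Y)"
  shows "u \<otimes>\<^sub>v v \<in> vecs (web (tensor_pcs X Y))"
  using assms
  by (auto simp: vecs_def vtensor_def tensor_pcs_def Let_def ennreal_mult_less_top split: pt.splits)

lemma vtensor_pts:
  assumes "u \<in> pts X" "v \<in> pts Y" "u \<in> vecs (web X)" "v \<in> vecs (web Y)"
  shows "u \<otimes>\<^sub>v v \<in> pts (tensor_pcs X Y)"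
proof -
  have "u \<otimes>\<^sub>v v \<in> vecs (web (tensor_pcs X Y))" using assms by (intro vtensor_vecs)
  then show ?thesis using assms(1,2)
    by (auto simp: tensor_pcs_def Let_def orth_def pairing_def mult.commute)
qed

lemma pinterp_vecs:
  assumes "\<And>n. pts (car (\<rho> n)) \<subseteq> vecs (web (car (\<rho> n)))"
  shows "pts (car (pinterp \<phi> \<rho>)) \<subseteq> vecs (web (car (pinterp \<phi> \<rho>)))"
  using assms
  by (cases \<phi>) (auto simp: one_coalg_def one_pcs_def bang_coalg_def bang_pcs_def tensor_coalg_def
      tensor_pcs_def plus_coalg_def plus_pcs_def union_coalg_def Let_def dest: orth_subset_vecs[THEN subsetD])

lemma psem_vecs: "pts (car (psem \<phi>)) \<subseteq> vecs (web (car (psem \<phi>)))"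
  unfolding psem_def by (rule pinterp_vecs) (simp add: empty_coalg_def)

lemma ctx_sem_vecs: "pts (car (ctx_sem \<Gamma>)) \<subseteq> vecs (web (car (ctx_sem \<Gamma>)))"
  by (cases \<Gamma>) (auto simp: one_coalg_def one_pcs_def tensor_coalg_def tensor_pcs_def Let_def
      dest: orth_subset_vecs[THEN subsetD])

lemma coalgebraic_tensor:
  assumes "coalgebraic A u" "coalgebraic B v" "u \<in> vecs (web (car A))" "v \<in> vecs (web (car B))"
  shows "coalgebraic (tensor_coalg A B) (u \<otimes>\<^sub>v v)"
  using assms
  by (simp add: coalgebraic_def tensor_coalg_def vtensor_pts mapp_mcomp mapp_mtensor mon_mat_prom)

lemma coalgebraic_one: "coalgebraic one_coalg (basis PStar)"
proof -
  have "(str one_coalg \<bullet>\<^sub>v basis PStar) x = prom (basis PStar) x" for x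
  proof -
    have "(str one_coalg \<bullet>\<^sub>v basis PStar) x = str one_coalg PStar x"
      unfolding mapp_def by (subst sum_single[of PStar]) (auto simp: basis_def)
    also have "\<dots> = prom (basis PStar) x"
    proof (cases x)
      case (PBag b)
      have "(\<exists>k. b = replicate_mset k PStar) \<longleftrightarrow> set_mset b \<subseteq> {PStar}"
        by (metis set_mset_subset_singletonD set_mset_replicate_mset_subset subset_refl empty_subsetI)
      moreover have "mpow (basis PStar) b = (if set_mset b \<subseteq> {PStar} then 1 else 0)"
        by (auto simp: mpow_def basis_def intro!: prod.neutral)
      ultimately show ?thesis by (simp add: one_coalg_def prom_def PBag)
    qed (auto simp: one_coalg_def prom_def)
    finally show ?thesis .
  qed
  then show ?thesis by (auto simp: coalgebraic_def one_coalg_def one_pcs_def vecs_def basis_def)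
qed

lemma mapp_str: "coalgebraic A u \<Longrightarrow> (\<integral>\<^sup>+ a. str A a (PBag b) * u a \<partial>count_space UNIV) = mpow u b"
  unfolding coalgebraic_def mapp_def prom_def by (drule conjunct2, drule fun_cong[of _ _ "PBag b"]) simp

lemma mapp_contr: "coalgebraic A u \<Longrightarrow> contr_mat A \<bullet>\<^sub>v u = u \<otimes>\<^sub>v u"
  by (rule ext) (auto simp: mapp_def contr_mat_def vtensor_def mapp_str mpow_mset split: pt.splits)

lemma clause_const: "coalgebraic A u \<Longrightarrow> const_mat A v \<bullet>\<^sub>v u = v"
proof
  fix b assume A: "coalgebraic A u"
  have "(const_mat A v \<bullet>\<^sub>v u) b = (\<integral>\<^sup>+ a. str A a (PBag {#}) * u a * v b \<partial>count_space UNIV)"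
    by (simp add: mapp_def const_mat_def mult_ac)
  also have "\<dots> = v b" using A by (simp add: nn_integral_multc mapp_str mpow_def)
  finally show "(const_mat A v \<bullet>\<^sub>v u) b = v b" .
qed

lemma clause_pair: "coalgebraic A u \<Longrightarrow> pair_mat A s t \<bullet>\<^sub>v u = (s \<bullet>\<^sub>v u) \<otimes>\<^sub>v (t \<bullet>\<^sub>v u)"
  by (simp add: pair_mat_def mapp_mcomp mapp_contr mapp_mtensor)

lemma clause_stop: "coalgebraic A u \<Longrightarrow> stop_mat A t \<bullet>\<^sub>v u = prom (t \<bullet>\<^sub>v u)"
  by (simp add: stop_mat_def mapp_mcomp coalgebraic_def mapp_bang_prom)

lemma clause_bind:
  "coalgebraic A u \<Longrightarrow> u \<in> vecs (web (car A)) \<Longrightarrow> bind_mat A s t \<bullet>\<^sub>v u = t \<bullet>\<^sub>v ((s \<bullet>\<^sub>v u) \<otimes>\<^sub>v u)"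
  by (simp add: bind_mat_def mapp_mcomp clause_pair mapp_id)

lemma clause_case:
  assumes "coalgebraic A u" "u \<in> vecs (web (car A))"
  shows "case_mat A X Y s t1 t2 \<bullet>\<^sub>v u =
    (\<lambda>b. (t1 \<bullet>\<^sub>v ((rho_mat X Lft \<bullet>\<^sub>v s \<bullet>\<^sub>v u) \<otimes>\<^sub>v u)) b
       + (t2 \<bullet>\<^sub>v ((rho_mat Y Rgt \<bullet>\<^sub>v s \<bullet>\<^sub>v u) \<otimes>\<^sub>v u)) b)"
proof -
  have "case_mat A X Y s t1 t2 \<bullet>\<^sub>v u =
    (\<lambda>b. (bind_mat A (rho_mat X Lft \<odot> s) t1 \<bullet>\<^sub>v u) b + (bind_mat A (rho_mat Y Rgt \<odot> s) t2 \<bullet>\<^sub>v u) b)"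
    by (simp add: mapp_def case_mat_def distrib_right nn_integral_add)
  then show ?thesis by (simp add: clause_bind assms mapp_mcomp)
qed

lemma clause_proj_l:
  assumes "coalgebraic B v" "u \<in> vecs (web (car A))"
  shows "proj_mat Lft A B \<bullet>\<^sub>v (u \<otimes>\<^sub>v v) = u"
proof
  fix c
  have "(proj_mat Lft A B \<bullet>\<^sub>v (u \<otimes>\<^sub>v v)) c =
    (\<integral>\<^sup>+ a. \<integral>\<^sup>+ b. (id_mat (car A) a c * u a) * (str B b (PBag {#}) * v b) \<partial>count_space UNIV \<partial>count_space UNIV)"
    unfolding mapp_def by (subst sum_PPair) (auto simp: proj_mat_def vtensor_def mult_ac split: pt.splits)
  also have "\<dots> = (id_mat (car A) \<bullet>\<^sub>v u) c"
    using assms(1) by (simp add: nn_integral_cmult mapp_str mpow_def mapp_def)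
  finally show "(proj_mat Lft A B \<bullet>\<^sub>v (u \<otimes>\<^sub>v v)) c = u c" using assms(2) by (simp add: mapp_id)
qed

lemma clause_proj_r:
  assumes "coalgebraic A u" "v \<in> vecs (web (car B))"
  shows "proj_mat Rgt A B \<bullet>\<^sub>v (u \<otimes>\<^sub>v v) = v"
proof
  fix c
  have "(proj_mat Rgt A B \<bullet>\<^sub>v (u \<otimes>\<^sub>v v)) c =
    (\<integral>\<^sup>+ a. \<integral>\<^sup>+ b. (str A a (PBag {#}) * u a) * (id_mat (car B) b c * v b) \<partial>count_space UNIV \<partial>count_space UNIV)"
    unfolding mapp_def by (subst sum_PPair) (auto simp: proj_mat_def vtensor_def mult_ac split: pt.splits)
  also have "\<dots> = (id_mat (car B) \<bullet>\<^sub>v v) c"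
    using assms(1) by (simp add: nn_integral_cmult nn_integral_multc mapp_str mpow_def mapp_def)
  finally show "(proj_mat Rgt A B \<bullet>\<^sub>v (u \<otimes>\<^sub>v v)) c = v c" using assms(2) by (simp add: mapp_id)
qed

fun env_vec :: "vec list \<Rightarrow> vec" where
  "env_vec [] = basis PStar"
| "env_vec (u # us) = u \<otimes>\<^sub>v env_vec us"

lemma coalgebraic_env:
  "list_all2 (\<lambda>\<phi> u. coalgebraic (psem \<phi>) u) \<Gamma> us \<Longrightarrow> coalgebraic (ctx_sem \<Gamma>) (env_vec us)"
proof (induction \<Gamma> us rule: list_all2_induct)
  case (Cons \<phi> \<Gamma> u us)
  then have "u \<in> vecs (web (car (psem \<phi>)))" "env_vec us \<in> vecs (web (car (ctx_sem \<Gamma>)))"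
    using psem_vecs[of \<phi>] ctx_sem_vecs[of \<Gamma>] by (auto simp: coalgebraic_def)
  then show ?case using Cons by (simp add: coalgebraic_tensor)
qed (simp add: coalgebraic_one)

lemma clause_var:
  "\<lbrakk>list_all2 (\<lambda>\<phi> u. coalgebraic (psem \<phi>) u) \<Gamma> us; n < length \<Gamma>\<rbrakk> \<Longrightarrow>
   var_mat \<Gamma> n \<bullet>\<^sub>v env_vec us = us ! n"
proof (induction \<Gamma> us arbitrary: n rule: list_all2_induct)
  case (Cons \<phi> \<Gamma> u us)
  have "u \<in> vecs (web (car (psem \<phi>)))" "env_vec us \<in> vecs (web (car (ctx_sem \<Gamma>)))"
    and "coalgebraic (ctx_sem \<Gamma>) (env_vec us)"
    using Cons.hyps psem_vecs[of \<phi>] ctx_sem_vecs[of \<Gamma>] coalgebraic_env[OF Cons.hyps(2)]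
    by (auto simp: coalgebraic_def)
  then show ?case
    using Cons by (cases n) (auto simp: clause_proj_l clause_proj_r mapp_mcomp)
qed simp

lemma clause_app:
  assumes "coalgebraic A u"
  shows "app_mat A s t \<bullet>\<^sub>v u = (\<lambda>a b. (s \<bullet>\<^sub>v u) (PPair a b)) \<bullet>\<^sub>v (t \<bullet>\<^sub>v u)"
proof
  fix b
  let ?S = "s \<bullet>\<^sub>v u" and ?T = "t \<bullet>\<^sub>v u"
  let ?E = "\<lambda>x b. if \<exists>a. x = PPair (PPair a b) a then 1 else 0 :: ennreal"
  have "(app_mat A s t \<bullet>\<^sub>v u) b = (?E \<bullet>\<^sub>v (?S \<otimes>\<^sub>v ?T)) b"
    using assms(1) by (simp add: app_mat_def mapp_mcomp clause_pair)
  also have "\<dots> = (\<integral>\<^sup>+ x. \<integral>\<^sup>+ a. ?E (PPair x a) b * (?S x * ?T a)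
      \<partial>count_space UNIV \<partial>count_space UNIV)"
    unfolding mapp_def by (subst sum_PPair) (auto simp: vtensor_def split: pt.splits)
  also have "\<dots> = (\<integral>\<^sup>+ a. \<integral>\<^sup>+ x. ?E (PPair x a) b * (?S x * ?T a)
      \<partial>count_space UNIV \<partial>count_space UNIV)"
    by (rule sum_swap)
  also have "\<dots> = (\<integral>\<^sup>+ a. ?S (PPair a b) * ?T a \<partial>count_space UNIV)"
  proof (rule nn_integral_cong)
    fix a
    show "(\<integral>\<^sup>+ x. ?E (PPair x a) b * (?S x * ?T a) \<partial>count_space UNIV) = ?S (PPair a b) * ?T a"
      by (subst sum_single[of "PPair a b"]) auto
  qed
  finally show "(app_mat A s t \<bullet>\<^sub>v u) b = ((\<lambda>a b. ?S (PPair a b)) \<bullet>\<^sub>v ?T) b"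
    by (simp add: mapp_def)
qed

lemma clause_lam: "(\<lambda>a b. (lam_mat t \<bullet>\<^sub>v u) (PPair a b)) \<bullet>\<^sub>v v = t \<bullet>\<^sub>v (v \<otimes>\<^sub>v u)"
proof
  fix b
  have "(t \<bullet>\<^sub>v (v \<otimes>\<^sub>v u)) b =
      (\<integral>\<^sup>+ a. \<integral>\<^sup>+ g. t (PPair a g) b * u g * v a \<partial>count_space UNIV \<partial>count_space UNIV)"
    unfolding mapp_def by (subst sum_PPair) (auto simp: vtensor_def mult_ac split: pt.splits)
  then show "((\<lambda>a b. (lam_mat t \<bullet>\<^sub>v u) (PPair a b)) \<bullet>\<^sub>v v) b = (t \<bullet>\<^sub>v (v \<otimes>\<^sub>v u)) b"
    by (simp add: mapp_def lam_mat_def nn_integral_multc)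
qed

lemma mcomp_mono: "s \<le> s' \<Longrightarrow> t \<le> t' \<Longrightarrow> s \<odot> t \<le> s' \<odot> t'"
  by (auto simp: mcomp_def le_fun_def intro!: nn_integral_mono mult_mono)

lemma mtensor_mono: "s \<le> s' \<Longrightarrow> t \<le> t' \<Longrightarrow> s \<otimes>\<^sub>m t \<le> s' \<otimes>\<^sub>m t'"
  by (auto simp: mtensor_def le_fun_def intro!: mult_mono split: pt.splits)

lemma mpow_mono: "(\<And>x. u x \<le> v x) \<Longrightarrow> mpow u b \<le> mpow v b"
  unfolding mpow_mset by (induction b) (auto intro!: mult_mono)

lemma bang_mat_mono: "s \<le> t \<Longrightarrow> bang_mat s \<le> bang_mat t"
  by (auto simp: bang_mat_def bang_coeff_def le_fun_def split: pt.splits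
      intro!: nn_integral_mono mult_left_mono mpow_mono)

lemma clause_fix:
  assumes A: "coalgebraic A u" "u \<in> vecs (web (car A))"
  shows "fix_mat A t \<bullet>\<^sub>v u = (\<lambda>b. SUP n. ((\<lambda>w. t \<bullet>\<^sub>v (prom w \<otimes>\<^sub>v u)) ^^ n) (\<lambda>_. 0) b)"
proof
  fix b
  let ?F = "\<lambda>s. bind_mat A (stop_mat A s) t"
  let ?T = "\<lambda>n. (?F ^^ n) (\<lambda>_ _. 0)"
  have "mono ?F"
    by (intro monoI) (auto simp: bind_mat_def pair_mat_def stop_mat_def
        intro!: mcomp_mono mtensor_mono bang_mat_mono)
  then have "incseq ?T"
    using mono_funpow[of ?F] by (simp add: bot_fun_def bot_ennreal)
  then have T: "incseq (\<lambda>n a. ?T n a b * u a)"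
    by (auto simp: incseq_def le_fun_def intro!: mult_right_mono)
  have "?T n \<bullet>\<^sub>v u = ((\<lambda>w. t \<bullet>\<^sub>v (prom w \<otimes>\<^sub>v u)) ^^ n) (\<lambda>_. 0)" for n
  proof (induction n)
    case 0
    show ?case by (simp add: mapp_def)
  next
    case (Suc n)
    then show ?case using A by (simp add: clause_bind clause_stop)
  qed
  moreover have "(fix_mat A t \<bullet>\<^sub>v u) b = (SUP n. (?T n \<bullet>\<^sub>v u) b)"
    using nn_integral_monotone_convergence_SUP[OF T, of "count_space UNIV"]
    by (simp add: mapp_def fix_mat_def SUP_mult_right_ennreal)
  ultimately show "(fix_mat A t \<bullet>\<^sub>v u) b = (SUP n. ((\<lambda>w. t \<bullet>\<^sub>v (prom w \<otimes>\<^sub>v u)) ^^ n) (\<lambda>_. 0) b)"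
    by simp
qed

end

theory Submission
  imports Defs
begin

text \<open>The coalgebra structures of all positive types are restrictions of one partial commutative
monoid structure on points, so that promotion becomes a product in an algebra of power series.  In
this algebra a term has a step-counting semantics, a power series with one extra variable that marks
reduction steps.  A reduction step multiplies it by that variable; comparing coefficients
shows that \<open>Red\<^sup>\<infinity>\<close> computes the denotation of a closed term of type \<open>1\<close>.

For every point \<open>a\<close> of a closed type there are test terms with coins whose bias is a parameter.  The
probability of convergence of such a test applied to \<open>M\<close> is a power series in these parameters, and
one of its coefficients is a nonzero multiple of the entry of the denotation of \<open>M\<close> at \<open>a\<close>.  Since
the coefficients of a power series that is finite at all small rational points are determined by
these values, observationally equivalent terms have equal entries.\<close>

section \<open>Power series over a partial commutative monoid\<close>

text \<open>Adequacy in the presence of recursive types is commonly obtained from a logical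
  relation, whose existence at types with negative occurrences of the type variable is itself a
  difficulty. Counting steps avoids it: by soundness of one step, the coefficient of index k of a
  term is the weighted sum of the coefficients of index k - 1 of its reducts, so adequacy is an
  induction on the number of steps. All coefficients lie in \<open>ennreal\<close>, so every
  infinite sum exists and sums can be exchanged freely; finiteness enters only through
  probabilities. Definability is an induction on the derivation that a point lies in a web, not on
  types, which again copes with recursive types. The hard case is a bag as a value: the entry of
  \<open>Stop M\<close> at a bag is a product of entries of M, so M must be a random mixture of
  terms for the elements, and a single monomial of the product has to recognise the whole bag with
  its multiplicities. This is done with a derivation on power series, applied once for each
  element.\<close>

abbreviation csum :: "('a \<Rightarrow> ennreal) \<Rightarrow> ennreal"  (binder \<open>\<Sum>\<^sup>+\<close> 10) where
  "csum f \<equiv> nn_integral (count_space UNIV) f"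

lemma csum_if: "(\<Sum>\<^sup>+ x. if P then f x else 0) = (if P then \<Sum>\<^sup>+ x. f x else 0)"
  by simp

lemma csum_if_eq:
  "(\<Sum>\<^sup>+ x. if x = a then f x else 0) = f a"
  "(\<Sum>\<^sup>+ x. if a = x then f x else 0) = f a"
  by (subst sum_single[of a]; simp)+

text \<open>Trades an existential statement with a unique witness for a sum over the witness, which
  can then be exchanged with other sums.\<close>

lemma csum_functional:
  assumes "\<And>x y. P x \<Longrightarrow> P y \<Longrightarrow> x = y"
  shows "(\<Sum>\<^sup>+ x. if P x then c else 0) = (if \<exists>x. P x then c else 0)"
proof (cases "\<exists>x. P x")
  case True
  then obtain a where "P a" by blast
  then show ?thesis using assms by (subst sum_single[of a]) auto
qed simp

lemma csum_neq_0_iff: "csum f \<noteq> 0 \<longleftrightarrow> (\<exists>x. f x \<noteq> 0)"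
  by (simp add: nn_integral_0_iff emeasure_count_space_eq_0)

lemma csum_0I: "(\<And>x. f x = 0) \<Longrightarrow> csum f = 0"
  using csum_neq_0_iff[of f] by blast

text \<open>\<open>padd x y z\<close> stands for \<open>z = x + y\<close>; every element has its own neutral element.\<close>

class pcm =
  fixes padd :: "'a \<Rightarrow> 'a \<Rightarrow> 'a \<Rightarrow> bool"
    and pemp :: "'a \<Rightarrow> bool"
  assumes padd_commute: "padd x y z \<Longrightarrow> padd y x z"
    and padd_functional: "padd x y z \<Longrightarrow> padd x y z' \<Longrightarrow> z = z'"
    and padd_assoc: "padd x y w \<Longrightarrow> padd w z t \<Longrightarrow> \<exists>v. padd y z v \<and> padd x v t"
    and padd_pempD: "pemp x \<Longrightarrow> padd x y z \<Longrightarrow> y = z"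
    and padd_pemp_ex: "\<exists>x. pemp x \<and> padd x z z"
begin

lemma padd_commute_iff: "padd x y z \<longleftrightarrow> padd y x z"
  using padd_commute by blast

lemma padd_assoc': "padd y z v \<Longrightarrow> padd x v t \<Longrightarrow> \<exists>w. padd x y w \<and> padd w z t"
  by (metis padd_assoc padd_commute)

lemma padd_pempD2: "pemp y \<Longrightarrow> padd x y z \<Longrightarrow> x = z"
  using padd_pempD padd_commute by blast

text \<open>By associativity x + y is defined because x + (y + z) is; as both are units, the sum
  equals y and also x.\<close>

lemma pemp_padd_unique: "pemp x \<Longrightarrow> padd x z z \<Longrightarrow> pemp y \<Longrightarrow> padd y z z \<Longrightarrow> x = y"
  by (metis padd_assoc' padd_pempD padd_pempD2)

lemma pemp_ex1: "\<exists>!x. pemp x \<and> padd x z z"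
  using padd_pemp_ex pemp_padd_unique by blast

lemma pemp_padd_self: "pemp x \<Longrightarrow> padd x x x"
  by (metis padd_pemp_ex padd_pempD2)

end

text \<open>A type constructor of its own, so that families of coefficients can carry convolution as
  their class multiplication.\<close>

datatype 'a ser = Ser (cf: "'a \<Rightarrow> ennreal")

lemma ser_eqI: "(\<And>x. cf r x = cf s x) \<Longrightarrow> r = s"
  by (cases r; cases s) auto

instantiation ser :: (pcm) "{zero, one, plus, times}"
begin
definition zero_ser :: "'a ser" where "0 = Ser (\<lambda>_. 0)"
definition one_ser :: "'a ser" where "1 = Ser (\<lambda>x. if pemp x then 1 else 0)"
definition plus_ser :: "'a ser \<Rightarrow> 'a ser \<Rightarrow> 'a ser" where
  "r + s = Ser (\<lambda>x. cf r x + cf s x)"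
definition times_ser :: "'a ser \<Rightarrow> 'a ser \<Rightarrow> 'a ser" where
  "r * s = Ser (\<lambda>z. \<Sum>\<^sup>+ x. \<Sum>\<^sup>+ y. if padd x y z then cf r x * cf s y else 0)"
instance ..
end

lemma cf_0 [simp]: "cf 0 x = 0"
  and cf_1: "cf 1 x = (if pemp x then 1 else 0)"
  and cf_plus [simp]: "cf (r + s) x = cf r x + cf s x"
  and cf_times: "cf (r * s) z = (\<Sum>\<^sup>+ x. \<Sum>\<^sup>+ y. if padd x y z then cf r x * cf s y else 0)"
  by (simp_all add: zero_ser_def one_ser_def plus_ser_def times_ser_def)

lemma times_ser_commute: "r * s = s * (r :: 'a :: pcm ser)"
proof (rule ser_eqI)
  fix z
  show "cf (r * s) z = cf (s * r) z"
    unfolding cf_times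
    by (subst sum_swap) (auto simp: mult.commute padd_commute_iff intro!: nn_integral_cong)
qed

text \<open>Both sides sum over the triples whose iterated sum is z. The intermediate sum is unique
  when it exists, so summing over it amounts to asserting that it exists, and the two existence
  conditions are equivalent by \<open>padd_assoc\<close>.\<close>

lemma times_ser_assoc: "(r * s) * t = r * (s * (t :: 'a :: pcm ser))"
proof (rule ser_eqI)
  fix z
  let ?f = "\<lambda>x y u. cf r x * cf s y * cf t u"
  have "cf ((r * s) * t) z =
      (\<Sum>\<^sup>+ w. \<Sum>\<^sup>+ u. \<Sum>\<^sup>+ x. \<Sum>\<^sup>+ y. if padd x y w \<and> padd w u z then ?f x y u else 0)"
    unfolding cf_times
    by (auto simp: nn_integral_multc[symmetric] intro!: nn_integral_cong)
  also have "\<dots> = (\<Sum>\<^sup>+ u. \<Sum>\<^sup>+ x. \<Sum>\<^sup>+ y. \<Sum>\<^sup>+ w. if padd x y w \<and> padd w u z then ?f x y u else 0)"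
    by (subst sum_swap, rule nn_integral_cong, subst sum_swap, rule nn_integral_cong, rule sum_swap)
  also have "\<dots> = (\<Sum>\<^sup>+ u. \<Sum>\<^sup>+ x. \<Sum>\<^sup>+ y. if \<exists>w. padd x y w \<and> padd w u z then ?f x y u else 0)"
    by (intro nn_integral_cong csum_functional) (auto dest: padd_functional)
  also have "\<dots> = (\<Sum>\<^sup>+ x. \<Sum>\<^sup>+ y. \<Sum>\<^sup>+ u. if \<exists>w. padd x y w \<and> padd w u z then ?f x y u else 0)"
    by (subst sum_swap, rule nn_integral_cong, rule sum_swap)
  also have "\<dots> = (\<Sum>\<^sup>+ x. \<Sum>\<^sup>+ y. \<Sum>\<^sup>+ u. if \<exists>v. padd y u v \<and> padd x v z then ?f x y u else 0)"
    by (intro nn_integral_cong) (metis padd_assoc padd_assoc')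
  also have "\<dots> = (\<Sum>\<^sup>+ x. \<Sum>\<^sup>+ y. \<Sum>\<^sup>+ u. \<Sum>\<^sup>+ v. if padd y u v \<and> padd x v z then ?f x y u else 0)"
    by (intro nn_integral_cong csum_functional[symmetric]) (auto dest: padd_functional)
  also have "\<dots> = (\<Sum>\<^sup>+ x. \<Sum>\<^sup>+ v. \<Sum>\<^sup>+ y. \<Sum>\<^sup>+ u. if padd y u v \<and> padd x v z then ?f x y u else 0)"
    by (rule nn_integral_cong, rule sym, subst sum_swap, rule nn_integral_cong, rule sum_swap)
  also have "\<dots> = cf (r * (s * t)) z"
    unfolding cf_times
    by (auto simp: nn_integral_cmult[symmetric] mult.assoc intro!: nn_integral_cong)
  finally show "cf ((r * s) * t) z = cf (r * (s * t)) z" .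
qed

lemma times_ser_one: "1 * r = (r :: 'a :: pcm ser)"
proof (rule ser_eqI)
  fix z :: 'a
  obtain e where e: "pemp e" "padd e z z" and u: "\<And>x. pemp x \<Longrightarrow> padd x z z \<Longrightarrow> x = e"
    using pemp_ex1[of z] by blast
  \<comment> \<open>A unit that is a summand of z is the neutral element of z, and the other summand
    is then z itself.\<close>
  have *: "(pemp x \<and> padd x y z) \<longleftrightarrow> (x = e \<and> y = z)" for x y
    using e u padd_pempD by blast
  have "cf (1 * r) z = (\<Sum>\<^sup>+ x. \<Sum>\<^sup>+ y. if pemp x \<and> padd x y z then cf r y else 0)"
    unfolding cf_times cf_1 by (intro nn_integral_cong) simp
  also have "\<dots> = (\<Sum>\<^sup>+ x. \<Sum>\<^sup>+ y. if x = e \<and> y = z then cf r z else 0)"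
    unfolding * by (intro nn_integral_cong) simp
  also have "\<dots> = cf r z"
    by (subst sum_single[of e]) (auto simp: sum_single[of z])
  finally show "cf (1 * r) z = cf r z" .
qed

instance ser :: (pcm) comm_semiring_1
proof
  fix r s t :: "'a ser"
  show "r + s + t = r + (s + t)" "r + s = s + r" "0 + r = r"
    by (auto intro!: ser_eqI simp: add_ac)
  show "r * s * t = r * (s * t)" by (rule times_ser_assoc)
  show "r * s = s * r" by (rule times_ser_commute)
  show "1 * r = r" by (rule times_ser_one)
  show "0 * r = 0" "r * 0 = 0" by (auto intro!: ser_eqI simp: cf_times if_distrib cong: if_cong)
  show "(r + s) * t = r * t + s * t"
    by (rule ser_eqI)
       (auto simp: cf_times distrib_right nn_integral_add[symmetric] intro!: nn_integral_cong)
  obtain e :: 'a where "pemp e" using padd_pemp_ex by blast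
  then have "cf 0 e \<noteq> cf (1 :: 'a ser) e" by (simp add: cf_1)
  then show "(0 :: 'a ser) \<noteq> 1" by metis
qed

section \<open>Infinite sums and scalar multiples of series\<close>

definition isum :: "('i \<Rightarrow> 'a ser) \<Rightarrow> 'a ser" where
  "isum f = Ser (\<lambda>x. \<Sum>\<^sup>+ i. cf (f i) x)"

definition scal :: "ennreal \<Rightarrow> 'a ser \<Rightarrow> 'a ser" where
  "scal c r = Ser (\<lambda>x. c * cf r x)"

lemma cf_isum: "cf (isum f) x = (\<Sum>\<^sup>+ i. cf (f i) x)"
  and cf_scal [simp]: "cf (scal c r) x = c * cf r x"
  by (simp_all add: isum_def scal_def)

lemma cf_if: "cf (if P then r else 0) x = (if P then cf r x else 0)"
  by simp

lemma isum_0 [simp]: "isum (\<lambda>_. 0) = 0"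
  by (rule ser_eqI) (simp add: cf_isum)

lemma isum_mult: "isum f * r = isum (\<lambda>i. f i * r)"
proof (rule ser_eqI)
  fix z
  have "cf (isum f * r) z =
      (\<Sum>\<^sup>+ x. \<Sum>\<^sup>+ y. \<Sum>\<^sup>+ i. if padd x y z then cf (f i) x * cf r y else 0)"
    unfolding cf_times cf_isum
    by (auto simp: nn_integral_multc[symmetric] intro!: nn_integral_cong)
  also have "\<dots> = (\<Sum>\<^sup>+ i. \<Sum>\<^sup>+ x. \<Sum>\<^sup>+ y. if padd x y z then cf (f i) x * cf r y else 0)"
    by (rule sym, subst sum_swap, rule nn_integral_cong, rule sum_swap)
  finally show "cf (isum f * r) z = cf (isum (\<lambda>i. f i * r)) z"
    by (simp add: cf_isum cf_times)
qed

lemma mult_isum: "r * isum f = isum (\<lambda>i. r * f i)"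
  using isum_mult[of f r] by (simp add: mult.commute)

lemma isum_add: "isum (\<lambda>i. f i + g i) = isum f + isum g"
  by (rule ser_eqI) (simp add: cf_isum nn_integral_add)

lemma isum_swap: "isum (\<lambda>i. isum (\<lambda>j. f i j)) = isum (\<lambda>j. isum (\<lambda>i. f i j))"
  by (rule ser_eqI) (unfold cf_isum, rule sum_swap)

lemma isum_single: "(\<And>i. i \<noteq> a \<Longrightarrow> f i = 0) \<Longrightarrow> isum f = f a"
  by (rule ser_eqI) (auto simp: cf_isum intro!: sum_single)

lemma isum_if_eq [simp]:
  "isum (\<lambda>i. if i = a then f i else 0) = f a" "isum (\<lambda>i. if a = i then f i else 0) = f a"
  by (subst isum_single[of a]; simp)+

lemma isum_reindex:
  "inj p \<Longrightarrow> (\<And>i. i \<notin> range p \<Longrightarrow> f i = 0) \<Longrightarrow> isum f = isum (\<lambda>j. f (p j))"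
  by (rule ser_eqI) (auto simp: cf_isum intro!: sum_reindex)

lemma scal_mult: "scal c r * s = scal c (r * s)"
  by (rule ser_eqI) (auto simp: cf_times nn_integral_cmult[symmetric] mult.assoc intro!: nn_integral_cong)

lemma mult_scal: "r * scal c s = scal c (r * s)"
  using scal_mult[of c s r] by (simp add: mult.commute)

lemma scal_isum: "scal c (isum f) = isum (\<lambda>i. scal c (f i))"
  by (rule ser_eqI) (simp add: cf_isum nn_integral_cmult)

lemma scal_0 [simp]: "scal 0 r = 0" "scal c 0 = 0" and scal_1 [simp]: "scal 1 r = r"
  by (auto intro!: ser_eqI)

lemma if_mult_ser: "(if P then r else 0) * s = (if P then r * s else (0 :: 'a :: pcm ser))"
  "s * (if P then r else 0) = (if P then s * r else (0 :: 'a :: pcm ser))"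
  by simp_all

subsection \<open>Instances\<close>

text \<open>Serves for step counts, the exponents of \<open>tick\<close>.\<close>

instantiation nat :: pcm
begin
definition padd_nat :: "nat \<Rightarrow> nat \<Rightarrow> nat \<Rightarrow> bool" where "padd_nat x y z \<longleftrightarrow> z = x + y"
definition pemp_nat :: "nat \<Rightarrow> bool" where "pemp_nat x \<longleftrightarrow> x = 0"
instance by standard (auto simp: padd_nat_def pemp_nat_def)
end

text \<open>Serves for monomials in the coin parameters.\<close>

instantiation multiset :: (type) pcm
begin
definition padd_multiset :: "'a multiset \<Rightarrow> 'a multiset \<Rightarrow> 'a multiset \<Rightarrow> bool" where
  "padd_multiset x y z \<longleftrightarrow> z = x + y"
definition pemp_multiset :: "'a multiset \<Rightarrow> bool" where "pemp_multiset x \<longleftrightarrow> x = {#}"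
instance by standard (auto simp: padd_multiset_def pemp_multiset_def)
end

instantiation prod :: (pcm, pcm) pcm
begin
definition padd_prod :: "'a \<times> 'b \<Rightarrow> 'a \<times> 'b \<Rightarrow> 'a \<times> 'b \<Rightarrow> bool" where
  "padd_prod x y z \<longleftrightarrow> padd (fst x) (fst y) (fst z) \<and> padd (snd x) (snd y) (snd z)"
definition pemp_prod :: "'a \<times> 'b \<Rightarrow> bool" where "pemp_prod x \<longleftrightarrow> pemp (fst x) \<and> pemp (snd x)"
instance
proof
  fix x y z z' w t :: "'a \<times> 'b"
  show "padd x y z \<Longrightarrow> padd y x z" by (auto simp: padd_prod_def padd_commute_iff)
  show "padd x y z \<Longrightarrow> padd x y z' \<Longrightarrow> z = z'"
    by (auto simp: padd_prod_def prod_eq_iff dest: padd_functional)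
  show "padd x y w \<Longrightarrow> padd w z t \<Longrightarrow> \<exists>v. padd y z v \<and> padd x v t"
    using padd_assoc[of "fst x" "fst y" "fst w" "fst z" "fst t"]
      padd_assoc[of "snd x" "snd y" "snd w" "snd z" "snd t"]
    by (force simp: padd_prod_def)
  show "pemp x \<Longrightarrow> padd x y z \<Longrightarrow> y = z"
    by (auto simp: padd_prod_def pemp_prod_def prod_eq_iff dest: padd_pempD)
  show "\<exists>x. pemp x \<and> padd x z z"
    using padd_pemp_ex[of "fst z"] padd_pemp_ex[of "snd z"]
    by (force simp: padd_prod_def pemp_prod_def)
qed
end

text \<open>Serves for context points, with one entry per free variable; lists of different lengths
  have no sum.\<close>

instantiation list :: (pcm) pcm
begin
fun padd_list :: "'a list \<Rightarrow> 'a list \<Rightarrow> 'a list \<Rightarrow> bool" where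
  "padd_list [] [] [] = True"
| "padd_list (x # xs) (y # ys) (z # zs) = (padd x y z \<and> padd_list xs ys zs)"
| "padd_list _ _ _ = False"
definition pemp_list :: "'a list \<Rightarrow> bool" where "pemp_list xs \<longleftrightarrow> (\<forall>x\<in>set xs. pemp x)"

lemma padd_Cons_iff:
  "padd (x # xs) ys zs \<longleftrightarrow> (\<exists>y ys' z zs'. ys = y # ys' \<and> zs = z # zs' \<and> padd x y z \<and> padd xs ys' zs')"
  "padd xs (y # ys) zs \<longleftrightarrow> (\<exists>x xs' z zs'. xs = x # xs' \<and> zs = z # zs' \<and> padd x y z \<and> padd xs' ys zs')"
  "padd xs ys (z # zs) \<longleftrightarrow> (\<exists>x xs' y ys'. xs = x # xs' \<and> ys = y # ys' \<and> padd x y z \<and> padd xs' ys' zs)"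
  by (cases xs; cases ys; cases zs; simp)+

lemma padd_Nil_iff [simp]:
  "padd [] ys zs \<longleftrightarrow> ys = [] \<and> zs = []" "padd xs [] zs \<longleftrightarrow> xs = [] \<and> zs = []"
  "padd xs ys [] \<longleftrightarrow> xs = [] \<and> ys = []" for xs ys zs :: "'a list"
  by (cases xs; cases ys; cases zs; simp)+

instance
proof
  fix x y z z' w t :: "'a list"
  show "padd x y z \<Longrightarrow> padd y x z"
    by (induction x y z rule: padd_list.induct) (auto simp: padd_commute_iff)
  show "padd x y z \<Longrightarrow> padd x y z' \<Longrightarrow> z = z'"
    by (induction x y z arbitrary: z' rule: padd_list.induct)
       (auto simp: padd_Cons_iff dest: padd_functional)
  show "padd x y w \<Longrightarrow> padd w z t \<Longrightarrow> \<exists>v. padd y z v \<and> padd x v t"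
  proof (induction x y w arbitrary: z t rule: padd_list.induct)
    case (2 x xs y ys w ws)
    then obtain z1 zs t1 ts where zt: "z = z1 # zs" "t = t1 # ts"
      and *: "padd w z1 t1" "padd ws zs ts" "padd x y w" "padd xs ys ws"
      by (auto simp: padd_Cons_iff)
    from padd_assoc[OF *(3,1)] obtain v where "padd y z1 v" "padd x v t1" by blast
    moreover from "2.IH"[OF *(4,2)] obtain vs where "padd ys zs vs" "padd xs vs ts" by blast
    ultimately have "padd (y # ys) z (v # vs) \<and> padd (x # xs) (v # vs) t" by (simp add: zt)
    then show ?case by blast
  qed auto
  show "pemp x \<Longrightarrow> padd x y z \<Longrightarrow> y = z"
    by (induction x y z rule: padd_list.induct) (auto simp: pemp_list_def dest: padd_pempD)
  show "\<exists>x. pemp x \<and> padd x z z"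
  proof (induction z)
    case Nil
    then show ?case by (auto simp: pemp_list_def)
  next
    case (Cons a z)
    then obtain x where "pemp x" "padd x z z" by blast
    moreover obtain y where "pemp y" "padd y a a" using padd_pemp_ex by blast
    ultimately have "pemp (y # x) \<and> padd (y # x) (a # z) (a # z)" by (simp add: pemp_list_def)
    then show ?case by blast
  qed
qed
end

lemma pemp_Nil [simp]: "pemp []"
  and pemp_Cons [simp]: "pemp (x # xs) \<longleftrightarrow> pemp x \<and> pemp xs"
  and pemp_append [simp]: "pemp (xs @ ys) \<longleftrightarrow> pemp xs \<and> pemp ys"
  by (auto simp: pemp_list_def)

lemma padd_length: "padd xs ys zs \<Longrightarrow> length xs = length zs \<and> length ys = length zs"
  for xs ys zs :: "'a :: pcm list"
  by (induction xs ys zs rule: padd_list.induct) auto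

lemma padd_append:
  "length xs = length zs \<Longrightarrow> length ys = length zs \<Longrightarrow>
   padd (xs @ xs') (ys @ ys') (zs @ zs') \<longleftrightarrow> padd xs ys zs \<and> padd xs' ys' (zs' :: 'a :: pcm list)"
  by (induction xs ys zs rule: padd_list.induct) auto

subsection \<open>Points as a partial commutative monoid\<close>

text \<open>The comultiplication of all positive types at once: c = a + b records that a structure
  map has entry 1 at (c, [a, b]). Likewise \<open>pemp_pt'\<close> below records entry 1 at the
  empty bag, that is, which points may be discarded.\<close>

inductive padd_pt' :: "pt \<Rightarrow> pt \<Rightarrow> pt \<Rightarrow> bool" where
  "padd_pt' PStar PStar PStar"
| "padd_pt' a b c \<Longrightarrow> padd_pt' a' b' c' \<Longrightarrow> padd_pt' (PPair a a') (PPair b b') (PPair c c')"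
| "padd_pt' a b c \<Longrightarrow> padd_pt' (PIn i a) (PIn i b) (PIn i c)"
| "padd_pt' (PBag a) (PBag b) (PBag (a + b))"

inductive pemp_pt' :: "pt \<Rightarrow> bool" where
  "pemp_pt' PStar"
| "pemp_pt' a \<Longrightarrow> pemp_pt' b \<Longrightarrow> pemp_pt' (PPair a b)"
| "pemp_pt' a \<Longrightarrow> pemp_pt' (PIn i a)"
| "pemp_pt' (PBag {#})"

inductive_simps padd_pt'_simps:
  "padd_pt' PStar b c" "padd_pt' a PStar c" "padd_pt' a b PStar"
  "padd_pt' (PPair a a') b c" "padd_pt' a (PPair b b') c" "padd_pt' a b (PPair c c')"
  "padd_pt' (PIn i a) b c" "padd_pt' a (PIn i b) c" "padd_pt' a b (PIn i c)"
  "padd_pt' (PBag x) b c" "padd_pt' a (PBag x) c" "padd_pt' a b (PBag x)"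

inductive_simps pemp_pt'_simps:
  "pemp_pt' PStar" "pemp_pt' (PPair a b)" "pemp_pt' (PIn i a)" "pemp_pt' (PBag x)"

instantiation pt :: pcm
begin
definition padd_pt :: "pt \<Rightarrow> pt \<Rightarrow> pt \<Rightarrow> bool" where "padd_pt = padd_pt'"
definition pemp_pt :: "pt \<Rightarrow> bool" where "pemp_pt = pemp_pt'"

lemmas padd_pt_simps = padd_pt'_simps[folded padd_pt_def]
lemmas pemp_pt_simps [simp] = pemp_pt'_simps[folded pemp_pt_def]

instance
proof
  fix x y z z' w t :: pt
  show "padd x y z \<Longrightarrow> padd y x z" unfolding padd_pt_def
    by (induction rule: padd_pt'.induct) (auto simp: add.commute padd_pt'_simps)
  show "padd x y z \<Longrightarrow> padd x y z' \<Longrightarrow> z = z'" unfolding padd_pt_def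
  proof (induction arbitrary: z' rule: padd_pt'.induct)
    case (2 a b c a' b' c')
    from 2(5) obtain d d' where "z' = PPair d d'" "padd_pt' a b d" "padd_pt' a' b' d'"
      by (cases rule: padd_pt'.cases)
    with 2(3,4) show ?case by blast
  next
    case (3 a b c i)
    from 3(3) obtain d where "z' = PIn i d" "padd_pt' a b d"
      by (cases rule: padd_pt'.cases)
    with 3(2) show ?case by blast
  qed (auto elim: padd_pt'.cases)
  show "padd x y w \<Longrightarrow> padd w z t \<Longrightarrow> \<exists>v. padd y z v \<and> padd x v t" unfolding padd_pt_def
  proof (induction arbitrary: z t rule: padd_pt'.induct)
    case (2 a b c a' b' c')
    from 2(5) obtain d d' e e' where "z = PPair d d'" "t = PPair e e'" "padd_pt' c d e" "padd_pt' c' d' e'"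
      by (cases rule: padd_pt'.cases)
    with 2(3,4) show ?case by (meson padd_pt'.intros(2))
  next
    case (3 a b c i)
    from 3(3) obtain d e where "z = PIn i d" "t = PIn i e" "padd_pt' c d e"
      by (cases rule: padd_pt'.cases)
    with 3(2) show ?case by (meson padd_pt'.intros(3))
  next
    case (4 a b)
    from 4 obtain d where "z = PBag d" "t = PBag (a + b + d)" by (cases rule: padd_pt'.cases)
    then show ?case using padd_pt'.intros(4) by (metis add.assoc)
  next
    case 1
    then show ?case by (cases rule: padd_pt'.cases) (blast intro: padd_pt'.intros)
  qed
  show "pemp x \<Longrightarrow> padd x y z \<Longrightarrow> y = z" unfolding padd_pt_def pemp_pt_def
  proof (induction arbitrary: y z rule: pemp_pt'.induct)
    case (2 a b)
    from 2(5) obtain d d' e e' where "y = PPair d d'" "z = PPair e e'" "padd_pt' a d e" "padd_pt' b d' e'"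
      by (cases rule: padd_pt'.cases)
    with 2(3,4) show ?case by blast
  next
    case (3 a i)
    from 3(3) obtain d e where "y = PIn i d" "z = PIn i e" "padd_pt' a d e"
      by (cases rule: padd_pt'.cases)
    with 3(2) show ?case by blast
  qed (auto elim: padd_pt'.cases)
  show "\<exists>x. pemp x \<and> padd x z z" unfolding padd_pt_def pemp_pt_def
  proof (induction z)
    case (PBag b)
    then show ?case using padd_pt'.intros(4)[of "{#}" b] pemp_pt'.intros(4) by auto
  qed (blast intro: padd_pt'.intros pemp_pt'.intros)+
qed
end

section \<open>The coalgebra structure of the positive types\<close>

primrec plsum :: "'a :: pcm list \<Rightarrow> 'a \<Rightarrow> bool" where
  "plsum [] z = pemp z"
| "plsum (x # xs) z = (\<exists>y. plsum xs y \<and> padd x y z)"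

lemma plsum_move: "plsum (xs @ x # ys) z \<longleftrightarrow> plsum (x # xs @ ys) z"
proof (induction xs arbitrary: z)
  case (Cons w xs)
  have "(\<exists>y v. plsum (xs @ ys) v \<and> padd x v y \<and> padd w y z) \<longleftrightarrow>
        (\<exists>y v. plsum (xs @ ys) v \<and> padd w v y \<and> padd x y z)"
    by (meson padd_assoc padd_assoc' padd_commute)
  then show ?case by (simp add: Cons) blast
qed simp

lemma plsum_perm: "mset xs = mset ys \<Longrightarrow> plsum xs z \<longleftrightarrow> plsum ys z"
proof (induction xs arbitrary: ys z)
  case (Cons x xs)
  then have "x \<in> set ys" by (metis list.set_intros(1) set_mset_mset)
  then obtain as bs where ys: "ys = as @ x # bs" by (meson split_list)
  with Cons have "plsum xs y \<longleftrightarrow> plsum (as @ bs) y" for y by auto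
  then show ?case unfolding ys plsum_move by simp
qed auto

text \<open>The iterated comultiplication, which turns out to be the entry of the structure maps at
  (z, B). It is defined through an enumeration of B as a list; by \<open>plsum_perm\<close> the
  choice does not matter.\<close>

definition spl :: "'a :: pcm \<Rightarrow> 'a multiset \<Rightarrow> bool" where
  "spl z B \<longleftrightarrow> (\<exists>xs. mset xs = B \<and> plsum xs z)"

lemma spl_empty [simp]: "spl z {#} \<longleftrightarrow> pemp z"
  by (auto simp: spl_def)

lemma spl_add: "spl z (add_mset a B) \<longleftrightarrow> (\<exists>y. padd a y z \<and> spl y B)"
proof
  assume "spl z (add_mset a B)"
  then obtain xs where xs: "mset xs = add_mset a B" "plsum xs z" by (auto simp: spl_def)
  obtain ys where ys: "mset ys = B" using ex_mset by blast
  then have "plsum (a # ys) z" using xs plsum_perm[of xs "a # ys"] by simp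
  then show "\<exists>y. padd a y z \<and> spl y B" using ys by (auto simp: spl_def)
next
  assume "\<exists>y. padd a y z \<and> spl y B"
  then obtain y ys where "padd a y z" "mset ys = B" "plsum ys y" by (auto simp: spl_def)
  then show "spl z (add_mset a B)" unfolding spl_def by (intro exI[of _ "a # ys"]) auto
qed

lemma spl_single [simp]: "spl z {#a#} \<longleftrightarrow> z = a"
  unfolding spl_add spl_empty by (metis padd_pempD2 padd_pemp_ex padd_commute)

lemma spl_pair: "spl z {#a, b#} \<longleftrightarrow> padd a b z"
  by (subst spl_add) simp

text \<open>This and the next two characterisations give exactly the conditions tested by the
  entries of \<open>one_coalg\<close>, \<open>dig_mat\<close> and \<open>mon_mat\<close>.\<close>

lemma spl_PStar: "spl PStar B \<longleftrightarrow> set_mset B \<subseteq> {PStar}"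
  by (induction B) (auto simp: spl_add padd_pt_simps)

lemma spl_PBag: "spl (PBag b) B \<longleftrightarrow> (\<exists>D. B = image_mset PBag D \<and> b = \<Sum>\<^sub># D)"
proof (induction B arbitrary: b)
  case (add x B)
  show ?case
  proof
    assume "spl (PBag b) (add_mset x B)"
    then obtain c d where "x = PBag c" "b = c + d" "spl (PBag d) B"
      by (auto simp: spl_add padd_pt_simps)
    with add obtain D where "B = image_mset PBag D" "d = \<Sum>\<^sub># D" by blast
    then show "\<exists>D. add_mset x B = image_mset PBag D \<and> b = \<Sum>\<^sub># D"
      using \<open>x = PBag c\<close> \<open>b = c + d\<close> by (intro exI[of _ "add_mset c D"]) auto
  next
    assume "\<exists>D. add_mset x B = image_mset PBag D \<and> b = \<Sum>\<^sub># D"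
    then obtain c D where "x = PBag c" "B = image_mset PBag D" "b = c + \<Sum>\<^sub># D"
      by (auto dest!: msed_map_invR[OF sym])
    with add show "spl (PBag b) (add_mset x B)" by (auto simp: spl_add padd_pt_simps)
  qed
qed auto

lemma spl_PPair:
  "spl (PPair a b) B \<longleftrightarrow>
   (\<exists>r. B = image_mset (\<lambda>(a, b). PPair a b) r \<and> spl a (image_mset fst r) \<and> spl b (image_mset snd r))"
proof (induction B arbitrary: a b)
  case (add x B)
  show ?case
  proof
    assume "spl (PPair a b) (add_mset x B)"
    then obtain a1 b1 a2 b2 where x: "x = PPair a1 b1" "padd a1 a2 a" "padd b1 b2 b" "spl (PPair a2 b2) B"
      by (auto simp: spl_add padd_pt_simps)
    with add obtain r where "B = image_mset (\<lambda>(a, b). PPair a b) r"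
        "spl a2 (image_mset fst r)" "spl b2 (image_mset snd r)" by blast
    then show "\<exists>r. add_mset x B = image_mset (\<lambda>(a, b). PPair a b) r \<and> spl a (image_mset fst r)
        \<and> spl b (image_mset snd r)"
      using x by (intro exI[of _ "add_mset (a1, b1) r"]) (auto simp: spl_add)
  next
    assume "\<exists>r. add_mset x B = image_mset (\<lambda>(a, b). PPair a b) r \<and> spl a (image_mset fst r)
        \<and> spl b (image_mset snd r)"
    then obtain a1 b1 r where "x = PPair a1 b1" "B = image_mset (\<lambda>(a, b). PPair a b) r"
        "spl a (image_mset fst (add_mset (a1, b1) r))" "spl b (image_mset snd (add_mset (a1, b1) r))"
      by (fastforce dest!: msed_map_invR[OF sym])
    with add show "spl (PPair a b) (add_mset x B)" by (fastforce simp: spl_add padd_pt_simps)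
  qed
qed auto

text \<open>Cancellation is special to points and not part of the class. It makes the rest y in z =
  a + y unique, so that an existential over y can become a sum.\<close>

lemma padd_cancel: "padd a y z \<Longrightarrow> padd a y' z \<Longrightarrow> y = (y' :: pt)"
  unfolding padd_pt_def
proof (induction arbitrary: y' rule: padd_pt'.induct)
  case (2 a b c a' b' c')
  from 2(5) obtain d d' where "y' = PPair d d'" "padd_pt' a d c" "padd_pt' a' d' c'"
    by (cases rule: padd_pt'.cases)
  with 2(3,4) show ?case by blast
next
  case (3 a b c i)
  from 3(3) obtain d where "y' = PIn i d" "padd_pt' a d c"
    by (cases rule: padd_pt'.cases)
  with 3(2) show ?case by blast
qed (auto elim: padd_pt'.cases)

text \<open>Guarantees that cutting the sum of points down to a web loses no decomposition of a
  point of that web.\<close>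

definition hereditary :: "pt set \<Rightarrow> bool" where
  "hereditary W \<longleftrightarrow> (\<forall>a b c. padd a b c \<longrightarrow> c \<in> W \<longrightarrow> a \<in> W)"

lemma hereditaryD: "hereditary W \<Longrightarrow> padd a b c \<Longrightarrow> c \<in> W \<Longrightarrow> a \<in> W \<and> b \<in> W"
  unfolding hereditary_def using padd_commute by blast

lemma hereditary_spl: "hereditary W \<Longrightarrow> spl c B \<Longrightarrow> c \<in> W \<Longrightarrow> set_mset B \<subseteq> W"
  by (induction B arbitrary: c) (auto simp: spl_add dest: hereditaryD)

text \<open>The structure map is the universal comultiplication of points cut down to the web. Once
  all positive types are known to be good, they share the one algebra of series over
  \<open>pt\<close>.\<close>

definition good :: "coalg \<Rightarrow> bool" where
  "good A \<longleftrightarrow> hereditary (web (car A)) \<and>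
     (\<forall>x y. str A x y = (if x \<in> web (car A) \<and> (\<exists>B. y = PBag B \<and> spl x B) then 1 else 0))"

lemma good_str: "good A \<Longrightarrow> str A x (PBag B) = (if x \<in> web (car A) \<and> spl x B then 1 else 0)"
  by (simp add: good_def)

lemma good_str_other: "good A \<Longrightarrow> (\<And>B. y \<noteq> PBag B) \<Longrightarrow> str A x y = 0"
  by (simp add: good_def)

subsection \<open>Promotion as a product\<close>

lemma bang_coeff_csum:
  "bang_coeff t c d = (\<Sum>\<^sup>+ r. if image_mset fst r = c \<and> image_mset snd r = d
     then ennreal (real (mfact d) / real (mfact r)) * mpow (\<lambda>(a, b). t a b) r else 0)"
proof -
  have "bang_coeff t c d = (\<Sum>\<^sup>+ r. ennreal (real (mfact d) / real (mfact r)) * mpow (\<lambda>(a, b). t a b) r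
      * indicator {r. image_mset fst r = c \<and> image_mset snd r = d} r)"
    unfolding bang_coeff_def
    by (subst nn_integral_restrict_space[symmetric]) (auto simp: restrict_count_space)
  then show ?thesis by (auto simp: indicator_def intro!: nn_integral_cong)
qed

lemma bang_coeff_empty: "bang_coeff t c {#} = (if c = {#} then 1 else 0)"
  unfolding bang_coeff_csum by (subst sum_single[of "{#}"]) (auto simp: mpow_def mfact_def)

text \<open>Delete one pair (a, b) from r. Weighting the deletion by the multiplicity of (a, b)
  turns r! into the factorial of the rest; over all a these multiplicities add up to the
  multiplicity of b in \<open>add_mset b d\<close>, which is the factor that its factorial has
  beyond that of d.\<close>

lemma bang_coeff_add:
  "bang_coeff t c (add_mset b d) =
   (\<Sum>\<^sup>+ a. \<Sum>\<^sup>+ c'. if c = add_mset a c' then t a b * bang_coeff t c' d else 0)"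
proof -
  let ?w = "\<lambda>(a, b). t a b"
  let ?F = "\<lambda>d r. ennreal (real (mfact d) / real (mfact r)) * mpow ?w r"
  let ?G = "\<lambda>r a. if image_mset fst r = c \<and> image_mset snd r = add_mset b d \<and> (a, b) \<in># r
              then t a b * ?F d (r - {#(a, b)#}) else 0"
  have *: "(if image_mset fst r = c \<and> image_mset snd r = add_mset b d then ?F (add_mset b d) r else 0) =
      (\<Sum>\<^sup>+ a. ?G r a)" for r
  proof (cases "image_mset fst r = c \<and> image_mset snd r = add_mset b d")
    case True
    let ?c = "ennreal (real (mfact d) / real (mfact r)) * mpow ?w r"
    have G: "?G r a = ?c * of_nat (count r (a, b))" for a
    proof (cases "(a, b) \<in># r")
      case in_r: True
      then obtain r' where r': "r = add_mset (a, b) r'" by (meson mset_add)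
      have "real (mfact d) / real (mfact r') =
          real (mfact d) / real (mfact r) * real (count r (a, b))"
        using mfact_pos[of r'] by (simp add: r' mfact_add divide_simps del: of_nat_Suc of_nat_add distrib_left distrib_right mult_Suc)
      then have "ennreal (real (mfact d) / real (mfact r')) =
          ennreal (real (mfact d) / real (mfact r)) * of_nat (count r (a, b))"
        by (simp add: ennreal_mult' ennreal_of_nat_eq_real_of_nat del: times_divide_eq_left)
      then show ?thesis using in_r True by (simp add: r' mpow_mset mult_ac)
    next
      case False
      then have "count r (a, b) = 0" by (simp add: not_in_iff)
      then show ?thesis using False by simp
    qed
    have "(\<Sum>\<^sup>+ a. ?G r a) = ?c * of_nat (Suc (count d b))"
      unfolding G using sum_count_snd[of r b] True by (simp add: nn_integral_cmult)
    also have "\<dots> = ?F (add_mset b d) r"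
    proof -
      have "ennreal (real (mfact (add_mset b d)) / real (mfact r)) =
          ennreal (real (mfact d) / real (mfact r)) * of_nat (Suc (count d b))"
        unfolding ennreal_of_nat_eq_real_of_nat mfact_add
        by (subst ennreal_mult'[symmetric]) (simp_all add: algebra_simps)
      then show ?thesis by (simp add: mult_ac del: of_nat_Suc)
    qed
    finally show ?thesis using True by simp
  next
    case False
    then have "\<not> (\<exists>a. ?G r a \<noteq> 0)" by auto
    then have "(\<Sum>\<^sup>+ a. ?G r a) = 0" using csum_neq_0_iff[of "?G r"] by blast
    then show ?thesis unfolding if_not_P[OF False] by (rule sym)
  qed
  have "bang_coeff t c (add_mset b d) = (\<Sum>\<^sup>+ a. \<Sum>\<^sup>+ r. ?G r a)"
    unfolding bang_coeff_csum * by (rule sum_swap)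
  also have "\<dots> = (\<Sum>\<^sup>+ a. \<Sum>\<^sup>+ c'. if c = add_mset a c' then t a b * bang_coeff t c' d else 0)"
  proof (rule nn_integral_cong)
    fix a
    have "(\<Sum>\<^sup>+ r. ?G r a) = (\<Sum>\<^sup>+ r. ?G (add_mset (a, b) r) a)"
    proof (rule sum_reindex)
      fix r assume "r \<notin> range (add_mset (a, b))"
      then have "(a, b) \<notin># r" by (metis mset_add rangeI)
      then show "?G r a = 0" by simp
    qed (simp add: inj_def)
    also have "\<dots> = (\<Sum>\<^sup>+ r. \<Sum>\<^sup>+ c'. if c = add_mset a c' \<and> image_mset fst r = c' \<and> image_mset snd r = d
        then t a b * ?F d r else 0)"
    proof (rule nn_integral_cong)
      fix r
      show "?G (add_mset (a, b) r) a = (\<Sum>\<^sup>+ c'. if c = add_mset a c' \<and> image_mset fst r = c' \<and> image_mset snd r = d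
        then t a b * ?F d r else 0)"
        by (subst sum_single[of "image_mset fst r"]) auto
    qed
    also have "\<dots> = (\<Sum>\<^sup>+ c'. \<Sum>\<^sup>+ r. if c = add_mset a c' \<and> image_mset fst r = c' \<and> image_mset snd r = d
        then t a b * ?F d r else 0)"
      by (rule sum_swap)
    also have "\<dots> = (\<Sum>\<^sup>+ c'. if c = add_mset a c' then t a b * bang_coeff t c' d else 0)"
      unfolding bang_coeff_csum
      by (auto simp: nn_integral_cmult[symmetric] intro!: nn_integral_cong)
    finally show "(\<Sum>\<^sup>+ r. ?G r a) = (\<Sum>\<^sup>+ c'. if c = add_mset a c' then t a b * bang_coeff t c' d else 0)" .
  qed
  finally show ?thesis .
qed

lemma stop_mat_csum:
  assumes "good A" "g \<in> web (car A)"
  shows "stop_mat A t g (PBag D) = (\<Sum>\<^sup>+ c. if spl g c then bang_coeff t c D else 0)"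
proof -
  have "stop_mat A t g (PBag D) = (\<Sum>\<^sup>+ c. str A g (PBag c) * bang_coeff t c D)"
    unfolding stop_mat_def mcomp_def
    by (subst sum_PBag) (auto simp: good_str_other[OF assms(1)] bang_mat_def split: pt.splits)
  then show ?thesis using assms by (auto simp: good_str intro!: nn_integral_cong)
qed

text \<open>In the algebra of series over points, promotion is a product; the factorials of the
  exponential have disappeared.\<close>

lemma stop_mat_prod:
  assumes A: "good A" and g: "g \<in> web (car A)"
  shows "stop_mat A t g (PBag D) = cf (\<Prod>b\<in>#D. Ser (\<lambda>g. t g b)) g"
  unfolding stop_mat_csum[OF A g] using g
proof (induction D arbitrary: g)
  case empty
  show ?case by (subst sum_single[of "{#}"]) (auto simp: bang_coeff_empty cf_1)
next
  case (add b D)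
  have her: "hereditary (web (car A))" using A by (simp add: good_def)
  have "(\<Sum>\<^sup>+ c. if spl g c then bang_coeff t c (add_mset b D) else 0) =
     (\<Sum>\<^sup>+ c. \<Sum>\<^sup>+ a. \<Sum>\<^sup>+ c'. if c = add_mset a c' \<and> spl g (add_mset a c') then t a b * bang_coeff t c' D else 0)"
  proof (rule nn_integral_cong)
    fix c
    show "(if spl g c then bang_coeff t c (add_mset b D) else 0) =
        (\<Sum>\<^sup>+ a. \<Sum>\<^sup>+ c'. if c = add_mset a c' \<and> spl g (add_mset a c') then t a b * bang_coeff t c' D else 0)"
    proof (cases "spl g c")
      case True
      then show ?thesis by (auto simp: bang_coeff_add intro!: nn_integral_cong)
    next
      case False
      then show ?thesis by (simp only: if_False, intro csum_0I[symmetric] csum_0I) auto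
    qed
  qed
  also have "\<dots> = (\<Sum>\<^sup>+ a. \<Sum>\<^sup>+ c'. \<Sum>\<^sup>+ c. if c = add_mset a c' \<and> spl g (add_mset a c') then t a b * bang_coeff t c' D else 0)"
    by (subst sum_swap, rule nn_integral_cong, rule sum_swap)
  also have "\<dots> = (\<Sum>\<^sup>+ a. \<Sum>\<^sup>+ c'. if spl g (add_mset a c') then t a b * bang_coeff t c' D else 0)"
    by (intro nn_integral_cong, subst sum_single) auto
  \<comment> \<open>The rest y of the decomposition is unique by cancellation, so the existential
    becomes a sum that can be moved outwards to form a convolution.\<close>
  also have "\<dots> = (\<Sum>\<^sup>+ a. \<Sum>\<^sup>+ c'. \<Sum>\<^sup>+ y. if padd a y g \<and> spl y c' then t a b * bang_coeff t c' D else 0)"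
    unfolding spl_add
    by (intro nn_integral_cong csum_functional[symmetric]) (auto dest: padd_cancel)
  also have "\<dots> = (\<Sum>\<^sup>+ a. \<Sum>\<^sup>+ y. \<Sum>\<^sup>+ c'. if padd a y g \<and> spl y c' then t a b * bang_coeff t c' D else 0)"
    by (rule nn_integral_cong, rule sum_swap)
  also have "\<dots> = (\<Sum>\<^sup>+ a. \<Sum>\<^sup>+ y. if padd a y g then t a b * cf (\<Prod>b\<in>#D. Ser (\<lambda>g. t g b)) y else 0)"
  proof (intro nn_integral_cong)
    fix a y
    show "(\<Sum>\<^sup>+ c'. if padd a y g \<and> spl y c' then t a b * bang_coeff t c' D else 0) =
        (if padd a y g then t a b * cf (\<Prod>b\<in>#D. Ser (\<lambda>g. t g b)) y else 0)"
    proof (cases "padd a y g")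
      case True
      then have "y \<in> web (car A)" using her add.prems by (blast dest: hereditaryD)
      then show ?thesis
        using True by (simp add: add.IH[symmetric] nn_integral_cmult[symmetric] if_distrib cong: if_cong)
    qed simp
  qed
  also have "\<dots> = cf (\<Prod>b\<in>#add_mset b D. Ser (\<lambda>g. t g b)) g"
    by (simp add: cf_times cong: if_cong)
  finally show ?case .
qed

lemma stop_mat_other:
  assumes "\<And>D. y \<noteq> PBag D"
  shows "stop_mat A t g y = 0"
proof -
  have "bang_mat t x y = 0" for x using assms by (auto simp: bang_mat_def split: pt.splits)
  then show ?thesis by (simp add: stop_mat_def mcomp_def)
qed

lemma stop_mat_outside: "good A \<Longrightarrow> g \<notin> web (car A) \<Longrightarrow> stop_mat A t g y = 0"
  by (auto simp: stop_mat_def mcomp_def good_def)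

section \<open>Every type constructor yields a good coalgebra\<close>

lemma web_simps [simp]:
  "web (car one_coalg) = {PStar}"
  "web (car empty_coalg) = {}"
  "web (car (bang_coalg X)) = {PBag b | b. set_mset b \<subseteq> web X}"
  "web (car (tensor_coalg A B)) = {PPair a b | a b. a \<in> web (car A) \<and> b \<in> web (car B)}"
  "web (car (plus_coalg A B)) = PIn Lft ` web (car A) \<union> PIn Rgt ` web (car B)"
  "web (car (union_coalg F)) = (\<Union>n. web (car (F n)))"
  "web (lolli_pcs X Y) = {PPair a b | a b. a \<in> web X \<and> b \<in> web Y}"
  by (auto simp: one_coalg_def one_pcs_def empty_coalg_def bang_coalg_def bang_pcs_def tensor_coalg_def
      tensor_pcs_def plus_coalg_def plus_pcs_def union_coalg_def lolli_pcs_def dual_def Let_def)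

lemma good_one: "good one_coalg"
proof -
  have "(\<exists>k. B = replicate_mset k PStar) \<longleftrightarrow> set_mset B \<subseteq> {PStar}" for B
    by (metis set_mset_subset_singletonD set_mset_replicate_mset_subset subset_refl empty_subsetI)
  then have "(\<exists>k. y = PBag (replicate_mset k PStar)) \<longleftrightarrow> (\<exists>B. y = PBag B \<and> spl PStar B)" for y
    by (metis spl_PStar)
  then show ?thesis
    by (auto simp: good_def hereditary_def padd_pt_simps) (auto simp: one_coalg_def)
qed

lemma good_bang: "good (bang_coalg X)"
  by (auto simp: good_def hereditary_def padd_pt_simps) (auto simp: bang_coalg_def dig_mat_def spl_PBag)

lemma good_empty: "good empty_coalg"
  by (auto simp: good_def hereditary_def) (auto simp: empty_coalg_def)

lemma good_union:
  assumes "\<And>n. good (F n)"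
  shows "good (union_coalg F)"
proof -
  have "str (union_coalg F) x y = (SUP n. if x \<in> web (car (F n)) \<and> (\<exists>B. y = PBag B \<and> spl x B) then 1 else 0)" for x y
    using assms by (auto simp: union_coalg_def Let_def good_def)
  moreover have "(SUP n. if x \<in> web (car (F n)) \<and> (\<exists>B. y = PBag B \<and> spl x B) then 1 else 0) =
      (if x \<in> (\<Union>n. web (car (F n))) \<and> (\<exists>B. y = PBag B \<and> spl x B) then 1 else 0 :: ennreal)" for x y
  proof (cases "x \<in> (\<Union>n. web (car (F n))) \<and> (\<exists>B. y = PBag B \<and> spl x B)")
    case True
    then obtain n where n: "x \<in> web (car (F n)) \<and> (\<exists>B. y = PBag B \<and> spl x B)" by blast
    show ?thesis unfolding if_P[OF True]
      by (rule antisym, rule SUP_least, simp, rule SUP_upper2[of n], simp, unfold if_P[OF n], simp)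
  next
    case False
    then have "\<not> (x \<in> web (car (F n)) \<and> (\<exists>B. y = PBag B \<and> spl x B))" for n by blast
    then show ?thesis using False by (simp only: if_False) simp
  qed
  moreover have "hereditary (\<Union>n. web (car (F n)))"
    using assms unfolding good_def hereditary_def by blast
  ultimately show ?thesis by (simp add: good_def)
qed

text \<open>Decomposing a pair means giving a multiset of pairs whose marginals decompose the two
  components. The web condition built into \<open>mon_mat\<close> then holds because both webs are
  hereditary.\<close>

lemma good_tensor:
  assumes A: "good A" and B: "good B"
  shows "good (tensor_coalg A B)"
proof -
  let ?T = "tensor_coalg A B" and ?p = "\<lambda>(a, b). PPair a b"
  have her: "hereditary (web (car A))" "hereditary (web (car B))" using A B by (auto simp: good_def)
  then have "hereditary (web (car ?T))"
    unfolding hereditary_def web_simps by (auto simp: padd_pt_simps)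
  moreover have "str ?T x y = (if x \<in> web (car ?T) \<and> (\<exists>D. y = PBag D \<and> spl x D) then 1 else 0)" for x y
  proof (cases "\<exists>a b. x = PPair a b")
    case True
    then obtain a b where x: "x = PPair a b" by blast
    have eq: "str ?T x y = (\<Sum>\<^sup>+ x1. \<Sum>\<^sup>+ x2. str A a x1 * str B b x2 * mon_mat (car A) (car B) (PPair x1 x2) y)"
      unfolding tensor_coalg_def mcomp_def x
      by (simp, subst sum_PPair) (auto simp: mtensor_def split: pt.splits)
    show ?thesis
    proof (cases "\<exists>r. y = PBag (image_mset ?p r)")
      case True
      then obtain r where y: "y = PBag (image_mset ?p r)" by auto
      have injp: "inj ?p" by (auto simp: inj_def)
      have inj: "image_mset ?p r = image_mset ?p r' \<longleftrightarrow> r = r'" for r'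
        using multiset.inj_map[OF injp] unfolding inj_def by blast
      have m: "mon_mat (car A) (car B) (PPair x1 x2) y =
         (if set_mset r \<subseteq> web (car A) \<times> web (car B) \<and> x1 = PBag (image_mset fst r) \<and> x2 = PBag (image_mset snd r)
          then 1 else 0)" for x1 x2
        by (auto simp: mon_mat_def y inj)
      have "str ?T x y = str A a (PBag (image_mset fst r)) * str B b (PBag (image_mset snd r)) *
          (if set_mset r \<subseteq> web (car A) \<times> web (car B) then 1 else 0)"
        unfolding eq m
        by (subst sum_single[of "PBag (image_mset fst r)"]) (auto simp: sum_single[of "PBag (image_mset snd r)"])
      moreover have "set_mset r \<subseteq> web (car A) \<times> web (car B)"
        if "a \<in> web (car A)" "b \<in> web (car B)" "spl a (image_mset fst r)" "spl b (image_mset snd r)"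
        using hereditary_spl[OF her(1) that(3,1)] hereditary_spl[OF her(2) that(4,2)] by fastforce
      ultimately show ?thesis
        by (auto simp: good_str[OF A] good_str[OF B] x y spl_PPair inj)
    next
      case False
      then have "mon_mat (car A) (car B) z y = 0" for z by (auto simp: mon_mat_def)
      then show ?thesis unfolding eq using False by (auto simp: x spl_PPair)
    qed
  next
    case False
    then have "(str A \<otimes>\<^sub>m str B) x z = 0" for z by (auto simp: mtensor_def split: pt.splits)
    then have "str ?T x y = 0" by (simp add: tensor_coalg_def mcomp_def)
    then show ?thesis using False by auto
  qed
  ultimately show ?thesis by (simp add: good_def)
qed

text \<open>The structure of \<open>plus_coalg\<close> promotes an injection after the structure of
  a summand, so by \<open>stop_mat_prod\<close> its entries are the products computed here.\<close>

lemma prod_in_mat: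
  assumes "hereditary W" "a \<in> W" "W = web X"
  shows "cf (\<Prod>b\<in>#D. Ser (\<lambda>g. in_mat X i g b)) a = (if spl (PIn i a) D then 1 else 0)"
  using assms(2)
proof (induction D arbitrary: a)
  case empty
  show ?case by (simp add: cf_1)
next
  case (add x D)
  have "cf (\<Prod>b\<in>#add_mset x D. Ser (\<lambda>g. in_mat X i g b)) a =
      (\<Sum>\<^sup>+ b. \<Sum>\<^sup>+ c. if padd b c a \<and> x = PIn i b \<and> spl (PIn i c) D then 1 else 0)"
    unfolding image_mset_add_mset prod_mset.add_mset cf_times
  proof (intro nn_integral_cong)
    fix b c
    have "b \<in> W \<and> c \<in> W" if "padd b c a" using that assms(1) add.prems by (auto dest: hereditaryD)
    then show "(if padd b c a then cf (Ser (\<lambda>g. in_mat X i g x)) b *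
          cf (\<Prod>b\<in>#D. Ser (\<lambda>g. in_mat X i g b)) c else 0) =
        (if padd b c a \<and> x = PIn i b \<and> spl (PIn i c) D then 1 else 0)"
      using add.IH[of c] assms(3) by (auto simp: in_mat_def)
  qed
  also have "\<dots> = (\<Sum>\<^sup>+ b. if \<exists>c. padd b c a \<and> x = PIn i b \<and> spl (PIn i c) D then 1 else 0)"
    by (intro nn_integral_cong csum_functional) (auto dest: padd_cancel)
  also have "\<dots> = (if \<exists>b c. padd b c a \<and> x = PIn i b \<and> spl (PIn i c) D then 1 else 0)"
    by (rule csum_functional) auto
  also have "\<dots> = (if spl (PIn i a) (add_mset x D) then 1 else 0)"
    by (auto simp: spl_add padd_pt_simps)
  finally show ?case .
qed

lemma good_plus:
  assumes A: "good A" and B: "good B"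
  shows "good (plus_coalg A B)"
proof -
  let ?T = "plus_coalg A B"
  have her: "hereditary (web (car A))" "hereditary (web (car B))" using A B by (auto simp: good_def)
  then have "hereditary (web (car ?T))"
    unfolding hereditary_def web_simps by (auto simp: padd_pt_simps)
  moreover have "str ?T x y = (if x \<in> web (car ?T) \<and> (\<exists>D. y = PBag D \<and> spl x D) then 1 else 0)" for x y
  proof (cases x)
    case (PIn i a)
    let ?C = "sel i A B"
    have C: "good ?C" "hereditary (web (car ?C))" using A B her by (cases i; simp)+
    have "str ?T x y = stop_mat ?C (in_mat (car ?C) i) a y"
      by (simp add: plus_coalg_def PIn Let_def stop_mat_def)
    moreover have "x \<in> web (car ?T) \<longleftrightarrow> a \<in> web (car ?C)"
      by (cases i) (auto simp: PIn)
    ultimately show ?thesis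
      using stop_mat_outside[OF C(1), of a] stop_mat_other[of y] stop_mat_prod[OF C(1), of a]
        prod_in_mat[OF C(2) _ refl] PIn
      by (cases "a \<in> web (car ?C)"; cases "\<exists>D. y = PBag D") auto
  qed (auto simp: plus_coalg_def plus_pcs_def Let_def)
  ultimately show ?thesis by (simp add: good_def)
qed

text \<open>Joint induction over both sorts of types; the claim for general types is
  \<open>True\<close> because \<open>bang_coalg\<close> is good for every space.\<close>

lemma fixes \<sigma> :: gty
  shows good_pinterp: "(\<And>n. good (\<rho> n)) \<Longrightarrow> good (pinterp \<phi> \<rho>)"
    and "True"
proof (induction \<phi> and \<sigma> arbitrary: \<rho> and \<rho>)
  case (Mu \<phi>)
  have "good (((\<lambda>A. pinterp \<phi> (case_nat A \<rho>)) ^^ n) empty_coalg)" for n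
    by (induction n) (auto simp: good_empty Mu.prems intro!: Mu.IH split: nat.splits)
  then show ?case by (auto intro: good_union)
qed (auto simp: good_one good_bang good_tensor good_plus)

lemma good_psem: "good (psem \<phi>)"
  unfolding psem_def by (rule good_pinterp) (rule good_empty)

lemma good_ctx_sem: "good (ctx_sem \<Gamma>)"
  by (induction \<Gamma>) (auto simp: good_one good_tensor good_psem)

section \<open>Webs of closed types\<close>

text \<open>The webs of closed types as a least predicate, with \<open>Mu\<close> unfolded by
  substitution instead of approximated by a chain. Its rule induction works on points and so
  descends through recursive types, where the unfolded type need not be smaller.\<close>

inductive pw :: "pty \<Rightarrow> pt \<Rightarrow> bool" and gw :: "gty \<Rightarrow> pt \<Rightarrow> bool" where
  w_one: "pw One PStar"
| w_bang: "(\<And>x. x \<in># b \<Longrightarrow> gw \<sigma> x) \<Longrightarrow> pw (Bang \<sigma>) (PBag b)"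
| w_tensor: "pw \<phi> a \<Longrightarrow> pw \<psi> b \<Longrightarrow> pw (Tensor \<phi> \<psi>) (PPair a b)"
| w_plus: "pw (sel i \<phi> \<psi>) a \<Longrightarrow> pw (Plus \<phi> \<psi>) (PIn i a)"
| w_mu: "pw (psubst \<phi> 0 (Mu \<phi>)) a \<Longrightarrow> pw (Mu \<phi>) a"
| w_pos: "pw \<phi> a \<Longrightarrow> gw (Pos \<phi>) a"
| w_lolli: "pw \<phi> a \<Longrightarrow> gw \<sigma> b \<Longrightarrow> gw (Lolli \<phi> \<sigma>) (PPair a b)"

inductive_simps pw_simps:
  "pw One a" "pw (Bang \<sigma>) a" "pw (Tensor \<phi> \<psi>) a" "pw (Plus \<phi> \<psi>) a" "pw (Mu \<phi>) a"
  "gw (Pos \<phi>) a" "gw (Lolli \<phi> \<sigma>) a"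

section \<open>Closed types and closing substitutions\<close>

lemma pbound_mono: "pbound k \<phi> \<Longrightarrow> k \<le> j \<Longrightarrow> pbound j \<phi>"
  and gbound_mono: "gbound k \<sigma> \<Longrightarrow> k \<le> j \<Longrightarrow> gbound j \<sigma>"
  by (induction \<phi> and \<sigma> arbitrary: k j and k j) auto

lemma plift_bound: "pbound k \<phi> \<Longrightarrow> k \<le> j \<Longrightarrow> plift j \<phi> = \<phi>"
  and glift_bound: "gbound k \<sigma> \<Longrightarrow> k \<le> j \<Longrightarrow> glift j \<sigma> = \<sigma>"
  by (induction \<phi> and \<sigma> arbitrary: k j and k j) auto

lemma plift_closed: "pclosed \<phi> \<Longrightarrow> plift j \<phi> = \<phi>"
  using plift_bound by blast

lemma psubst_bound_id: "pbound k \<phi> \<Longrightarrow> k \<le> j \<Longrightarrow> psubst \<phi> j \<theta> = \<phi>"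
  and gsubst_bound_id: "gbound k \<sigma> \<Longrightarrow> k \<le> j \<Longrightarrow> gsubst \<sigma> j \<theta> = \<sigma>"
  by (induction \<phi> and \<sigma> arbitrary: k j \<theta> and k j \<theta>) auto

lemma psubst_closed: "pclosed \<phi> \<Longrightarrow> psubst \<phi> j \<theta> = \<phi>"
  using psubst_bound_id by blast

lemma psubst_bound: "pbound (Suc k) \<phi> \<Longrightarrow> pclosed \<theta> \<Longrightarrow> j \<le> k \<Longrightarrow> pbound k (psubst \<phi> j \<theta>)"
  and gsubst_bound: "gbound (Suc k) \<sigma> \<Longrightarrow> pclosed \<theta> \<Longrightarrow> j \<le> k \<Longrightarrow> gbound k (gsubst \<sigma> j \<theta>)"
  by (induction \<phi> and \<sigma> arbitrary: k j and k j) (auto simp: plift_closed pbound_mono[of 0])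

lemma pclosed_unfold: "pclosed (Mu \<phi>) \<Longrightarrow> pclosed (psubst \<phi> 0 (Mu \<phi>))"
  by (rule psubst_bound) auto

lemma psubst_commute:
  "pclosed \<theta> \<Longrightarrow> pclosed \<tau> \<Longrightarrow> psubst (psubst \<phi> (Suc j) \<theta>) j \<tau> = psubst (psubst \<phi> j \<tau>) j \<theta>"
  and gsubst_commute:
  "pclosed \<theta> \<Longrightarrow> pclosed \<tau> \<Longrightarrow> gsubst (gsubst \<sigma> (Suc j) \<theta>) j \<tau> = gsubst (gsubst \<sigma> j \<tau>) j \<theta>"
  by (induction \<phi> and \<sigma> arbitrary: j and j) (auto simp: plift_closed psubst_closed)

text \<open>Closes an open type by repeated substitution at one fixed index. Every substitution
  lowers the higher indices, so for closed entries the one at position i ends up replacing variable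
  k + i.\<close>

primrec pcl :: "nat \<Rightarrow> pty list \<Rightarrow> pty \<Rightarrow> pty" where
  "pcl k [] \<phi> = \<phi>"
| "pcl k (\<theta> # \<theta>s) \<phi> = pcl k \<theta>s (psubst \<phi> k \<theta>)"

primrec gcl :: "nat \<Rightarrow> pty list \<Rightarrow> gty \<Rightarrow> gty" where
  "gcl k [] \<sigma> = \<sigma>"
| "gcl k (\<theta> # \<theta>s) \<sigma> = gcl k \<theta>s (gsubst \<sigma> k \<theta>)"

lemma pcl_simps:
  "pcl k \<theta>s One = One" "pcl k \<theta>s (Bang \<sigma>) = Bang (gcl k \<theta>s \<sigma>)"
  "pcl k \<theta>s (Tensor \<phi> \<psi>) = Tensor (pcl k \<theta>s \<phi>) (pcl k \<theta>s \<psi>)"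
  "pcl k \<theta>s (Plus \<phi> \<psi>) = Plus (pcl k \<theta>s \<phi>) (pcl k \<theta>s \<psi>)"
  "gcl k \<theta>s (Pos \<phi>) = Pos (pcl k \<theta>s \<phi>)"
  "gcl k \<theta>s (Lolli \<phi> \<sigma>) = Lolli (pcl k \<theta>s \<phi>) (gcl k \<theta>s \<sigma>)"
  by (induction \<theta>s arbitrary: \<phi> \<psi> \<sigma>) auto

lemma pcl_Mu: "\<forall>\<theta>\<in>set \<theta>s. pclosed \<theta> \<Longrightarrow> pcl k \<theta>s (Mu \<phi>) = Mu (pcl (Suc k) \<theta>s \<phi>)"
  by (induction \<theta>s arbitrary: \<phi>) (auto simp: plift_closed)

lemma pcl_closed: "pclosed \<phi> \<Longrightarrow> pcl k \<theta>s \<phi> = \<phi>"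
  by (induction \<theta>s) (auto simp: psubst_closed)

lemma pcl_TVar: "\<forall>\<theta>\<in>set \<theta>s. pclosed \<theta> \<Longrightarrow> n < length \<theta>s \<Longrightarrow> pcl 0 \<theta>s (TVar n) = \<theta>s ! n"
  by (induction \<theta>s arbitrary: n) (auto simp: pcl_closed nth_Cons')

lemma pcl_bound: "\<forall>\<theta>\<in>set \<theta>s. pclosed \<theta> \<Longrightarrow> pbound (k + length \<theta>s) \<phi> \<Longrightarrow> pbound k (pcl k \<theta>s \<phi>)"
  by (induction \<theta>s arbitrary: \<phi>) (auto simp: psubst_bound)

lemma pcl_unfold:
  "\<forall>\<theta>\<in>set \<theta>s. pclosed \<theta> \<Longrightarrow> pclosed \<tau> \<Longrightarrow> psubst (pcl (Suc 0) \<theta>s \<phi>) 0 \<tau> = pcl 0 (\<tau> # \<theta>s) \<phi>"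
  by (induction \<theta>s arbitrary: \<phi>) (auto simp: psubst_commute)

text \<open>Stated for open types whose valuation is bounded by the webs of the closing types. In
  the \<open>Mu\<close> case each stage of the chain stays below the web of the closed recursive
  type itself, by the rule \<open>w_mu\<close>.\<close>

lemma web_pinterp_subset:
  "\<lbrakk>\<forall>\<theta>\<in>set \<theta>s. pclosed \<theta>; pbound (length \<theta>s) \<phi>; \<And>i. i < length \<theta>s \<Longrightarrow> web (car (\<rho> i)) \<subseteq> Collect (pw (\<theta>s ! i))\<rbrakk>
   \<Longrightarrow> web (car (pinterp \<phi> \<rho>)) \<subseteq> Collect (pw (pcl 0 \<theta>s \<phi>))"
  and web_ginterp_subset:
  "\<lbrakk>\<forall>\<theta>\<in>set \<theta>s. pclosed \<theta>; gbound (length \<theta>s) \<sigma>; \<And>i. i < length \<theta>s \<Longrightarrow> web (car (\<rho> i)) \<subseteq> Collect (pw (\<theta>s ! i))\<rbrakk>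
   \<Longrightarrow> web (ginterp \<sigma> \<rho>) \<subseteq> Collect (gw (gcl 0 \<theta>s \<sigma>))"
proof (induction \<phi> and \<sigma> arbitrary: \<rho> \<theta>s and \<rho> \<theta>s)
  case (Mu \<phi>)
  let ?\<mu> = "Mu (pcl (Suc 0) \<theta>s \<phi>)"
  have cl: "pclosed ?\<mu>" using pcl_bound[of \<theta>s "Suc 0" \<phi>] Mu.prems by simp
  have "web (car (((\<lambda>A. pinterp \<phi> (case_nat A \<rho>)) ^^ n) empty_coalg)) \<subseteq> Collect (pw ?\<mu>)" for n
  proof (induction n)
    case (Suc n)
    let ?A = "((\<lambda>A. pinterp \<phi> (case_nat A \<rho>)) ^^ n) empty_coalg"
    have "web (car (pinterp \<phi> (case_nat ?A \<rho>))) \<subseteq> Collect (pw (pcl 0 (?\<mu> # \<theta>s) \<phi>))"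
      by (rule Mu.IH) (use Mu.prems Suc cl in \<open>auto simp: nth_Cons split: nat.splits\<close>)
    then show ?case using pcl_unfold[of \<theta>s ?\<mu> \<phi>] Mu.prems cl by (auto simp: pw_simps)
  qed simp
  then show ?case using Mu.prems by (auto simp: pcl_Mu)
next
  case (Bang \<sigma>)
  have "web (ginterp \<sigma> \<rho>) \<subseteq> Collect (gw (gcl 0 \<theta>s \<sigma>))" by (rule Bang.IH) (use Bang.prems in auto)
  then show ?case by (auto simp: pcl_simps pw_simps)
next
  case (Tensor \<phi> \<psi>)
  have "web (car (pinterp \<phi> \<rho>)) \<subseteq> Collect (pw (pcl 0 \<theta>s \<phi>))" by (rule Tensor.IH) (use Tensor.prems in auto)
  moreover have "web (car (pinterp \<psi> \<rho>)) \<subseteq> Collect (pw (pcl 0 \<theta>s \<psi>))" by (rule Tensor.IH) (use Tensor.prems in auto)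
  ultimately show ?case by (auto simp: pcl_simps pw_simps)
next
  case (Plus \<phi> \<psi>)
  have "web (car (pinterp \<phi> \<rho>)) \<subseteq> Collect (pw (pcl 0 \<theta>s \<phi>))" by (rule Plus.IH) (use Plus.prems in auto)
  moreover have "web (car (pinterp \<psi> \<rho>)) \<subseteq> Collect (pw (pcl 0 \<theta>s \<psi>))" by (rule Plus.IH) (use Plus.prems in auto)
  ultimately show ?case by (auto simp: pcl_simps pw_simps intro: exI[of _ Lft] exI[of _ Rgt])
next
  case (Lolli \<phi> \<sigma>)
  have "web (car (pinterp \<phi> \<rho>)) \<subseteq> Collect (pw (pcl 0 \<theta>s \<phi>))" by (rule Lolli.IH) (use Lolli.prems in auto)
  moreover have "web (ginterp \<sigma> \<rho>) \<subseteq> Collect (gw (gcl 0 \<theta>s \<sigma>))" by (rule Lolli.IH) (use Lolli.prems in auto)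
  ultimately show ?case by (auto simp: pcl_simps pw_simps)
next
  case (Pos \<phi>)
  have "web (car (pinterp \<phi> \<rho>)) \<subseteq> Collect (pw (pcl 0 \<theta>s \<phi>))" by (rule Pos.IH) (use Pos.prems in auto)
  then show ?case by (auto simp: pcl_simps pw_simps)
qed (auto simp: pcl_simps pw_simps pcl_TVar)

lemma pinterp_cong: "pbound k \<phi> \<Longrightarrow> (\<And>i. i < k \<Longrightarrow> \<rho> i = \<rho>' i) \<Longrightarrow> pinterp \<phi> \<rho> = pinterp \<phi> \<rho>'"
  and ginterp_cong: "gbound k \<sigma> \<Longrightarrow> (\<And>i. i < k \<Longrightarrow> \<rho> i = \<rho>' i) \<Longrightarrow> ginterp \<sigma> \<rho> = ginterp \<sigma> \<rho>'"
proof (induction \<phi> and \<sigma> arbitrary: k \<rho> \<rho>' and k \<rho> \<rho>')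
  case (Mu \<phi>)
  have "pinterp \<phi> (case_nat A \<rho>) = pinterp \<phi> (case_nat A \<rho>')" for A
    by (rule Mu.IH[of "Suc k"]) (use Mu.prems in \<open>auto split: nat.splits\<close>)
  then show ?case by simp
next
  case (Tensor \<phi> \<psi>)
  have *: "pinterp \<phi> \<rho> = pinterp \<phi> \<rho>'" by (rule Tensor.IH[of k]) (use Tensor.prems in auto)
  have **: "pinterp \<psi> \<rho> = pinterp \<psi> \<rho>'" by (rule Tensor.IH[of k]) (use Tensor.prems in auto)
  show ?case unfolding pinterp.simps ginterp.simps * ** by (rule refl)
next
  case (Plus \<phi> \<psi>)
  have *: "pinterp \<phi> \<rho> = pinterp \<phi> \<rho>'" by (rule Plus.IH[of k]) (use Plus.prems in auto)
  have **: "pinterp \<psi> \<rho> = pinterp \<psi> \<rho>'" by (rule Plus.IH[of k]) (use Plus.prems in auto)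
  show ?case unfolding pinterp.simps ginterp.simps * ** by (rule refl)
next
  case (Lolli \<phi> \<sigma>)
  have *: "pinterp \<phi> \<rho> = pinterp \<phi> \<rho>'" by (rule Lolli.IH[of k]) (use Lolli.prems in auto)
  have **: "ginterp \<sigma> \<rho> = ginterp \<sigma> \<rho>'" by (rule Lolli.IH[of k]) (use Lolli.prems in auto)
  show ?case unfolding pinterp.simps ginterp.simps * ** by (rule refl)
next
  case (Bang \<sigma>)
  have *: "ginterp \<sigma> \<rho> = ginterp \<sigma> \<rho>'" by (rule Bang.IH[of k]) (use Bang.prems in auto)
  show ?case unfolding pinterp.simps ginterp.simps * by (rule refl)
next
  case (Pos \<phi>)
  have *: "pinterp \<phi> \<rho> = pinterp \<phi> \<rho>'" by (rule Pos.IH[of k]) (use Pos.prems in auto)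
  show ?case unfolding pinterp.simps ginterp.simps * by (rule refl)
qed auto

lemma pinterp_psubst:
  "pclosed \<theta> \<Longrightarrow> pinterp (psubst \<phi> k \<theta>) \<rho> =
     pinterp \<phi> (\<lambda>i. if i < k then \<rho> i else if i = k then pinterp \<theta> \<rho> else \<rho> (i - 1))"
  and ginterp_gsubst:
  "pclosed \<theta> \<Longrightarrow> ginterp (gsubst \<sigma> k \<theta>) \<rho> =
     ginterp \<sigma> (\<lambda>i. if i < k then \<rho> i else if i = k then pinterp \<theta> \<rho> else \<rho> (i - 1))"
proof (induction \<phi> and \<sigma> arbitrary: k \<rho> and k \<rho>)
  case (Mu \<phi>)
  have "pinterp \<theta> (case_nat A \<rho>) = pinterp \<theta> \<rho>" for A
    using pinterp_cong[of 0 \<theta>] Mu.prems by simp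
  then have *: "(\<lambda>i. if i < Suc k then case_nat A \<rho> i else if i = Suc k then pinterp \<theta> (case_nat A \<rho>)
        else case_nat A \<rho> (i - 1)) =
      case_nat A (\<lambda>i. if i < k then \<rho> i else if i = k then pinterp \<theta> \<rho> else \<rho> (i - 1))" for A
    by (auto simp: fun_eq_iff split: nat.splits)
  show ?case by (simp only: psubst.simps pinterp.simps plift_closed[OF Mu.prems] Mu.IH[OF Mu.prems] *)
qed simp_all

lemma web_pinterp_mono:
  "(\<And>i. web (car (\<rho> i)) \<subseteq> web (car (\<rho>' i))) \<Longrightarrow> web (car (pinterp \<phi> \<rho>)) \<subseteq> web (car (pinterp \<phi> \<rho>'))"
  and web_ginterp_mono:
  "(\<And>i. web (car (\<rho> i)) \<subseteq> web (car (\<rho>' i))) \<Longrightarrow> web (ginterp \<sigma> \<rho>) \<subseteq> web (ginterp \<sigma> \<rho>')"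
proof (induction \<phi> and \<sigma> arbitrary: \<rho> \<rho>' and \<rho> \<rho>')
  case (Mu \<phi>)
  have "web (car (((\<lambda>A. pinterp \<phi> (case_nat A \<rho>)) ^^ n) empty_coalg)) \<subseteq>
        web (car (((\<lambda>A. pinterp \<phi> (case_nat A \<rho>')) ^^ n) empty_coalg))" for n
  proof (induction n)
    case (Suc n)
    let ?A = "\<lambda>\<rho>. ((\<lambda>A. pinterp \<phi> (case_nat A \<rho>)) ^^ n) empty_coalg"
    have "web (car (pinterp \<phi> (case_nat (?A \<rho>) \<rho>))) \<subseteq> web (car (pinterp \<phi> (case_nat (?A \<rho>') \<rho>')))"
    proof (rule Mu.IH)
      show "web (car (case_nat (?A \<rho>) \<rho> i)) \<subseteq> web (car (case_nat (?A \<rho>') \<rho>' i))" for i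
        using Suc Mu.prems by (cases i) simp_all
    qed
    then show ?case by simp
  qed simp
  then show ?case by auto
next
  case (Tensor \<phi> \<psi>)
  have "web (car (pinterp \<phi> \<rho>)) \<subseteq> web (car (pinterp \<phi> \<rho>'))" by (rule Tensor.IH) (rule Tensor.prems)
  moreover have "web (car (pinterp \<psi> \<rho>)) \<subseteq> web (car (pinterp \<psi> \<rho>'))" by (rule Tensor.IH) (rule Tensor.prems)
  ultimately show ?case by auto
next
  case (Plus \<phi> \<psi>)
  have "web (car (pinterp \<phi> \<rho>)) \<subseteq> web (car (pinterp \<phi> \<rho>'))" by (rule Plus.IH) (rule Plus.prems)
  moreover have "web (car (pinterp \<psi> \<rho>)) \<subseteq> web (car (pinterp \<psi> \<rho>'))" by (rule Plus.IH) (rule Plus.prems)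
  ultimately show ?case by auto
next
  case (Bang \<sigma>)
  have "web (ginterp \<sigma> \<rho>) \<subseteq> web (ginterp \<sigma> \<rho>')" by (rule Bang.IH) (rule Bang.prems)
  then show ?case by auto
next
  case (Lolli \<phi> \<sigma>)
  have "web (car (pinterp \<phi> \<rho>)) \<subseteq> web (car (pinterp \<phi> \<rho>'))" by (rule Lolli.IH) (rule Lolli.prems)
  moreover have "web (ginterp \<sigma> \<rho>) \<subseteq> web (ginterp \<sigma> \<rho>')" by (rule Lolli.IH) (rule Lolli.prems)
  ultimately show ?case by auto
qed auto

lemma finite_chain_bound:
  assumes "finite S" "\<And>x. x \<in> S \<Longrightarrow> \<exists>n. x \<in> F n" "\<And>m n. m \<le> n \<Longrightarrow> F m \<subseteq> F n"
  shows "\<exists>n :: nat. S \<subseteq> F n"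
  using assms(1,2)
proof (induction S)
  case (insert x S)
  then obtain m n where "S \<subseteq> F m" "x \<in> F n" by blast
  then have "insert x S \<subseteq> F (max m n)" using assms(3)[of m "max m n"] assms(3)[of n "max m n"] by auto
  then show ?case ..
qed auto

text \<open>Webs depend continuously on the valuation: a point mentions only finitely many points of
  its components, and these occur together at some stage of the chain.\<close>

lemma web_pinterp_cont:
  "\<lbrakk>\<And>i m n. m \<le> n \<Longrightarrow> web (car (R m i)) \<subseteq> web (car (R n i)); \<And>i. web (car (\<rho> i)) \<subseteq> (\<Union>n. web (car (R n i)))\<rbrakk>
   \<Longrightarrow> web (car (pinterp \<phi> \<rho>)) \<subseteq> (\<Union>n :: nat. web (car (pinterp \<phi> (R n))))"
  and web_ginterp_cont:
  "\<lbrakk>\<And>i m n. m \<le> n \<Longrightarrow> web (car (R m i)) \<subseteq> web (car (R n i)); \<And>i. web (car (\<rho> i)) \<subseteq> (\<Union>n. web (car (R n i)))\<rbrakk>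
   \<Longrightarrow> web (ginterp \<sigma> \<rho>) \<subseteq> (\<Union>n :: nat. web (ginterp \<sigma> (R n)))"
proof (induction \<phi> and \<sigma> arbitrary: \<rho> R and \<rho> R)
  case (Mu \<phi>)
  let ?F = "\<lambda>\<rho> j. ((\<lambda>A. pinterp \<phi> (case_nat A \<rho>)) ^^ j) empty_coalg"
  have mono: "m \<le> n \<Longrightarrow> web (car (?F (R m) j)) \<subseteq> web (car (?F (R n) j))" for m n j
  proof (induction j)
    case (Suc j)
    have "web (car (pinterp \<phi> (case_nat (?F (R m) j) (R m)))) \<subseteq> web (car (pinterp \<phi> (case_nat (?F (R n) j) (R n))))"
    proof (rule web_pinterp_mono)
      show "web (car (case_nat (?F (R m) j) (R m) i)) \<subseteq> web (car (case_nat (?F (R n) j) (R n) i))" for i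
        using Suc Mu.prems(1) by (cases i) simp_all
    qed
    then show ?case by simp
  qed simp
  have "web (car (?F \<rho> j)) \<subseteq> (\<Union>n. web (car (?F (R n) j)))" for j
  proof (induction j)
    case (Suc j)
    have "web (car (pinterp \<phi> (case_nat (?F \<rho> j) \<rho>))) \<subseteq>
        (\<Union>n. web (car (pinterp \<phi> (case_nat (?F (R n) j) (R n)))))"
    proof (rule Mu.IH)
      show "m \<le> n \<Longrightarrow> web (car (case_nat (?F (R m) j) (R m) i)) \<subseteq> web (car (case_nat (?F (R n) j) (R n) i))" for i m n
        using mono Mu.prems(1) by (cases i) simp_all
      show "web (car (case_nat (?F \<rho> j) \<rho> i)) \<subseteq> (\<Union>n. web (car (case_nat (?F (R n) j) (R n) i)))" for i
        using Suc Mu.prems(2) by (cases i) simp_all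
    qed
    then show ?case by simp
  qed simp
  then show ?case by fastforce
next
  case (Bang \<sigma>)
  let ?F = "\<lambda>n. web (ginterp \<sigma> (R n))"
  have IH: "web (ginterp \<sigma> \<rho>) \<subseteq> (\<Union>n. ?F n)" by (rule Bang.IH) (use Bang.prems in auto)
  have "\<exists>n. set_mset b \<subseteq> ?F n" if "set_mset b \<subseteq> web (ginterp \<sigma> \<rho>)" for b
    by (rule finite_chain_bound) (use IH that web_ginterp_mono Bang.prems(1) in blast)+
  then show ?case by auto
next
  case (Tensor \<phi> \<psi>)
  have 1: "web (car (pinterp \<phi> \<rho>)) \<subseteq> (\<Union>n. web (car (pinterp \<phi> (R n))))" by (rule Tensor.IH) (use Tensor.prems in auto)
  have 2: "web (car (pinterp \<psi> \<rho>)) \<subseteq> (\<Union>n. web (car (pinterp \<psi> (R n))))" by (rule Tensor.IH) (use Tensor.prems in auto)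
  have "m \<le> n \<Longrightarrow> web (car (pinterp \<alpha> (R m))) \<subseteq> web (car (pinterp \<alpha> (R n)))" for m n \<alpha>
    by (rule web_pinterp_mono) (rule Tensor.prems)
  then have 3: "a \<in> web (car (pinterp \<phi> (R m))) \<Longrightarrow> b \<in> web (car (pinterp \<psi> (R n))) \<Longrightarrow>
     a \<in> web (car (pinterp \<phi> (R (max m n)))) \<and> b \<in> web (car (pinterp \<psi> (R (max m n))))" for a b m n
    by (meson max.cobounded1 max.cobounded2 subsetD)
  show ?case
  proof
    fix x assume "x \<in> web (car (pinterp (Tensor \<phi> \<psi>) \<rho>))"
    then obtain a b where x: "x = PPair a b" "a \<in> web (car (pinterp \<phi> \<rho>))" "b \<in> web (car (pinterp \<psi> \<rho>))" by auto
    then obtain m n where "a \<in> web (car (pinterp \<phi> (R m)))" "b \<in> web (car (pinterp \<psi> (R n)))" using 1 2 by blast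
    then have "x \<in> web (car (pinterp (Tensor \<phi> \<psi>) (R (max m n))))" using 3 x(1) by simp
    then show "x \<in> (\<Union>n. web (car (pinterp (Tensor \<phi> \<psi>) (R n))))" by blast
  qed
next
  case (Plus \<phi> \<psi>)
  have "web (car (pinterp \<phi> \<rho>)) \<subseteq> (\<Union>n. web (car (pinterp \<phi> (R n))))" by (rule Plus.IH) (use Plus.prems in auto)
  moreover have "web (car (pinterp \<psi> \<rho>)) \<subseteq> (\<Union>n. web (car (pinterp \<psi> (R n))))" by (rule Plus.IH) (use Plus.prems in auto)
  ultimately show ?case by (auto simp: image_iff subset_iff)
next
  case (Lolli \<phi> \<sigma>)
  have 1: "web (car (pinterp \<phi> \<rho>)) \<subseteq> (\<Union>n. web (car (pinterp \<phi> (R n))))" by (rule Lolli.IH) (use Lolli.prems in auto)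
  have 2: "web (ginterp \<sigma> \<rho>) \<subseteq> (\<Union>n. web (ginterp \<sigma> (R n)))" by (rule Lolli.IH) (use Lolli.prems in auto)
  have "m \<le> n \<Longrightarrow> web (car (pinterp \<alpha> (R m))) \<subseteq> web (car (pinterp \<alpha> (R n)))"
    "m \<le> n \<Longrightarrow> web (ginterp \<tau> (R m)) \<subseteq> web (ginterp \<tau> (R n))" for m n \<alpha> \<tau>
    by (rule web_pinterp_mono web_ginterp_mono, rule Lolli.prems, assumption)+
  then have 3: "a \<in> web (car (pinterp \<phi> (R m))) \<Longrightarrow> b \<in> web (ginterp \<sigma> (R n)) \<Longrightarrow>
     a \<in> web (car (pinterp \<phi> (R (max m n)))) \<and> b \<in> web (ginterp \<sigma> (R (max m n)))" for a b m n
    by (meson max.cobounded1 max.cobounded2 subsetD)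
  show ?case
  proof
    fix x assume "x \<in> web (ginterp (Lolli \<phi> \<sigma>) \<rho>)"
    then obtain a b where x: "x = PPair a b" "a \<in> web (car (pinterp \<phi> \<rho>))" "b \<in> web (ginterp \<sigma> \<rho>)" by auto
    then obtain m n where "a \<in> web (car (pinterp \<phi> (R m)))" "b \<in> web (ginterp \<sigma> (R n))" using 1 2 by blast
    then have "x \<in> web (ginterp (Lolli \<phi> \<sigma>) (R (max m n)))" using 3 x(1) by simp
    then show "x \<in> (\<Union>n. web (ginterp (Lolli \<phi> \<sigma>) (R n)))" by blast
  qed
next
  case (Pos \<phi>)
  then show ?case by simp
qed auto

text \<open>By continuity, applying the type operator to the union of the chain produces only points
  that later stages of the chain contain already.\<close>

lemma web_psem_unfold:
  assumes "pclosed (Mu \<phi>)"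
  shows "web (car (psem (psubst \<phi> 0 (Mu \<phi>)))) \<subseteq> web (car (psem (Mu \<phi>)))"
proof -
  let ?\<rho> = "\<lambda>_. empty_coalg"
  let ?G = "\<lambda>A. pinterp \<phi> (case_nat A ?\<rho>)"
  let ?F = "\<lambda>n. (?G ^^ n) empty_coalg"
  have "web (car (?F n)) \<subseteq> web (car (?F (Suc n)))" for n
  proof (induction n)
    case (Suc n)
    have "web (car (?G (?F n))) \<subseteq> web (car (?G (?F (Suc n))))"
      by (rule web_pinterp_mono) (use Suc in \<open>auto split: nat.splits\<close>)
    then show ?case by simp
  qed simp
  then have chain: "m \<le> n \<Longrightarrow> web (car (?F m)) \<subseteq> web (car (?F n))" for m n
    by (rule lift_Suc_mono_le)
  have "(\<lambda>i. if i < 0 then ?\<rho> i else if i = 0 then psem (Mu \<phi>) else ?\<rho> (i - 1)) = case_nat (psem (Mu \<phi>)) ?\<rho>"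
    by (auto simp: fun_eq_iff split: nat.splits)
  then have 1: "psem (psubst \<phi> 0 (Mu \<phi>)) = ?G (psem (Mu \<phi>))"
    using pinterp_psubst[OF assms, of \<phi> 0 ?\<rho>] unfolding psem_def by metis
  have 2: "web (car (?G (psem (Mu \<phi>)))) \<subseteq> (\<Union>n. web (car (pinterp \<phi> (case_nat (?F n) ?\<rho>))))"
    by (rule web_pinterp_cont) (use chain in \<open>auto simp: psem_def split: nat.splits\<close>)
  have 3: "web (car (psem (Mu \<phi>))) = (\<Union>n. web (car (?F n)))" by (simp add: psem_def)
  have "pinterp \<phi> (case_nat (?F n) ?\<rho>) = ?F (Suc n)" for n by simp
  then have "(\<Union>n. web (car (pinterp \<phi> (case_nat (?F n) ?\<rho>)))) \<subseteq> (\<Union>n. web (car (?F n)))"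
    by (metis (no_types, lifting) SUP_least UNIV_I UN_upper)
  then show ?thesis using 2 unfolding 1 3 by (rule subset_trans[rotated])
qed

text \<open>One inclusion is rule induction on points with the unfolding lemma at \<open>Mu\<close>;
  the other is the bound for open types, taken with no type variables.\<close>

lemma web_psem: "pclosed \<phi> \<Longrightarrow> web (car (psem \<phi>)) = Collect (pw \<phi>)"
  and web_gsem: "gclosed \<sigma> \<Longrightarrow> web (gsem \<sigma>) = Collect (gw \<sigma>)"
proof -
  have sup: "pw \<phi> a \<Longrightarrow> pclosed \<phi> \<longrightarrow> a \<in> web (car (psem \<phi>))"
    "gw \<sigma> a \<Longrightarrow> gclosed \<sigma> \<longrightarrow> a \<in> web (gsem \<sigma>)" for a \<phi> \<sigma>
  proof (induction rule: pw_gw.inducts)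
    case (w_mu \<phi> a)
    then show ?case using web_psem_unfold[of \<phi>] pclosed_unfold[of \<phi>] by auto
  next
    case (w_plus i \<phi> \<psi> a)
    then show ?case by (cases i) (auto simp: psem_def)
  qed (auto simp: psem_def gsem_def)
  show "pclosed \<phi> \<Longrightarrow> web (car (psem \<phi>)) = Collect (pw \<phi>)"
    using sup(1)[of \<phi>] web_pinterp_subset[of "[]" \<phi> "\<lambda>_. empty_coalg"] by (auto simp: psem_def)
  show "gclosed \<sigma> \<Longrightarrow> web (gsem \<sigma>) = Collect (gw \<sigma>)"
    using sup(2)[of \<sigma>] web_ginterp_subset[of "[]" \<sigma> "\<lambda>_. empty_coalg"] by (auto simp: gsem_def)
qed

lemma pw_padd: "pw \<phi> c \<Longrightarrow> padd a b c \<Longrightarrow> pw \<phi> a \<and> pw \<phi> b"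
proof -
  have "pw \<phi> c \<Longrightarrow> \<forall>a b. padd a b c \<longrightarrow> pw \<phi> a \<and> pw \<phi> b" "gw \<sigma> c \<Longrightarrow> True" for c \<phi> \<sigma>
    by (induction rule: pw_gw.inducts) (auto simp: padd_pt_simps pw_simps)
  then show "pw \<phi> c \<Longrightarrow> padd a b c \<Longrightarrow> pw \<phi> a \<and> pw \<phi> b" by blast
qed

section \<open>Step-counting semantics\<close>

text \<open>The coefficient of \<open>U M b\<close> at \<open>(g, k)\<close> collects the contributions to the entry \<open>(g, b)\<close> of the
  denotation of \<open>M\<close> whose evaluation takes \<open>k\<close> steps; \<open>tick\<close> is the formal variable marking a step.\<close>

type_synonym tser = "(pt list \<times> nat) ser"

definition tick :: tser where
  "tick = Ser (\<lambda>(g, k). if pemp g \<and> k = 1 then 1 else 0)"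

text \<open>Using variable n discards all the others, so their points have to be units; no step is
  taken.\<close>

definition var_ser :: "nat \<Rightarrow> pt \<Rightarrow> tser" where
  "var_ser n b = Ser (\<lambda>(g, k). if k = 0 \<and> (\<exists>g1 g2. g = g1 @ b # g2 \<and> length g1 = n \<and> pemp g1 \<and> pemp g2)
     then 1 else 0)"

definition cur :: "pt \<Rightarrow> tser \<Rightarrow> tser" where
  "cur a r = Ser (\<lambda>(g, k). cf r (a # g, k))"

text \<open>One unfolding of a fixpoint: B is the bag of uses that the body makes of its variable,
  and each use is served by s.\<close>

definition fstep :: "(pt \<Rightarrow> tser) \<Rightarrow> (pt \<Rightarrow> tser) \<Rightarrow> pt \<Rightarrow> tser" where
  "fstep m s b = tick * isum (\<lambda>B. (\<Prod>a\<in>#B. s a) * cur (PBag B) (m b))"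

text \<open>Every iteration gains a factor \<open>tick\<close>, so the coefficient of index k is
  stable from iterate \<open>Suc k\<close> on and can be read off there.\<close>

definition fixser :: "((pt \<Rightarrow> tser) \<Rightarrow> pt \<Rightarrow> tser) \<Rightarrow> pt \<Rightarrow> tser" where
  "fixser F b = Ser (\<lambda>(g, k). cf ((F ^^ Suc k) (\<lambda>_. 0) b) (g, k))"

text \<open>Eliminators, fixpoints and coins carry a \<open>tick\<close> for the step they perform
  as a redex. Value constructors carry none, so that values can be multiplicative.
  \<open>Lam\<close> cuts its argument down to the web of its type because the matrix of the
  interpretation vanishes elsewhere.\<close>

primrec U :: "tm \<Rightarrow> pt \<Rightarrow> tser" where
  "U (Var n) = var_ser n"
| "U Unit = (\<lambda>b. if b = PStar then 1 else 0)"
| "U (Stop M) = (\<lambda>b. case b of PBag B \<Rightarrow> (\<Prod>a\<in>#B. U M a) | _ \<Rightarrow> 0)"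
| "U (MkPair M N) = (\<lambda>b. case b of PPair x y \<Rightarrow> U M x * U N y | _ \<Rightarrow> 0)"
| "U (In i M) = (\<lambda>b. case b of PIn j a \<Rightarrow> if j = i then U M a else 0 | _ \<Rightarrow> 0)"
| "U (Lam \<phi> M) = (\<lambda>b. case b of PPair x y \<Rightarrow> if pw \<phi> x then cur x (U M y) else 0 | _ \<Rightarrow> 0)"
| "U (App M N) = (\<lambda>b. tick * isum (\<lambda>a. U M (PPair a b) * U N a))"
| "U (Case M Nl Nr) = (\<lambda>b. tick * isum (\<lambda>a. U M (PIn Lft a) * cur a (U Nl b) + U M (PIn Rgt a) * cur a (U Nr b)))"
| "U (Pr i M) = (\<lambda>b. tick * isum (\<lambda>a. if pemp a then U M (sel i (PPair b a) (PPair a b)) else 0))"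
| "U (Go M) = (\<lambda>b. tick * U M (PBag {#b#}))"
| "U (Fix \<sigma> M) = fixser (fstep (U M))"
| "U (Fold M) = U M"
| "U (Unfold M) = (\<lambda>b. tick * U M b)"
| "U (Coin p) = (\<lambda>b. tick * scal (coin_vec p b) 1)"

lemma padd_prod_iff: "padd (x, k) (y, l) (z, m) \<longleftrightarrow> padd x y z \<and> padd k l m"
  and pemp_prod_iff: "pemp (x, k) \<longleftrightarrow> pemp x \<and> pemp k"
  by (auto simp: padd_prod_def pemp_prod_def)

lemma csum_pair: "csum f = (\<Sum>\<^sup>+ a. \<Sum>\<^sup>+ b. f (a, b))"
  using nn_integral_fst_count_space[of f] by simp

lemma cf_cur [simp]: "cf (cur a r) (g, k) = cf r (a # g, k)"
  by (simp add: cur_def)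

lemma cur_simps:
  "cur a 0 = 0" "cur a (r + s) = cur a r + cur a s" "cur a (isum f) = isum (\<lambda>i. cur a (f i))"
  "cur a (scal c r) = scal c (cur a r)"
  by (auto intro!: ser_eqI simp: cf_isum split_paired_all)

lemma cf_tick_mult: "cf (tick * r) (g, k) = (case k of 0 \<Rightarrow> 0 | Suc j \<Rightarrow> cf r (g, j))"
proof -
  obtain e where e: "pemp e" "padd e g g" and u: "\<And>x. pemp x \<Longrightarrow> padd x g g \<Longrightarrow> x = e"
    using pemp_ex1[of g] by blast
  have *: "(pemp x \<and> padd x y g) \<longleftrightarrow> (x = e \<and> y = g)" for x y
    using e u padd_pempD by blast
  have "cf (tick * r) (g, k) = (\<Sum>\<^sup>+ x. \<Sum>\<^sup>+ m :: nat. \<Sum>\<^sup>+ y. \<Sum>\<^sup>+ j.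
      if (pemp x \<and> padd x y g) \<and> m = 1 \<and> k = Suc j then cf r (y, j) else 0)"
    unfolding cf_times csum_pair
    by (intro nn_integral_cong) (auto simp: tick_def padd_prod_iff padd_nat_def)
  also have "\<dots> = (\<Sum>\<^sup>+ x. \<Sum>\<^sup>+ m :: nat. \<Sum>\<^sup>+ y. \<Sum>\<^sup>+ j.
      if x = e then if m = 1 then if y = g then if k = Suc j then cf r (g, j) else 0 else 0 else 0 else 0)"
    unfolding * by (intro nn_integral_cong) simp
  also have "\<dots> = (\<Sum>\<^sup>+ j. if k = Suc j then cf r (g, j) else 0)"
    by (simp only: csum_if csum_if_eq)
  also have "\<dots> = (case k of 0 \<Rightarrow> 0 | Suc j \<Rightarrow> cf r (g, j))"
    by (cases k) (auto simp: csum_if_eq)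
  finally show ?thesis .
qed

subsection \<open>Agreement up to a number of steps\<close>

text \<open>Congruence modulo the n-th power of \<open>tick\<close>.\<close>

definition eqn :: "nat \<Rightarrow> tser \<Rightarrow> tser \<Rightarrow> bool" where
  "eqn n r s \<longleftrightarrow> (\<forall>g k. k < n \<longrightarrow> cf r (g, k) = cf s (g, k))"

lemma eqn_refl [simp]: "eqn n r r"
  by (simp add: eqn_def)

lemma eqn_0 [simp]: "eqn 0 r s"
  by (simp add: eqn_def)

lemma eqn_isum: "(\<And>i. eqn n (f i) (h i)) \<Longrightarrow> eqn n (isum f) (isum h)"
  by (simp add: eqn_def cf_isum)

lemma eqn_mult: "eqn n r r' \<Longrightarrow> eqn n s s' \<Longrightarrow> eqn n (r * s) (r' * s')"
  unfolding eqn_def cf_times csum_pair padd_prod_iff padd_nat_def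
  by (intro allI impI nn_integral_cong) auto

lemma eqn_prod: "(\<And>i. eqn n (f i) (h i)) \<Longrightarrow> eqn n (\<Prod>i\<in>#B. f i) (\<Prod>i\<in>#B. h i)"
  by (induction B) (auto intro: eqn_mult)

lemma eqn_tick: "eqn n r s \<Longrightarrow> eqn (Suc n) (tick * r) (tick * s)"
  by (auto simp: eqn_def cf_tick_mult split: nat.splits)

lemma eqn_mono: "eqn n r s \<Longrightarrow> m \<le> n \<Longrightarrow> eqn m r s"
  by (auto simp: eqn_def)

lemma ser_eqn_eqI: "(\<And>n. eqn n r s) \<Longrightarrow> r = s"
  by (rule ser_eqI) (metis eqn_def lessI surj_pair)

definition contractive :: "((pt \<Rightarrow> tser) \<Rightarrow> pt \<Rightarrow> tser) \<Rightarrow> bool" where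
  "contractive F \<longleftrightarrow> (\<forall>n s s'. (\<forall>b. eqn n (s b) (s' b)) \<longrightarrow> (\<forall>b. eqn (Suc n) (F s b) (F s' b)))"

lemma contractive_fstep: "contractive (fstep m)"
  by (auto simp: contractive_def fstep_def intro!: eqn_tick eqn_isum eqn_mult eqn_prod)

lemma contractive_iter:
  assumes "contractive F"
  shows "eqn n ((F ^^ n) z b) ((F ^^ (n + m)) z b)"
  by (induction n arbitrary: b) (use assms in \<open>auto simp: contractive_def\<close>)

lemma fixser_eqn: "contractive F \<Longrightarrow> eqn n (fixser F b) ((F ^^ n) (\<lambda>_. 0) b)"
  unfolding eqn_def fixser_def
proof (intro allI impI)
  fix g k assume F: "contractive F" and "k < n"
  then have "eqn (Suc k) ((F ^^ Suc k) (\<lambda>_. 0) b) ((F ^^ (Suc k + (n - Suc k))) (\<lambda>_. 0) b)"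
    by (intro contractive_iter)
  then show "cf (Ser (\<lambda>(g, k). cf ((F ^^ Suc k) (\<lambda>_. 0) b) (g, k))) (g, k) = cf ((F ^^ n) (\<lambda>_. 0) b) (g, k)"
    using \<open>k < n\<close> unfolding eqn_def by simp
qed

text \<open>The Banach fixpoint argument for the distance given by powers of \<open>tick\<close>:
  for every n, both sides agree with iterate \<open>Suc n\<close> at all indices below
  \<open>Suc n\<close>.\<close>

lemma fixser_unfold:
  assumes "contractive F"
  shows "fixser F b = F (fixser F) b"
proof (rule ser_eqn_eqI)
  fix n
  have "eqn (Suc n) (fixser F b) ((F ^^ Suc n) (\<lambda>_. 0) b)" by (rule fixser_eqn[OF assms])
  moreover have "eqn (Suc n) (F (fixser F) b) (F ((F ^^ n) (\<lambda>_. 0)) b)"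
    using assms fixser_eqn[OF assms] by (auto simp: contractive_def)
  ultimately have "eqn (Suc n) (fixser F b) (F (fixser F) b)" by (simp add: eqn_def)
  then show "eqn n (fixser F b) (F (fixser F) b)" by (rule eqn_mono) simp
qed

subsection \<open>Unused variables\<close>

text \<open>Only the first n variables matter: further context entries are discarded and must
  therefore be units. The extra entries come at the end, so no variable index shifts.\<close>

definition wk :: "nat \<Rightarrow> tser \<Rightarrow> bool" where
  "wk n r \<longleftrightarrow> (\<forall>g h k. length g = n \<longrightarrow> cf r (g @ h, k) = (if pemp h then cf r (g, k) else 0))"

lemma wk_0: "wk n 0" and wk_1: "wk n 1" and wk_tick: "wk n tick"
  and wk_add: "wk n r \<Longrightarrow> wk n s \<Longrightarrow> wk n (r + s)"
  and wk_scal: "wk n r \<Longrightarrow> wk n (scal c r)"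
  by (auto simp: wk_def cf_1 pemp_prod_iff tick_def)

lemma wk_isum: "(\<And>i. wk n (f i)) \<Longrightarrow> wk n (isum f)"
  by (auto simp: wk_def cf_isum)

lemma wk_cur: "wk (Suc n) r \<Longrightarrow> wk n (cur a r)"
  unfolding wk_def by (metis append_Cons cf_cur length_Cons)

lemma padd_append_split:
  fixes x y g h :: "'a :: pcm list"
  assumes "padd x y (g @ h)"
  obtains g1 h1 g2 h2 where "x = g1 @ h1" "y = g2 @ h2" "length g1 = length g" "length g2 = length g"
    "padd g1 g2 g" "padd h1 h2 h"
proof
  have l: "length x = length (g @ h)" "length y = length (g @ h)" using padd_length[OF assms] by auto
  let ?n = "length g"
  show "x = take ?n x @ drop ?n x" "y = take ?n y @ drop ?n y" "length (take ?n x) = ?n" "length (take ?n y) = ?n"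
    using l by auto
  then show "padd (take ?n x) (take ?n y) g" "padd (drop ?n x) (drop ?n y) h"
    using assms padd_append[of "take ?n x" g "take ?n y" "drop ?n x" "drop ?n y" h] by auto
qed

lemma wk_mult:
  assumes r: "wk n r" and s: "wk n s"
  shows "wk n (r * s)"
  unfolding wk_def
proof (intro allI impI)
  fix g h :: "pt list" and k :: nat
  assume n: "length g = n"
  let ?f = "\<lambda>x y. if padd x y (g @ h, k) then cf r x * cf s y else 0"
  \<comment> \<open>In a nonzero summand the tail h is the sum of two tails that are both units, and
    such a sum equals either of them.\<close>
  have key: "\<exists>g1 k1 g2 k2. x = (g1 @ h, k1) \<and> y = (g2 @ h, k2) \<and> pemp h" if "?f x y \<noteq> 0" for x y
  proof -
    obtain x' k1 y' k2 where xy: "x = (x', k1)" "y = (y', k2)" by fastforce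
    from that have "padd x' y' (g @ h)" by (auto simp: xy padd_prod_iff split: if_splits)
    then obtain g1 h1 g2 h2 where *: "x' = g1 @ h1" "y' = g2 @ h2" "length g1 = n" "length g2 = n"
      "padd h1 h2 h" using n by (elim padd_append_split) auto
    from that have "cf r (g1 @ h1, k1) \<noteq> 0" "cf s (g2 @ h2, k2) \<noteq> 0"
      by (auto simp: xy * split: if_splits)
    then have "pemp h1" "pemp h2" using r s *(3,4) unfolding wk_def by metis+
    then have "h1 = h" "h2 = h" using *(5) padd_pempD padd_pempD2 by blast+
    then show ?thesis using xy * \<open>pemp h1\<close> by auto
  qed
  show "cf (r * s) (g @ h, k) = (if pemp h then cf (r * s) (g, k) else 0)"
  proof (cases "pemp h")
    case False
    then have "?f x y = 0" for x y using key by blast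
    then show ?thesis using False unfolding cf_times by (simp only: csum_0I if_False)
  next
    case True
    let ?p = "\<lambda>(g :: pt list, k :: nat). (g @ h, k)"
    have inj: "inj ?p" by (auto simp: inj_def)
    have "cf (r * s) (g @ h, k) = (\<Sum>\<^sup>+ x. \<Sum>\<^sup>+ y. ?f x y)" by (simp add: cf_times)
    also have "\<dots> = (\<Sum>\<^sup>+ x. \<Sum>\<^sup>+ y. ?f (?p x) y)"
    proof (rule sum_reindex[OF inj], rule csum_0I, rule ccontr)
      fix x y assume "x \<notin> range ?p" "?f x y \<noteq> 0"
      with key[of x y] show False by (auto simp: image_iff)
    qed
    also have "\<dots> = (\<Sum>\<^sup>+ x. \<Sum>\<^sup>+ y. ?f (?p x) (?p y))"
    proof (rule nn_integral_cong, rule sum_reindex[OF inj], rule ccontr)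
      fix x y assume "y \<notin> range ?p" "?f (?p x) y \<noteq> 0"
      with key[of "?p x" y] show False by (auto simp: image_iff)
    qed
    also have "\<dots> = cf (r * s) (g, k)"
      unfolding cf_times
    proof (intro nn_integral_cong)
      fix x y :: "pt list \<times> nat"
      obtain x' k1 y' k2 where xy: "x = (x', k1)" "y = (y', k2)" by fastforce
      have "padd (x' @ h) (y' @ h) (g @ h) \<longleftrightarrow> padd x' y' g"
      proof (cases "length x' = length g \<and> length y' = length g")
        case t: True
        then show ?thesis using padd_append[of x' g y'] pemp_padd_self[OF True] by auto
      next
        case False
        then show ?thesis using padd_length[of x' y' g] padd_length[of "x' @ h" "y' @ h" "g @ h"] by auto
      qed
      moreover have "cf r (x' @ h, k1) = cf r (x', k1)" "cf s (y' @ h, k2) = cf s (y', k2)" if "padd x' y' g"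
        using r s padd_length[OF that] n True unfolding wk_def by simp_all
      ultimately show "?f (?p x) (?p y) = (if padd x y (g, k) then cf r x * cf s y else 0)"
        by (auto simp: xy padd_prod_iff)
    qed
    finally show ?thesis using True by simp
  qed
qed

lemma wk_prod: "(\<And>i. wk n (f i)) \<Longrightarrow> wk n (\<Prod>i\<in>#B. f i)"
  by (induction B) (auto intro: wk_mult wk_1)

lemma wk_fstep: "(\<And>b. wk (Suc n) (m b)) \<Longrightarrow> (\<And>b. wk n (s b)) \<Longrightarrow> wk n (fstep m s b)"
  by (auto simp: fstep_def intro!: wk_mult wk_tick wk_isum wk_prod wk_cur)

lemma wk_fixser:
  assumes "\<And>b. wk (Suc n) (m b)"
  shows "wk n (fixser (fstep m) b)"
proof -
  have "wk n ((fstep m ^^ j) (\<lambda>_. 0) b)" for j b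
    by (induction j arbitrary: b) (auto simp: wk_0 intro!: wk_fstep assms)
  from this[of "Suc _"] show ?thesis unfolding wk_def fixser_def by simp
qed

lemma wk_var:
  assumes "i < n"
  shows "wk n (var_ser i b)"
  unfolding wk_def
proof (intro allI impI)
  fix g h :: "pt list" and k assume n: "length g = n"
  have "(\<exists>g1 g2. g @ h = g1 @ b # g2 \<and> length g1 = i \<and> pemp g1 \<and> pemp g2) \<longleftrightarrow>
     pemp h \<and> (\<exists>g1 g2. g = g1 @ b # g2 \<and> length g1 = i \<and> pemp g1 \<and> pemp g2)" (is "?L \<longleftrightarrow> ?R")
  proof
    assume ?L
    then obtain g1 g2 where *: "g @ h = g1 @ b # g2" "length g1 = i" "pemp g1" "pemp g2" by blast
    define g3 where "g3 = take (n - Suc i) g2"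
    have "g = take n (g @ h)" "h = drop n (g @ h)" using n by simp_all
    then have "g = g1 @ b # g3" "h = drop (n - Suc i) g2"
      unfolding * using assms *(2) by (auto simp: g3_def take_Cons' drop_Cons' Suc_diff_Suc)
    moreover have "pemp g3" "pemp (drop (n - Suc i) g2)"
      using *(4) by (auto simp: pemp_list_def g3_def dest: in_set_takeD in_set_dropD)
    ultimately show ?R using * by blast
  next
    assume ?R
    then obtain g1 g2 where "g = g1 @ b # g2" "length g1 = i" "pemp g1" "pemp g2" "pemp h" by blast
    then show ?L by (intro exI[of _ g1] exI[of _ "g2 @ h"]) auto
  qed
  then show "cf (var_ser i b) (g @ h, k) = (if pemp h then cf (var_ser i b) (g, k) else 0)"
    by (auto simp: var_ser_def)
qed

lemma wk_U: "\<Gamma> \<turnstile> M : \<sigma> \<Longrightarrow> wk (length \<Gamma>) (U M b)"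
  by (induction arbitrary: b rule: typing.induct)
     (auto split: pt.splits intro!: wk_var wk_0 wk_1 wk_mult wk_tick wk_isum wk_prod wk_cur wk_add wk_scal wk_fixser)

text \<open>A closed series takes from the context only its neutral element, so just the step counts
  are convolved.\<close>

lemma cf_wk0_mult:
  assumes "wk 0 u"
  shows "cf (u * r) (g, k) = (\<Sum>\<^sup>+ i. \<Sum>\<^sup>+ j. if k = i + j then cf u ([], i) * cf r (g, j) else 0)"
proof -
  obtain e where e: "pemp e" "padd e g g" and un: "\<And>x. pemp x \<Longrightarrow> padd x g g \<Longrightarrow> x = e"
    using pemp_ex1[of g] by blast
  have *: "(pemp x \<and> padd x y g) \<longleftrightarrow> (x = e \<and> y = g)" for x y
    using e un padd_pempD by blast
  have u: "cf u (x, i) = (if pemp x then cf u ([], i) else 0)" for x i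
    using assms unfolding wk_def by (metis append_Nil list.size(3))
  have "cf (u * r) (g, k) = (\<Sum>\<^sup>+ x. \<Sum>\<^sup>+ i. \<Sum>\<^sup>+ y. \<Sum>\<^sup>+ j.
      if (pemp x \<and> padd x y g) \<and> k = i + j then cf u ([], i) * cf r (y, j) else 0)"
    unfolding cf_times csum_pair
    by (intro nn_integral_cong, subst u) (auto simp: padd_prod_iff padd_nat_def)
  also have "\<dots> = (\<Sum>\<^sup>+ x. \<Sum>\<^sup>+ i. \<Sum>\<^sup>+ y. \<Sum>\<^sup>+ j.
      if x = e then if y = g then if k = i + j then cf u ([], i) * cf r (g, j) else 0 else 0 else 0)"
    unfolding * by (intro nn_integral_cong) simp
  also have "\<dots> = (\<Sum>\<^sup>+ i. \<Sum>\<^sup>+ j. if k = i + j then cf u ([], i) * cf r (g, j) else 0)"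
    by (simp only: csum_if csum_if_eq)
  finally show ?thesis .
qed

lemma cur_mult_wk0: "wk 0 u \<Longrightarrow> cur a (u * r) = u * cur a r"
  by (rule ser_eqI) (simp add: split_paired_all cf_wk0_mult cong: if_cong)

subsection \<open>Substitution of closed values\<close>

text \<open>Fixes the last context entry, which is the outermost variable. Binders add entries at
  the front, so this variable remains the last one under every binder.\<close>

definition slice :: "pt \<Rightarrow> tser \<Rightarrow> tser" where
  "slice a r = Ser (\<lambda>(g, k). cf r (g @ [a], k))"

lemma cf_slice [simp]: "cf (slice a r) (g, k) = cf r (g @ [a], k)"
  by (simp add: slice_def)

lemma slice_simps:
  "slice a 0 = 0" "slice a (r + s) = slice a r + slice a s" "slice a (isum f) = isum (\<lambda>i. slice a (f i))"
  "slice a (scal c r) = scal c (slice a r)" "slice a 1 = (if pemp a then 1 else 0)"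
  "slice a tick = (if pemp a then tick else 0)" "slice a (cur b r) = cur b (slice a r)"
  by (auto intro!: ser_eqI simp: cf_isum split_paired_all cf_1 pemp_prod_iff tick_def)

lemma slice_mult:
  "slice a (r * s) = isum (\<lambda>x. isum (\<lambda>y. if padd x y a then slice x r * slice y s else 0))"
proof (rule ser_eqI, clarify)
  fix g :: "pt list" and k :: nat
  let ?f = "\<lambda>x y. if padd x y (g @ [a], k) then cf r x * cf s y else 0"
  let ?p = "\<lambda>(a :: pt, g :: pt list, k :: nat). (g @ [a], k)"
  have inj: "inj ?p" by (auto simp: inj_def)
  have out: "x \<notin> range ?p \<Longrightarrow> fst x = []" for x
    by (cases x; cases "fst x" rule: rev_cases) (auto simp: image_iff)
  have "cf (slice a (r * s)) (g, k) = (\<Sum>\<^sup>+ x. \<Sum>\<^sup>+ y. ?f x y)" by (simp add: cf_times)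
  also have "\<dots> = (\<Sum>\<^sup>+ x. \<Sum>\<^sup>+ y. ?f (?p x) y)"
    by (rule sum_reindex[OF inj], rule csum_0I) (auto dest!: out simp: padd_prod_def)
  also have "\<dots> = (\<Sum>\<^sup>+ x. \<Sum>\<^sup>+ y. ?f (?p x) (?p y))"
    by (rule nn_integral_cong, rule sum_reindex[OF inj]) (auto dest!: out simp: padd_prod_def)
  also have "\<dots> = (\<Sum>\<^sup>+ x. \<Sum>\<^sup>+ g1. \<Sum>\<^sup>+ y. \<Sum>\<^sup>+ g2. ?f (?p (x, g1)) (?p (y, g2)))"
    unfolding csum_pair[where ?'b = "pt list \<times> nat"] ..
  also have "\<dots> = (\<Sum>\<^sup>+ x. \<Sum>\<^sup>+ y. \<Sum>\<^sup>+ g1. \<Sum>\<^sup>+ g2. ?f (?p (x, g1)) (?p (y, g2)))"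
    by (rule nn_integral_cong, rule sum_swap)
  also have "\<dots> = (\<Sum>\<^sup>+ x. \<Sum>\<^sup>+ y. \<Sum>\<^sup>+ g1. \<Sum>\<^sup>+ g2. if padd x y a then if padd g1 g2 (g, k)
      then cf (slice x r) g1 * cf (slice y s) g2 else 0 else 0)"
  proof (intro nn_integral_cong)
    fix x y :: pt and p q :: "pt list \<times> nat"
    obtain g1 k1 g2 k2 where pq: "p = (g1, k1)" "q = (g2, k2)" by fastforce
    have "padd (g1 @ [x]) (g2 @ [y]) (g @ [a]) \<longleftrightarrow> padd g1 g2 g \<and> padd x y a"
    proof (cases "length g1 = length g \<and> length g2 = length g")
      case True
      then show ?thesis using padd_append[of g1 g g2 "[x]" "[y]" "[a]"] by auto
    next
      case False
      then show ?thesis using padd_length[of g1 g2 g] padd_length[of "g1 @ [x]" "g2 @ [y]" "g @ [a]"] by auto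
    qed
    then show "?f (?p (x, p)) (?p (y, q)) = (if padd x y a then if padd p q (g, k)
      then cf (slice x r) p * cf (slice y s) q else 0 else 0)"
      by (auto simp: padd_prod_iff pq)
  qed
  also have "\<dots> = cf (isum (\<lambda>x. isum (\<lambda>y. if padd x y a then slice x r * slice y s else 0))) (g, k)"
    by (simp only: csum_if cf_isum cf_if cf_times)
  finally show "cf (slice a (r * s)) (g, k) =
      cf (isum (\<lambda>x. isum (\<lambda>y. if padd x y a then slice x r * slice y s else 0))) (g, k)" .
qed

text \<open>Coalgebraic points in series form: the first conjunct is compatibility with duplication,
  the second with discarding.\<close>

definition multiplicative :: "(pt \<Rightarrow> tser) \<Rightarrow> bool" where
  "multiplicative v \<longleftrightarrow> (\<forall>a b. v a * v b = isum (\<lambda>c. if padd a b c then v c else 0)) \<and>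
     isum (\<lambda>a. if pemp a then v a else 0) = 1"

text \<open>Substitution of v for the last variable, as an operation on series. A product of series
  splits the point of that variable between its factors; a multiplicative v splits in the same way,
  which makes this a homomorphism.\<close>

definition msub :: "(pt \<Rightarrow> tser) \<Rightarrow> tser \<Rightarrow> tser" where
  "msub v r = isum (\<lambda>a. v a * slice a r)"

lemma msub_simps:
  "msub v 0 = 0" "msub v (r + s) = msub v r + msub v s" "msub v (isum f) = isum (\<lambda>i. msub v (f i))"
  "msub v (scal c r) = scal c (msub v r)"
  by (simp_all add: msub_def slice_simps distrib_left isum_add mult_isum isum_swap[of "\<lambda>a i. v a * slice a (f i)"]
      mult_scal scal_isum)

lemma msub_const:
  assumes "multiplicative v"
  shows "msub v 1 = 1" "msub v tick = tick"
proof -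
  have "isum (\<lambda>a. if pemp a then v a else 0) * r = r" for r using assms by (simp add: multiplicative_def)
  then show "msub v 1 = 1" "msub v tick = tick"
    unfolding msub_def slice_simps by (simp_all add: isum_mult if_mult_ser)
qed

lemma msub_mult:
  assumes "multiplicative v"
  shows "msub v (r * s) = msub v r * msub v s"
proof -
  have "msub v (r * s) = isum (\<lambda>a. isum (\<lambda>x. isum (\<lambda>y. if padd x y a then v a * (slice x r * slice y s) else 0)))"
    by (simp add: msub_def slice_mult mult_isum if_mult_ser)
  also have "\<dots> = isum (\<lambda>x. isum (\<lambda>y. isum (\<lambda>a. if padd x y a then v a * (slice x r * slice y s) else 0)))"
    by (subst isum_swap, subst (2) isum_swap) (rule refl)
  also have "\<dots> = isum (\<lambda>x. isum (\<lambda>y. isum (\<lambda>a. if padd x y a then v a else 0) * (slice x r * slice y s)))"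
    by (simp add: isum_mult if_mult_ser)
  also have "\<dots> = isum (\<lambda>x. isum (\<lambda>y. (v x * slice x r) * (v y * slice y s)))"
  proof -
    have "isum (\<lambda>a. if padd x y a then v a else 0) = v x * v y" for x y
      using assms by (simp add: multiplicative_def)
    then show ?thesis by (simp only: mult_ac)
  qed
  also have "\<dots> = msub v r * msub v s"
    unfolding msub_def by (subst isum_mult, subst mult_isum, rule refl)
  finally show ?thesis .
qed

lemma msub_prod: "multiplicative v \<Longrightarrow> msub v (\<Prod>i\<in>#B. f i) = (\<Prod>i\<in>#B. msub v (f i))"
  by (induction B) (auto simp: msub_const msub_mult)

lemma msub_cur: "(\<And>a. wk 0 (v a)) \<Longrightarrow> msub v (cur x r) = cur x (msub v r)"
  by (simp add: msub_def cur_simps cur_mult_wk0 slice_simps)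

lemma eqn_msub: "eqn n r s \<Longrightarrow> eqn n (msub v r) (msub v s)"
  unfolding msub_def by (intro eqn_isum eqn_mult eqn_refl) (simp add: eqn_def)

text \<open>Terms have to be compared on contexts of the right length only: the series of a
  substituted term and the substituted series may differ on other lengths.\<close>

definition agree :: "nat \<Rightarrow> tser \<Rightarrow> tser \<Rightarrow> bool" where
  "agree n r s \<longleftrightarrow> (\<forall>g k. length g = n \<longrightarrow> cf r (g, k) = cf s (g, k))"

lemma agree_refl [simp]: "agree n r r"
  and agree_sym: "agree n r s \<Longrightarrow> agree n s r"
  and agree_trans: "agree n r s \<Longrightarrow> agree n s t \<Longrightarrow> agree n r t"
  and agree_cur: "agree (Suc n) r s \<Longrightarrow> agree n (cur a r) (cur a s)"
  and agree_add: "agree n r r' \<Longrightarrow> agree n s s' \<Longrightarrow> agree n (r + s) (r' + s')"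
  and agree_scal: "agree n r s \<Longrightarrow> agree n (scal c r) (scal c s)"
  by (simp_all add: agree_def)

lemma agree_isum: "(\<And>i. agree n (f i) (h i)) \<Longrightarrow> agree n (isum f) (isum h)"
  by (simp add: agree_def cf_isum)

lemma agree_mult: "agree n r r' \<Longrightarrow> agree n s s' \<Longrightarrow> agree n (r * s) (r' * s')"
  unfolding agree_def cf_times csum_pair padd_prod_iff
  by (intro allI impI nn_integral_cong) (auto dest!: padd_length)

lemma agree_prod: "(\<And>i. agree n (f i) (h i)) \<Longrightarrow> agree n (\<Prod>i\<in>#B. f i) (\<Prod>i\<in>#B. h i)"
  by (induction B) (auto intro: agree_mult)

subsection \<open>Typing\<close>

lemma typing_weaken: "\<Gamma> \<turnstile> M : \<sigma> \<Longrightarrow> \<Gamma> @ \<Delta> \<turnstile> M : \<sigma>"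
proof (induction rule: typing.induct)
  case (t_var n \<Gamma>)
  then show ?case using typing.t_var[of n "\<Gamma> @ \<Delta>"] by (simp add: nth_append)
qed (auto intro: typing.intros)

lemma typing_weaken_closed: "[] \<turnstile> M : \<sigma> \<Longrightarrow> \<Delta> \<turnstile> M : \<sigma>"
  using typing_weaken[of "[]"] by simp

lemma lift_typed: "\<Gamma> \<turnstile> M : \<sigma> \<Longrightarrow> length \<Gamma> \<le> k \<Longrightarrow> lift k M = M"
  by (induction arbitrary: k rule: typing.induct) auto

text \<open>The replaced variable is the last one and the substituted term is closed, hence
  unchanged by \<open>lift\<close>. Reduction of closed terms only substitutes in this way.\<close>

lemma typing_subst:
  "\<Gamma> \<turnstile> M : \<sigma> \<Longrightarrow> \<Gamma> = \<Delta> @ [\<phi>] \<Longrightarrow> [] \<turnstile> V : Pos \<phi> \<Longrightarrow> \<Delta> \<turnstile> subst M (length \<Delta>) V : \<sigma>"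
proof (induction arbitrary: \<Delta> rule: typing.induct)
  case (t_var n \<Gamma>)
  then show ?case
    using typing.t_var[of n \<Delta>] by (auto simp: nth_append less_Suc_eq typing_weaken_closed)
next
  case (t_lam \<psi> \<Gamma> M \<sigma>)
  then show ?case using t_lam.IH[of "\<psi> # \<Delta>"] by (auto simp: lift_typed intro: typing.intros)
next
  case (t_case \<Gamma> M \<phi>' \<psi>' Nl \<sigma> Nr)
  then show ?case using t_case.IH(2)[of "\<phi>' # \<Delta>"] t_case.IH(3)[of "\<psi>' # \<Delta>"]
    by (auto simp: lift_typed intro: typing.intros)
next
  case (t_fix \<sigma> \<Gamma> M)
  then show ?case using t_fix.IH[of "Bang \<sigma> # \<Delta>"] by (auto simp: lift_typed intro: typing.intros)
qed (auto intro: typing.intros)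

inductive_cases typingE:
  "\<Gamma> \<turnstile> Var n : \<sigma>" "\<Gamma> \<turnstile> Unit : \<sigma>" "\<Gamma> \<turnstile> Stop M : \<sigma>" "\<Gamma> \<turnstile> MkPair M N : \<sigma>" "\<Gamma> \<turnstile> In i M : \<sigma>"
  "\<Gamma> \<turnstile> Lam \<phi> M : \<sigma>" "\<Gamma> \<turnstile> App M N : \<sigma>" "\<Gamma> \<turnstile> Case M Nl Nr : \<sigma>" "\<Gamma> \<turnstile> Pr i M : \<sigma>" "\<Gamma> \<turnstile> Go M : \<sigma>"
  "\<Gamma> \<turnstile> Fix \<tau> M : \<sigma>" "\<Gamma> \<turnstile> Fold M : \<sigma>" "\<Gamma> \<turnstile> Unfold M : \<sigma>" "\<Gamma> \<turnstile> Coin p : \<sigma>"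

lemma typing_subst0: "[\<phi>] \<turnstile> M : \<sigma> \<Longrightarrow> [] \<turnstile> V : Pos \<phi> \<Longrightarrow> [] \<turnstile> subst M 0 V : \<sigma>"
  using typing_subst[of "[\<phi>]" M \<sigma> "[]" \<phi> V] by simp

lemma weak_red_typing: "weak_red M M' \<Longrightarrow> [] \<turnstile> M : \<sigma> \<Longrightarrow> [] \<turnstile> M' : \<sigma>"
proof (induction rule: weak_red.induct)
  case (3 V W i)
  then show ?case by (cases i) (auto elim!: typingE)
next
  case (4 \<tau> M)
  then have "[] \<turnstile> Stop (Fix \<tau> M) : Pos (Bang \<tau>)" by (auto elim!: typingE intro: typing.intros)
  with 4 show ?case by (auto elim!: typingE(11) intro: typing_subst0)
next
  case (5 V i Nl Nr)
  then show ?case by (cases i) (auto elim!: typingE intro: typing_subst0)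
qed (auto elim!: typingE intro: typing_subst0)

lemma typing_in_unit: "\<Gamma> \<turnstile> In i Unit : Pos (Plus One One)"
  by (rule typing.t_in) (cases i; simp add: typing.t_unit)+

lemma prob_step_typing: "prob_step M p M' \<Longrightarrow> [] \<turnstile> M : \<sigma> \<Longrightarrow> [] \<turnstile> M' : \<sigma>"
proof (induction arbitrary: \<sigma> rule: prob_step.induct)
  case (1 M M')
  then show ?case by (rule weak_red_typing)
qed ((erule typingE, auto intro: typing.intros typing_in_unit)+)

subsection \<open>Supports\<close>

definition nz :: "pty list \<Rightarrow> tser \<Rightarrow> bool" where
  "nz \<Gamma> r \<longleftrightarrow> (\<exists>g k. list_all2 pw \<Gamma> g \<and> cf r (g, k) \<noteq> 0)"

lemma list_all2_pw_padd:
  "padd g1 g2 g \<Longrightarrow> list_all2 pw \<Gamma> g \<Longrightarrow> list_all2 pw \<Gamma> g1 \<and> list_all2 pw \<Gamma> g2"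
  by (induction g1 g2 g arbitrary: \<Gamma> rule: padd_list.induct) (auto simp: list_all2_Cons2 dest: pw_padd)

lemma nz_0 [simp]: "\<not> nz \<Gamma> 0"
  by (simp add: nz_def)

lemma nz_mult: "nz \<Gamma> (r * s) \<Longrightarrow> nz \<Gamma> r \<and> nz \<Gamma> s"
proof -
  assume "nz \<Gamma> (r * s)"
  then obtain g k where g: "list_all2 pw \<Gamma> g" and "cf (r * s) (g, k) \<noteq> 0" by (auto simp: nz_def)
  then obtain x y where "padd x y (g, k)" "cf r x \<noteq> 0" "cf s y \<noteq> 0"
    unfolding cf_times csum_neq_0_iff by (auto split: if_splits)
  moreover obtain g1 k1 g2 k2 where "x = (g1, k1)" "y = (g2, k2)" by fastforce
  ultimately show ?thesis using list_all2_pw_padd[of g1 g2 g \<Gamma>] g by (auto simp: nz_def padd_prod_iff)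
qed

lemma nz_isum: "nz \<Gamma> (isum f) \<Longrightarrow> \<exists>i. nz \<Gamma> (f i)"
  unfolding nz_def cf_isum csum_neq_0_iff by blast

lemma nz_add: "nz \<Gamma> (r + s) \<Longrightarrow> nz \<Gamma> r \<or> nz \<Gamma> s"
  unfolding nz_def by fastforce

lemma nz_scal: "nz \<Gamma> (scal c r) \<Longrightarrow> c \<noteq> 0 \<and> nz \<Gamma> r"
  unfolding nz_def by fastforce

lemma nz_cur: "nz \<Gamma> (cur a r) \<Longrightarrow> pw \<phi> a \<Longrightarrow> nz (\<phi> # \<Gamma>) r"
  unfolding nz_def by (metis cf_cur list_all2_Cons)

lemma nz_prod: "nz \<Gamma> (\<Prod>i\<in>#B. f i) \<Longrightarrow> i \<in># B \<Longrightarrow> nz \<Gamma> (f i)"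
  by (induction B) (auto dest: nz_mult)

text \<open>Induction on the iterate: a nonzero contribution consumes a bag whose elements lie in
  the web by the previous stage, so this bag is a legal point for the bound variable.\<close>

lemma nz_fstep_iter:
  assumes "\<And>b. nz (Bang \<sigma> # \<Gamma>) (m b) \<Longrightarrow> gw \<sigma> b"
  shows "nz \<Gamma> ((fstep m ^^ j) (\<lambda>_. 0) b) \<Longrightarrow> gw \<sigma> b"
proof (induction j arbitrary: b)
  case (Suc j)
  then have "nz \<Gamma> (fstep m ((fstep m ^^ j) (\<lambda>_. 0)) b)" by simp
  then obtain B where *: "nz \<Gamma> (\<Prod>a\<in>#B. (fstep m ^^ j) (\<lambda>_. 0) a)" "nz \<Gamma> (cur (PBag B) (m b))"
    unfolding fstep_def by (blast dest: nz_mult nz_isum)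
  then have "pw (Bang \<sigma>) (PBag B)" by (auto simp: pw_simps dest: nz_prod Suc.IH)
  then show ?case using * assms nz_cur by blast
qed simp

lemma nz_fixser: "nz \<Gamma> (fixser F b) \<Longrightarrow> \<exists>j. nz \<Gamma> ((F ^^ j) (\<lambda>_. 0) b)"
  unfolding nz_def fixser_def by (auto simp del: funpow.simps)

lemma nz_var: "nz \<Gamma> (var_ser n b) \<Longrightarrow> n < length \<Gamma> \<Longrightarrow> pw (\<Gamma> ! n) b"
  unfolding nz_def var_ser_def
  by (auto split: if_splits dest!: list_all2_nthD[where p = n])

text \<open>Reconciles the cut-offs at webs with the unrestricted sums over points, both in beta
  reduction and in the comparison with the interpretation.\<close>

lemma U_support: "\<Gamma> \<turnstile> M : \<sigma> \<Longrightarrow> nz \<Gamma> (U M b) \<Longrightarrow> gw \<sigma> b"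
proof (induction arbitrary: b rule: typing.induct)
  case (t_var n \<Gamma>)
  then show ?case by (auto simp: pw_simps dest: nz_var)
next
  case (t_stop \<Gamma> M \<sigma>)
  then show ?case by (auto simp: pw_simps split: pt.splits dest: nz_prod)
next
  case (t_pair \<Gamma> M \<phi> N \<psi>)
  then show ?case by (auto simp: pw_simps split: pt.splits dest!: nz_mult)
next
  case (t_in \<Gamma> M i \<phi> \<psi>)
  then show ?case by (auto simp: pw_simps split: pt.splits if_splits)
next
  case (t_lam \<phi> \<Gamma> M \<sigma>)
  then show ?case by (auto simp: pw_simps split: pt.splits if_splits dest: nz_cur)
next
  case (t_app \<Gamma> M \<phi> \<sigma> N)
  then show ?case by (fastforce simp: pw_simps dest!: nz_mult nz_isum)
next
  case (t_case \<Gamma> M \<phi> \<psi> Nl \<sigma> Nr)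
  from t_case.prems have "nz \<Gamma> (isum (\<lambda>a. U M (PIn Lft a) * cur a (U Nl b) + U M (PIn Rgt a) * cur a (U Nr b)))"
    by (auto dest: nz_mult)
  then obtain a where "nz \<Gamma> (U M (PIn Lft a) * cur a (U Nl b)) \<or> nz \<Gamma> (U M (PIn Rgt a) * cur a (U Nr b))"
    using nz_isum nz_add by blast
  then show ?case
  proof
    assume *: "nz \<Gamma> (U M (PIn Lft a) * cur a (U Nl b))"
    then have "pw \<phi> a" using t_case.IH(1) by (fastforce simp: pw_simps dest!: nz_mult)
    then show ?thesis using * t_case.IH(2) by (blast dest: nz_mult nz_cur)
  next
    assume *: "nz \<Gamma> (U M (PIn Rgt a) * cur a (U Nr b))"
    then have "pw \<psi> a" using t_case.IH(1) by (fastforce simp: pw_simps dest!: nz_mult)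
    then show ?thesis using * t_case.IH(3) by (blast dest: nz_mult nz_cur)
  qed
next
  case (t_pr \<Gamma> M \<phi> \<psi> i)
  from t_pr.prems obtain a where "nz \<Gamma> (U M (sel i (PPair b a) (PPair a b)))"
    by (auto dest!: nz_mult nz_isum split: if_splits)
  then show ?case using t_pr.IH by (cases i) (fastforce simp: pw_simps)+
next
  case (t_go \<Gamma> M \<sigma>)
  then show ?case by (fastforce simp: pw_simps dest!: nz_mult)
next
  case (t_fix \<sigma> \<Gamma> M)
  then show ?case using nz_fstep_iter[of \<sigma> \<Gamma> "U M"] by (auto dest!: nz_fixser)
next
  case (t_fold \<Gamma> M \<phi>)
  then show ?case by (auto simp: pw_simps)
next
  case (t_unfold \<Gamma> M \<phi>)
  then show ?case by (auto simp: pw_simps dest!: nz_mult)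
next
  case (t_coin p \<Gamma>)
  then have "coin_vec p b \<noteq> 0" by (auto dest!: nz_mult nz_scal)
  then have "b = PIn Lft PStar \<or> b = PIn Rgt PStar" by (auto simp: coin_vec_def basis_def split: if_splits)
  then show ?case by (auto simp: pw_simps)
qed (auto simp: pw_simps split: if_splits)

subsection \<open>The substitution lemma\<close>

text \<open>The replaced variable is discarded here, so only the unit entries of v count, and they
  add up to 1.\<close>

lemma agree_var:
  assumes "multiplicative v" "i < n"
  shows "agree n (msub v (var_ser i b)) (var_ser i b)"
proof -
  have *: "agree n (slice a (var_ser i b)) (if pemp a then var_ser i b else 0)" for a
    using wk_var[OF assms(2)] by (auto simp: agree_def wk_def)
  have "agree n (msub v (var_ser i b)) (isum (\<lambda>a. v a * (if pemp a then var_ser i b else 0)))"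
    unfolding msub_def by (intro agree_isum agree_mult agree_refl *)
  also have "isum (\<lambda>a. v a * (if pemp a then var_ser i b else 0)) = isum (\<lambda>a. if pemp a then v a else 0) * var_ser i b"
    by (simp add: isum_mult if_mult_ser)
  also have "\<dots> = var_ser i b" using assms(1) by (simp add: multiplicative_def)
  finally show ?thesis .
qed

lemma agree_var_last: "agree n (msub v (var_ser n b)) (v b)"
proof -
  have "agree n (slice a (var_ser n b)) (if a = b then 1 else 0)" for a
    by (auto simp: agree_def var_ser_def cf_1 pemp_prod_iff pemp_nat_def)
  then have "agree n (msub v (var_ser n b)) (isum (\<lambda>a. v a * (if a = b then 1 else 0)))"
    unfolding msub_def by (intro agree_isum agree_mult agree_refl)
  then show ?thesis by (simp add: if_mult_ser)
qed

text \<open>Substitution commutes with each iterate. A coefficient of the fixpoint is one of a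
  finite iterate, and \<open>msub\<close> respects congruence modulo powers of
  \<open>tick\<close>.\<close>

lemma agree_fixser:
  assumes v: "multiplicative v" "\<And>a. wk 0 (v a)"
    and m: "\<And>b. agree (Suc n) (m' b) (msub v (m b))"
  shows "agree n (fixser (fstep m') b) (msub v (fixser (fstep m) b))"
proof -
  have step: "agree n (fstep m' s' b) (msub v (fstep m s b))" if s: "\<And>b. agree n (s' b) (msub v (s b))" for s s' b
  proof -
    have "agree n (fstep m' s' b) (tick * isum (\<lambda>B. (\<Prod>a\<in>#B. msub v (s a)) * cur (PBag B) (msub v (m b))))"
      unfolding fstep_def by (intro agree_mult agree_refl agree_isum agree_prod agree_cur s m)
    also have "tick * isum (\<lambda>B. (\<Prod>a\<in>#B. msub v (s a)) * cur (PBag B) (msub v (m b))) = msub v (fstep m s b)"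
      unfolding fstep_def
      by (simp add: msub_mult[OF v(1)] msub_const[OF v(1)] msub_simps msub_prod[OF v(1)] msub_cur[OF v(2)])
    finally show ?thesis .
  qed
  have it: "agree n ((fstep m' ^^ j) (\<lambda>_. 0) b) (msub v ((fstep m ^^ j) (\<lambda>_. 0) b))" for j b
    by (induction j arbitrary: b) (simp_all add: msub_simps step)
  show ?thesis
    unfolding agree_def
  proof (intro allI impI)
    fix g :: "pt list" and k :: nat assume "length g = n"
    have "cf (fixser (fstep m') b) (g, k) = cf (msub v ((fstep m ^^ Suc k) (\<lambda>_. 0) b)) (g, k)"
      using it[of "Suc k" b] \<open>length g = n\<close> by (simp add: fixser_def agree_def)
    also have "\<dots> = cf (msub v (fixser (fstep m) b)) (g, k)"
      using eqn_msub[OF fixser_eqn[OF contractive_fstep, of "Suc k" m b], of v] unfolding eqn_def by simp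
    finally show "cf (fixser (fstep m') b) (g, k) = cf (msub v (fixser (fstep m) b)) (g, k)" .
  qed
qed

text \<open>Induction on typing with the replaced variable kept at the end of the context. Every
  clause of \<open>U\<close> is built from operations that \<open>msub\<close> preserves for a
  closed multiplicative argument.\<close>

lemma U_subst:
  assumes V: "[] \<turnstile> V : Pos \<phi>" "multiplicative (U V)"
  shows "\<Gamma> \<turnstile> M : \<sigma> \<Longrightarrow> \<Gamma> = \<Delta> @ [\<phi>] \<Longrightarrow>
    agree (length \<Delta>) (U (subst M (length \<Delta>) V) b) (msub (U V) (U M b))"
proof (induction arbitrary: b \<Delta> rule: typing.induct)
  let ?v = "U V"
  have wk: "wk 0 (?v a)" for a using wk_U[OF V(1)] by simp
  have lft: "lift 0 V = V" using lift_typed[OF V(1)] by simp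
  note sim = msub_mult[OF V(2)] msub_const[OF V(2)] msub_simps msub_prod[OF V(2)] msub_cur[OF wk]
  {
    case (t_var n \<Gamma>)
    then show ?case
      using agree_var[OF V(2), THEN agree_sym] agree_var_last[THEN agree_sym] by (auto simp: less_Suc_eq)
  next
    case (t_stop \<Gamma> M \<sigma>)
    then show ?case by (auto simp: sim split: pt.split intro!: agree_prod)
  next
    case (t_pair \<Gamma> M \<phi> N \<psi>)
    then show ?case by (auto simp: sim split: pt.split intro!: agree_mult)
  next
    case (t_in \<Gamma> M i \<phi> \<psi>)
    then show ?case by (auto simp: sim split: pt.split)
  next
    case (t_lam \<psi> \<Gamma> M \<sigma>)
    then show ?case using t_lam.IH[of "\<psi> # \<Delta>"]
      by (auto simp: sim lft split: pt.split intro!: agree_cur)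
  next
    case (t_app \<Gamma> M \<phi> \<sigma> N)
    then show ?case by (auto simp: sim intro!: agree_mult agree_isum)
  next
    case (t_case \<Gamma> M \<phi>' \<psi>' Nl \<sigma> Nr)
    then show ?case using t_case.IH(2)[of "\<phi>' # \<Delta>"] t_case.IH(3)[of "\<psi>' # \<Delta>"]
      by (auto simp: sim lft intro!: agree_mult agree_isum agree_add agree_cur)
  next
    case (t_pr \<Gamma> M \<phi> \<psi> i)
    have "msub ?v (if pemp a then r else 0) = (if pemp a then msub ?v r else 0)" for a :: pt and r
      by (simp add: sim)
    then show ?case using t_pr by (auto simp: sim intro!: agree_mult agree_isum)
  next
    case (t_go \<Gamma> M \<sigma>)
    then show ?case by (auto simp: sim intro!: agree_mult)
  next
    case (t_fix \<sigma> \<Gamma> M)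
    then show ?case using t_fix.IH[of "Bang \<sigma> # \<Delta>"] by (auto simp: lft intro!: agree_fixser V(2) wk)
  next
    case (t_unfold \<Gamma> M \<phi>)
    then show ?case by (auto simp: sim intro!: agree_mult)
  next
    case (t_coin p \<Gamma>)
    then show ?case by (simp add: sim)
  }
qed (auto simp: msub_simps msub_const[OF V(2)])

section \<open>Closed values are multiplicative\<close>

lemma multiplicativeI:
  assumes "\<And>a b c. padd a b c \<Longrightarrow> v c = v a * v b" "\<And>a b. \<not> (\<exists>c. padd a b c) \<Longrightarrow> v a * v b = 0"
    "isum (\<lambda>a. if pemp a then v a else 0) = 1"
  shows "multiplicative v"
  unfolding multiplicative_def
proof (intro conjI allI assms(3))
  fix a b
  show "v a * v b = isum (\<lambda>c. if padd a b c then v c else 0)"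
  proof (cases "\<exists>c. padd a b c")
    case True
    then obtain c where "padd a b c" by blast
    then show ?thesis using assms(1) by (subst isum_single[of c]) (auto dest: padd_functional)
  next
    case False
    then show ?thesis using assms(2)[of a b] by auto
  qed
qed

lemma multiplicativeD:
  assumes "multiplicative v"
  shows "padd a b c \<Longrightarrow> v c = v a * v b" "\<not> (\<exists>c. padd a b c) \<Longrightarrow> v a * v b = 0"
    "isum (\<lambda>a. if pemp a then v a else 0) = 1"
proof -
  have *: "v a * v b = isum (\<lambda>c. if padd a b c then v c else 0)"
    using assms by (simp add: multiplicative_def)
  show "padd a b c \<Longrightarrow> v c = v a * v b" unfolding * by (subst isum_single[of c]) (auto dest: padd_functional)
  show "\<not> (\<exists>c. padd a b c) \<Longrightarrow> v a * v b = 0" unfolding * by simp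
  show "isum (\<lambda>a. if pemp a then v a else 0) = 1" using assms by (simp add: multiplicative_def)
qed

text \<open>For \<open>Stop\<close> the entry at a bag is a product over its elements, so adding
  bags multiplies entries. Pairs and injections inherit the property from their components, and a
  variable is excluded because the value is closed.\<close>

lemma multiplicative_value: "is_value V \<Longrightarrow> [] \<turnstile> V : \<sigma> \<Longrightarrow> multiplicative (U V)"
proof (induction arbitrary: \<sigma> rule: is_value.induct)
  case 2
  show ?case
  proof (rule multiplicativeI)
    show "isum (\<lambda>a. if pemp a then U Unit a else 0) = 1"
      by (subst isum_single[of PStar]) auto
  qed (auto simp: padd_pt_simps)
next
  case (3 M)
  show ?case
  proof (rule multiplicativeI)
    fix a b c :: pt assume "padd a b c"
    then show "U (Stop M) c = U (Stop M) a * U (Stop M) b"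
      by (cases a; cases b) (auto simp: padd_pt_simps)
  next
    fix a b :: pt assume "\<not> (\<exists>c. padd a b c)"
    then show "U (Stop M) a * U (Stop M) b = 0"
      by (cases a; cases b) (auto simp: padd_pt_simps)
  next
    show "isum (\<lambda>a. if pemp a then U (Stop M) a else 0) = 1"
      by (subst isum_single[of "PBag {#}"]) (auto split: pt.splits)
  qed
next
  case (4 V W)
  then have V: "multiplicative (U V)" and W: "multiplicative (U W)" by (auto elim!: typingE)
  show ?case
  proof (rule multiplicativeI)
    fix a b c :: pt assume "padd a b c"
    then show "U (MkPair V W) c = U (MkPair V W) a * U (MkPair V W) b"
      by (cases a; cases b) (auto simp: padd_pt_simps multiplicativeD(1)[OF V] multiplicativeD(1)[OF W] mult_ac)
  next
    fix a b :: pt assume n: "\<not> (\<exists>c. padd a b c)"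
    show "U (MkPair V W) a * U (MkPair V W) b = 0"
    proof (cases "\<exists>x y x' y'. a = PPair x y \<and> b = PPair x' y'")
      case True
      then obtain x y x' y' where ab: "a = PPair x y" "b = PPair x' y'" by blast
      then have "(\<not> (\<exists>c. padd x x' c)) \<or> (\<not> (\<exists>c. padd y y' c))" using n by (auto simp: padd_pt_simps)
      then have "U V x * U V x' = 0 \<or> U W y * U W y' = 0" using multiplicativeD(2)[OF V] multiplicativeD(2)[OF W] by blast
      moreover have "U (MkPair V W) a * U (MkPair V W) b = (U V x * U V x') * (U W y * U W y')"
        by (simp add: ab mult_ac)
      ultimately show ?thesis by auto
    qed (cases a; cases b; auto)
  next
    have "isum (\<lambda>a. if pemp a then U (MkPair V W) a else 0) =
        isum (\<lambda>p. if pemp (PPair (fst p) (snd p)) then U (MkPair V W) (PPair (fst p) (snd p)) else 0)"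
    proof (rule isum_reindex)
      fix a assume a: "a \<notin> range (\<lambda>p. PPair (fst p) (snd p))"
      have "a \<noteq> PPair x y" for x y
        using a rangeI[of "\<lambda>p. PPair (fst p) (snd p)" "(x, y)"] by auto
      then show "(if pemp a then U (MkPair V W) a else 0) = 0" by (auto split: pt.split)
    qed (auto simp: inj_def)
    also have "\<dots> = isum (\<lambda>x. isum (\<lambda>y. (if pemp x then U V x else 0) * (if pemp y then U W y else 0)))"
      by (rule ser_eqI) (simp add: cf_isum csum_pair if_mult_ser, intro nn_integral_cong, simp)
    also have "\<dots> = isum (\<lambda>x. if pemp x then U V x else 0) * isum (\<lambda>y. if pemp y then U W y else 0)"
      by (subst isum_mult, subst mult_isum, rule refl)
    finally show "isum (\<lambda>a. if pemp a then U (MkPair V W) a else 0) = 1"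
      using multiplicativeD(3)[OF V] multiplicativeD(3)[OF W] by simp
  qed
next
  case (5 V i)
  then have V: "multiplicative (U V)" by (auto elim!: typingE)
  show ?case
  proof (rule multiplicativeI)
    fix a b c :: pt assume "padd a b c"
    then show "U (In i V) c = U (In i V) a * U (In i V) b"
      by (cases a; cases b) (auto simp: padd_pt_simps multiplicativeD(1)[OF V])
  next
    fix a b :: pt assume "\<not> (\<exists>c. padd a b c)"
    then show "U (In i V) a * U (In i V) b = 0"
      by (cases a; cases b) (auto simp: padd_pt_simps multiplicativeD(2)[OF V])
  next
    have "isum (\<lambda>a. if pemp a then U (In i V) a else 0) = isum (\<lambda>a. if pemp (PIn i a) then U (In i V) (PIn i a) else 0)"
      by (rule isum_reindex) (auto simp: inj_def image_iff split: pt.splits)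
    then show "isum (\<lambda>a. if pemp a then U (In i V) a else 0) = 1" using multiplicativeD(3)[OF V] by (simp cong: if_cong)
  qed
next
  case (6 V)
  then show ?case by (auto elim!: typingE)
qed (auto elim!: typingE)

subsection \<open>Soundness of reduction\<close>

text \<open>Progress and preservation of the semantics in one property: the reducts form a
  probability distribution, and passing to them costs one factor \<open>tick\<close>. The empty
  context suffices, as only closed terms are reduced.\<close>

definition sound :: "tm \<Rightarrow> bool" where
  "sound M \<longleftrightarrow> (\<exists>p M'. prob_step M p M') \<and> csum (Red M) = 1 \<and>
     (\<forall>b. agree 0 (U M b) (tick * isum (\<lambda>M'. scal (Red M M') (U M' b))))"

lemma sound_not_value: "sound M \<Longrightarrow> \<not> is_value M \<and> (\<forall>\<phi> L. M \<noteq> Lam \<phi> L)"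
  using value_no_reduct Lam_no_reduct by (auto simp: sound_def)

text \<open>An evaluation context uses its hole exactly once, so its series is linear in that of the
  hole and the equation for M passes through. Two families of coefficients are provided because
  \<open>Case\<close> reads its hole at left and at right points.\<close>

lemma sound_ctx:
  assumes M: "sound M" and C: "inj C"
    and steps: "\<And>p L. prob_step (C M) p L \<longleftrightarrow> (\<exists>M'. L = C M' \<and> prob_step M p M')"
    and lin: "\<And>b. \<exists>p k p' k'. \<forall>M. U (C M) b = isum (\<lambda>i :: pt. U M (p i) * k i + U M (p' i) * k' i)"
  shows "sound (C M)"
proof -
  have red: "Red (C M) (C M') = Red M M'" for M'
  proof -
    have "prob_step (C M) p (C M') \<longleftrightarrow> prob_step M p M'" for p using steps C by (auto dest: injD)
    moreover have "\<not> no_reduct M" "\<not> no_reduct (C M)" using M steps by (auto simp: sound_def no_reduct_def)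
    ultimately show ?thesis by (simp add: Red_def)
  qed
  have red0: "Red (C M) L = 0" if "L \<notin> range C" for L
  proof -
    have "\<not> prob_step (C M) p L" for p using that steps by auto
    moreover have "\<not> no_reduct (C M)" using M steps by (auto simp: sound_def no_reduct_def)
    ultimately show ?thesis by (simp add: Red_def)
  qed
  have "csum (Red (C M)) = 1"
    using sum_reindex[OF C red0] M by (simp add: red sound_def)
  moreover have "agree 0 (U (C M) b) (tick * isum (\<lambda>L. scal (Red (C M) L) (U L b)))" for b
  proof -
    obtain p k p' k' where K: "\<And>M. U (C M) b = isum (\<lambda>i :: pt. U M (p i) * k i + U M (p' i) * k' i)"
      using lin[of b] by blast
    let ?r = "\<lambda>a. tick * isum (\<lambda>M'. scal (Red M M') (U M' a))"
    have "agree 0 (U M a) (?r a)" for a using M by (simp add: sound_def)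
    then have "agree 0 (U (C M) b) (isum (\<lambda>i. ?r (p i) * k i + ?r (p' i) * k' i))"
      unfolding K by (intro agree_isum agree_add agree_mult agree_refl)
    also have "isum (\<lambda>i. ?r (p i) * k i + ?r (p' i) * k' i) =
        isum (\<lambda>i. tick * isum (\<lambda>M'. scal (Red M M') (U M' (p i) * k i + U M' (p' i) * k' i)))"
    proof -
      have "?r a * x + ?r a' * x' = tick * isum (\<lambda>M'. scal (Red M M') (U M' a * x + U M' a' * x'))" for a a' x x'
      proof -
        have "scal c (r + s) = scal c r + scal c s" for c and r s :: tser
          by (rule ser_eqI) (simp add: distrib_left)
        then show ?thesis
          by (simp add: mult.assoc isum_mult scal_mult isum_add distrib_left[symmetric])
      qed
      then show ?thesis by simp
    qed
    also have "\<dots> = tick * isum (\<lambda>M'. scal (Red M M') (U (C M') b))"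
      unfolding K mult_isum[symmetric] scal_isum by (subst isum_swap) (rule refl)
    also have "isum (\<lambda>M'. scal (Red M M') (U (C M') b)) = isum (\<lambda>L. scal (Red (C M) L) (U L b))"
      by (subst isum_reindex[OF C, of "\<lambda>L. scal (Red (C M) L) (U L b)"]) (simp_all add: red0 red)
    finally show ?thesis .
  qed
  ultimately show ?thesis using M steps unfolding sound_def by blast
qed

lemma sound_redex:
  assumes steps: "\<And>p L. prob_step M p L \<longleftrightarrow> p = 1 \<and> L = M'"
    and U: "\<And>b. agree 0 (U M b) (tick * U M' b)"
  shows "sound M"
proof -
  have "Red M = (\<lambda>L. if L = M' then 1 else 0)"
  proof
    fix L
    have "\<not> no_reduct M" using steps by (auto simp: no_reduct_def)
    then show "Red M L = (if L = M' then 1 else 0)" by (auto simp: Red_def steps)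
  qed
  moreover have "scal (if L = M' then 1 else 0) r = (if L = M' then r else 0)" for L and r :: tser by simp
  ultimately show ?thesis using steps U by (simp add: sound_def csum_if_eq)
qed

inductive_simps prob_step_simps:
  "prob_step (Go M) p L" "prob_step (App M N) p L" "prob_step (Pr i M) p L" "prob_step (MkPair M N) p L"
  "prob_step (In i M) p L" "prob_step (Case M Nl Nr) p L" "prob_step (Fold M) p L" "prob_step (Unfold M) p L"
  "prob_step (Fix \<sigma> M) p L" "prob_step (Coin q) p L"

inductive_simps weak_red_simps:
  "weak_red (Go M) L" "weak_red (App M N) L" "weak_red (Pr i M) L" "weak_red (MkPair M N) L"
  "weak_red (In i M) L" "weak_red (Case M Nl Nr) L" "weak_red (Fold M) L" "weak_red (Unfold M) L"
  "weak_red (Fix \<sigma> M) L" "weak_red (Coin q) L"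

lemmas step_simps = prob_step_simps weak_red_simps value_no_reduct Lam_no_reduct is_value.intros

lemma sound_Go: "sound M \<Longrightarrow> sound (Go M)"
proof (rule sound_ctx[where C = Go])
  assume M: "sound M"
  show "prob_step (Go M) p L \<longleftrightarrow> (\<exists>M'. L = Go M' \<and> prob_step M p M')" for p L
    using sound_not_value[OF M] by (auto simp: step_simps)
  fix b
  \<comment> \<open>A single entry is presented as a sum over points by a coefficient supported at
    the arbitrarily chosen point \<open>PStar\<close>.\<close>
  show "\<exists>p k p' k'. \<forall>M. U (Go M) b = isum (\<lambda>i :: pt. U M (p i) * k i + U M (p' i) * k' i)"
    by (intro exI[of _ "\<lambda>_. PBag {#b#}"] exI[of _ "\<lambda>i. if i = PStar then tick else 0"] exI[of _ "\<lambda>_. 0"])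
       (simp add: if_mult_ser mult.commute)
qed (auto simp: inj_def)

lemma sound_App1: "sound M \<Longrightarrow> is_value V \<Longrightarrow> sound (App M V)"
proof (rule sound_ctx[where C = "\<lambda>M. App M V"])
  assume M: "sound M" and V: "is_value V"
  show "prob_step (App M V) p L \<longleftrightarrow> (\<exists>M'. L = App M' V \<and> prob_step M p M')" for p L
    using sound_not_value[OF M] V by (auto simp: step_simps)
  fix b
  show "\<exists>p k p' k'. \<forall>M. U (App M V) b = isum (\<lambda>i :: pt. U M (p i) * k i + U M (p' i) * k' i)"
    by (intro exI[of _ "\<lambda>a. PPair a b"] exI[of _ "\<lambda>a. tick * U V a"] exI[of _ "\<lambda>_. 0"])
       (simp add: mult_isum mult.left_commute)
qed (auto simp: inj_def)

lemma sound_App2: "sound M \<Longrightarrow> sound (App N M)"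
proof (rule sound_ctx[where C = "App N"])
  assume M: "sound M"
  show "prob_step (App N M) p L \<longleftrightarrow> (\<exists>M'. L = App N M' \<and> prob_step M p M')" for p L
    using sound_not_value[OF M] by (auto simp: step_simps)
  fix b
  show "\<exists>p k p' k'. \<forall>M. U (App N M) b = isum (\<lambda>i :: pt. U M (p i) * k i + U M (p' i) * k' i)"
    by (intro exI[of _ "\<lambda>a. a"] exI[of _ "\<lambda>a. tick * U N (PPair a b)"] exI[of _ "\<lambda>_. 0"])
       (simp add: mult_isum mult_ac)
qed (auto simp: inj_def)

lemma sound_Pr: "sound M \<Longrightarrow> sound (Pr i M)"
proof (rule sound_ctx[where C = "Pr i"])
  assume M: "sound M"
  show "prob_step (Pr i M) p L \<longleftrightarrow> (\<exists>M'. L = Pr i M' \<and> prob_step M p M')" for p L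
    using sound_not_value[OF M] by (auto simp: step_simps)
  fix b
  show "\<exists>p k p' k'. \<forall>M. U (Pr i M) b = isum (\<lambda>i :: pt. U M (p i) * k i + U M (p' i) * k' i)"
    by (intro exI[of _ "\<lambda>a. sel i (PPair b a) (PPair a b)"] exI[of _ "\<lambda>a. if pemp a then tick else 0"] exI[of _ "\<lambda>_. 0"])
       (simp add: mult_isum if_mult_ser mult.commute)
qed (auto simp: inj_def)

lemma sound_MkPair1: "sound M \<Longrightarrow> sound (MkPair M N)"
proof (rule sound_ctx[where C = "\<lambda>M. MkPair M N"])
  assume M: "sound M"
  show "prob_step (MkPair M N) p L \<longleftrightarrow> (\<exists>M'. L = MkPair M' N \<and> prob_step M p M')" for p L
    using sound_not_value[OF M] by (auto simp: step_simps)
  fix b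
  show "\<exists>p k p' k'. \<forall>M. U (MkPair M N) b = isum (\<lambda>i :: pt. U M (p i) * k i + U M (p' i) * k' i)"
  proof (cases "\<exists>x y. b = PPair x y")
    case True
    then obtain x y where "b = PPair x y" by blast
    then show ?thesis
      by (intro exI[of _ "\<lambda>_. x"] exI[of _ "\<lambda>i. if i = PStar then U N y else 0"] exI[of _ "\<lambda>_. 0"])
         (simp add: if_mult_ser)
  next
    case False
    then show ?thesis by (intro exI[of _ "\<lambda>_. PStar"] exI[of _ "\<lambda>_. 0"]) (simp split: pt.split)
  qed
qed (auto simp: inj_def)

lemma sound_MkPair2: "sound M \<Longrightarrow> is_value V \<Longrightarrow> sound (MkPair V M)"
proof (rule sound_ctx[where C = "MkPair V"])
  assume M: "sound M" and V: "is_value V"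
  show "prob_step (MkPair V M) p L \<longleftrightarrow> (\<exists>M'. L = MkPair V M' \<and> prob_step M p M')" for p L
    using sound_not_value[OF M] V by (auto simp: step_simps)
  fix b
  show "\<exists>p k p' k'. \<forall>M. U (MkPair V M) b = isum (\<lambda>i :: pt. U M (p i) * k i + U M (p' i) * k' i)"
  proof (cases "\<exists>x y. b = PPair x y")
    case True
    then obtain x y where "b = PPair x y" by blast
    then show ?thesis
      by (intro exI[of _ "\<lambda>_. y"] exI[of _ "\<lambda>i. if i = PStar then U V x else 0"] exI[of _ "\<lambda>_. 0"])
         (simp add: if_mult_ser mult.commute)
  next
    case False
    then show ?thesis by (intro exI[of _ "\<lambda>_. PStar"] exI[of _ "\<lambda>_. 0"]) (simp split: pt.split)
  qed
qed (auto simp: inj_def)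

lemma sound_In: "sound M \<Longrightarrow> sound (In i M)"
proof (rule sound_ctx[where C = "In i"])
  assume M: "sound M"
  show "prob_step (In i M) p L \<longleftrightarrow> (\<exists>M'. L = In i M' \<and> prob_step M p M')" for p L
    by (auto simp: step_simps)
  fix b
  show "\<exists>p k p' k'. \<forall>M. U (In i M) b = isum (\<lambda>i :: pt. U M (p i) * k i + U M (p' i) * k' i)"
  proof (cases "\<exists>x. b = PIn i x")
    case True
    then obtain x where "b = PIn i x" by blast
    then show ?thesis
      by (intro exI[of _ "\<lambda>_. x"] exI[of _ "\<lambda>i. if i = PStar then 1 else 0"] exI[of _ "\<lambda>_. 0"])
         (simp add: if_mult_ser)
  next
    case False
    then show ?thesis by (intro exI[of _ "\<lambda>_. PStar"] exI[of _ "\<lambda>_. 0"]) (auto split: pt.split)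
  qed
qed (auto simp: inj_def)

lemma sound_Case: "sound M \<Longrightarrow> sound (Case M Nl Nr)"
proof (rule sound_ctx[where C = "\<lambda>M. Case M Nl Nr"])
  assume M: "sound M"
  show "prob_step (Case M Nl Nr) p L \<longleftrightarrow> (\<exists>M'. L = Case M' Nl Nr \<and> prob_step M p M')" for p L
    using sound_not_value[OF M] by (auto simp: step_simps)
  fix b
  show "\<exists>p k p' k'. \<forall>M. U (Case M Nl Nr) b = isum (\<lambda>i :: pt. U M (p i) * k i + U M (p' i) * k' i)"
    by (intro exI[of _ "PIn Lft"] exI[of _ "PIn Rgt"] exI[of _ "\<lambda>a. tick * cur a (U Nl b)"]
        exI[of _ "\<lambda>a. tick * cur a (U Nr b)"])
       (simp add: mult_isum distrib_left mult.left_commute)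
qed (auto simp: inj_def)

lemma sound_Fold: "sound M \<Longrightarrow> sound (Fold M)"
proof (rule sound_ctx[where C = Fold])
  assume M: "sound M"
  show "prob_step (Fold M) p L \<longleftrightarrow> (\<exists>M'. L = Fold M' \<and> prob_step M p M')" for p L
    by (auto simp: step_simps)
  fix b
  show "\<exists>p k p' k'. \<forall>M. U (Fold M) b = isum (\<lambda>i :: pt. U M (p i) * k i + U M (p' i) * k' i)"
    by (intro exI[of _ "\<lambda>_. b"] exI[of _ "\<lambda>i. if i = PStar then 1 else 0"] exI[of _ "\<lambda>_. 0"])
       (simp add: if_mult_ser)
qed (auto simp: inj_def)

lemma sound_Unfold: "sound M \<Longrightarrow> sound (Unfold M)"
proof (rule sound_ctx[where C = Unfold])
  assume M: "sound M"
  show "prob_step (Unfold M) p L \<longleftrightarrow> (\<exists>M'. L = Unfold M' \<and> prob_step M p M')" for p L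
    using sound_not_value[OF M] by (auto simp: step_simps)
  fix b
  show "\<exists>p k p' k'. \<forall>M. U (Unfold M) b = isum (\<lambda>i :: pt. U M (p i) * k i + U M (p' i) * k' i)"
    by (intro exI[of _ "\<lambda>_. b"] exI[of _ "\<lambda>i. if i = PStar then tick else 0"] exI[of _ "\<lambda>_. 0"])
       (simp add: if_mult_ser mult.commute)
qed (auto simp: inj_def)

text \<open>In a context with a single variable, the first entry is also the last.\<close>

lemma agree_slice_cur: "agree 0 (slice a r) (cur a r)"
  by (simp add: agree_def)

lemma agree_subst0:
  assumes "[\<phi>] \<turnstile> M : \<sigma>" "[] \<turnstile> V : Pos \<phi>" "is_value V"
  shows "agree 0 (U (subst M 0 V) b) (isum (\<lambda>a. U V a * cur a (U M b)))"
proof -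
  have "agree 0 (U (subst M 0 V) b) (msub (U V) (U M b))"
    using U_subst[OF assms(2) multiplicative_value[OF assms(3,2)] assms(1), of "[]"] by simp
  moreover have "agree 0 (msub (U V) (U M b)) (isum (\<lambda>a. U V a * cur a (U M b)))"
    unfolding msub_def by (intro agree_isum agree_mult agree_refl agree_slice_cur)
  ultimately show ?thesis by (rule agree_trans)
qed

text \<open>The cut-off in the clause of \<open>Lam\<close> is harmless: off the web of its type the
  series of the argument vanishes.\<close>

lemma sound_beta:
  assumes "[] \<turnstile> App (Lam \<phi> M) V : \<sigma>" "is_value V"
  shows "sound (App (Lam \<phi> M) V)"
proof (rule sound_redex)
  show "prob_step (App (Lam \<phi> M) V) p L \<longleftrightarrow> p = 1 \<and> L = subst M 0 V" for p L
    using assms(2) by (auto simp: step_simps)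
  have ty: "[\<phi>] \<turnstile> M : \<sigma>" "[] \<turnstile> V : Pos \<phi>" using assms(1) by (auto elim!: typingE)
  fix b
  have k: "agree 0 ((if pw \<phi> a then cur a (U M b) else 0) * U V a) (U V a * cur a (U M b))" for a
  proof (cases "pw \<phi> a")
    case True
    then show ?thesis by (simp add: mult.commute)
  next
    case False
    then have "\<not> nz [] (U V a)" using U_support[OF ty(2)] by (auto simp: pw_simps)
    then have "agree 0 (U V a) 0" by (auto simp: agree_def nz_def)
    then have "agree 0 (U V a * cur a (U M b)) (0 * cur a (U M b))" by (intro agree_mult agree_refl)
    then show ?thesis using False by (auto intro: agree_sym)
  qed
  have "agree 0 (tick * isum (\<lambda>a. (if pw \<phi> a then cur a (U M b) else 0) * U V a))
      (tick * isum (\<lambda>a. U V a * cur a (U M b)))"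
    by (rule agree_mult[OF agree_refl agree_isum[OF k]])
  then have "agree 0 (U (App (Lam \<phi> M) V) b) (tick * isum (\<lambda>a. U V a * cur a (U M b)))"
    by simp
  moreover have "agree 0 (tick * isum (\<lambda>a. U V a * cur a (U M b))) (tick * U (subst M 0 V) b)"
    by (rule agree_mult[OF agree_refl agree_sym[OF agree_subst0[OF ty assms(2)]]])
  ultimately show "agree 0 (U (App (Lam \<phi> M) V) b) (tick * U (subst M 0 V) b)" by (rule agree_trans)
qed

text \<open>The fixpoint equation is already a substitution: the product over a bag in
  \<open>fstep\<close> is the entry of \<open>Stop (Fix \<tau> M)\<close> at this bag.\<close>

lemma sound_Fix:
  assumes "[] \<turnstile> Fix \<tau> M : \<sigma>"
  shows "sound (Fix \<tau> M)"
proof (rule sound_redex)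
  let ?V = "Stop (Fix \<tau> M)"
  show "prob_step (Fix \<tau> M) p L \<longleftrightarrow> p = 1 \<and> L = subst M 0 ?V" for p L
    by (auto simp: step_simps)
  have ty: "[Bang \<tau>] \<turnstile> M : \<tau>" "[] \<turnstile> ?V : Pos (Bang \<tau>)"
    using assms by (auto elim!: typingE intro: typing.intros)
  fix b
  have "U (Fix \<tau> M) b = tick * isum (\<lambda>B. U ?V (PBag B) * cur (PBag B) (U M b))"
    using fixser_unfold[OF contractive_fstep, of "U M" b] by (simp add: fstep_def)
  also have "isum (\<lambda>B. U ?V (PBag B) * cur (PBag B) (U M b)) = isum (\<lambda>a. U ?V a * cur a (U M b))"
    by (rule isum_reindex[symmetric]) (auto simp: inj_def image_iff split: pt.splits)
  finally have e: "U (Fix \<tau> M) b = tick * isum (\<lambda>a. U ?V a * cur a (U M b))" .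
  show "agree 0 (U (Fix \<tau> M) b) (tick * U (subst M 0 ?V) b)"
    unfolding e by (rule agree_mult[OF agree_refl agree_sym[OF agree_subst0[OF ty is_value.intros(3)]]])
qed

lemma sound_case_redex:
  assumes "[] \<turnstile> Case (In i V) Nl Nr : \<sigma>" "is_value V"
  shows "sound (Case (In i V) Nl Nr)"
proof (rule sound_redex)
  show "prob_step (Case (In i V) Nl Nr) p L \<longleftrightarrow> p = 1 \<and> L = subst (sel i Nl Nr) 0 V" for p L
    using assms(2) by (auto simp: step_simps)
  obtain \<phi> where ty: "[\<phi>] \<turnstile> sel i Nl Nr : \<sigma>" "[] \<turnstile> V : Pos \<phi>"
    using assms(1) by (cases i) (auto elim!: typingE)
  fix b
  have e: "U (Case (In i V) Nl Nr) b = tick * isum (\<lambda>a. U V a * cur a (U (sel i Nl Nr) b))"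
    by (cases i) simp_all
  show "agree 0 (U (Case (In i V) Nl Nr) b) (tick * U (subst (sel i Nl Nr) 0 V) b)"
    unfolding e by (rule agree_mult[OF agree_refl agree_sym[OF agree_subst0[OF ty assms(2)]]])
qed

lemma sound_pr_redex:
  assumes "[] \<turnstile> Pr i (MkPair V W) : \<sigma>" "is_value V" "is_value W"
  shows "sound (Pr i (MkPair V W))"
proof (rule sound_redex)
  show "prob_step (Pr i (MkPair V W)) p L \<longleftrightarrow> p = 1 \<and> L = sel i V W" for p L
    using assms(2,3) by (auto simp: step_simps)
  have "multiplicative (U V)" "multiplicative (U W)"
    using assms by (auto elim!: typingE intro: multiplicative_value)
  note * = this[THEN multiplicativeD(3)]
  fix b
  have "U (Pr i (MkPair V W)) b = tick * U (sel i V W) b"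
  proof (cases i)
    case Lft
    have "isum (\<lambda>a. if pemp a then U V b * U W a else 0) = U V b * isum (\<lambda>a. if pemp a then U W a else 0)"
      by (simp add: mult_isum if_mult_ser)
    then show ?thesis by (simp add: Lft * cong: if_cong)
  next
    case Rgt
    have "isum (\<lambda>a. if pemp a then U V a * U W b else 0) = isum (\<lambda>a. if pemp a then U V a else 0) * U W b"
      by (simp add: isum_mult if_mult_ser)
    then show ?thesis by (simp add: Rgt * cong: if_cong)
  qed
  then show "agree 0 (U (Pr i (MkPair V W)) b) (tick * U (sel i V W) b)" by simp
qed

lemma sound_Coin:
  assumes "0 \<le> p" "p \<le> 1"
  shows "sound (Coin p)"
proof -
  let ?l = "ennreal (real_of_rat p)" and ?r = "ennreal (real_of_rat (1 - p))"
  have steps: "prob_step (Coin p) q L \<longleftrightarrow> (L = In Lft Unit \<and> q = p \<or> L = In Rgt Unit \<and> q = 1 - p)" for q L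
    by (auto simp: step_simps)
  have red: "Red (Coin p) = (\<lambda>L. (if L = In Lft Unit then ?l else 0) + (if L = In Rgt Unit then ?r else 0))"
  proof
    fix L
    have "\<not> no_reduct (Coin p)" using steps by (auto simp: no_reduct_def)
    then show "Red (Coin p) L = (if L = In Lft Unit then ?l else 0) + (if L = In Rgt Unit then ?r else 0)"
      by (auto simp: Red_def steps)
  qed
  have "?l + ?r = 1"
    using assms by (simp add: ennreal_plus[symmetric] of_rat_diff del: ennreal_plus)
  then have "csum (Red (Coin p)) = 1"
    unfolding red by (simp add: nn_integral_add csum_if_eq)
  moreover have "U (Coin p) b = tick * isum (\<lambda>M'. scal (Red (Coin p) M') (U M' b))" for b
  proof -
    have "scal (Red (Coin p) L) (U L b) = (if L = In Lft Unit then scal ?l (U L b) else 0)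
        + (if L = In Rgt Unit then scal ?r (U L b) else 0)" for L
      by (auto simp: red)
    then have "isum (\<lambda>M'. scal (Red (Coin p) M') (U M' b)) = scal ?l (U (In Lft Unit) b) + scal ?r (U (In Rgt Unit) b)"
      by (simp only: isum_add isum_if_eq)
    also have "\<dots> = scal (coin_vec p b) 1"
      by (rule ser_eqI) (auto simp: coin_vec_def basis_def split: pt.splits)
    finally show ?thesis by simp
  qed
  ultimately show ?thesis using steps by (auto simp: sound_def)
qed

section \<open>Canonical forms and progress\<close>

lemma closed_value_forms:
  assumes "is_value V" "[] \<turnstile> V : \<sigma>"
  shows "\<exists>\<phi>. \<sigma> = Pos \<phi>"
    and "\<sigma> = Pos One \<Longrightarrow> V = Unit"
    and "\<sigma> = Pos (Bang \<tau>) \<Longrightarrow> \<exists>M. V = Stop M"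
    and "\<sigma> = Pos (Tensor \<phi> \<psi>) \<Longrightarrow> \<exists>V1 V2. V = MkPair V1 V2 \<and> is_value V1 \<and> is_value V2"
    and "\<sigma> = Pos (Plus \<phi> \<psi>) \<Longrightarrow> \<exists>i W. V = In i W \<and> is_value W"
    and "\<sigma> = Pos (Mu \<phi>) \<Longrightarrow> \<exists>W. V = Fold W \<and> is_value W"
  using assms by (cases rule: is_value.cases; auto elim: typingE)+

text \<open>Induction on typing. A subterm in evaluation position is either sound, and then
  \<open>sound_ctx\<close> applies, or it is a normal form whose shape, known from its type, exposes
  a redex or makes the whole term a value.\<close>

theorem sound_or_normal:
  "\<Gamma> \<turnstile> M : \<sigma> \<Longrightarrow> \<Gamma> = [] \<Longrightarrow> is_value M \<or> (\<exists>\<phi> L. M = Lam \<phi> L) \<or> sound M"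
proof (induction rule: typing.induct)
  case (t_pair \<Gamma> M \<phi> N \<psi>)
  have "is_value M \<or> sound M" "is_value N \<or> sound N" using t_pair by (auto elim: typingE)
  then show ?case using sound_MkPair1 sound_MkPair2 is_value.intros by blast
next
  case (t_in \<Gamma> M i \<phi> \<psi>)
  then have "is_value M \<or> sound M" by (auto elim: typingE)
  then show ?case using sound_In is_value.intros by blast
next
  case (t_app \<Gamma> M \<phi> \<sigma> N)
  have N: "is_value N \<or> sound N" using t_app by (auto elim: typingE)
  have M: "(\<exists>\<phi> L. M = Lam \<phi> L) \<or> sound M" using t_app closed_value_forms(1)[of M] by blast
  have ty: "[] \<turnstile> App M N : \<sigma>" using t_app typing.t_app by blast
  show ?case using N M ty sound_App1 sound_App2 sound_beta by blast
next
  case (t_case \<Gamma> M \<phi> \<psi> Nl \<sigma> Nr)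
  have M: "is_value M \<or> sound M" using t_case by (auto elim: typingE)
  have ty: "[] \<turnstile> Case M Nl Nr : \<sigma>" using t_case typing.t_case by blast
  from M show ?case
  proof
    assume "is_value M"
    then obtain i W where "M = In i W" "is_value W" using closed_value_forms(5)[OF _ _ refl, of M \<phi> \<psi>] t_case by auto
    then show ?thesis using ty sound_case_redex by auto
  qed (simp add: sound_Case)
next
  case (t_pr \<Gamma> M \<phi> \<psi> i)
  have M: "is_value M \<or> sound M" using t_pr by (auto elim: typingE)
  have ty: "[] \<turnstile> Pr i M : Pos (sel i \<phi> \<psi>)" using t_pr typing.t_pr by blast
  from M show ?case
  proof
    assume "is_value M"
    then obtain V W where "M = MkPair V W" "is_value V" "is_value W"
      using closed_value_forms(4)[OF _ _ refl, of M \<phi> \<psi>] t_pr by auto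
    then show ?thesis using ty sound_pr_redex by auto
  qed (simp add: sound_Pr)
next
  case (t_go \<Gamma> M \<sigma>)
  have M: "is_value M \<or> sound M" using t_go by (auto elim: typingE)
  have "sound (Go (Stop N))" for N
    by (rule sound_redex[of _ N]) (auto simp: step_simps)
  moreover have "is_value M \<Longrightarrow> \<exists>N. M = Stop N" using closed_value_forms(3)[OF _ _ refl, of M \<sigma>] t_go by auto
  ultimately show ?case using M sound_Go by auto
next
  case (t_fix \<sigma> \<Gamma> M)
  then have "[] \<turnstile> Fix \<sigma> M : \<sigma>" using typing.t_fix by blast
  then show ?case using sound_Fix by blast
next
  case (t_fold \<Gamma> M \<phi>)
  then have "is_value M \<or> sound M" by (auto elim: typingE)
  then show ?case using sound_Fold is_value.intros by blast
next
  case (t_unfold \<Gamma> M \<phi>)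
  have M: "is_value M \<or> sound M" using t_unfold by (auto elim: typingE)
  have "sound (Unfold (Fold W))" if "is_value W" for W
    by (rule sound_redex[of _ W]) (use that in \<open>auto simp: step_simps\<close>)
  moreover have "is_value M \<Longrightarrow> \<exists>W. M = Fold W \<and> is_value W"
    using closed_value_forms(6)[OF _ _ refl, of M \<phi>] t_unfold by auto
  ultimately show ?case using M sound_Unfold by auto
next
  case (t_coin p \<Gamma>)
  then show ?case using sound_Coin by blast
qed (auto intro: is_value.intros)

lemma sound_or_Unit: "[] \<turnstile> M : Pos One \<Longrightarrow> M = Unit \<or> sound M"
  using sound_or_normal[of "[]" M] closed_value_forms(2)[of M] by (auto elim: typingE)

subsection \<open>Adequacy\<close>

lemma Red_Unit: "Red Unit = (\<lambda>N. if N = Unit then 1 else 0)"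
proof
  fix N
  have "\<not> prob_step Unit p N" for p N by (simp add: value_no_reduct is_value.intros)
  then show "Red Unit N = (if N = Unit then 1 else 0)" by (simp add: Red_def no_reduct_def)
qed

lemma Red_typing: "[] \<turnstile> M : \<sigma> \<Longrightarrow> Red M N \<noteq> 0 \<Longrightarrow> [] \<turnstile> N : \<sigma>"
  by (auto simp: Red_def split: if_splits intro: prob_step_typing)

text \<open>Coefficient k is the probability of reaching \<open>Unit\<close> in exactly k steps.
  \<open>Unit\<close> is absorbing for \<open>Red\<close>, so the power n collects all k up to
  n.\<close>

lemma Red_pow_U: "[] \<turnstile> M : Pos One \<Longrightarrow> Red_pow n M Unit = (\<Sum>k\<le>n. cf (U M PStar) ([], k))"
proof (induction n arbitrary: M)
  case 0
  from sound_or_Unit[OF 0] show ?case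
  proof
    assume "sound M"
    moreover from this have "M \<noteq> Unit" using sound_not_value by (auto intro: is_value.intros)
    ultimately show ?thesis by (auto simp: sound_def agree_def cf_tick_mult)
  qed (simp add: cf_1 pemp_prod_iff pemp_nat_def)
next
  case (Suc n)
  from sound_or_Unit[OF Suc.prems] show ?case
  proof
    assume M: "M = Unit"
    have "Red_pow (Suc n) M Unit = (\<Sum>\<^sup>+ N. if N = Unit then Red_pow n Unit Unit else 0)"
      by (simp add: M Red_Unit if_distrib cong: if_cong) (auto intro!: nn_integral_cong)
    also have "\<dots> = (\<Sum>k\<le>Suc n. cf (U M PStar) ([], k))"
      using Suc.IH[of Unit] typing.t_unit
      by (simp add: M csum_if_eq cf_1 pemp_prod_iff pemp_nat_def)
    finally show ?thesis .
  next
    assume M: "sound M"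
    have eq: "cf (U M PStar) ([], k) = cf (tick * isum (\<lambda>N. scal (Red M N) (U N PStar))) ([], k)" for k
      using M by (simp add: sound_def agree_def)
    have "Red_pow (Suc n) M Unit = (\<Sum>\<^sup>+ N. Red M N * (\<Sum>k\<le>n. cf (U N PStar) ([], k)))"
      unfolding Red_pow.simps
    proof (rule nn_integral_cong)
      fix N
      show "Red M N * Red_pow n N Unit = Red M N * (\<Sum>k\<le>n. cf (U N PStar) ([], k))"
        using Suc.IH[of N] Red_typing[OF Suc.prems, of N] by (cases "Red M N = 0") auto
    qed
    also have "\<dots> = (\<Sum>k\<le>n. \<Sum>\<^sup>+ N. Red M N * cf (U N PStar) ([], k))"
      by (simp add: sum_distrib_left nn_integral_sum)
    also have "\<dots> = (\<Sum>k\<le>n. cf (U M PStar) ([], Suc k))"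
      by (simp add: eq cf_tick_mult cf_isum)
    \<comment> \<open>The index 0 may be added since its coefficient vanishes by the factor
      \<open>tick\<close>.\<close>
    also have "\<dots> = (\<Sum>k\<le>Suc n. cf (U M PStar) ([], k))"
      by (simp only: sum.atMost_Suc_shift) (simp add: eq cf_tick_mult)
    finally show ?thesis .
  qed
qed

text \<open>Forgets the step count, that is, sets \<open>tick\<close> to 1.\<close>

definition ev :: "tser \<Rightarrow> pt list \<Rightarrow> ennreal" where
  "ev r g = (\<Sum>\<^sup>+ k. cf r (g, k))"

theorem adequacy:
  assumes "[] \<turnstile> M : Pos One"
  shows "Red_inf M Unit = ev (U M PStar) []"
proof -
  let ?f = "\<lambda>k. cf (U M PStar) ([], k)"
  have "no_reduct Unit" by (simp add: no_reduct_def value_no_reduct is_value.intros)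
  then have "Red_inf M Unit = (SUP n. \<Sum>k\<le>n. ?f k)" by (simp add: Red_inf_def Red_pow_U[OF assms])
  also have "\<dots> = (SUP n. \<Sum>k<n. ?f k)"
  proof (rule antisym)
    show "(SUP n. \<Sum>k\<le>n. ?f k) \<le> (SUP n. \<Sum>k<n. ?f k)"
    proof (rule SUP_mono)
      show "\<exists>m\<in>UNIV. (\<Sum>k\<le>n. ?f k) \<le> (\<Sum>k<m. ?f k)" for n
        by (rule bexI[of _ "Suc n"]) (simp_all add: lessThan_Suc_atMost)
    qed
    show "(SUP n. \<Sum>k<n. ?f k) \<le> (SUP n. \<Sum>k\<le>n. ?f k)"
      by (rule SUP_subset_mono) (auto intro!: sum_mono2)
  qed
  also have "\<dots> = ev (U M PStar) []"
    by (simp add: ev_def nn_integral_count_space_nat suminf_eq_SUP)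
  finally show ?thesis .
qed

lemma Red_pow_le_1: "[] \<turnstile> M : Pos One \<Longrightarrow> Red_pow n M Unit \<le> 1"
proof (induction n arbitrary: M)
  case (Suc n)
  have "Red_pow (Suc n) M Unit \<le> csum (Red M)"
    unfolding Red_pow.simps
  proof (rule nn_integral_mono)
    fix N
    show "Red M N * Red_pow n N Unit \<le> Red M N"
    proof (cases "Red M N = 0")
      case False
      then have "Red_pow n N Unit \<le> 1" using Suc.IH Red_typing[OF Suc.prems] by blast
      then show ?thesis using mult_left_mono[of "Red_pow n N Unit" 1 "Red M N"] by simp
    qed simp
  qed
  also have "csum (Red M) = 1"
    using sound_or_Unit[OF Suc.prems] by (auto simp: sound_def Red_Unit csum_if_eq)
  finally show ?case .
qed auto

text \<open>The bound is obtained operationally, from total probability 1. It is what makes the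
  power series of the tests finite when all parameters are 1.\<close>

lemma ev_le_1: "[] \<turnstile> M : Pos One \<Longrightarrow> ev (U M PStar) [] \<le> 1"
  by (simp add: adequacy[symmetric] Red_inf_def Red_pow_le_1 SUP_least)

section \<open>Comparison with the interpretation of terms\<close>

lemma ev_simps:
  "ev 0 g = 0" "ev (r + s) g = ev r g + ev s g" "ev (isum f) g = (\<Sum>\<^sup>+ i. ev (f i) g)"
  "ev (scal c r) g = c * ev r g" "ev (cur a r) g = ev r (a # g)"
  "ev 1 g = (if pemp g then 1 else 0)"
proof -
  show "ev (isum f) g = (\<Sum>\<^sup>+ i. ev (f i) g)" unfolding ev_def cf_isum by (rule sum_swap)
  have "ev 1 g = (\<Sum>\<^sup>+ k :: nat. if k = 0 then if pemp g then 1 else 0 else 0)"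
    by (auto simp: ev_def cf_1 pemp_prod_iff pemp_nat_def intro!: nn_integral_cong)
  then show "ev 1 g = (if pemp g then 1 else 0)" by (simp only: csum_if_eq)
qed (simp_all add: ev_def nn_integral_add nn_integral_cmult)

lemma ev_if: "ev (if P then r else 0) g = (if P then ev r g else 0)"
  by (simp add: ev_simps)

lemma ev_mult: "ev (r * s) g = (\<Sum>\<^sup>+ g1. \<Sum>\<^sup>+ g2. if padd g1 g2 g then ev r g1 * ev s g2 else 0)"
proof -
  have "ev (r * s) g = (\<Sum>\<^sup>+ k. \<Sum>\<^sup>+ g1. \<Sum>\<^sup>+ i. \<Sum>\<^sup>+ g2. \<Sum>\<^sup>+ j.
      if k = i + j then if padd g1 g2 g then cf r (g1, i) * cf s (g2, j) else 0 else 0)"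
    unfolding ev_def cf_times csum_pair
    by (intro nn_integral_cong) (auto simp: padd_prod_iff padd_nat_def)
  also have "\<dots> = (\<Sum>\<^sup>+ g1. \<Sum>\<^sup>+ i. \<Sum>\<^sup>+ g2. \<Sum>\<^sup>+ j. \<Sum>\<^sup>+ k.
      if k = i + j then if padd g1 g2 g then cf r (g1, i) * cf s (g2, j) else 0 else 0)"
    by (subst sum_swap, rule nn_integral_cong, subst sum_swap, rule nn_integral_cong, subst sum_swap,
        rule nn_integral_cong, rule sum_swap)
  also have "\<dots> = (\<Sum>\<^sup>+ g1. \<Sum>\<^sup>+ i. \<Sum>\<^sup>+ g2. \<Sum>\<^sup>+ j. if padd g1 g2 g then cf r (g1, i) * cf s (g2, j) else 0)"
    by (simp only: csum_if_eq)
  also have "\<dots> = (\<Sum>\<^sup>+ g1. \<Sum>\<^sup>+ g2. \<Sum>\<^sup>+ i. \<Sum>\<^sup>+ j. if padd g1 g2 g then cf r (g1, i) * cf s (g2, j) else 0)"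
    by (rule nn_integral_cong, rule sum_swap)
  also have "\<dots> = (\<Sum>\<^sup>+ g1. \<Sum>\<^sup>+ g2. if padd g1 g2 g then ev r g1 * ev s g2 else 0)"
    unfolding csum_if ev_def by (simp add: nn_integral_cmult nn_integral_multc cong: if_cong)
  finally show ?thesis .
qed

lemma ev_tick [simp]: "ev (tick * r) g = ev r g"
proof -
  have "ev (tick * r) g = (\<Sum>\<^sup>+ k. cf (tick * r) (g, Suc k))"
    unfolding ev_def by (rule sum_reindex) (auto simp: cf_tick_mult image_iff split: nat.splits)
  then show ?thesis by (simp add: cf_tick_mult ev_def)
qed

lemma ev_nz: "list_all2 pw \<Gamma> g \<Longrightarrow> ev r g \<noteq> 0 \<Longrightarrow> nz \<Gamma> r"
  unfolding ev_def csum_neq_0_iff nz_def by blast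

lemma ev_support: "\<Gamma> \<turnstile> M : \<sigma> \<Longrightarrow> list_all2 pw \<Gamma> g \<Longrightarrow> ev (U M b) g \<noteq> 0 \<Longrightarrow> gw \<sigma> b"
  using ev_nz U_support by blast

section \<open>Contexts coded as points of the iterated tensor\<close>

definition cp :: "pt list \<Rightarrow> pt" where
  "cp g = foldr PPair g PStar"

lemma cp_simps [simp]: "cp [] = PStar" "cp (a # g) = PPair a (cp g)"
  by (simp_all add: cp_def)

lemma inj_cp: "inj cp"
proof (rule injI)
  show "cp g = cp h \<Longrightarrow> g = h" for g h
    by (induction g arbitrary: h) (case_tac h; simp)+
qed

lemma cp_eq_iff [simp]: "cp g = cp h \<longleftrightarrow> g = h"
  using inj_cp by (simp add: inj_eq)

lemma pemp_cp [simp]: "pemp (cp g) \<longleftrightarrow> pemp g"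
  by (induction g) auto

lemma padd_cp: "padd x y (cp g) \<longleftrightarrow> (\<exists>g1 g2. x = cp g1 \<and> y = cp g2 \<and> padd g1 g2 g)"
proof (induction g arbitrary: x y)
  case (Cons a g)
  show ?case
  proof
    assume "padd x y (cp (a # g))"
    then obtain a1 x' a2 y' where "x = PPair a1 x'" "y = PPair a2 y'" "padd a1 a2 a" "padd x' y' (cp g)"
      by (auto simp: padd_pt_simps)
    with Cons obtain g1 g2 where "x = cp (a1 # g1)" "y = cp (a2 # g2)" "padd (a1 # g1) (a2 # g2) (a # g)"
      by auto
    then show "\<exists>g1 g2. x = cp g1 \<and> y = cp g2 \<and> padd g1 g2 (a # g)" by blast
  qed (use Cons in \<open>auto simp: padd_pt_simps padd_Cons_iff\<close>)
qed (auto simp: padd_pt_simps)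

lemma csum_padd_cp:
  "(\<Sum>\<^sup>+ x. \<Sum>\<^sup>+ y. if padd x y (cp g) then f x y else 0) =
   (\<Sum>\<^sup>+ g1. \<Sum>\<^sup>+ g2. if padd g1 g2 g then f (cp g1) (cp g2) else 0)"
proof -
  let ?f = "\<lambda>x y. if padd x y (cp g) then f x y else 0"
  have "(\<Sum>\<^sup>+ x. \<Sum>\<^sup>+ y. ?f x y) = (\<Sum>\<^sup>+ g1. \<Sum>\<^sup>+ y. ?f (cp g1) y)"
    by (rule sum_reindex[OF inj_cp], rule csum_0I) (auto simp: padd_cp)
  also have "\<dots> = (\<Sum>\<^sup>+ g1. \<Sum>\<^sup>+ g2. ?f (cp g1) (cp g2))"
    by (rule nn_integral_cong, rule sum_reindex[OF inj_cp]) (auto simp: padd_cp)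
  finally show ?thesis by (simp add: padd_cp)
qed

lemma web_ctx_sem:
  "\<forall>\<phi>\<in>set \<Gamma>. pclosed \<phi> \<Longrightarrow> web (car (ctx_sem \<Gamma>)) = {cp g | g. list_all2 pw \<Gamma> g}"
proof (induction \<Gamma>)
  case (Cons \<phi> \<Gamma>)
  then have *: "web (car (psem \<phi>)) = Collect (pw \<phi>)" "web (car (ctx_sem \<Gamma>)) = {cp g | g. list_all2 pw \<Gamma> g}"
    by (auto simp: web_psem)
  show ?case
  proof (intro set_eqI iffI)
    fix x assume "x \<in> web (car (ctx_sem (\<phi> # \<Gamma>)))"
    then obtain a g where "x = cp (a # g)" "list_all2 pw (\<phi> # \<Gamma>) (a # g)" by (auto simp: *)
    then show "x \<in> {cp g | g. list_all2 pw (\<phi> # \<Gamma>) g}" by blast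
  qed (auto simp: * list_all2_Cons1)
qed simp

lemma str_ctx_sem:
  "\<forall>\<phi>\<in>set \<Gamma>. pclosed \<phi> \<Longrightarrow> list_all2 pw \<Gamma> g \<Longrightarrow> str (ctx_sem \<Gamma>) (cp g) (PBag B) = (if spl (cp g) B then 1 else 0)"
  by (auto simp: good_str[OF good_ctx_sem] web_ctx_sem)

lemma str_outside: "good A \<Longrightarrow> x \<notin> web (car A) \<Longrightarrow> str A x y = 0"
  by (simp add: good_def)

lemma gclosed_typing: "\<Gamma> \<turnstile> M : \<sigma> \<Longrightarrow> \<forall>\<phi>\<in>set \<Gamma>. pclosed \<phi> \<Longrightarrow> gclosed \<sigma>"
proof (induction rule: typing.induct)
  case (t_pr \<Gamma> M \<phi> \<psi> i)
  then show ?case by (cases i) auto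
next
  case (t_unfold \<Gamma> M \<phi>)
  then show ?case using pclosed_unfold by auto
qed auto

lemma pair_mat_outside: "good A \<Longrightarrow> x \<notin> web (car A) \<Longrightarrow> pair_mat A s t x y = 0"
  unfolding pair_mat_def mcomp_def
  by (rule csum_0I) (auto simp: contr_mat_def str_outside split: pt.splits)

lemma bind_mat_outside: "good A \<Longrightarrow> x \<notin> web (car A) \<Longrightarrow> bind_mat A s t x y = 0"
  by (simp add: bind_mat_def mcomp_def pair_mat_outside)

lemma pair_mat_other: "(\<And>a b. y \<noteq> PPair a b) \<Longrightarrow> pair_mat A s t x y = 0"
  unfolding pair_mat_def mcomp_def
  by (rule csum_0I) (auto simp: mtensor_def split: pt.splits)

context
  fixes \<Gamma> :: "pty list" and g :: "pt list"
  assumes cl: "\<forall>\<phi>\<in>set \<Gamma>. pclosed \<phi>" and g: "list_all2 pw \<Gamma> g"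
begin

lemma pair_mat_cp:
  "pair_mat (ctx_sem \<Gamma>) s t (cp g) (PPair a b) =
   (\<Sum>\<^sup>+ g1. \<Sum>\<^sup>+ g2. if padd g1 g2 g then s (cp g1) a * t (cp g2) b else 0)"
proof -
  have "pair_mat (ctx_sem \<Gamma>) s t (cp g) (PPair a b) =
      (\<Sum>\<^sup>+ x. \<Sum>\<^sup>+ y. str (ctx_sem \<Gamma>) (cp g) (PBag {#x, y#}) * (s x a * t y b))"
    unfolding pair_mat_def mcomp_def
    by (subst sum_PPair) (auto simp: contr_mat_def mtensor_def split: pt.splits)
  also have "\<dots> = (\<Sum>\<^sup>+ x. \<Sum>\<^sup>+ y. if padd x y (cp g) then s x a * t y b else 0)"
    by (intro nn_integral_cong) (simp add: str_ctx_sem[OF cl g] spl_pair)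
  finally show ?thesis by (simp only: csum_padd_cp)
qed

lemma bind_mat_cp:
  "bind_mat (ctx_sem \<Gamma>) s t (cp g) b =
   (\<Sum>\<^sup>+ a. \<Sum>\<^sup>+ g1. \<Sum>\<^sup>+ g2. if padd g1 g2 g then s (cp g1) a * t (cp (a # g2)) b else 0)"
proof -
  let ?I = "id_mat (car (ctx_sem \<Gamma>))"
  have "bind_mat (ctx_sem \<Gamma>) s t (cp g) b =
      (\<Sum>\<^sup>+ a. \<Sum>\<^sup>+ y. pair_mat (ctx_sem \<Gamma>) s ?I (cp g) (PPair a y) * t (PPair a y) b)"
    unfolding bind_mat_def mcomp_def by (subst sum_PPair) (simp_all add: pair_mat_other)
  also have "\<dots> = (\<Sum>\<^sup>+ a. \<Sum>\<^sup>+ y. \<Sum>\<^sup>+ g1. \<Sum>\<^sup>+ g2.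
      if y = cp g2 then if padd g1 g2 g then s (cp g1) a * t (PPair a y) b else 0 else 0)"
  proof (intro nn_integral_cong)
    fix a y
    have "pair_mat (ctx_sem \<Gamma>) s ?I (cp g) (PPair a y) * t (PPair a y) b =
       (\<Sum>\<^sup>+ g1. \<Sum>\<^sup>+ g2. (if padd g1 g2 g then s (cp g1) a * ?I (cp g2) y else 0) * t (PPair a y) b)"
      unfolding pair_mat_cp by (simp add: nn_integral_multc)
    also have "\<dots> = (\<Sum>\<^sup>+ g1. \<Sum>\<^sup>+ g2.
      if y = cp g2 then if padd g1 g2 g then s (cp g1) a * t (PPair a y) b else 0 else 0)"
    proof (intro nn_integral_cong)
      fix g1 g2
      have "cp g2 \<in> web (car (ctx_sem \<Gamma>))" if "padd g1 g2 g"
        using list_all2_pw_padd[OF that g] web_ctx_sem[OF cl] by auto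
      then show "(if padd g1 g2 g then s (cp g1) a * ?I (cp g2) y else 0) * t (PPair a y) b =
          (if y = cp g2 then if padd g1 g2 g then s (cp g1) a * t (PPair a y) b else 0 else 0)"
        by (auto simp: id_mat_def)
    qed
    finally show "pair_mat (ctx_sem \<Gamma>) s ?I (cp g) (PPair a y) * t (PPair a y) b = \<dots>" .
  qed
  also have "\<dots> = (\<Sum>\<^sup>+ a. \<Sum>\<^sup>+ g1. \<Sum>\<^sup>+ g2. \<Sum>\<^sup>+ y.
      if y = cp g2 then if padd g1 g2 g then s (cp g1) a * t (PPair a y) b else 0 else 0)"
    by (rule nn_integral_cong, subst sum_swap, rule nn_integral_cong, rule sum_swap)
  finally show ?thesis by (simp only: csum_if_eq cp_simps)
qed

text \<open>The common core of \<open>Case\<close> and \<open>Fix\<close>. The support condition on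
  r reconciles the cut-off of s at the web with the product of series, where no web is
  mentioned.\<close>

lemma bind_mat_ev:
  assumes s: "\<And>g a. list_all2 pw \<Gamma> g \<Longrightarrow> s (cp g) a = (if pw \<phi> a then ev (r a) g else 0)"
    and t: "\<And>g a. list_all2 pw \<Gamma> g \<Longrightarrow> pw \<phi> a \<Longrightarrow> t (cp (a # g)) b = ev m (a # g)"
    and r: "\<And>g a. list_all2 pw \<Gamma> g \<Longrightarrow> ev (r a) g \<noteq> 0 \<Longrightarrow> pw \<phi> a"
  shows "bind_mat (ctx_sem \<Gamma>) s t (cp g) b = ev (isum (\<lambda>a. r a * cur a m)) g"
  unfolding bind_mat_cp ev_simps ev_mult
proof (intro nn_integral_cong)
  fix a g1 g2
  show "(if padd g1 g2 g then s (cp g1) a * t (cp (a # g2)) b else 0) =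
      (if padd g1 g2 g then ev (r a) g1 * ev m (a # g2) else 0)"
    using list_all2_pw_padd[OF _ g, of g1 g2] s[of g1 a] t[of g2 a] r[of g1 a] by auto
qed

lemma app_mat_cp:
  "app_mat (ctx_sem \<Gamma>) s t (cp g) b = (\<Sum>\<^sup>+ a. pair_mat (ctx_sem \<Gamma>) s t (cp g) (PPair (PPair a b) a))"
proof -
  have "app_mat (ctx_sem \<Gamma>) s t (cp g) b = (\<Sum>\<^sup>+ x. \<Sum>\<^sup>+ a. pair_mat (ctx_sem \<Gamma>) s t (cp g) (PPair x a) *
      (if x = PPair a b then 1 else 0))"
    unfolding app_mat_def mcomp_def by (subst sum_PPair) (auto intro!: nn_integral_cong)
  also have "\<dots> = (\<Sum>\<^sup>+ a. \<Sum>\<^sup>+ x. if x = PPair a b then pair_mat (ctx_sem \<Gamma>) s t (cp g) (PPair x a) else 0)"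
    by (subst sum_swap) (intro nn_integral_cong, simp)
  finally show ?thesis by (simp only: csum_if_eq)
qed

end

text \<open>By \<open>stop_mat_prod\<close> promotion is a product of series over points. The coding
  \<open>cp\<close> carries sums of lists to sums of points, so this product has the same
  convolutions as the product over contexts.\<close>

lemma stop_mat_ev:
  assumes cl: "\<forall>\<phi>\<in>set \<Gamma>. pclosed \<phi>" and g: "list_all2 pw \<Gamma> g"
    and t: "\<And>g b. list_all2 pw \<Gamma> g \<Longrightarrow> t (cp g) b = ev (r b) g"
  shows "stop_mat (ctx_sem \<Gamma>) t (cp g) (PBag D) = ev (\<Prod>b\<in>#D. r b) g"
proof -
  have "cp g \<in> web (car (ctx_sem \<Gamma>))" using g web_ctx_sem[OF cl] by auto
  then have "stop_mat (ctx_sem \<Gamma>) t (cp g) (PBag D) = cf (\<Prod>b\<in>#D. Ser (\<lambda>x. t x b)) (cp g)"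
    by (rule stop_mat_prod[OF good_ctx_sem])
  also have "\<dots> = ev (\<Prod>b\<in>#D. r b) g"
    using g
  proof (induction D arbitrary: g)
    case empty
    then show ?case by (simp add: cf_1 ev_simps)
  next
    case (add b D)
    have "cf (\<Prod>b\<in>#add_mset b D. Ser (\<lambda>x. t x b)) (cp g) =
       (\<Sum>\<^sup>+ g1. \<Sum>\<^sup>+ g2. if padd g1 g2 g then t (cp g1) b * cf (\<Prod>b\<in>#D. Ser (\<lambda>x. t x b)) (cp g2) else 0)"
      by (simp add: cf_times csum_padd_cp cong: if_cong)
    also have "\<dots> = ev (\<Prod>b\<in>#add_mset b D. r b) g"
      unfolding image_mset_add_mset prod_mset.add_mset ev_mult
    proof (intro nn_integral_cong)
      fix g1 g2
      show "(if padd g1 g2 g then t (cp g1) b * cf (\<Prod>b\<in>#D. Ser (\<lambda>x. t x b)) (cp g2) else 0) =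
          (if padd g1 g2 g then ev (r b) g1 * ev (\<Prod>b\<in>#D. r b) g2 else 0)"
        using list_all2_pw_padd[OF _ add.prems, of g1 g2] t[of g1 b] add.IH[of g2] by auto
    qed
    finally show ?case .
  qed
  finally show ?thesis .
qed

section \<open>Fixpoints as suprema of increasing iterates\<close>

definition le_ser :: "'a ser \<Rightarrow> 'a ser \<Rightarrow> bool" where
  "le_ser r s \<longleftrightarrow> (\<forall>x. cf r x \<le> cf s x)"

lemma le_ser_refl [simp]: "le_ser r r"
  by (simp add: le_ser_def)

lemma le_ser_mult: "le_ser r r' \<Longrightarrow> le_ser s s' \<Longrightarrow> le_ser (r * s) (r' * s')"
  unfolding le_ser_def cf_times by (intro allI nn_integral_mono) (auto intro: mult_mono)

lemma le_ser_isum: "(\<And>i. le_ser (f i) (h i)) \<Longrightarrow> le_ser (isum f) (isum h)"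
  unfolding le_ser_def cf_isum by (intro allI nn_integral_mono) auto

lemma le_ser_prod: "(\<And>i. le_ser (f i) (h i)) \<Longrightarrow> le_ser (\<Prod>i\<in>#B. f i) (\<Prod>i\<in>#B. h i)"
  by (induction B) (auto intro: le_ser_mult)

lemma le_ser_fstep: "(\<And>b. le_ser (s b) (s' b)) \<Longrightarrow> le_ser (fstep m s b) (fstep m s' b)"
  unfolding fstep_def by (intro le_ser_mult le_ser_isum le_ser_prod le_ser_refl)

text \<open>Iterate n and the fixpoint share all coefficients below n, and the iterates increase; so
  summation over step counts commutes with the limit.\<close>

lemma ev_fixser: "ev (fixser (fstep m) b) g = (SUP j. ev ((fstep m ^^ j) (\<lambda>_. 0) b) g)"
proof (rule antisym)
  let ?F = "\<lambda>j. (fstep m ^^ j) (\<lambda>_. 0)"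
  have "ev (fixser (fstep m) b) g = (SUP n. \<Sum>k<n. cf (fixser (fstep m) b) (g, k))"
    by (simp add: ev_def nn_integral_count_space_nat suminf_eq_SUP)
  also have "\<dots> = (SUP n. \<Sum>k<n. cf (?F n b) (g, k))"
    using fixser_eqn[OF contractive_fstep, of _ m b] unfolding eqn_def by (intro SUP_cong sum.cong refl) simp
  also have "\<dots> \<le> (SUP n. ev (?F n b) g)"
  proof (rule SUP_mono')
    show "(\<Sum>k<n. cf (?F n b) (g, k)) \<le> ev (?F n b) g" for n
      by (simp add: ev_def nn_integral_count_space_nat sum_le_suminf)
  qed
  finally show "ev (fixser (fstep m) b) g \<le> (SUP n. ev (?F n b) g)" .
  have "le_ser (?F j b) (?F (Suc j) b)" for j b
    by (induction j arbitrary: b) (auto simp: le_ser_def[of 0] intro!: le_ser_fstep)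
  then have "cf (?F j b) x \<le> cf (?F (Suc j) b) x" for j x by (simp only: le_ser_def)
  then have mono: "i \<le> j \<Longrightarrow> cf (?F i b) x \<le> cf (?F j b) x" for i j x
    by (rule lift_Suc_mono_le)
  show "(SUP j. ev (?F j b) g) \<le> ev (fixser (fstep m) b) g"
  proof (rule SUP_least)
    fix j
    show "ev (?F j b) g \<le> ev (fixser (fstep m) b) g"
      unfolding ev_def
    proof (rule nn_integral_mono)
      fix k
      have "cf (?F j b) (g, k) \<le> cf (?F (max j (Suc k)) b) (g, k)" by (rule mono) simp
      also have "\<dots> = cf (fixser (fstep m) b) (g, k)"
        using fixser_eqn[OF contractive_fstep, of "max j (Suc k)" m b] unfolding eqn_def by simp
      finally show "cf (?F j b) (g, k) \<le> cf (fixser (fstep m) b) (g, k)" .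
    qed
  qed
qed

lemma ev_var: "ev (var_ser n b) g = (if \<exists>g1 g2. g = g1 @ b # g2 \<and> length g1 = n \<and> pemp g1 \<and> pemp g2 then 1 else 0)"
proof -
  have "ev (var_ser n b) g = (\<Sum>\<^sup>+ k :: nat. if k = 0 then if \<exists>g1 g2. g = g1 @ b # g2 \<and> length g1 = n \<and> pemp g1 \<and> pemp g2 then 1 else 0 else 0)"
    unfolding ev_def var_ser_def by (intro nn_integral_cong) simp
  then show ?thesis by (simp only: csum_if_eq)
qed

lemma ev_var_0: "ev (var_ser 0 b) (a # g) = (if a = b \<and> pemp g then 1 else 0)"
  by (auto simp: ev_var)

lemma ev_var_Suc: "ev (var_ser (Suc n) b) (a # g) = (if pemp a then ev (var_ser n b) g else 0)"
proof -
  have "(\<exists>g1 g2. a # g = g1 @ b # g2 \<and> length g1 = Suc n \<and> pemp g1 \<and> pemp g2) \<longleftrightarrow>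
      pemp a \<and> (\<exists>g1 g2. g = g1 @ b # g2 \<and> length g1 = n \<and> pemp g1 \<and> pemp g2)"
    (is "?L \<longleftrightarrow> ?R")
  proof
    assume ?R
    then obtain g1 g2 where "pemp a" "g = g1 @ b # g2" "length g1 = n" "pemp g1" "pemp g2" by blast
    then show ?L by (intro exI[of _ "a # g1"] exI[of _ g2]) auto
  next
    assume ?L
    then obtain g1 g2 where *: "a # g = g1 @ b # g2" "length g1 = Suc n" "pemp g1" "pemp g2" by blast
    then show ?R by (cases g1) auto
  qed
  then show ?thesis by (simp add: ev_var)
qed


text \<open>The second conjunct is used for \<open>Lam\<close>, where an argument point off its web
  becomes an entry off the web of the extended context.\<close>

definition interp :: "pty list \<Rightarrow> tm \<Rightarrow> mat \<Rightarrow> bool" where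
  "interp \<Gamma> M t \<longleftrightarrow> (\<forall>g b. list_all2 pw \<Gamma> g \<longrightarrow> t (cp g) b = ev (U M b) g) \<and>
     (\<forall>x b. x \<notin> web (car (ctx_sem \<Gamma>)) \<longrightarrow> t x b = 0)"

lemma interpD:
  "interp \<Gamma> M t \<Longrightarrow> list_all2 pw \<Gamma> g \<Longrightarrow> t (cp g) b = ev (U M b) g"
  "interp \<Gamma> M t \<Longrightarrow> x \<notin> web (car (ctx_sem \<Gamma>)) \<Longrightarrow> t x b = 0"
  by (auto simp: interp_def)

lemma mcomp_outside: "(\<And>b. t x b = 0) \<Longrightarrow> (s \<odot> t) x c = 0"
  by (simp add: mcomp_def)

section \<open>The interpretation, clause by clause\<close>

lemma interp_var:
  "\<forall>\<phi>\<in>set \<Gamma>. pclosed \<phi> \<Longrightarrow> n < length \<Gamma> \<Longrightarrow> interp \<Gamma> (Var n) (var_mat \<Gamma> n)"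
proof (induction \<Gamma> arbitrary: n)
  case (Cons \<phi> \<Gamma>)
  then have cl: "pclosed \<phi>" "\<forall>\<phi>\<in>set \<Gamma>. pclosed \<phi>" by auto
  note ws = web_psem[OF cl(1)] web_ctx_sem[OF cl(2)]
  have gd: "good (psem \<phi>)" "good (ctx_sem \<Gamma>)" by (rule good_psem good_ctx_sem)+
  show ?case
  proof (cases n)
    case 0
    show ?thesis unfolding interp_def
    proof (intro conjI allI impI)
      fix g b assume "list_all2 pw (\<phi> # \<Gamma>) g"
      then obtain a h where g: "g = a # h" "pw \<phi> a" "list_all2 pw \<Gamma> h" by (auto simp: list_all2_Cons1)
      then show "var_mat (\<phi> # \<Gamma>) n (cp g) b = ev (U (Var n) b) g"
        using str_ctx_sem[OF cl(2) g(3)] by (auto simp: 0 ev_var_0 proj_mat_def id_mat_def ws)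
    next
      fix x b assume "x \<notin> web (car (ctx_sem (\<phi> # \<Gamma>)))"
      then show "var_mat (\<phi> # \<Gamma>) n x b = 0"
        by (auto simp: 0 proj_mat_def id_mat_def good_str[OF gd(2)] split: pt.splits)
    qed
  next
    case (Suc k)
    then have IH: "interp \<Gamma> (Var k) (var_mat \<Gamma> k)" using Cons by auto
    have eq: "var_mat (\<phi> # \<Gamma>) n (PPair a x) b = str (psem \<phi>) a (PBag {#}) * var_mat \<Gamma> k x b" for a x b
    proof -
      have "var_mat (\<phi> # \<Gamma>) n (PPair a x) b =
          (\<Sum>\<^sup>+ z. str (psem \<phi>) a (PBag {#}) * id_mat (car (ctx_sem \<Gamma>)) x z * var_mat \<Gamma> k z b)"
        by (simp add: Suc mcomp_def proj_mat_def)
      also have "\<dots> = str (psem \<phi>) a (PBag {#}) * id_mat (car (ctx_sem \<Gamma>)) x x * var_mat \<Gamma> k x b"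
        by (rule sum_single) (auto simp: id_mat_def)
      also have "\<dots> = str (psem \<phi>) a (PBag {#}) * var_mat \<Gamma> k x b"
        using interpD(2)[OF IH, of x b] by (auto simp: id_mat_def)
      finally show ?thesis .
    qed
    show ?thesis unfolding interp_def
    proof (intro conjI allI impI)
      fix g b assume "list_all2 pw (\<phi> # \<Gamma>) g"
      then obtain a h where g: "g = a # h" "pw \<phi> a" "list_all2 pw \<Gamma> h" by (auto simp: list_all2_Cons1)
      then show "var_mat (\<phi> # \<Gamma>) n (cp g) b = ev (U (Var n) b) g"
        using interpD(1)[OF IH g(3), of b] by (simp only: g(1) cp_simps eq) (auto simp: Suc ev_var_Suc good_str[OF gd(1)] ws)
    next
      fix x b assume x: "x \<notin> web (car (ctx_sem (\<phi> # \<Gamma>)))"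
      show "var_mat (\<phi> # \<Gamma>) n x b = 0"
      proof (cases "\<exists>a y. x = PPair a y")
        case True
        then obtain a y where xe: "x = PPair a y" by blast
        then have "a \<notin> web (car (psem \<phi>)) \<or> y \<notin> web (car (ctx_sem \<Gamma>))" using x by auto
        then show ?thesis using interpD(2)[OF IH, of y b] by (auto simp only: xe eq) (auto simp: good_str[OF gd(1)])
      next
        case False
        then have "proj_mat Rgt (psem \<phi>) (ctx_sem \<Gamma>) x z = 0" for z by (auto simp: proj_mat_def split: pt.splits)
        then show ?thesis by (simp add: Suc mcomp_def)
      qed
    qed
  qed
qed simp

lemma interp_const:
  assumes "\<forall>\<phi>\<in>set \<Gamma>. pclosed \<phi>" "\<And>b g. ev (U M b) g = (if pemp g then v b else 0)"
  shows "interp \<Gamma> M (const_mat (ctx_sem \<Gamma>) v)"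
  unfolding interp_def const_mat_def
  using assms str_ctx_sem[OF assms(1)] str_outside[OF good_ctx_sem] by auto

lemma interp_case:
  assumes cl: "\<forall>\<phi>\<in>set \<Gamma>. pclosed \<phi>" "pclosed \<phi>" "pclosed \<psi>"
    and M: "\<Gamma> \<turnstile> M : Pos (Plus \<phi> \<psi>)" "interp \<Gamma> M s"
    and N: "interp (\<phi> # \<Gamma>) Nl t1" "interp (\<psi> # \<Gamma>) Nr t2"
  shows "interp \<Gamma> (Case M Nl Nr) (case_mat (ctx_sem \<Gamma>) (car (psem \<phi>)) (car (psem \<psi>)) s t1 t2)"
  unfolding interp_def
proof (intro conjI allI impI)
  fix g b assume g: "list_all2 pw \<Gamma> g"
  have rho: "(rho_mat (car (psem \<theta>)) i \<odot> s) (cp g) a = (if pw \<theta> a then ev (U M (PIn i a)) g else 0)"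
    if "list_all2 pw \<Gamma> g" "pclosed \<theta>" for \<theta> i a g
    unfolding mcomp_def
    by (subst sum_single[of "PIn i a"]) (use that M(2) in \<open>auto simp: rho_mat_def web_psem interpD(1)\<close>)
  have sup: "pw (sel i \<phi> \<psi>) a" if "list_all2 pw \<Gamma> g" "ev (U M (PIn i a)) g \<noteq> 0" for i a g
    using ev_support[OF M(1) that] by (auto simp: pw_simps)
  have "bind_mat (ctx_sem \<Gamma>) (rho_mat (car (psem \<phi>)) Lft \<odot> s) t1 (cp g) b =
      ev (isum (\<lambda>a. U M (PIn Lft a) * cur a (U Nl b))) g"
    by (rule bind_mat_ev[OF cl(1) g, of _ \<phi>])
       (use rho cl sup[where i = Lft] in \<open>auto simp del: cp_simps intro!: interpD(1)[OF N(1)]\<close>)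
  moreover have "bind_mat (ctx_sem \<Gamma>) (rho_mat (car (psem \<psi>)) Rgt \<odot> s) t2 (cp g) b =
      ev (isum (\<lambda>a. U M (PIn Rgt a) * cur a (U Nr b))) g"
    by (rule bind_mat_ev[OF cl(1) g, of _ \<psi>])
       (use rho cl sup[where i = Rgt] in \<open>auto simp del: cp_simps intro!: interpD(1)[OF N(2)]\<close>)
  ultimately show "case_mat (ctx_sem \<Gamma>) (car (psem \<phi>)) (car (psem \<psi>)) s t1 t2 (cp g) b = ev (U (Case M Nl Nr) b) g"
    by (simp add: case_mat_def isum_add ev_simps)
next
  fix x b assume "x \<notin> web (car (ctx_sem \<Gamma>))"
  then show "case_mat (ctx_sem \<Gamma>) (car (psem \<phi>)) (car (psem \<psi>)) s t1 t2 x b = 0"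
    by (simp add: case_mat_def bind_mat_outside[OF good_ctx_sem])
qed

text \<open>Both fixpoints are suprema of iterates, which are compared stage by stage; the ticks in
  \<open>fstep\<close> disappear under \<open>ev\<close>.\<close>

lemma interp_fix:
  assumes cl: "\<forall>\<phi>\<in>set \<Gamma>. pclosed \<phi>" "gclosed \<sigma>"
    and M: "Bang \<sigma> # \<Gamma> \<turnstile> M : \<sigma>" "interp (Bang \<sigma> # \<Gamma>) M t"
  shows "interp \<Gamma> (Fix \<sigma> M) (fix_mat (ctx_sem \<Gamma>) t)"
proof -
  let ?T = "\<lambda>j. ((\<lambda>s. bind_mat (ctx_sem \<Gamma>) (stop_mat (ctx_sem \<Gamma>) s) t) ^^ j) (\<lambda>_ _. 0)"
  let ?F = "\<lambda>j. (fstep (U M) ^^ j) (\<lambda>_. 0)"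
  have sup: "list_all2 pw \<Gamma> g \<Longrightarrow> ev (\<Prod>a\<in>#B. ?F j a) g \<noteq> 0 \<Longrightarrow> pw (Bang \<sigma>) (PBag B)" for g B j
    using nz_fstep_iter[of \<sigma> \<Gamma> "U M" j, OF U_support[OF M(1)]]
    by (auto simp: pw_simps dest!: ev_nz nz_prod)
  have it: "list_all2 pw \<Gamma> g \<Longrightarrow> ?T j (cp g) b = ev (?F j b) g" for j g b
  proof (induction j arbitrary: g b)
    case (Suc j)
    let ?r = "\<lambda>a. case a of PBag B \<Rightarrow> \<Prod>a\<in>#B. ?F j a | _ \<Rightarrow> 0"
    have stop: "stop_mat (ctx_sem \<Gamma>) (?T j) (cp h) a = ev (?r a) h" if "list_all2 pw \<Gamma> h" for h a
    proof (cases "\<exists>B. a = PBag B")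
      case True
      then obtain B where "a = PBag B" by blast
      then show ?thesis using stop_mat_ev[OF cl(1) that Suc.IH, where D = B] by simp
    next
      case False
      then show ?thesis by (auto simp: stop_mat_other ev_simps split: pt.splits)
    qed
    have supr: "pw (Bang \<sigma>) a" if "list_all2 pw \<Gamma> h" "ev (?r a) h \<noteq> 0" for h a
      using that sup by (cases a) (auto simp: ev_simps)
    have "?T (Suc j) (cp g) b = bind_mat (ctx_sem \<Gamma>) (stop_mat (ctx_sem \<Gamma>) (?T j)) t (cp g) b" by simp
    also have "\<dots> = ev (isum (\<lambda>a. ?r a * cur a (U M b))) g"
    proof (rule bind_mat_ev[OF cl(1) Suc.prems, of _ "Bang \<sigma>"])
      show "stop_mat (ctx_sem \<Gamma>) (?T j) (cp h) a = (if pw (Bang \<sigma>) a then ev (?r a) h else 0)"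
        if "list_all2 pw \<Gamma> h" for h a
        using stop[OF that, of a] supr[OF that, of a] by auto
      show "t (cp (a # h)) b = ev (U M b) (a # h)" if "list_all2 pw \<Gamma> h" "pw (Bang \<sigma>) a" for h a
        using that by (intro interpD(1)[OF M(2)]) simp
    qed (rule supr)
    also have "isum (\<lambda>a. ?r a * cur a (U M b)) = isum (\<lambda>B. ?r (PBag B) * cur (PBag B) (U M b))"
      by (rule isum_reindex) (auto simp: inj_def image_iff split: pt.splits)
    also have "ev \<dots> g = ev (?F (Suc j) b) g" by (simp add: fstep_def)
    finally show ?case .
  qed (simp add: ev_simps)
  have out: "x \<notin> web (car (ctx_sem \<Gamma>)) \<Longrightarrow> ?T j x b = 0" for j x b
    by (cases j) (auto simp: bind_mat_outside[OF good_ctx_sem])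
  show ?thesis unfolding interp_def fix_mat_def
    by (auto simp: it out ev_fixser)
qed

text \<open>The series of M involves no derivation, so this also shows that all typing derivations
  of a term in a given closed context yield the same matrix.\<close>

theorem denotes_interp:
  "\<Gamma> \<turnstile> M : \<sigma> \<leadsto> t \<Longrightarrow> \<forall>\<phi>\<in>set \<Gamma>. pclosed \<phi> \<Longrightarrow> interp \<Gamma> M t"
proof (induction rule: denotes.induct)
  case (d_var n \<Gamma>)
  then show ?case by (intro interp_var)
next
  case (d_unit \<Gamma>)
  then show ?case by (intro interp_const) (auto simp: ev_simps basis_def)
next
  case (d_coin p \<Gamma>)
  then show ?case by (intro interp_const) (auto simp: ev_simps)
next
  case (d_stop \<Gamma> M \<sigma> t)
  then have IH: "interp \<Gamma> M t" by simp
  show ?case unfolding interp_def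
  proof (intro conjI allI impI)
    fix g b assume g: "list_all2 pw \<Gamma> g"
    show "stop_mat (ctx_sem \<Gamma>) t (cp g) b = ev (U (Stop M) b) g"
    proof (cases "\<exists>B. b = PBag B")
      case True
      then show ?thesis using stop_mat_ev[OF d_stop.prems g interpD(1)[OF IH]] by auto
    next
      case False
      then show ?thesis by (auto simp: stop_mat_other ev_simps split: pt.splits)
    qed
  qed (rule stop_mat_outside[OF good_ctx_sem])
next
  case (d_pair \<Gamma> M \<phi> s N \<psi> t)
  then have IH: "interp \<Gamma> M s" "interp \<Gamma> N t" by auto
  show ?case unfolding interp_def
  proof (intro conjI allI impI)
    fix g b assume g: "list_all2 pw \<Gamma> g"
    show "pair_mat (ctx_sem \<Gamma>) s t (cp g) b = ev (U (MkPair M N) b) g"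
    proof (cases "\<exists>x y. b = PPair x y")
      case True
      then obtain x y where b: "b = PPair x y" by blast
      show ?thesis
        using list_all2_pw_padd[OF _ g] interpD(1)[OF IH(1)] interpD(1)[OF IH(2)]
        by (simp add: b pair_mat_cp[OF d_pair.prems g] ev_mult) (intro nn_integral_cong, auto)
    next
      case False
      then show ?thesis by (auto simp: pair_mat_other ev_simps split: pt.splits)
    qed
  qed (rule pair_mat_outside[OF good_ctx_sem])
next
  case (d_in \<Gamma> M i \<phi> \<psi> t)
  then have IH: "interp \<Gamma> M t" and ty: "\<Gamma> \<turnstile> M : Pos (sel i \<phi> \<psi>)" and cl: "pclosed (sel i \<phi> \<psi>)"
    by (auto simp: typing_iff_denotes, cases i, auto)
  show ?case unfolding interp_def
  proof (intro conjI allI impI)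
    fix g b assume g: "list_all2 pw \<Gamma> g"
    show "(in_mat (car (psem (sel i \<phi> \<psi>))) i \<odot> t) (cp g) b = ev (U (In i M) b) g"
    proof (cases "\<exists>a. b = PIn i a")
      case True
      then obtain a where b: "b = PIn i a" by blast
      have "(in_mat (car (psem (sel i \<phi> \<psi>))) i \<odot> t) (cp g) b = t (cp g) a * in_mat (car (psem (sel i \<phi> \<psi>))) i a b"
        unfolding mcomp_def by (rule sum_single) (auto simp: b in_mat_def)
      then show ?thesis
        using ev_support[OF ty g, of a] interpD(1)[OF IH g, of a]
        by (auto simp: b in_mat_def web_psem[OF cl] pw_simps)
    next
      case False
      then have "(in_mat (car (psem (sel i \<phi> \<psi>))) i \<odot> t) (cp g) b = 0"
        by (auto simp: mcomp_def in_mat_def intro!: csum_0I)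
      then show ?thesis using False by (auto simp: ev_simps split: pt.splits)
    qed
  qed (use interpD(2)[OF IH] in \<open>auto intro: mcomp_outside\<close>)
next
  case (d_lam \<phi> \<Gamma> M \<sigma> t)
  then have IH: "interp (\<phi> # \<Gamma>) M t" by auto
  have cl: "\<forall>\<theta>\<in>set (\<phi> # \<Gamma>). pclosed \<theta>" using d_lam by auto
  show ?case unfolding interp_def
  proof (intro conjI allI impI)
    fix g b assume g: "list_all2 pw \<Gamma> g"
    show "lam_mat t (cp g) b = ev (U (Lam \<phi> M) b) g"
    proof (cases "\<exists>x y. b = PPair x y")
      case True
      then obtain x y where b: "b = PPair x y" by blast
      have "\<not> pw \<phi> x \<Longrightarrow> cp (x # g) \<notin> web (car (ctx_sem (\<phi> # \<Gamma>)))"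
        unfolding web_ctx_sem[OF cl] by (auto simp del: cp_simps simp: list_all2_Cons1)
      then show ?thesis
        using interpD(1)[OF IH, of "x # g" y] interpD(2)[OF IH, of "cp (x # g)" y] g
        by (auto simp: b lam_mat_def ev_simps)
    next
      case False
      then show ?thesis by (auto simp: lam_mat_def ev_simps split: pt.splits)
    qed
  next
    fix x b assume "x \<notin> web (car (ctx_sem \<Gamma>))"
    then have "PPair a x \<notin> web (car (ctx_sem (\<phi> # \<Gamma>)))" for a by simp
    then show "lam_mat t x b = 0" using interpD(2)[OF IH] by (auto simp: lam_mat_def split: pt.splits)
  qed
next
  case (d_app \<Gamma> M \<phi> \<sigma> s N t)
  then have IH: "interp \<Gamma> M s" "interp \<Gamma> N t" by auto
  show ?case unfolding interp_def
  proof (intro conjI allI impI)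
    fix g b assume g: "list_all2 pw \<Gamma> g"
    have "pair_mat (ctx_sem \<Gamma>) s t (cp g) (PPair (PPair a b) a) = ev (U M (PPair a b) * U N a) g" for a
      unfolding pair_mat_cp[OF d_app.prems g] ev_mult
      using list_all2_pw_padd[OF _ g] interpD(1)[OF IH(1)] interpD(1)[OF IH(2)]
      by (intro nn_integral_cong) auto
    then show "app_mat (ctx_sem \<Gamma>) s t (cp g) b = ev (U (App M N) b) g"
      by (simp add: app_mat_cp[OF d_app.prems g] ev_simps)
  next
    fix x b assume "x \<notin> web (car (ctx_sem \<Gamma>))"
    then show "app_mat (ctx_sem \<Gamma>) s t x b = 0"
      by (simp add: app_mat_def mcomp_outside pair_mat_outside[OF good_ctx_sem])
  qed
next
  case (d_case \<Gamma> M \<phi> \<psi> s Nl \<sigma> t1 Nr t2)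
  then have ty: "\<Gamma> \<turnstile> M : Pos (Plus \<phi> \<psi>)" by (auto simp: typing_iff_denotes)
  then have "pclosed \<phi>" "pclosed \<psi>" using gclosed_typing[OF ty] d_case.prems by auto
  then show ?case using d_case ty by (intro interp_case) auto
next
  case (d_pr \<Gamma> M \<phi> \<psi> t i)
  then have IH: "interp \<Gamma> M t" and ty: "\<Gamma> \<turnstile> M : Pos (Tensor \<phi> \<psi>)" by (auto simp: typing_iff_denotes)
  then have cl: "pclosed \<phi>" "pclosed \<psi>" using gclosed_typing[OF ty] d_pr.prems by auto
  show ?case unfolding interp_def
  proof (intro conjI allI impI)
    fix g c assume g: "list_all2 pw \<Gamma> g"
    have sup: "ev (U M (PPair a b)) g \<noteq> 0 \<Longrightarrow> pw \<phi> a \<and> pw \<psi> b" for a b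
      using ev_support[OF ty g] by (auto simp: pw_simps)
    have "(proj_mat i (psem \<phi>) (psem \<psi>) \<odot> t) (cp g) c =
        (\<Sum>\<^sup>+ a. \<Sum>\<^sup>+ b. ev (U M (PPair a b)) g * proj_mat i (psem \<phi>) (psem \<psi>) (PPair a b) c)"
      unfolding mcomp_def
      by (subst sum_PPair) (auto simp: proj_mat_def interpD(1)[OF IH g] split: pt.splits)
    also have "\<dots> = (\<Sum>\<^sup>+ a. \<Sum>\<^sup>+ b. if sel i a b = c \<and> pemp (sel i b a) then ev (U M (PPair a b)) g else 0)"
    proof (intro nn_integral_cong)
      fix a b
      show "ev (U M (PPair a b)) g * proj_mat i (psem \<phi>) (psem \<psi>) (PPair a b) c =
         (if sel i a b = c \<and> pemp (sel i b a) then ev (U M (PPair a b)) g else 0)"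
        using sup[of a b]
        by (cases i) (auto simp: proj_mat_def id_mat_def good_str[OF good_psem] web_psem cl)
    qed
    also have "\<dots> = (\<Sum>\<^sup>+ a. if pemp a then ev (U M (sel i (PPair c a) (PPair a c))) g else 0)"
    proof (cases i)
      case Lft
      have "(\<Sum>\<^sup>+ a. \<Sum>\<^sup>+ b. if a = c \<and> pemp b then ev (U M (PPair a b)) g else 0) =
        (\<Sum>\<^sup>+ a. if a = c then \<Sum>\<^sup>+ b. if pemp b then ev (U M (PPair a b)) g else 0 else 0)"
        by (intro nn_integral_cong) simp
      then show ?thesis by (simp add: Lft csum_if_eq cong: if_cong)
    next
      case Rgt
      have "(\<Sum>\<^sup>+ a. \<Sum>\<^sup>+ b. if b = c \<and> pemp a then ev (U M (PPair a b)) g else 0) =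
        (\<Sum>\<^sup>+ a. \<Sum>\<^sup>+ b. if b = c then if pemp a then ev (U M (PPair a b)) g else 0 else 0)"
        by (intro nn_integral_cong) simp
      then show ?thesis by (simp only: Rgt csum_if_eq sel.simps)
    qed
    also have "\<dots> = ev (U (Pr i M) c) g" by (simp add: ev_simps ev_if)
    finally show "(proj_mat i (psem \<phi>) (psem \<psi>) \<odot> t) (cp g) c = ev (U (Pr i M) c) g" .
  qed (use interpD(2)[OF IH] in \<open>auto intro: mcomp_outside\<close>)
next
  case (d_go \<Gamma> M \<sigma> t)
  then have IH: "interp \<Gamma> M t" and ty: "\<Gamma> \<turnstile> M : Pos (Bang \<sigma>)" by (auto simp: typing_iff_denotes)
  then have cl: "gclosed \<sigma>" using gclosed_typing[OF ty] d_go.prems by auto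
  show ?case unfolding interp_def
  proof (intro conjI allI impI)
    fix g b assume g: "list_all2 pw \<Gamma> g"
    have "(der_mat (gsem \<sigma>) \<odot> t) (cp g) b = t (cp g) (PBag {#b#}) * der_mat (gsem \<sigma>) (PBag {#b#}) b"
      unfolding mcomp_def by (rule sum_single) (auto simp: der_mat_def)
    then show "(der_mat (gsem \<sigma>) \<odot> t) (cp g) b = ev (U (Go M) b) g"
      using ev_support[OF ty g, of "PBag {#b#}"] interpD(1)[OF IH g, of "PBag {#b#}"]
      by (auto simp: der_mat_def web_gsem[OF cl] pw_simps)
  qed (use interpD(2)[OF IH] in \<open>auto intro: mcomp_outside\<close>)
next
  case (d_fix \<sigma> \<Gamma> M t)
  then have "Bang \<sigma> # \<Gamma> \<turnstile> M : \<sigma>" by (auto simp: typing_iff_denotes)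
  then show ?case using d_fix by (intro interp_fix) auto
qed (auto simp: interp_def)

corollary closed_denotes_ev:
  assumes "closed_denotes M \<sigma> u"
  shows "u b = ev (U M b) []"
proof -
  obtain t where t: "[] \<turnstile> M : \<sigma> \<leadsto> t" "u = t \<bullet>\<^sub>v basis PStar" using assms by (auto simp: closed_denotes_def)
  have "u b = t PStar b * basis PStar PStar"
    unfolding t(2) mapp_def by (rule sum_single) (simp add: basis_def)
  also have "\<dots> = ev (U M b) []"
    using interpD(1)[OF denotes_interp[OF t(1)], of "[]" b] by (simp add: basis_def)
  finally show ?thesis .
qed

section \<open>Power series in the coin parameters\<close>

lemma csum_upper: "f i \<le> csum f"
proof -
  have "(\<Sum>\<^sup>+ x. if x = i then f x else 0) \<le> csum f" by (rule nn_integral_mono) simp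
  then show ?thesis by (simp only: csum_if_eq)
qed

text \<open>Compare both series at a small rational x. The common terms below k cancel, and the
  terms of d beyond k are at most x^(k+1) times the total D. Dividing by x^k leaves the error x * D,
  which is arbitrarily small.\<close>

lemma power_series_coeff_le:
  fixes c d :: "nat \<Rightarrow> ennreal"
  assumes eq: "\<And>x :: rat. 0 \<le> x \<Longrightarrow> x \<le> 1 \<Longrightarrow>
      (\<Sum>\<^sup>+ k. c k * ennreal (real_of_rat x) ^ k) = (\<Sum>\<^sup>+ k. d k * ennreal (real_of_rat x) ^ k)"
    and fin: "csum d < \<infinity>" and low: "\<And>j. j < k \<Longrightarrow> c j = d j"
  shows "c k \<le> d k"
proof (rule ennreal_le_epsilon)
  fix e :: real assume "0 < e"
  have fin_d: "d j < \<infinity>" for j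
    using fin csum_upper[of d j] by (simp add: le_less_trans)
  obtain D where D: "csum d = ennreal D" "0 \<le> D" using fin by (cases "csum d") auto
  \<comment> \<open>Chosen so that x = 1 / (n + 1) satisfies x * D \<le> e.\<close>
  obtain n :: nat where n: "D / e < real n" using reals_Archimedean2 by blast
  define x :: rat where "x = 1 / of_nat (Suc n)"
  define X where "X = ennreal (real_of_rat x)"
  have rx: "real_of_rat x = 1 / real (Suc n)" by (simp add: x_def of_rat_divide del: of_nat_Suc)
  have x: "0 < x" "x \<le> 1" by (simp_all add: x_def)
  have X: "0 < X" "X < \<infinity>" "X \<le> 1" using x by (auto simp: X_def rx ennreal_le_1)
  define P where "P = (\<Sum>j<k. c j * X ^ j)"
  have P': "P = (\<Sum>j<k. d j * X ^ j)" using low by (simp add: P_def)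
  \<comment> \<open>Finiteness of the common part permits its cancellation in
    \<open>ennreal\<close>.\<close>
  have P: "P < \<infinity>"
    unfolding P' using fin_d X(2) by (auto intro!: ennreal_mult_less_top[THEN iffD2] simp: power_less_top_ennreal)
  have "P + c k * X ^ k = (\<Sum>j\<le>k. c j * X ^ j)" by (simp add: P_def lessThan_Suc_atMost[symmetric])
  also have "\<dots> \<le> (\<Sum>\<^sup>+ j. c j * X ^ j)"
    unfolding nn_integral_count_space_nat by (rule sum_le_suminf) auto
  also have "\<dots> = (\<Sum>\<^sup>+ j. d j * X ^ j)" using eq[of x] x by (simp add: X_def)
  also have "\<dots> \<le> (\<Sum>\<^sup>+ j. (if j \<le> k then d j * X ^ j else 0) + X ^ Suc k * d j)"
  proof (rule nn_integral_mono)
    fix j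
    show "d j * X ^ j \<le> (if j \<le> k then d j * X ^ j else 0) + X ^ Suc k * d j"
    proof (cases "j \<le> k")
      case False
      then have "X ^ j \<le> X ^ Suc k" using X(3) by (intro power_decreasing) auto
      then show ?thesis using False mult_right_mono[of "X ^ j" "X ^ Suc k" "d j"] by (simp add: mult_ac)
    qed simp
  qed
  also have "\<dots> = (\<Sum>\<^sup>+ j. if j \<le> k then d j * X ^ j else 0) + X ^ Suc k * csum d"
    by (simp add: nn_integral_add nn_integral_cmult del: power_Suc)
  also have "(\<Sum>\<^sup>+ j. if j \<le> k then d j * X ^ j else 0) = (\<Sum>j\<le>k. d j * X ^ j)"
    by (subst nn_integral_count_space'[of "{..k}"]) auto
  also have "\<dots> = P + d k * X ^ k" by (simp add: P' lessThan_Suc_atMost[symmetric])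
  finally have "P + c k * X ^ k \<le> P + (d k * X ^ k + X ^ Suc k * csum d)" by (simp add: add.assoc)
  then have "c k * X ^ k \<le> d k * X ^ k + X ^ Suc k * csum d"
    using P by (auto simp: ennreal_add_left_cancel_le)
  also have "\<dots> = (d k + X * csum d) * X ^ k" by (simp add: algebra_simps)
  finally have "c k * X ^ k \<le> (d k + X * csum d) * X ^ k" .
  then have "c k \<le> d k + X * csum d"
    using X power_less_top_ennreal[of X k] by (subst (asm) ennreal_mult_le_mult_iff[of "X ^ k", unfolded mult.commute[of "X ^ k"]])
      (auto simp: power_less_top_ennreal less_top[symmetric])
  also have "X * csum d \<le> ennreal e"
  proof -
    have "D \<le> e * real (Suc n)" using n \<open>0 < e\<close> by (simp add: field_simps)
    then have "real_of_rat x * D \<le> e" by (simp add: rx field_simps)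
    then show ?thesis unfolding D X_def
      by (subst ennreal_mult[symmetric]) (use x D in \<open>auto intro: ennreal_leI\<close>)
  qed
  finally show "c k \<le> d k + ennreal e" by simp
qed

lemma power_series_unique:
  fixes c d :: "nat \<Rightarrow> ennreal"
  assumes eq: "\<And>x :: rat. 0 \<le> x \<Longrightarrow> x \<le> 1 \<Longrightarrow>
      (\<Sum>\<^sup>+ k. c k * ennreal (real_of_rat x) ^ k) = (\<Sum>\<^sup>+ k. d k * ennreal (real_of_rat x) ^ k)"
    and fin: "csum c < \<infinity>"
  shows "c k = d k"
proof (induction k rule: less_induct)
  case (less k)
  \<comment> \<open>The values at x = 1 are the sums of the coefficients, so finiteness passes from
    c to d and the comparison works in both directions.\<close>
  have "csum d < \<infinity>" using fin eq[of 1] by simp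
  then show ?case
    using power_series_coeff_le[of c d k] power_series_coeff_le[of d c k] eq fin less by (intro antisym) auto
qed

section \<open>Series in several coin parameters\<close>

type_synonym pser = "nat multiset ser"

definition evq :: "(nat \<Rightarrow> ennreal) \<Rightarrow> pser \<Rightarrow> ennreal" where
  "evq q c = (\<Sum>\<^sup>+ m. cf c m * mpow q m)"

lemma mpow_add: "mpow q (m + m') = mpow q m * mpow q m'"
  by (simp add: mpow_mset)

lemma evq_simps:
  "evq q 0 = 0" "evq q (c + d) = evq q c + evq q d" "evq q (isum f) = (\<Sum>\<^sup>+ i. evq q (f i))"
  "evq q (scal x c) = x * evq q c" "evq q 1 = 1"
proof -
  show "evq q (isum f) = (\<Sum>\<^sup>+ i. evq q (f i))"
    unfolding evq_def cf_isum by (subst sum_swap) (simp add: nn_integral_multc)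
  show "evq q 1 = 1"
    unfolding evq_def by (subst sum_single[of "{#}"]) (auto simp: cf_1 pemp_multiset_def mpow_mset)
qed (simp_all add: evq_def nn_integral_add nn_integral_cmult distrib_right mult.assoc)

lemma evq_mult: "evq q (c * d) = evq q c * evq q d"
proof -
  have "evq q (c * d) = (\<Sum>\<^sup>+ m. \<Sum>\<^sup>+ x. \<Sum>\<^sup>+ y. if m = x + y then (cf c x * mpow q x) * (cf d y * mpow q y) else 0)"
    unfolding evq_def cf_times padd_multiset_def nn_integral_multc[OF borel_measurable_count_space, symmetric]
    by (intro nn_integral_cong) (auto simp: mpow_add mult_ac)
  also have "\<dots> = (\<Sum>\<^sup>+ x. \<Sum>\<^sup>+ y. \<Sum>\<^sup>+ m. if m = x + y then (cf c x * mpow q x) * (cf d y * mpow q y) else 0)"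
    by (subst sum_swap, rule nn_integral_cong, rule sum_swap)
  also have "\<dots> = evq q c * evq q d"
    by (simp only: csum_if_eq) (simp add: evq_def nn_integral_cmult nn_integral_multc)
  finally show ?thesis .
qed

lemma evq_prod: "evq q (\<Prod>i\<in>#B. f i) = (\<Prod>i\<in>#B. evq q (f i))"
  by (induction B) (auto simp: evq_simps evq_mult)

definition pvar :: "nat \<Rightarrow> pser" where
  "pvar v = Ser (\<lambda>m. if m = {#v#} then 1 else 0)"

lemma evq_pvar: "evq q (pvar v) = q v"
  unfolding evq_def by (subst sum_single[of "{#v#}"]) (auto simp: pvar_def mpow_mset)

definition over :: "nat set \<Rightarrow> pser \<Rightarrow> bool" where
  "over V c \<longleftrightarrow> (\<forall>m. cf c m \<noteq> 0 \<longrightarrow> set_mset m \<subseteq> V)"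

lemma over_simps:
  "over V 0" "over V 1" "over V c \<Longrightarrow> over V d \<Longrightarrow> over V (c + d)" "over V c \<Longrightarrow> over V (scal x c)"
  "v \<in> V \<Longrightarrow> over V (pvar v)"
  by (auto simp: over_def cf_1 pemp_multiset_def pvar_def add_eq_0_iff_both_eq_0 split: if_splits)

lemma over_isum: "(\<And>i. over V (f i)) \<Longrightarrow> over V (isum f)"
  unfolding over_def cf_isum csum_neq_0_iff by blast

lemma over_mult: "over V c \<Longrightarrow> over V d \<Longrightarrow> over V (c * d)"
  unfolding over_def cf_times csum_neq_0_iff padd_multiset_def by (fastforce split: if_splits)

lemma over_prod: "(\<And>i. over V (f i)) \<Longrightarrow> over V (\<Prod>i\<in>#B. f i)"
  by (induction B) (auto intro: over_mult over_simps)

lemma over_mono: "over V c \<Longrightarrow> V \<subseteq> W \<Longrightarrow> over W c"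
  by (auto simp: over_def)

text \<open>A monomial over two disjoint sets of variables decomposes in only one way into a
  monomial over each of them, so the convolution has a single term.\<close>

lemma cf_mult_disjoint:
  assumes "over V c" "over W d" "V \<inter> W = {}" "set_mset m \<subseteq> V" "set_mset m' \<subseteq> W"
  shows "cf (c * d) (m + m') = cf c m * cf d m'"
proof -
  have "x = m \<and> y = m'" if "m + m' = x + y" "cf c x * cf d y \<noteq> 0" for x y
  proof -
    have V: "set_mset x \<subseteq> V" "set_mset y \<subseteq> W" using that(2) assms(1,2) by (auto simp: over_def)
    have *: "filter_mset (\<lambda>v. v \<in> V) z = z" if "set_mset z \<subseteq> V" for z
      using that by (auto simp: filter_mset_eq_conv)
    have **: "filter_mset (\<lambda>v. v \<in> V) z = {#}" if "set_mset z \<subseteq> W" for z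
    proof -
      have "filter_mset (\<lambda>v. v \<in> V) z = filter_mset (\<lambda>_. False) z"
        using that assms(3) by (intro filter_mset_cong) auto
      then show ?thesis by simp
    qed
    have "filter_mset (\<lambda>v. v \<in> V) (m + m') = filter_mset (\<lambda>v. v \<in> V) (x + y)" using that(1) by simp
    then have "m = x" using V assms(4,5) by (simp add: * **)
    then show ?thesis using that(1) by simp
  qed
  then have "cf (c * d) (m + m') = (\<Sum>\<^sup>+ x. \<Sum>\<^sup>+ y. if x = m then if y = m' then cf c x * cf d y else 0 else 0)"
    unfolding cf_times padd_multiset_def by (intro nn_integral_cong) force
  then show ?thesis by (simp only: csum_if csum_if_eq)
qed

definition valid :: "(nat \<Rightarrow> rat) \<Rightarrow> bool" where
  "valid q \<longleftrightarrow> (\<forall>v. 0 \<le> q v \<and> q v \<le> 1)"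

definition qv :: "(nat \<Rightarrow> rat) \<Rightarrow> nat \<Rightarrow> ennreal" where
  "qv q v = ennreal (real_of_rat (q v))"

lemma qv_le_1: "valid q \<Longrightarrow> qv q v \<le> 1"
  by (auto simp: valid_def qv_def ennreal_le_1)

text \<open>The coefficient of the k-th power of v, as a series in the remaining variables.\<close>

definition pcoeff :: "nat \<Rightarrow> nat \<Rightarrow> pser \<Rightarrow> pser" where
  "pcoeff v k c = Ser (\<lambda>m. if v \<in># m then 0 else cf c (replicate_mset k v + m))"

lemma evq_pcoeff: "evq q c = (\<Sum>\<^sup>+ k. evq q (pcoeff v k c) * q v ^ k)"
proof -
  have "evq q c = (\<Sum>\<^sup>+ m. \<Sum>\<^sup>+ k. if k = count m v then cf c m * mpow q m else 0)"
    unfolding evq_def by (simp only: csum_if_eq)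
  also have "\<dots> = (\<Sum>\<^sup>+ k. \<Sum>\<^sup>+ m. if k = count m v then cf c m * mpow q m else 0)"
    by (rule sum_swap)
  also have "\<dots> = (\<Sum>\<^sup>+ k. evq q (pcoeff v k c) * q v ^ k)"
  proof (rule nn_integral_cong)
    fix k
    let ?p = "\<lambda>m. replicate_mset k v + m"
    have "(\<Sum>\<^sup>+ m. if k = count m v then cf c m * mpow q m else 0) =
        (\<Sum>\<^sup>+ m. if k = count (?p m) v then cf c (?p m) * mpow q (?p m) else 0)"
    proof (rule sum_reindex)
      fix m assume "m \<notin> range ?p"
      moreover have "m = ?p (m - replicate_mset k v)" if "k = count m v"
        using that by (auto simp: count_le_replicate_mset_subset_eq[symmetric])
      ultimately show "(if k = count m v then cf c m * mpow q m else 0) = 0" by (metis rangeI)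
    qed (auto simp: inj_def)
    also have "\<dots> = (\<Sum>\<^sup>+ m. cf (pcoeff v k c) m * mpow q m * q v ^ k)"
    proof (rule nn_integral_cong)
      fix m
      have "mpow q (replicate_mset k v) = q v ^ k" by (simp add: mpow_mset)
      moreover have "k = count (?p m) v \<longleftrightarrow> v \<notin># m" by (simp add: not_in_iff)
      ultimately show "(if k = count (?p m) v then cf c (?p m) * mpow q (?p m) else 0) =
          cf (pcoeff v k c) m * mpow q m * q v ^ k"
        by (simp add: pcoeff_def mpow_add mult_ac)
    qed
    also have "\<dots> = evq q (pcoeff v k c) * q v ^ k" by (simp add: evq_def nn_integral_multc)
    finally show "(\<Sum>\<^sup>+ m. if k = count m v then cf c m * mpow q m else 0) = evq q (pcoeff v k c) * q v ^ k" .
  qed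
  finally show ?thesis .
qed

lemma pcoeff_inject: "(\<And>k. pcoeff v k c = pcoeff v k d) \<Longrightarrow> c = d"
proof (rule ser_eqI)
  fix m assume *: "\<And>k. pcoeff v k c = pcoeff v k d"
  let ?k = "count m v"
  have m: "m = replicate_mset ?k v + filter_mset (\<lambda>w. w \<noteq> v) m"
    by (rule multiset_eqI) auto
  have "cf (pcoeff v ?k c) (filter_mset (\<lambda>w. w \<noteq> v) m) = cf (pcoeff v ?k d) (filter_mset (\<lambda>w. w \<noteq> v) m)"
    using * by simp
  then show "cf c m = cf d m" by (subst m, subst (2) m) (simp add: pcoeff_def)
qed

lemma evq_cong_over: "over V c \<Longrightarrow> (\<And>v. v \<in> V \<Longrightarrow> q v = q' v) \<Longrightarrow> evq q c = evq q' c"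
  unfolding evq_def
proof (rule nn_integral_cong)
  fix m assume "over V c" "\<And>v. v \<in> V \<Longrightarrow> q v = q' v"
  then have "q x = q' x" if "cf c m \<noteq> 0" "x \<in># m" for x using that by (auto simp: over_def)
  then have "cf c m \<noteq> 0 \<Longrightarrow> mpow q m = mpow q' m" by (simp add: mpow_def)
  then show "cf c m * mpow q m = cf c m * mpow q' m" by (cases "cf c m = 0") auto
qed

lemma over_pcoeff: "over (insert v V) c \<Longrightarrow> over V (pcoeff v k c)"
  unfolding over_def
proof (intro allI impI)
  fix m assume "\<forall>m. cf c m \<noteq> 0 \<longrightarrow> set_mset m \<subseteq> insert v V" "cf (pcoeff v k c) m \<noteq> 0"
  then have "v \<notin># m" "set_mset (replicate_mset k v + m) \<subseteq> insert v V"
    by (auto simp: pcoeff_def split: if_splits simp del: set_mset_union)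
  then show "set_mset m \<subseteq> V" by auto
qed

text \<open>One variable at a time. With the other parameters fixed, both sides are power series in
  v, so their coefficients have equal values; these coefficients are series in fewer variables, to
  which the induction hypothesis applies. The value with all parameters 1 dominates the sums
  involved.\<close>

lemma pser_unique:
  assumes "finite V" "over V c" "over V d" "\<And>q. valid q \<Longrightarrow> evq (qv q) c = evq (qv q) d" "evq (\<lambda>_. 1) c < \<infinity>"
  shows "c = d"
  using assms
proof (induction V arbitrary: c d rule: finite_induct)
  case empty
  have e: "evq q c = cf c {#}" if "over {} c" for c q
  proof -
    have "evq q c = cf c {#} * mpow q {#}"
      unfolding evq_def by (rule sum_single) (use that in \<open>auto simp: over_def\<close>)
    then show ?thesis by (simp add: mpow_mset)
  qed
  have "valid (\<lambda>_. 0)" by (simp add: valid_def)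
  then have "cf c {#} = cf d {#}" using empty(3)[of "\<lambda>_. 0"] e empty(1,2) by metis
  moreover have "cf c m = 0" "cf d m = 0" if "m \<noteq> {#}" for m
    using empty(1,2) that by (auto simp: over_def)
  ultimately show ?case by (intro ser_eqI) metis
next
  case (insert v V)
  show ?case
  proof (rule pcoeff_inject[of v])
    fix k
    have ov: "over V (pcoeff v k c)" "over V (pcoeff v k d)" for k
      using insert.prems(1,2) over_pcoeff by blast+
    show "pcoeff v k c = pcoeff v k d"
    proof (rule insert.IH[OF ov])
      fix q assume q: "valid q"
      have upd: "evq (qv (q(v := x))) (pcoeff v j e) = evq (qv q) (pcoeff v j e)" if "over V (pcoeff v j e)" for x j e
        by (rule evq_cong_over[OF that]) (use insert.hyps in \<open>auto simp: qv_def\<close>)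
      have ser: "evq (qv (q(v := x))) e = (\<Sum>\<^sup>+ k. evq (qv q) (pcoeff v k e) * ennreal (real_of_rat x) ^ k)"
        if "\<And>k. over V (pcoeff v k e)" for x e
        by (subst evq_pcoeff[of _ e v]) (simp add: upd that qv_def[of _ v])
      show "evq (qv q) (pcoeff v k c) = evq (qv q) (pcoeff v k d)"
      proof (rule power_series_unique)
        fix x :: rat assume x: "0 \<le> x" "x \<le> 1"
        then have "valid (q(v := x))" using q by (auto simp: valid_def)
        then have "evq (qv (q(v := x))) c = evq (qv (q(v := x))) d" by (rule insert.prems(3))
        then show "(\<Sum>\<^sup>+ k. evq (qv q) (pcoeff v k c) * ennreal (real_of_rat x) ^ k) =
            (\<Sum>\<^sup>+ k. evq (qv q) (pcoeff v k d) * ennreal (real_of_rat x) ^ k)"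
          by (simp only: ser[OF ov(1)] ser[OF ov(2)])
      next
        have "(\<Sum>\<^sup>+ k. evq (qv q) (pcoeff v k c)) = evq (qv (q(v := 1))) c"
          using ser[of c 1, OF ov(1)] by simp
        also have "\<dots> \<le> evq (\<lambda>_. 1) c"
          unfolding evq_def using q
          by (intro nn_integral_mono mult_left_mono mpow_mono qv_le_1) (auto simp: valid_def)
        finally show "(\<Sum>\<^sup>+ k. evq (qv q) (pcoeff v k c)) < \<infinity>" using insert.prems(4) by simp
      qed
    next
      have "evq (\<lambda>_. 1) (pcoeff v k c) \<le> (\<Sum>\<^sup>+ k. evq (\<lambda>_. 1) (pcoeff v k c))"
        by (rule csum_upper)
      also have "\<dots> = evq (\<lambda>_. 1) c" using evq_pcoeff[of "\<lambda>_. 1" c v] by simp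
      finally show "evq (\<lambda>_. 1) (pcoeff v k c) < \<infinity>" using insert.prems(4) by simp
    qed
  qed
qed

section \<open>Definability\<close>

text \<open>The family \<open>G\<close>, a power series in the parameters \<open>n, \<dots>, n' - 1\<close>, has a monomial whose
  coefficient vanishes at all points but \<open>a\<close>.\<close>

definition isol :: "nat \<Rightarrow> nat \<Rightarrow> ((nat \<Rightarrow> rat) \<Rightarrow> 'x \<Rightarrow> ennreal) \<Rightarrow> 'x \<Rightarrow> bool" where
  "isol n n' G a \<longleftrightarrow> (\<exists>C m \<kappa>. (\<forall>q x. valid q \<longrightarrow> G q x = evq (qv q) (C x)) \<and> (\<forall>x. over {n..<n'} (C x)) \<and>
     set_mset m \<subseteq> {n..<n'} \<and> 0 < \<kappa> \<and> \<kappa> < \<infinity> \<and> (\<forall>x. cf (C x) m = (if x = a then \<kappa> else 0)))"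

lemma isolI:
  assumes "\<And>q x. valid q \<Longrightarrow> G q x = evq (qv q) (C x)" "\<And>x. over {n..<n'} (C x)"
    "set_mset m \<subseteq> {n..<n'}" "0 < \<kappa>" "\<kappa> < \<infinity>" "\<And>x. cf (C x) m = (if x = a then \<kappa> else 0)"
  shows "isol n n' G a"
  unfolding isol_def using assms by blast

lemma isolE:
  assumes "isol n n' G a"
  obtains C m \<kappa> where "\<And>q x. valid q \<Longrightarrow> G q x = evq (qv q) (C x)" "\<And>x. over {n..<n'} (C x)"
    "set_mset m \<subseteq> {n..<n'}" "0 < \<kappa>" "\<kappa> < \<infinity>" "\<And>x. cf (C x) m = (if x = a then \<kappa> else 0)"
  using assms unfolding isol_def by blast

lemma isol_cong: "isol n n' G a \<Longrightarrow> (\<And>q x. valid q \<Longrightarrow> H q x = G q x) \<Longrightarrow> isol n n' H a"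
  unfolding isol_def by metis

lemma isol_const: "isol n n (\<lambda>q x. if x = a then 1 else 0) a"
  by (rule isolI[where C = "\<lambda>x. if x = a then 1 else 0" and m = "{#}" and \<kappa> = 1])
     (auto simp: evq_simps over_simps cf_1 pemp_multiset_def)

text \<open>The two families use disjoint intervals of parameters, so the coefficient at the
  combined monomial is the product of their coefficients.\<close>

lemma isol_times:
  assumes "isol n n1 G a" "isol n1 n2 H b" "n \<le> n1" "n1 \<le> n2"
  shows "isol n n2 (\<lambda>q (x, y). G q x * H q y) (a, b)"
proof -
  obtain C m \<kappa> where C: "\<And>q x. valid q \<Longrightarrow> G q x = evq (qv q) (C x)" "\<And>x. over {n..<n1} (C x)"
    "set_mset m \<subseteq> {n..<n1}" "0 < \<kappa>" "\<kappa> < \<infinity>" "\<And>x. cf (C x) m = (if x = a then \<kappa> else 0)"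
    using isolE[OF assms(1)] by blast
  obtain D m' \<kappa>' where D: "\<And>q x. valid q \<Longrightarrow> H q x = evq (qv q) (D x)" "\<And>x. over {n1..<n2} (D x)"
    "set_mset m' \<subseteq> {n1..<n2}" "0 < \<kappa>'" "\<kappa>' < \<infinity>" "\<And>x. cf (D x) m' = (if x = b then \<kappa>' else 0)"
    using isolE[OF assms(2)] by blast
  have sub: "{n..<n1} \<subseteq> {n..<n2}" "{n1..<n2} \<subseteq> {n..<n2}" using assms by auto
  show ?thesis
  proof (rule isolI[where C = "\<lambda>(x, y). C x * D y" and m = "m + m'" and \<kappa> = "\<kappa> * \<kappa>'"])
    show "(case x of (x, y) \<Rightarrow> G q x * H q y) = evq (qv q) (case x of (x, y) \<Rightarrow> C x * D y)" if "valid q" for q x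
      using that C D by (auto simp: evq_mult split: prod.split)
    show "over {n..<n2} (case x of (x, y) \<Rightarrow> C x * D y)" for x
      using over_mono[OF C(2) sub(1)] over_mono[OF D(2) sub(2)] by (auto intro: over_mult split: prod.split)
    show "cf (case x of (x, y) \<Rightarrow> C x * D y) (m + m') = (if x = (a, b) then \<kappa> * \<kappa>' else 0)" for x
      using cf_mult_disjoint[OF C(2) D(2) _ C(3) D(3)] C(6) D(6) by (auto split: prod.split)
    show "0 < \<kappa> * \<kappa>'" "\<kappa> * \<kappa>' < \<infinity>"
      using C(4,5) D(4,5) by (auto simp: ennreal_zero_less_mult_iff ennreal_mult_less_top)
  qed (use C(3) D(3) sub in auto)
qed

text \<open>At the isolating monomial only the summand x = a survives, so the image of a is isolated
  even where f identifies points.\<close>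

lemma isol_push:
  assumes "isol n n' G a"
  shows "isol n n' (\<lambda>q z. \<Sum>\<^sup>+ x. if z = f x then G q x else 0) (f a)"
proof -
  obtain C m \<kappa> where C: "\<And>q x. valid q \<Longrightarrow> G q x = evq (qv q) (C x)" "\<And>x. over {n..<n'} (C x)"
    "set_mset m \<subseteq> {n..<n'}" "0 < \<kappa>" "\<kappa> < \<infinity>" "\<And>x. cf (C x) m = (if x = a then \<kappa> else 0)"
    using isolE[OF assms(1)] by blast
  show ?thesis
  proof (rule isolI[where C = "\<lambda>z. isum (\<lambda>x. if z = f x then C x else 0)" and m = m and \<kappa> = \<kappa>])
    show "(\<Sum>\<^sup>+ x. if z = f x then G q x else 0) = evq (qv q) (isum (\<lambda>x. if z = f x then C x else 0))" if "valid q" for q z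
      using C(1)[OF that] by (auto simp: evq_simps intro!: nn_integral_cong)
    show "over {n..<n'} (isum (\<lambda>x. if z = f x then C x else 0))" for z
      using C(2) by (intro over_isum) (simp add: over_simps)
    show "cf (isum (\<lambda>x. if z = f x then C x else 0)) m = (if z = f a then \<kappa> else 0)" for z
    proof -
      have "cf (isum (\<lambda>x. if z = f x then C x else 0)) m = (\<Sum>\<^sup>+ x. if x = a then if z = f x then \<kappa> else 0 else 0)"
        unfolding cf_isum by (intro nn_integral_cong) (simp add: C(6))
      then show ?thesis by (simp only: csum_if_eq)
    qed
  qed (use C in auto)
qed

lemma isol_restrict:
  assumes "isol n n' G a" "P a"
  shows "isol n n' (\<lambda>q x. if P x then G q x else 0) a"
proof -
  obtain C m \<kappa> where C: "\<And>q x. valid q \<Longrightarrow> G q x = evq (qv q) (C x)" "\<And>x. over {n..<n'} (C x)"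
    "set_mset m \<subseteq> {n..<n'}" "0 < \<kappa>" "\<kappa> < \<infinity>" "\<And>x. cf (C x) m = (if x = a then \<kappa> else 0)"
    using isolE[OF assms(1)] by blast
  show ?thesis
    by (rule isolI[where C = "\<lambda>x. if P x then C x else 0" and m = m and \<kappa> = \<kappa>])
       (use C assms(2) in \<open>auto simp: evq_simps over_simps\<close>)
qed

lemma csum_inj: "inj f \<Longrightarrow> (\<Sum>\<^sup>+ x. if f y = f x then g x else 0) = g y"
  by (subst sum_single[of y]) (auto simp: inj_eq)

lemma isol_inj:
  assumes "isol n n' G a" "inj f" "\<And>q x. valid q \<Longrightarrow> H q (f x) = G q x"
    "\<And>q z. valid q \<Longrightarrow> z \<notin> range f \<Longrightarrow> H q z = 0"
  shows "isol n n' H (f a)"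
proof (rule isol_cong[OF isol_push[OF assms(1), of f]])
  fix q z assume q: "valid q"
  show "H q z = (\<Sum>\<^sup>+ x. if z = f x then G q x else 0)"
  proof (cases "z \<in> range f")
    case True
    then show ?thesis using assms(3)[OF q] by (auto simp: csum_inj[OF assms(2)])
  next
    case False
    then have "(\<Sum>\<^sup>+ x. if z = f x then G q x else 0) = 0" by (intro csum_0I) auto
    then show ?thesis using assms(4)[OF q False] by simp
  qed
qed

subsection \<open>Evaluation of the test terms\<close>

lemma ev_mult_wk0:
  assumes "wk 0 u"
  shows "ev (u * r) g = ev u [] * ev r g"
proof -
  have "ev (u * r) g = (\<Sum>\<^sup>+ k. \<Sum>\<^sup>+ i. \<Sum>\<^sup>+ j. if k = i + j then cf u ([], i) * cf r (g, j) else 0)"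
    unfolding ev_def cf_wk0_mult[OF assms] ..
  also have "\<dots> = (\<Sum>\<^sup>+ i. \<Sum>\<^sup>+ j. \<Sum>\<^sup>+ k. if k = i + j then cf u ([], i) * cf r (g, j) else 0)"
    by (subst sum_swap, rule nn_integral_cong, rule sum_swap)
  also have "\<dots> = ev u [] * ev r g"
    by (simp only: csum_if_eq) (simp add: ev_def nn_integral_cmult nn_integral_multc)
  finally show ?thesis .
qed

lemma ev_closed:
  assumes "[] \<turnstile> M : \<sigma>"
  shows "ev (U M b) g = (if pemp g then ev (U M b) [] else 0)"
proof -
  have "cf (U M b) (g, k) = (if pemp g then cf (U M b) ([], k) else 0)" for k
    using wk_U[OF assms] unfolding wk_def by (metis append_Nil list.size(3))
  then show ?thesis by (simp add: ev_def)
qed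

lemma ev_app_closed:
  "[] \<turnstile> M : \<sigma> \<Longrightarrow> ev (U (App M N) b) g = (\<Sum>\<^sup>+ a. ev (U M (PPair a b)) [] * ev (U N a) g)"
  using wk_U[of "[]" M \<sigma>] by (simp add: ev_simps ev_mult_wk0)

lemma ev_mult_Nil: "ev (r * s) [] = ev r [] * ev s []"
proof -
  have "ev (r * s) [] = (\<Sum>\<^sup>+ g1 :: pt list. \<Sum>\<^sup>+ g2 :: pt list. if g1 = [] then if g2 = [] then ev r [] * ev s [] else 0 else 0)"
    unfolding ev_mult by (intro nn_integral_cong) auto
  then show ?thesis by (simp only: csum_if csum_if_eq)
qed

lemma ev_tick_Nil: "ev tick [] = 1"
  using ev_tick[of 1 "[]"] by (simp add: ev_simps)

lemma ev_prod_Nil: "ev (\<Prod>i\<in>#B. f i) [] = (\<Prod>i\<in>#B. ev (f i) [])"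
  by (induction B) (auto simp: ev_simps ev_mult_Nil)

lemma ev_Lam: "ev (U (Lam \<phi> M) (PPair x b)) g = (if pw \<phi> x then ev (U M b) (x # g) else 0)"
  by (simp add: ev_simps)

abbreviation seq :: "tm \<Rightarrow> tm \<Rightarrow> tm" where
  "seq M N \<equiv> App (Lam One N) M"

lemma ev_mult_single:
  "ev (r * s) [x] = (\<Sum>\<^sup>+ y. \<Sum>\<^sup>+ z. if padd y z x then ev r [y] * ev s [z] else 0)"
proof -
  have "ev (r * s) [x] = (\<Sum>\<^sup>+ y. \<Sum>\<^sup>+ g2. if padd [y] g2 [x] then ev r [y] * ev s g2 else 0)"
    unfolding ev_mult
    by (rule sum_reindex[where p = "\<lambda>y. [y]"], simp add: inj_def, rule csum_0I) (auto simp: padd_Cons_iff image_iff)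
  also have "\<dots> = (\<Sum>\<^sup>+ y. \<Sum>\<^sup>+ z. if padd [y] [z] [x] then ev r [y] * ev s [z] else 0)"
    by (rule nn_integral_cong, rule sum_reindex[where p = "\<lambda>y. [y]"]) (auto simp: inj_def padd_Cons_iff image_iff)
  finally show ?thesis by simp
qed

text \<open>The free variable is shared by both parts, so its point x is split as y + z. The unit
  value returned by M is recorded as the leading \<open>PStar\<close>.\<close>

lemma ev_seq:
  "ev (U (seq M N) b) [x] =
   (\<Sum>\<^sup>+ y. \<Sum>\<^sup>+ z. if padd y z x then ev (U N b) [PStar, y] * ev (U M PStar) [z] else 0)"
proof -
  have "isum (\<lambda>a. (if pw One a then cur a (U N b) else 0) * U M a) = cur PStar (U N b) * U M PStar"
    by (subst isum_single[of PStar]) (auto simp: pw_simps)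
  then have "U (seq M N) b = tick * (cur PStar (U N b) * U M PStar)" by simp
  then show ?thesis by (simp only: ev_tick) (simp only: ev_mult_single ev_simps)
qed

text \<open>Among the decompositions of x with a unit as second summand there is just the trivial
  one.\<close>

lemma csum_padd_pemp: "(\<Sum>\<^sup>+ y. \<Sum>\<^sup>+ z. if padd y z x then if pemp z then f y else 0 else 0) = f (x :: 'a :: pcm)"
proof -
  obtain e where e: "pemp e" "padd e x x" and u: "\<And>z. pemp z \<Longrightarrow> padd z x x \<Longrightarrow> z = e"
    using pemp_ex1[of x] by blast
  have "(padd y z x \<and> pemp z) \<longleftrightarrow> (y = x \<and> z = e)" for y z
    using e u padd_pempD padd_commute by blast
  then have "(\<Sum>\<^sup>+ y. \<Sum>\<^sup>+ z. if padd y z x then if pemp z then f y else 0 else 0) =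
      (\<Sum>\<^sup>+ y. \<Sum>\<^sup>+ z. if y = x then if z = e then f y else 0 else 0)"
    by (intro nn_integral_cong) (smt (verit))
  then show ?thesis by (simp only: csum_if csum_if_eq)
qed

lemma csum_pemp_padd: "(\<Sum>\<^sup>+ y. \<Sum>\<^sup>+ z. if padd y z x then if pemp y then f z else 0 else 0) = f (x :: 'a :: pcm)"
  by (subst sum_swap, subst padd_commute_iff) (rule csum_padd_pemp)

lemma ev_var0_mult:
  assumes "\<And>z. ev r [z] = (if pemp z then k else 0)"
  shows "ev (var_ser 0 y * r) [x] = (if x = y then k else 0)"
proof -
  have "ev (var_ser 0 y * r) [x] =
      (\<Sum>\<^sup>+ w. \<Sum>\<^sup>+ z. if padd w z x then if pemp z then if w = y then k else 0 else 0 else 0)"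
    unfolding ev_mult_single by (intro nn_integral_cong) (auto simp: ev_var_0 assms)
  then show ?thesis by (simp only: csum_padd_pemp)
qed

lemma ev_case_Var0:
  assumes "\<And>a z. ev (U Nl b) [a, z] = (if pemp z then kl a else 0)"
    "\<And>a z. ev (U Nr b) [a, z] = (if pemp z then kr a else 0)"
  shows "ev (U (Case (Var 0) Nl Nr) b) [x] =
    (\<Sum>\<^sup>+ a. (if x = PIn Lft a then kl a else 0) + (if x = PIn Rgt a then kr a else 0))"
proof -
  have "ev (var_ser 0 (PIn Lft a) * cur a (U Nl b)) [x] = (if x = PIn Lft a then kl a else 0)"
    "ev (var_ser 0 (PIn Rgt a) * cur a (U Nr b)) [x] = (if x = PIn Rgt a then kr a else 0)" for a
    by (rule ev_var0_mult, simp add: ev_simps assms)+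
  then show ?thesis by (simp add: ev_simps)
qed

lemma ev_Var0: "ev (U (Var 0) b) [x] = (if x = b then 1 else 0)"
  by (simp add: ev_var_0)

lemma ev_Var1: "ev (U (Var (Suc 0)) b) [PStar, x] = (if x = b then 1 else 0)"
  by (simp add: ev_var_0 ev_var_Suc)

lemma ev_app_Var0: "[] \<turnstile> M : \<sigma> \<Longrightarrow> ev (U (App M (Var 0)) b) [x] = ev (U M (PPair x b)) []"
  unfolding ev_app_closed ev_Var0 by (subst sum_single[of x]) auto

lemma ev_app_Var1: "[] \<turnstile> M : \<sigma> \<Longrightarrow> ev (U (App M (Var (Suc 0))) b) [PStar, x] = ev (U M (PPair x b)) []"
  unfolding ev_app_closed ev_Var1 by (subst sum_single[of x]) auto

section \<open>Divergence and probabilistic choice\<close>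

definition diverge :: "gty \<Rightarrow> tm" where
  "diverge \<sigma> = Fix \<sigma> (Go (Var 0))"

lemma typing_diverge: "gclosed \<sigma> \<Longrightarrow> \<Gamma> \<turnstile> diverge \<sigma> : \<sigma>"
  unfolding diverge_def using typing.t_var[of 0 "Bang \<sigma> # \<Gamma>"] by (auto intro: typing.intros)

text \<open>Starting from 0, only the empty bag could contribute to an unfolding, but
  \<open>Go\<close> on the variable asks for a bag of one element; so all iterates are 0.\<close>

lemma ev_diverge: "ev (U (diverge \<sigma>) b) g = 0"
proof -
  let ?m = "U (Go (Var 0))"
  have v: "cur (PBag {#}) (tick * var_ser 0 (PBag {#b#})) = 0" for b
    by (rule ser_eqI) (auto simp: split_paired_all cf_tick_mult var_ser_def split: nat.split)
  have "fstep ?m (\<lambda>_. 0) b = 0" for b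
  proof -
    have "(\<Prod>a\<in>#B. 0) * cur (PBag B) (?m b) = 0" for B
      by (cases "B = {#}") (auto simp: v power_0_left)
    then show ?thesis unfolding fstep_def by simp
  qed
  then have "(fstep ?m ^^ j) (\<lambda>_. 0) = (\<lambda>_. 0)" for j by (induction j) auto
  then show ?thesis by (simp add: diverge_def ev_fixser ev_simps)
qed

definition choice :: "rat \<Rightarrow> tm \<Rightarrow> tm \<Rightarrow> tm" where
  "choice p M N = Case (Coin p) M N"

lemma typing_choice:
  "0 \<le> p \<Longrightarrow> p \<le> 1 \<Longrightarrow> [] \<turnstile> M : \<sigma> \<Longrightarrow> [] \<turnstile> N : \<sigma> \<Longrightarrow> [] \<turnstile> choice p M N : \<sigma>"
  unfolding choice_def by (rule typing.t_case[OF typing.t_coin]) (auto intro: typing_weaken_closed)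

lemma ev_choice:
  assumes "[] \<turnstile> M : \<sigma>" "[] \<turnstile> N : \<sigma>"
  shows "ev (U (choice p M N) b) [] =
    ennreal (real_of_rat p) * ev (U M b) [] + ennreal (real_of_rat (1 - p)) * ev (U N b) []"
proof -
  let ?l = "ennreal (real_of_rat p)" and ?r = "ennreal (real_of_rat (1 - p))"
  have "ev (U (choice p M N) b) [] =
      (\<Sum>\<^sup>+ a. coin_vec p (PIn Lft a) * ev (U M b) [a] + coin_vec p (PIn Rgt a) * ev (U N b) [a])"
    by (simp add: choice_def ev_simps ev_mult_Nil ev_tick_Nil)
  also have "\<dots> = (\<Sum>\<^sup>+ a. if a = PStar then ?l * ev (U M b) [a] + ?r * ev (U N b) [a] else 0)"
    by (intro nn_integral_cong) (auto simp: coin_vec_def basis_def)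
  also have "\<dots> = ?l * ev (U M b) [PStar] + ?r * ev (U N b) [PStar]" by (simp only: csum_if_eq)
  finally show ?thesis using ev_closed[OF assms(1), of b "[PStar]"] ev_closed[OF assms(2), of b "[PStar]"] by simp
qed

text \<open>Quantifying over the first parameter n provides fresh parameters whenever two families
  are combined. Typing is demanded for valid q only, because coins need a bias in the unit
  interval.\<close>

definition def_pos :: "gty \<Rightarrow> pt \<Rightarrow> bool" where
  "def_pos \<sigma> a \<longleftrightarrow> (\<forall>n. \<exists>n'\<ge>n. \<exists>P. (\<forall>q. valid q \<longrightarrow> [] \<turnstile> P q : \<sigma>) \<and>
     isol n n' (\<lambda>q x. ev (U (P q) x) []) a)"

definition def_test :: "pty \<Rightarrow> pt \<Rightarrow> bool" where
  "def_test \<phi> a \<longleftrightarrow> (\<forall>n. \<exists>n'\<ge>n. \<exists>T. (\<forall>q. valid q \<longrightarrow> [] \<turnstile> T q : Lolli \<phi> (Pos One)) \<and>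
     isol n n' (\<lambda>q x. ev (U (T q) (PPair x PStar)) []) a)"

text \<open>The tests for general types use their argument exactly once.\<close>

definition def_neg :: "gty \<Rightarrow> pt \<Rightarrow> bool" where
  "def_neg \<sigma> a \<longleftrightarrow> (\<forall>n. \<exists>n'\<ge>n. \<exists>T. (\<forall>q. valid q \<longrightarrow> [] \<turnstile> T q : Lolli (Bang \<sigma>) (Pos One) \<and>
       (\<forall>B. size B \<noteq> 1 \<longrightarrow> ev (U (T q) (PPair (PBag B) PStar)) [] = 0)) \<and>
     isol n n' (\<lambda>q x. ev (U (T q) (PPair (PBag {#x#}) PStar)) []) a)"

section \<open>Values and tests for each type constructor\<close>

lemma def_one: "def_pos (Pos One) PStar" "def_test One PStar"
proof -
  show "def_pos (Pos One) PStar" unfolding def_pos_def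
  proof (intro allI)
    fix n
    have "isol n n (\<lambda>q x. ev (U Unit x) []) PStar"
      by (rule isol_cong[OF isol_const]) (simp add: ev_simps)
    then show "\<exists>n'\<ge>n. \<exists>P. (\<forall>q. valid q \<longrightarrow> [] \<turnstile> P q : Pos One) \<and> isol n n' (\<lambda>q x. ev (U (P q) x) []) PStar"
      by (intro exI[of _ n] conjI exI[of _ "\<lambda>_. Unit"]) (auto intro: typing.intros)
  qed
  show "def_test One PStar" unfolding def_test_def
  proof (intro allI)
    fix n
    let ?T = "Lam One (Var 0)"
    have "isol n n (\<lambda>q x. ev (U ?T (PPair x PStar)) []) PStar"
      unfolding ev_Lam ev_Var0 by (rule isol_cong[OF isol_const]) (auto simp: pw_simps)
    moreover have "[] \<turnstile> ?T : Lolli One (Pos One)" using typing.t_var[of 0 "[One]"] by (auto intro: typing.intros)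
    ultimately show "\<exists>n'\<ge>n. \<exists>T. (\<forall>q. valid q \<longrightarrow> [] \<turnstile> T q : Lolli One (Pos One)) \<and>
        isol n n' (\<lambda>q x. ev (U (T q) (PPair x PStar)) []) PStar"
      by (intro exI[of _ n] conjI exI[of _ "\<lambda>_. ?T"]) auto
  qed
qed

lemma def_pos_tensor:
  assumes "def_pos (Pos \<phi>) a" "def_pos (Pos \<psi>) b"
  shows "def_pos (Pos (Tensor \<phi> \<psi>)) (PPair a b)"
  unfolding def_pos_def
proof (intro allI)
  fix n
  obtain n1 P where P: "n \<le> n1" "\<forall>q. valid q \<longrightarrow> [] \<turnstile> P q : Pos \<phi>" "isol n n1 (\<lambda>q x. ev (U (P q) x) []) a"
    using assms(1) unfolding def_pos_def by blast
  obtain n2 Q where Q: "n1 \<le> n2" "\<forall>q. valid q \<longrightarrow> [] \<turnstile> Q q : Pos \<psi>" "isol n1 n2 (\<lambda>q x. ev (U (Q q) x) []) b"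
    using assms(2) unfolding def_pos_def by blast
  have "isol n n2 (\<lambda>q x. ev (U (MkPair (P q) (Q q)) x) []) (case (a, b) of (x, y) \<Rightarrow> PPair x y)"
    by (rule isol_inj[OF isol_times[OF P(3) Q(3) P(1) Q(1)]])
       (auto simp: inj_def ev_mult_Nil ev_simps image_iff split: pt.splits)
  then show "\<exists>n'\<ge>n. \<exists>P. (\<forall>q. valid q \<longrightarrow> [] \<turnstile> P q : Pos (Tensor \<phi> \<psi>)) \<and> isol n n' (\<lambda>q x. ev (U (P q) x) []) (PPair a b)"
    using P Q by (intro exI[of _ n2] conjI exI[of _ "\<lambda>q. MkPair (P q) (Q q)"]) (auto intro: typing.intros)
qed

text \<open>The projection discards the other component, whose point must then be a unit.\<close>

lemma ev_Pr_Var: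
  "ev (U (Pr i (Var 0)) c) [x] = (if \<exists>e. pemp e \<and> x = sel i (PPair c e) (PPair e c) then 1 else 0)"
  "ev (U (Pr i (Var (Suc 0))) c) [PStar, x] = (if \<exists>e. pemp e \<and> x = sel i (PPair c e) (PPair e c) then 1 else 0)"
proof -
  have s: "(\<Sum>\<^sup>+ e. if pemp e then if x = sel i (PPair c e) (PPair e c) then 1 else 0 else 0) =
      (if \<exists>e. pemp e \<and> x = sel i (PPair c e) (PPair e c) then 1 else 0 :: ennreal)"
  proof -
    have "(\<Sum>\<^sup>+ e. if pemp e \<and> x = sel i (PPair c e) (PPair e c) then 1 else 0) =
      (if \<exists>e. pemp e \<and> x = sel i (PPair c e) (PPair e c) then 1 else 0 :: ennreal)"
      by (rule csum_functional) (cases i; auto)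
    then show ?thesis by (simp add: if_if_eq_conj)
  qed
  show "ev (U (Pr i (Var 0)) c) [x] = (if \<exists>e. pemp e \<and> x = sel i (PPair c e) (PPair e c) then 1 else 0)"
    unfolding s[symmetric] by (simp add: ev_simps ev_if ev_Var0[simplified] cong: if_cong)
  show "ev (U (Pr i (Var (Suc 0))) c) [PStar, x] = (if \<exists>e. pemp e \<and> x = sel i (PPair c e) (PPair e c) then 1 else 0)"
    unfolding s[symmetric] by (simp add: ev_simps ev_if ev_Var1[simplified] cong: if_cong)
qed


lemma typing_seq: "\<Gamma> \<turnstile> M : Pos One \<Longrightarrow> One # \<Gamma> \<turnstile> N : \<sigma> \<Longrightarrow> \<Gamma> \<turnstile> seq M N : \<sigma>"
  by (rule typing.t_app[OF typing.t_lam]) simp_all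

lemma typing_Var0: "\<phi> # \<Gamma> \<turnstile> Var 0 : Pos \<phi>"
  using typing.t_var[of 0 "\<phi> # \<Gamma>"] by simp

lemma typing_Var1: "\<psi> # \<phi> # \<Gamma> \<turnstile> Var (Suc 0) : Pos \<phi>"
  using typing.t_var[of "Suc 0" "\<psi> # \<phi> # \<Gamma>"] by simp

lemma typing_Pr: "\<Gamma> \<turnstile> M : Pos (Tensor \<phi> \<psi>) \<Longrightarrow> \<Gamma> \<turnstile> Pr Lft M : Pos \<phi>"
  "\<Gamma> \<turnstile> M : Pos (Tensor \<phi> \<psi>) \<Longrightarrow> \<Gamma> \<turnstile> Pr Rgt M : Pos \<psi>"
  using typing.t_pr[of \<Gamma> M \<phi> \<psi> Lft] typing.t_pr[of \<Gamma> M \<phi> \<psi> Rgt] by auto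

lemmas typing_rules = typing_seq typing_Var0 typing_Var1 typing_Pr typing.t_lam typing.t_app
  typing.t_go typing.t_stop typing.t_unit typing_weaken_closed

text \<open>Each test projects its own copy of the pair, so the discarded components are units.
  Hence \<open>PPair d c\<close> can only split as \<open>PPair e c\<close> plus
  \<open>PPair d e'\<close>, where e and e' are the neutral elements of d and c.\<close>

lemma ev_test_tensor:
  assumes T: "[] \<turnstile> T1 : \<sigma>1" "[] \<turnstile> T2 : \<sigma>2"
  shows "ev (U (seq (App T1 (Pr Lft (Var 0))) (App T2 (Pr Rgt (Var (Suc 0))))) PStar) [x] =
    (case x of PPair d c \<Rightarrow> ev (U T1 (PPair d PStar)) [] * ev (U T2 (PPair c PStar)) [] | _ \<Rightarrow> 0)"
proof -
  let ?B = "\<lambda>z. case z of PPair d e \<Rightarrow> if pemp e then ev (U T1 (PPair d PStar)) [] else 0 | _ \<Rightarrow> 0"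
  let ?A = "\<lambda>y. case y of PPair e c \<Rightarrow> if pemp e then ev (U T2 (PPair c PStar)) [] else 0 | _ \<Rightarrow> 0"
  have A: "ev (U (App T2 (Pr Rgt (Var (Suc 0)))) PStar) [PStar, y] = ?A y" for y
  proof (cases "\<exists>e c. y = PPair e c")
    case True
    then obtain e c where "y = PPair e c" by blast
    then show ?thesis unfolding ev_app_closed[OF T(2)] ev_Pr_Var by (subst sum_single[of c]) auto
  next
    case False
    then show ?thesis unfolding ev_app_closed[OF T(2)] ev_Pr_Var by (auto split: pt.split intro!: csum_0I)
  qed
  have B: "ev (U (App T1 (Pr Lft (Var 0))) PStar) [y] = ?B y" for y
  proof (cases "\<exists>d e. y = PPair d e")
    case True
    then obtain d e where "y = PPair d e" by blast
    then show ?thesis unfolding ev_app_closed[OF T(1)] ev_Pr_Var by (subst sum_single[of d]) auto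
  next
    case False
    then show ?thesis unfolding ev_app_closed[OF T(1)] ev_Pr_Var by (auto split: pt.split intro!: csum_0I)
  qed
  have eq: "ev (U (seq (App T1 (Pr Lft (Var 0))) (App T2 (Pr Rgt (Var (Suc 0))))) PStar) [x] =
      (\<Sum>\<^sup>+ y. \<Sum>\<^sup>+ z. if padd y z x then ?A y * ?B z else 0)"
    unfolding ev_seq A B ..
  show ?thesis
  proof (cases "\<exists>d c. x = PPair d c")
    case True
    then obtain d c where x: "x = PPair d c" by blast
    obtain e where e: "pemp e" "padd e d d" using padd_pemp_ex by blast
    obtain e' where e': "pemp e'" "padd e' c c" using padd_pemp_ex by blast
    let ?y = "PPair e c" and ?z = "PPair d e'"
    have key: "y = ?y \<and> z = ?z" if p: "padd y z x" and nz: "?A y * ?B z \<noteq> 0" for y z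
    proof -
      obtain e1 c1 d1 e2 where yz: "y = PPair e1 c1" "z = PPair d1 e2" "pemp e1" "pemp e2"
        using nz by (auto split: pt.splits if_splits)
      then have *: "padd e1 d1 d" "padd c1 e2 c" using p x by (auto simp: padd_pt_simps)
      then have "d1 = d" "c1 = c" using yz padd_pempD padd_pempD2 by blast+
      then show ?thesis using yz * e e' pemp_padd_unique padd_commute by blast
    qed
    have p: "padd ?y ?z x" using e e' padd_commute by (auto simp: x padd_pt_simps)
    have "(\<Sum>\<^sup>+ y. \<Sum>\<^sup>+ z. if padd y z x then ?A y * ?B z else 0) =
       (\<Sum>\<^sup>+ y. \<Sum>\<^sup>+ z. if y = ?y then if z = ?z then ?A ?y * ?B ?z else 0 else 0)"
    proof (intro nn_integral_cong)
      fix y z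
      show "(if padd y z x then ?A y * ?B z else 0) = (if y = ?y then if z = ?z then ?A ?y * ?B ?z else 0 else 0)"
      proof (cases "y = ?y \<and> z = ?z")
        case True
        then show ?thesis using p by simp
      next
        case False
        then have "padd y z x \<Longrightarrow> ?A y * ?B z = 0" using key by blast
        then show ?thesis using False by auto
      qed
    qed
    also have "\<dots> = ?A ?y * ?B ?z" by (simp only: csum_if csum_if_eq)
    finally show ?thesis unfolding eq by (simp add: x e e' mult.commute)
  next
    case False
    have "padd y z x \<Longrightarrow> ?A y * ?B z = 0" for y z
      using False by (auto simp: padd_pt_simps split: pt.split)
    then have "(\<Sum>\<^sup>+ y. \<Sum>\<^sup>+ z. if padd y z x then ?A y * ?B z else 0) = 0" by (intro csum_0I) (simp add: if_split)
    then show ?thesis unfolding eq using False by (auto split: pt.split)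
  qed
qed

lemma def_test_tensor:
  assumes "def_test \<phi> a" "def_test \<psi> b" "pclosed \<phi>" "pclosed \<psi>" "pw (Tensor \<phi> \<psi>) (PPair a b)"
  shows "def_test (Tensor \<phi> \<psi>) (PPair a b)"
  unfolding def_test_def
proof (intro allI)
  fix n
  obtain n1 P where P: "n \<le> n1" "\<forall>q. valid q \<longrightarrow> [] \<turnstile> P q : Lolli \<phi> (Pos One)"
    "isol n n1 (\<lambda>q x. ev (U (P q) (PPair x PStar)) []) a"
    using assms(1) unfolding def_test_def by blast
  obtain n2 Q where Q: "n1 \<le> n2" "\<forall>q. valid q \<longrightarrow> [] \<turnstile> Q q : Lolli \<psi> (Pos One)"
    "isol n1 n2 (\<lambda>q x. ev (U (Q q) (PPair x PStar)) []) b"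
    using assms(2) unfolding def_test_def by blast
  let ?b = "\<lambda>q. seq (App (P q) (Pr Lft (Var 0))) (App (Q q) (Pr Rgt (Var (Suc 0))))"
  let ?T = "\<lambda>q. Lam (Tensor \<phi> \<psi>) (?b q)"
  have b: "ev (U (?b q) PStar) [x] = (case x of
      PPair d c \<Rightarrow> ev (U (P q) (PPair d PStar)) [] * ev (U (Q q) (PPair c PStar)) [] | _ \<Rightarrow> 0)" if "valid q" for q x
    by (rule ev_test_tensor) (use P(2) Q(2) that in blast)+
  have "isol n n2 (\<lambda>q x. ev (U (?b q) PStar) [x]) (case (a, b) of (x, y) \<Rightarrow> PPair x y)"
    by (rule isol_inj[OF isol_times[OF P(3) Q(3) P(1) Q(1)]])
       (auto simp: inj_def image_iff b simp del: U.simps split: pt.split)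
  then have "isol n n2 (\<lambda>q x. ev (U (?T q) (PPair x PStar)) []) (PPair a b)"
    unfolding ev_Lam using isol_restrict[where P = "pw (Tensor \<phi> \<psi>)"] assms(5) by simp
  moreover have "valid q \<Longrightarrow> [] \<turnstile> ?T q : Lolli (Tensor \<phi> \<psi>) (Pos One)" for q
    using P(2) Q(2) assms(3,4)
    by (intro typing.t_lam typing_seq) (auto intro: typing_rules)
  ultimately show "\<exists>n'\<ge>n. \<exists>T. (\<forall>q. valid q \<longrightarrow> [] \<turnstile> T q : Lolli (Tensor \<phi> \<psi>) (Pos One)) \<and>
      isol n n' (\<lambda>q x. ev (U (T q) (PPair x PStar)) []) (PPair a b)"
    using P(1) Q(1) by (intro exI[of _ n2] conjI exI[of _ ?T]) auto
qed

lemma def_pos_plus: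
  assumes "def_pos (Pos (sel i \<phi> \<psi>)) a" "pclosed \<phi>" "pclosed \<psi>"
  shows "def_pos (Pos (Plus \<phi> \<psi>)) (PIn i a)"
  unfolding def_pos_def
proof (intro allI)
  fix n
  obtain n1 P where P: "n \<le> n1" "\<forall>q. valid q \<longrightarrow> [] \<turnstile> P q : Pos (sel i \<phi> \<psi>)" "isol n n1 (\<lambda>q x. ev (U (P q) x) []) a"
    using assms(1) unfolding def_pos_def by blast
  have "isol n n1 (\<lambda>q x. ev (U (In i (P q)) x) []) (PIn i a)"
    by (rule isol_inj[OF P(3)]) (auto simp: inj_def ev_simps image_iff split: pt.splits)
  then show "\<exists>n'\<ge>n. \<exists>P. (\<forall>q. valid q \<longrightarrow> [] \<turnstile> P q : Pos (Plus \<phi> \<psi>)) \<and> isol n n' (\<lambda>q x. ev (U (P q) x) []) (PIn i a)"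
    using P assms by (intro exI[of _ n1] conjI exI[of _ "\<lambda>q. In i (P q)"]) (auto intro: typing.intros)
qed

lemma ev_app_Var0_2: "[] \<turnstile> M : \<sigma> \<Longrightarrow> ev (U (App M (Var 0)) b) [a, z] = (if pemp z then ev (U M (PPair a b)) [] else 0)"
  unfolding ev_app_closed by (subst sum_single[of a]) (auto simp: ev_var_0)

text \<open>The branch for the other side diverges and contributes 0.\<close>

lemma def_test_plus:
  assumes "def_test (sel i \<phi> \<psi>) a" "pclosed \<phi>" "pclosed \<psi>" "pw (Plus \<phi> \<psi>) (PIn i a)"
  shows "def_test (Plus \<phi> \<psi>) (PIn i a)"
  unfolding def_test_def
proof (intro allI)
  fix n
  obtain n1 P where P: "n \<le> n1" "\<forall>q. valid q \<longrightarrow> [] \<turnstile> P q : Lolli (sel i \<phi> \<psi>) (Pos One)"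
    "isol n n1 (\<lambda>q x. ev (U (P q) (PPair x PStar)) []) a"
    using assms(1) unfolding def_test_def by blast
  let ?N = "\<lambda>q j. if j = i then App (P q) (Var 0) else diverge (Pos One)"
  let ?b = "\<lambda>q. Case (Var 0) (?N q Lft) (?N q Rgt)"
  let ?T = "\<lambda>q. Lam (Plus \<phi> \<psi>) (?b q)"
  have N: "ev (U (?N q j) PStar) [x, z] = (if pemp z then if j = i then ev (U (P q) (PPair x PStar)) [] else 0 else 0)"
    if "valid q" for q j x z
  proof -
    have ty: "[] \<turnstile> P q : Lolli (sel i \<phi> \<psi>) (Pos One)" using P(2) that by blast
    show ?thesis using ev_app_Var0_2[OF ty] by (simp add: ev_diverge del: U.simps)
  qed
  have b: "ev (U (?b q) PStar) [x] = (\<Sum>\<^sup>+ y. if x = PIn i y then ev (U (P q) (PPair y PStar)) [] else 0)" if "valid q" for q x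
    unfolding ev_case_Var0[OF N[OF that] N[OF that]] by (cases i) (auto intro!: nn_integral_cong)
  have "isol n n1 (\<lambda>q x. ev (U (?b q) PStar) [x]) (PIn i a)"
    by (rule isol_cong[OF isol_push[OF P(3), of "PIn i"]]) (rule b)
  then have "isol n n1 (\<lambda>q x. ev (U (?T q) (PPair x PStar)) []) (PIn i a)"
    unfolding ev_Lam using isol_restrict[where P = "pw (Plus \<phi> \<psi>)"] assms(4) by simp
  moreover have "valid q \<Longrightarrow> [] \<turnstile> ?T q : Lolli (Plus \<phi> \<psi>) (Pos One)" for q
    using P(2) assms(2,3)
    by (intro typing.t_lam typing.t_case[OF typing_Var0]; cases i) (auto intro: typing_rules typing_diverge)
  ultimately show "\<exists>n'\<ge>n. \<exists>T. (\<forall>q. valid q \<longrightarrow> [] \<turnstile> T q : Lolli (Plus \<phi> \<psi>) (Pos One)) \<and>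
      isol n n' (\<lambda>q x. ev (U (T q) (PPair x PStar)) []) (PIn i a)"
    using P(1) by (intro exI[of _ n1] conjI exI[of _ ?T]) auto
qed

lemma def_pos_mu:
  assumes "def_pos (Pos (psubst \<phi> 0 (Mu \<phi>))) a" "pclosed (Mu \<phi>)"
  shows "def_pos (Pos (Mu \<phi>)) a"
  unfolding def_pos_def
proof (intro allI)
  fix n
  obtain n1 P where P: "n \<le> n1" "\<forall>q. valid q \<longrightarrow> [] \<turnstile> P q : Pos (psubst \<phi> 0 (Mu \<phi>))" "isol n n1 (\<lambda>q x. ev (U (P q) x) []) a"
    using assms(1) unfolding def_pos_def by blast
  then show "\<exists>n'\<ge>n. \<exists>P. (\<forall>q. valid q \<longrightarrow> [] \<turnstile> P q : Pos (Mu \<phi>)) \<and> isol n n' (\<lambda>q x. ev (U (P q) x) []) a"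
    using assms(2) by (intro exI[of _ n1] conjI exI[of _ "\<lambda>q. Fold (P q)"]) (auto intro: typing.intros)
qed

lemma def_test_mu:
  assumes "def_test (psubst \<phi> 0 (Mu \<phi>)) a" "pclosed (Mu \<phi>)" "pw (Mu \<phi>) a"
  shows "def_test (Mu \<phi>) a"
  unfolding def_test_def
proof (intro allI)
  fix n
  obtain n1 P where P: "n \<le> n1" "\<forall>q. valid q \<longrightarrow> [] \<turnstile> P q : Lolli (psubst \<phi> 0 (Mu \<phi>)) (Pos One)"
    "isol n n1 (\<lambda>q x. ev (U (P q) (PPair x PStar)) []) a"
    using assms(1) unfolding def_test_def by blast
  let ?b = "\<lambda>q. App (P q) (Unfold (Var 0))"
  let ?T = "\<lambda>q. Lam (Mu \<phi>) (?b q)"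
  have b: "ev (U (?b q) PStar) [x] = ev (U (P q) (PPair x PStar)) []" if "valid q" for q x
  proof -
    have v: "ev (U (Unfold (Var 0)) y) [x] = (if x = y then 1 else 0)" for y by (simp add: ev_var_0)
    have ty: "[] \<turnstile> P q : Lolli (psubst \<phi> 0 (Mu \<phi>)) (Pos One)" using P(2) that by blast
    show ?thesis unfolding ev_app_closed[OF ty] v by (subst sum_single[of x]) auto
  qed
  have "isol n n1 (\<lambda>q x. ev (U (?b q) PStar) [x]) a" by (rule isol_cong[OF P(3)]) (rule b)
  then have "isol n n1 (\<lambda>q x. ev (U (?T q) (PPair x PStar)) []) a"
    unfolding ev_Lam using isol_restrict[where P = "pw (Mu \<phi>)"] assms(3) by simp
  moreover have "valid q \<Longrightarrow> [] \<turnstile> ?T q : Lolli (Mu \<phi>) (Pos One)" for q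
    using P(2) assms(2)
    by (auto intro!: typing.t_lam typing.t_app[OF typing_weaken_closed typing.t_unfold[OF typing_Var0]])
  ultimately show "\<exists>n'\<ge>n. \<exists>T. (\<forall>q. valid q \<longrightarrow> [] \<turnstile> T q : Lolli (Mu \<phi>) (Pos One)) \<and>
      isol n n' (\<lambda>q x. ev (U (T q) (PPair x PStar)) []) a"
    using P(1) by (intro exI[of _ n1] conjI exI[of _ ?T]) auto
qed

text \<open>\<open>Go\<close> on the variable reads a bag of exactly one element, which gives the
  linearity required of the test.\<close>

lemma def_neg_pos:
  assumes "def_test \<phi> a" "pclosed \<phi>" "pw \<phi> a"
  shows "def_neg (Pos \<phi>) a"
  unfolding def_neg_def
proof (intro allI)
  fix n
  obtain n1 P where P: "n \<le> n1" "\<forall>q. valid q \<longrightarrow> [] \<turnstile> P q : Lolli \<phi> (Pos One)"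
    "isol n n1 (\<lambda>q x. ev (U (P q) (PPair x PStar)) []) a"
    using assms(1) unfolding def_test_def by blast
  let ?b = "\<lambda>q. App (P q) (Go (Var 0))"
  let ?T = "\<lambda>q. Lam (Bang (Pos \<phi>)) (?b q)"
  have b: "ev (U (?b q) PStar) [PBag B] = (\<Sum>\<^sup>+ y. if B = {#y#} then ev (U (P q) (PPair y PStar)) [] else 0)"
    if "valid q" for q B
  proof -
    have v: "ev (U (Go (Var 0)) y) [PBag B] = (if B = {#y#} then 1 else 0)" for y by (auto simp: ev_var_0)
    have ty: "[] \<turnstile> P q : Lolli \<phi> (Pos One)" using P(2) that by blast
    show ?thesis unfolding ev_app_closed[OF ty] v by (intro nn_integral_cong) auto
  qed
  have "isol n n1 (\<lambda>q x. ev (U (?b q) PStar) [PBag {#x#}]) a"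
    by (rule isol_cong[OF P(3)]) (simp add: b csum_if_eq del: U.simps)
  then have "isol n n1 (\<lambda>q x. ev (U (?T q) (PPair (PBag {#x#}) PStar)) []) a"
    unfolding ev_Lam using isol_restrict[where P = "\<lambda>x. pw (Bang (Pos \<phi>)) (PBag {#x#})"] assms(3)
    by (simp add: pw_simps)
  moreover have "ev (U (?T q) (PPair (PBag B) PStar)) [] = 0" if "valid q" "size B \<noteq> 1" for q B
    unfolding ev_Lam b[OF that(1)] using that(2) by (auto intro!: csum_0I)
  moreover have "valid q \<Longrightarrow> [] \<turnstile> ?T q : Lolli (Bang (Pos \<phi>)) (Pos One)" for q
    using P(2) assms(2)
    by (auto intro!: typing.t_lam typing.t_app[OF typing_weaken_closed typing.t_go[OF typing_Var0]])
  ultimately show "\<exists>n'\<ge>n. \<exists>T. (\<forall>q. valid q \<longrightarrow> [] \<turnstile> T q : Lolli (Bang (Pos \<phi>)) (Pos One) \<and>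
       (\<forall>B. size B \<noteq> 1 \<longrightarrow> ev (U (T q) (PPair (PBag B) PStar)) [] = 0)) \<and>
     isol n n' (\<lambda>q x. ev (U (T q) (PPair (PBag {#x#}) PStar)) []) a"
    using P(1) by (intro exI[of _ n1] conjI exI[of _ ?T]) auto
qed

text \<open>The function first tests its argument for a and then behaves as the family for b, so the
  two series multiply.\<close>

lemma def_pos_lolli:
  assumes "def_test \<phi> a" "def_pos \<sigma> b" "pclosed \<phi>" "pw \<phi> a"
  shows "def_pos (Lolli \<phi> \<sigma>) (PPair a b)"
  unfolding def_pos_def
proof (intro allI)
  fix n
  obtain n1 T where T: "n \<le> n1" "\<forall>q. valid q \<longrightarrow> [] \<turnstile> T q : Lolli \<phi> (Pos One)"
    "isol n n1 (\<lambda>q x. ev (U (T q) (PPair x PStar)) []) a"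
    using assms(1) unfolding def_test_def by blast
  obtain n2 P where P: "n1 \<le> n2" "\<forall>q. valid q \<longrightarrow> [] \<turnstile> P q : \<sigma>" "isol n1 n2 (\<lambda>q x. ev (U (P q) x) []) b"
    using assms(2) unfolding def_pos_def by blast
  let ?b = "\<lambda>q. seq (App (T q) (Var 0)) (P q)"
  have b: "ev (U (?b q) y) [x] = ev (U (T q) (PPair x PStar)) [] * ev (U (P q) y) []" if "valid q" for q x y
  proof -
    have ty: "[] \<turnstile> T q : Lolli \<phi> (Pos One)" "[] \<turnstile> P q : \<sigma>" using T(2) P(2) that by auto
    have "ev (U (?b q) y) [x] = (\<Sum>\<^sup>+ u. \<Sum>\<^sup>+ z. if padd u z x then if pemp u
        then ev (U (T q) (PPair z PStar)) [] * ev (U (P q) y) [] else 0 else 0)"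
      unfolding ev_seq ev_app_Var0[OF ty(1)] ev_closed[OF ty(2), of _ "[PStar, _]"]
      by (intro nn_integral_cong) (simp add: mult.commute)
    then show ?thesis by (simp only: csum_pemp_padd)
  qed
  have "isol n n2 (\<lambda>q x. ev (U (Lam \<phi> (?b q)) x) []) (case (a, b) of (x, y) \<Rightarrow> PPair x y)"
  proof (rule isol_inj[OF isol_restrict[OF isol_times[OF T(3) P(3) T(1) P(1)], of "\<lambda>(x, y). pw \<phi> x"]])
    show "ev (U (Lam \<phi> (?b q)) (case x of (x, y) \<Rightarrow> PPair x y)) [] = (if case x of (x, y) \<Rightarrow> pw \<phi> x
      then case x of (x, y) \<Rightarrow> ev (U (T q) (PPair x PStar)) [] * ev (U (P q) y) [] else 0)" if "valid q" for q x
      by (cases x) (simp add: ev_Lam b[OF that] del: U.simps)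
  qed (auto simp: assms(4) inj_def image_iff ev_simps split: pt.split)
  moreover have "valid q \<Longrightarrow> [] \<turnstile> Lam \<phi> (?b q) : Lolli \<phi> \<sigma>" for q
    using T(2) P(2) assms(3) by (intro typing.t_lam typing_seq) (auto intro: typing_rules)
  ultimately show "\<exists>n'\<ge>n. \<exists>P. (\<forall>q. valid q \<longrightarrow> [] \<turnstile> P q : Lolli \<phi> \<sigma>) \<and> isol n n' (\<lambda>q x. ev (U (P q) x) []) (PPair a b)"
    using T(1) P(1) by (intro exI[of _ n2] conjI exI[of _ "\<lambda>q. Lam \<phi> (?b q)"]) auto
qed

text \<open>The test applies the given function to the family for a and hands the result as a thunk
  to the test for b. That test is linear, so the thunk is used once, and with it the
  function.\<close>

lemma def_neg_lolli:
  assumes "def_pos (Pos \<phi>) a" "def_neg \<sigma> b" "pclosed \<phi>" "gclosed \<sigma>" "pw \<phi> a" "gw \<sigma> b"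
  shows "def_neg (Lolli \<phi> \<sigma>) (PPair a b)"
  unfolding def_neg_def
proof (intro allI)
  fix n
  obtain n1 P where P: "n \<le> n1" "\<forall>q. valid q \<longrightarrow> [] \<turnstile> P q : Pos \<phi>" "isol n n1 (\<lambda>q x. ev (U (P q) x) []) a"
    using assms(1) unfolding def_pos_def by blast
  obtain n2 N where N: "n1 \<le> n2" "\<forall>q. valid q \<longrightarrow> [] \<turnstile> N q : Lolli (Bang \<sigma>) (Pos One) \<and>
       (\<forall>B. size B \<noteq> 1 \<longrightarrow> ev (U (N q) (PPair (PBag B) PStar)) [] = 0)"
    "isol n1 n2 (\<lambda>q x. ev (U (N q) (PPair (PBag {#x#}) PStar)) []) b"
    using assms(2) unfolding def_neg_def by blast
  let ?a = "\<lambda>q. App (Go (Var 0)) (P q)"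
  let ?b = "\<lambda>q. App (N q) (Stop (?a q))"
  let ?\<tau> = "Lolli \<phi> \<sigma>"
  let ?T = "\<lambda>q. Lam (Bang ?\<tau>) (?b q)"
  let ?N = "\<lambda>q d. ev (U (N q) (PPair (PBag {#d#}) PStar)) []"
  have a: "ev (U (?a q) d) [PBag B] = (\<Sum>\<^sup>+ x. if B = {#PPair x d#} then ev (U (P q) x) [] else 0)" if "valid q" for q d B
  proof -
    have wk: "wk 0 (U (P q) x)" for x using wk_U[of "[]" "P q"] P(2) that by auto
    have "ev (U (?a q) d) [PBag B] = (\<Sum>\<^sup>+ x. ev (U (P q) x * U (Go (Var 0)) (PPair x d)) [PBag B])"
      by (simp add: ev_simps mult.commute)
    also have "\<dots> = (\<Sum>\<^sup>+ x. if B = {#PPair x d#} then ev (U (P q) x) [] else 0)"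
      unfolding ev_mult_wk0[OF wk] by (intro nn_integral_cong) (auto simp: ev_var_0)
    finally show ?thesis .
  qed
  have b: "ev (U (?b q) PStar) [PBag B] =
     (\<Sum>\<^sup>+ d. \<Sum>\<^sup>+ x. if B = {#PPair x d#} then ev (U (P q) x) [] * ?N q d else 0)" if q: "valid q" for q B
  proof -
    have ty: "[] \<turnstile> N q : Lolli (Bang \<sigma>) (Pos One)" using N(2) q by auto
    have "ev (U (?b q) PStar) [PBag B] = (\<Sum>\<^sup>+ y. ev (U (N q) (PPair y PStar)) [] * ev (U (Stop (?a q)) y) [PBag B])"
      by (rule ev_app_closed[OF ty])
    also have "\<dots> = (\<Sum>\<^sup>+ d. ?N q d * ev (U (Stop (?a q)) (PBag {#d#})) [PBag B])"
    proof (rule sum_reindex)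
      fix y assume y: "y \<notin> range (\<lambda>d. PBag {#d#})"
      show "ev (U (N q) (PPair y PStar)) [] * ev (U (Stop (?a q)) y) [PBag B] = 0"
      proof (cases "\<exists>D. y = PBag D")
        case True
        then obtain D where D: "y = PBag D" by blast
        then have "size D \<noteq> 1" using y size_1_singleton_mset[of D] by auto
        then show ?thesis using N(2) q D by auto
      next
        case False
        then show ?thesis by (auto simp: ev_simps split: pt.split)
      qed
    qed (auto simp: inj_def)
    also have "\<dots> = (\<Sum>\<^sup>+ d. ?N q d * ev (U (?a q) d) [PBag B])" by simp
    also have "\<dots> = (\<Sum>\<^sup>+ d. \<Sum>\<^sup>+ x. if B = {#PPair x d#} then ev (U (P q) x) [] * ?N q d else 0)"
      unfolding a[OF q] nn_integral_cmult[OF borel_measurable_count_space, symmetric]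
      by (intro nn_integral_cong) (auto simp: mult.commute)
    finally show ?thesis .
  qed
  have "isol n n2 (\<lambda>q z. ev (U (?b q) PStar) [PBag {#z#}]) (case (a, b) of (x, y) \<Rightarrow> PPair x y)"
  proof (rule isol_inj[OF isol_times[OF P(3) N(3) P(1) N(1)]])
    fix q and p :: "pt \<times> pt" assume q: "valid q"
    obtain x y where p: "p = (x, y)" by fastforce
    have "(\<Sum>\<^sup>+ d. \<Sum>\<^sup>+ u. if {#PPair x y#} = {#PPair u d#} then ev (U (P q) u) [] * ?N q d else 0) =
        (\<Sum>\<^sup>+ d. \<Sum>\<^sup>+ u. if d = y then if u = x then ev (U (P q) u) [] * ?N q d else 0 else 0)"
      by (intro nn_integral_cong) auto
    then show "ev (U (?b q) PStar) [PBag {#case p of (x, y) \<Rightarrow> PPair x y#}] =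
        (case p of (x, y) \<Rightarrow> ev (U (P q) x) [] * ?N q y)"
      unfolding p prod.case b[OF q] by (simp only: csum_if csum_if_eq)
  next
    fix q z assume q: "valid q" and z: "z \<notin> range (\<lambda>(x, y). PPair x y)"
    have "z \<noteq> PPair x d" for x d using z by auto
    then show "ev (U (?b q) PStar) [PBag {#z#}] = 0" unfolding b[OF q] by (intro csum_0I) auto
  qed (auto simp: inj_def)
  then have "isol n n2 (\<lambda>q x. ev (U (?T q) (PPair (PBag {#x#}) PStar)) []) (PPair a b)"
    unfolding ev_Lam using isol_restrict[where P = "\<lambda>x. pw (Bang ?\<tau>) (PBag {#x#})"] assms(5,6)
    by (simp add: pw_simps)
  moreover have "ev (U (?T q) (PPair (PBag B) PStar)) [] = 0" if "valid q" "size B \<noteq> 1" for q B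
    unfolding ev_Lam b[OF that(1)] using that(2) by (auto intro!: csum_0I)
  moreover have "valid q \<Longrightarrow> [] \<turnstile> ?T q : Lolli (Bang ?\<tau>) (Pos One)" for q
    using P(2) N(2) assms(3,4)
    by (auto intro!: typing.t_lam typing.t_app[OF typing_weaken_closed
          typing.t_stop[OF typing.t_app[OF typing.t_go[OF typing_Var0] typing_weaken_closed]]])
  ultimately show "\<exists>n'\<ge>n. \<exists>T. (\<forall>q. valid q \<longrightarrow> [] \<turnstile> T q : Lolli (Bang ?\<tau>) (Pos One) \<and>
       (\<forall>B. size B \<noteq> 1 \<longrightarrow> ev (U (T q) (PPair (PBag B) PStar)) [] = 0)) \<and>
     isol n n' (\<lambda>q x. ev (U (T q) (PPair (PBag {#x#}) PStar)) []) (PPair a b)"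
    using P(1) N(1) by (intro exI[of _ n2] conjI exI[of _ ?T]) auto
qed

subsection \<open>Producing bags\<close>

text \<open>Extraction of the part of a series multiplied by \<open>\<mu>\<close>, where \<open>\<mu>\<close> contains the variable \<open>v\<close>
  once. On series whose monomials without \<open>v\<close> only use the variables in \<open>S\<close>, it is a derivation.\<close>

definition dpart :: "nat set \<Rightarrow> nat multiset \<Rightarrow> pser \<Rightarrow> pser" where
  "dpart S \<mu> c = Ser (\<lambda>s. if set_mset s \<subseteq> S then cf c (\<mu> + s) else 0)"

definition rigid :: "nat \<Rightarrow> nat set \<Rightarrow> pser \<Rightarrow> bool" where
  "rigid v S c \<longleftrightarrow> (\<forall>m. cf c m \<noteq> 0 \<longrightarrow> v \<notin># m \<longrightarrow> set_mset m \<subseteq> S)"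

lemma over_dpart: "over S (dpart S \<mu> c)"
  by (simp add: over_def dpart_def)

lemma rigid_1: "rigid v S 1"
  by (simp add: rigid_def cf_1 pemp_multiset_def)

lemma rigid_mult: "rigid v S c \<Longrightarrow> rigid v S d \<Longrightarrow> rigid v S (c * d)"
  unfolding rigid_def cf_times csum_neq_0_iff padd_multiset_def by (fastforce split: if_splits)

lemma rigid_prod: "(\<And>x. rigid v S (z x)) \<Longrightarrow> rigid v S (\<Prod>x\<in>#B. z x)"
  by (induction B) (auto intro: rigid_1 rigid_mult)

lemma dpart_empty_mult: "dpart S {#} (c * d) = dpart S {#} c * dpart S {#} d"
proof (rule ser_eqI)
  fix s
  show "cf (dpart S {#} (c * d)) s = cf (dpart S {#} c * dpart S {#} d) s"
  proof (cases "set_mset s \<subseteq> S")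
    case True
    then show ?thesis
      by (simp add: dpart_def[of S _ "c * d"] cf_times padd_multiset_def)
         (intro nn_integral_cong, auto simp: dpart_def)
  next
    case False
    then have "cf (dpart S {#} c * dpart S {#} d) s = 0"
      using over_mult[OF over_dpart over_dpart, of S "{#}" c "{#}" d] by (auto simp: over_def)
    then show ?thesis using False by (simp add: dpart_def)
  qed
qed

lemma dpart_empty_prod: "dpart S {#} (\<Prod>x\<in>#B. z x) = (\<Prod>x\<in>#B. dpart S {#} (z x))"
proof (induction B)
  case empty
  show ?case by (rule ser_eqI) (auto simp: dpart_def cf_1 pemp_multiset_def)
qed (simp add: dpart_empty_mult)

context
  fixes v :: nat and S :: "nat set" and \<mu> :: "nat multiset"
  assumes \<mu>: "count \<mu> v = 1" "set_mset \<mu> \<inter> S = {}"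
begin

text \<open>As v occurs once in \<mu> and lies in x, it is absent from y. Rigidity then places y
  inside S, which is disjoint from \<mu>, so all of \<mu> comes from x.\<close>

lemma dpart_half:
  assumes "rigid v S d" "set_mset s \<subseteq> S"
  shows "(\<Sum>\<^sup>+ x. \<Sum>\<^sup>+ y. if \<mu> + s = x + y \<and> v \<in># x then cf c x * cf d y else 0) =
    cf (dpart S \<mu> c * dpart S {#} d) s"
proof -
  let ?f = "\<lambda>x y. if \<mu> + s = x + y \<and> v \<in># x then cf c x * cf d y else 0"
  have v: "v \<in># \<mu>" using \<mu>(1) by (metis count_inI zero_neq_one)
  then have vS: "v \<notin> S" using \<mu>(2) by auto
  then have vs: "count s v = 0" using assms(2) by (auto simp: count_eq_zero_iff)
  have "?f x y = 0" if x: "x \<notin> range ((+) \<mu>)" for x y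
  proof (rule ccontr)
    assume "?f x y \<noteq> 0"
    then have *: "\<mu> + s = x + y" "v \<in># x" "cf d y \<noteq> 0" by (auto split: if_splits)
    have "count (\<mu> + s) v = count (x + y) v" using *(1) by simp
    then have "count x v + count y v = 1" using \<mu>(1) vs by simp
    moreover have "1 \<le> count x v" using *(2) by simp
    ultimately have "count y v = 0" by linarith
    then have "v \<notin># y" by (simp add: not_in_iff)
    then have y: "set_mset y \<subseteq> S" using assms(1) *(3) by (auto simp: rigid_def)
    have "\<mu> \<subseteq># x"
    proof (rule mset_subset_eqI)
      fix e
      show "count \<mu> e \<le> count x e"
      proof (cases "e \<in># \<mu>")
        case True
        then have "count y e = 0" using y \<mu>(2) by (auto simp: count_eq_zero_iff)
        moreover have "count (\<mu> + s) e = count (x + y) e" using *(1) by simp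
        ultimately show ?thesis by simp
      qed (simp add: not_in_iff)
    qed
    then have "x = \<mu> + (x - \<mu>)" by simp
    then show False using x by (metis rangeI)
  qed
  then have "(\<Sum>\<^sup>+ x. \<Sum>\<^sup>+ y. ?f x y) = (\<Sum>\<^sup>+ x. \<Sum>\<^sup>+ y. ?f (\<mu> + x) y)"
    by (intro sum_reindex csum_0I) (auto simp: inj_def)
  also have "\<dots> = cf (dpart S \<mu> c * dpart S {#} d) s"
    unfolding cf_times padd_multiset_def
    by (intro nn_integral_cong) (use assms(2) v in \<open>auto simp: dpart_def add.assoc\<close>)
  finally show ?thesis .
qed

text \<open>The Leibniz rule: the single v of \<mu> stems from exactly one of the two
  factors.\<close>

lemma dpart_mult:
  assumes c: "rigid v S c" and d: "rigid v S d"
  shows "dpart S \<mu> (c * d) = dpart S \<mu> c * dpart S {#} d + dpart S {#} c * dpart S \<mu> d"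
proof (rule ser_eqI)
  fix s
  show "cf (dpart S \<mu> (c * d)) s = cf (dpart S \<mu> c * dpart S {#} d + dpart S {#} c * dpart S \<mu> d) s"
  proof (cases "set_mset s \<subseteq> S")
    case True
    have v: "v \<in># \<mu>" using \<mu>(1) by (metis count_inI zero_neq_one)
    then have vs: "count s v = 0" using True \<mu>(2) by (auto simp: count_eq_zero_iff)
    have ex: "v \<in># x \<longleftrightarrow> v \<notin># y" if "\<mu> + s = x + y" for x y
    proof -
      have "count (\<mu> + s) v = count (x + y) v" using that by simp
      then have "count x v + count y v = 1" using \<mu>(1) vs by simp
      then have "count x v = 1 \<and> count y v = 0 \<or> count x v = 0 \<and> count y v = 1" by linarith
      then show ?thesis by (metis count_eq_zero_iff zero_neq_one)
    qed
    have "cf (dpart S \<mu> (c * d)) s = (\<Sum>\<^sup>+ x. \<Sum>\<^sup>+ y. if \<mu> + s = x + y then cf c x * cf d y else 0)"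
      using True by (simp add: dpart_def cf_times padd_multiset_def)
    also have "\<dots> = (\<Sum>\<^sup>+ x. \<Sum>\<^sup>+ y. (if \<mu> + s = x + y \<and> v \<in># x then cf c x * cf d y else 0) +
        (if \<mu> + s = y + x \<and> v \<in># y then cf d y * cf c x else 0))"
    proof (intro nn_integral_cong)
      fix x y :: "nat multiset"
      have c: "y + x = x + y" by (rule add.commute)
      show "(if \<mu> + s = x + y then cf c x * cf d y else 0) =
          (if \<mu> + s = x + y \<and> v \<in># x then cf c x * cf d y else 0) +
          (if \<mu> + s = y + x \<and> v \<in># y then cf d y * cf c x else 0)"
        unfolding c mult.commute[of "cf d y"] using ex[of x y] by (cases "\<mu> + s = x + y"; cases "v \<in># x") simp_all
    qed
    also have "\<dots> = (\<Sum>\<^sup>+ x. \<Sum>\<^sup>+ y. if \<mu> + s = x + y \<and> v \<in># x then cf c x * cf d y else 0) +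
        (\<Sum>\<^sup>+ x. \<Sum>\<^sup>+ y. if \<mu> + s = y + x \<and> v \<in># y then cf d y * cf c x else 0)"
      by (simp add: nn_integral_add)
    also have "(\<Sum>\<^sup>+ x. \<Sum>\<^sup>+ y. if \<mu> + s = y + x \<and> v \<in># y then cf d y * cf c x else 0) =
        (\<Sum>\<^sup>+ y. \<Sum>\<^sup>+ x. if \<mu> + s = y + x \<and> v \<in># y then cf d y * cf c x else 0)" by (rule sum_swap)
    finally show ?thesis
      by (simp only: dpart_half[OF c True] dpart_half[OF d True] cf_plus mult.commute[of "dpart S \<mu> d"])
  next
    case False
    then have "cf (dpart S \<mu> c * dpart S {#} d + dpart S {#} c * dpart S \<mu> d) s = 0"
      using over_mult[OF over_dpart over_dpart, of S \<mu> c "{#}" d]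
        over_mult[OF over_dpart over_dpart, of S "{#}" c \<mu> d] by (auto simp: over_def)
    then show ?thesis using False by (simp add: dpart_def)
  qed
qed

text \<open>The derivative of a product over a bag. Any one of the occurrences of a may be the
  differentiated factor; all other elements have derivative 0.\<close>

lemma dpart_prod:
  assumes z: "\<And>x. rigid v S (z x)" "\<And>x. dpart S {#} (z x) = y x"
    "\<And>x. dpart S \<mu> (z x) = (if x = a then scal \<kappa> 1 else 0)"
  shows "dpart S \<mu> (\<Prod>x\<in>#B. z x) = scal (of_nat (count B a) * \<kappa>) (\<Prod>x\<in>#B - {#a#}. y x)"
proof (induction B)
  case empty
  have "\<mu> \<noteq> {#}" using \<mu>(1) by auto
  then show ?case by (intro ser_eqI) (simp add: dpart_def cf_1 pemp_multiset_def)
next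
  case (add b B)
  have "dpart S \<mu> (\<Prod>x\<in>#add_mset b B. z x) =
      (if b = a then scal \<kappa> 1 else 0) * (\<Prod>x\<in>#B. y x) +
      y b * scal (of_nat (count B a) * \<kappa>) (\<Prod>x\<in>#B - {#a#}. y x)"
    using z by (simp add: dpart_mult rigid_prod dpart_empty_prod add)
  also have "\<dots> = scal (of_nat (count (add_mset b B) a) * \<kappa>) (\<Prod>x\<in>#add_mset b B - {#a#}. y x)"
  proof (cases "b = a")
    case True
    have sc: "scal (x + x') r = scal x r + scal x' r" for x x' and r :: pser
      by (rule ser_eqI) (simp add: distrib_right)
    have "y a * scal (of_nat (count B a) * \<kappa>) (\<Prod>x\<in>#B - {#a#}. y x) = scal (of_nat (count B a) * \<kappa>) (\<Prod>x\<in>#B. y x)"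
    proof (cases "a \<in># B")
      case True
      then obtain B' where "B = add_mset a B'" by (meson mset_add)
      then show ?thesis by (simp add: mult_scal)
    next
      case False
      then have "count B a = 0" by (simp add: not_in_iff)
      then show ?thesis by simp
    qed
    then show ?thesis using True by (simp add: scal_mult sc distrib_right)
  next
    case False
    then have "add_mset b B - {#a#} = add_mset b (B - {#a#})" by simp
    then show ?thesis using False by (simp add: mult_scal)
  qed
  finally show ?case .
qed

end

lemma scal_prod:
  fixes f :: "'a \<Rightarrow> 'b :: pcm ser"
  shows "(\<Prod>x\<in>#B. scal c (f x)) = scal (c ^ size B) (\<Prod>x\<in>#B. f x)"
proof (induction B)
  case (add b B)
  have "scal x (scal x' r) = scal (x * x') r" for x x' and r :: "'b ser"
    by (rule ser_eqI) (simp add: mult.assoc)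
  then show ?case using add by (simp add: scal_mult mult_scal power_Suc2 del: power_Suc)
qed simp

text \<open>The mixture for a # as throws a fair coin between the family for a, guarded by a fresh
  coin of bias q n, and the mixture for as. Every monomial of the guarded branch contains n exactly
  once, so the derivation at the monomial of a extended by n selects one factor a of the product
  over B and leaves the other branch for all remaining factors, where induction applies.\<close>

lemma def_mix:
  assumes "\<And>x. x \<in> set as \<Longrightarrow> def_pos \<sigma> x" "gclosed \<sigma>"
  shows "\<exists>n'\<ge>n. \<exists>P C m \<kappa>. (\<forall>q. valid q \<longrightarrow> [] \<turnstile> P q : \<sigma> \<and> (\<forall>x. ev (U (P q) x) [] = evq (qv q) (C x))) \<and>
    (\<forall>x. over {n..<n'} (C x)) \<and> set_mset m \<subseteq> {n..<n'} \<and> 0 < \<kappa> \<and> \<kappa> < \<infinity> \<and>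
    (\<forall>B. cf (\<Prod>x\<in>#B. C x) m = (if B = mset as then \<kappa> else 0))"
  using assms(1)
proof (induction as arbitrary: n)
  case Nil
  \<comment> \<open>A diverging term makes the product vanish on every bag except the empty one,
    where it is 1.\<close>
  have "cf (\<Prod>x\<in>#B. 0 :: pser) {#} = (if B = {#} then 1 else 0)" for B :: "pt multiset"
    by (cases "B = {#}") (auto simp: cf_1 pemp_multiset_def power_0_left)
  then show ?case
    by (intro exI[of _ n] conjI exI[of _ "\<lambda>_. diverge \<sigma>"] exI[of _ "\<lambda>_. 0"] exI[of _ "{#}"] exI[of _ 1])
       (auto simp: typing_diverge assms(2) ev_diverge evq_simps over_simps)
next
  case (Cons a as)
  have "def_pos \<sigma> a" using Cons.prems by simp
  \<comment> \<open>Parameter n is set aside for the guard.\<close>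
  then obtain n1 P where P: "Suc n \<le> n1" "\<forall>q. valid q \<longrightarrow> [] \<turnstile> P q : \<sigma>" "isol (Suc n) n1 (\<lambda>q x. ev (U (P q) x) []) a"
    unfolding def_pos_def by blast
  obtain C m \<kappa> where C: "\<And>q x. valid q \<Longrightarrow> ev (U (P q) x) [] = evq (qv q) (C x)" "\<And>x. over {Suc n..<n1} (C x)"
    "set_mset m \<subseteq> {Suc n..<n1}" "0 < \<kappa>" "\<kappa> < \<infinity>" "\<And>x. cf (C x) m = (if x = a then \<kappa> else 0)"
    using isolE[OF P(3)] by blast
  have "\<exists>n2\<ge>n1. \<exists>P C m \<kappa>. (\<forall>q. valid q \<longrightarrow> [] \<turnstile> P q : \<sigma> \<and> (\<forall>x. ev (U (P q) x) [] = evq (qv q) (C x))) \<and>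
    (\<forall>x. over {n1..<n2} (C x)) \<and> set_mset m \<subseteq> {n1..<n2} \<and> 0 < \<kappa> \<and> \<kappa> < \<infinity> \<and>
    (\<forall>B. cf (\<Prod>x\<in>#B. C x) m = (if B = mset as then \<kappa> else 0))"
    by (rule Cons.IH) (simp add: Cons.prems)
  then obtain n2 Q D m' \<kappa>' where Q0: "n1 \<le> n2"
    "\<forall>q. valid q \<longrightarrow> [] \<turnstile> Q q : \<sigma> \<and> (\<forall>x. ev (U (Q q) x) [] = evq (qv q) (D x))"
    "\<forall>x. over {n1..<n2} (D x)" "set_mset m' \<subseteq> {n1..<n2}" "0 < \<kappa>'" "\<kappa>' < \<infinity>"
    "\<forall>B. cf (\<Prod>x\<in>#B. D x) m' = (if B = mset as then \<kappa>' else 0)"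
    by blast
  then have Q: "n1 \<le> n2"
    "\<And>q. valid q \<Longrightarrow> [] \<turnstile> Q q : \<sigma>" "\<And>q x. valid q \<Longrightarrow> ev (U (Q q) x) [] = evq (qv q) (D x)"
    "\<And>x. over {n1..<n2} (D x)" "set_mset m' \<subseteq> {n1..<n2}" "0 < \<kappa>'" "\<kappa>' < \<infinity>"
    "\<And>B. cf (\<Prod>x\<in>#B. D x) m' = (if B = mset as then \<kappa>' else 0)"
    by blast+
  let ?h = "ennreal (real_of_rat (1 / 2))"
  define R where "R q = choice (1 / 2) (choice (q n) (P q) (diverge \<sigma>)) (Q q)" for q :: "nat \<Rightarrow> rat"
  define z where "z x = scal ?h (pvar n * C x) + scal ?h (D x)" for x
  define \<mu> where "\<mu> = add_mset n m"
  \<comment> \<open>The factors are the number of occurrences of a that can be differentiated, the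
    weight of the guarded branch with the coefficient for a, and one factor 1/2 for each remaining
    element together with the coefficient for the rest.\<close>
  define K where "K = of_nat (count (mset (a # as)) a) * (?h * \<kappa>) * (?h ^ length as * \<kappa>')"
  have half: "real_of_rat (1 / 2) = 1 / 2" by (simp add: of_rat_divide)
  have ty: "[] \<turnstile> P q : \<sigma>" "[] \<turnstile> Q q : \<sigma>" "[] \<turnstile> choice (q n) (P q) (diverge \<sigma>) : \<sigma>" if "valid q" for q
    using that P(2) Q(2) assms(2) by (auto simp: valid_def intro!: typing_choice typing_diverge)
  have R: "[] \<turnstile> R q : \<sigma>" "ev (U (R q) x) [] = evq (qv q) (z x)" if q: "valid q" for q x
  proof -
    show "[] \<turnstile> R q : \<sigma>" using ty[OF q] by (auto simp: R_def intro!: typing_choice)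
    show "ev (U (R q) x) [] = evq (qv q) (z x)"
      unfolding R_def ev_choice[OF ty(3)[OF q] ty(2)[OF q]] ev_choice[OF ty(1)[OF q] typing_diverge[OF assms(2)]] z_def
      using C(1)[OF q] Q(3)[OF q]
      by (simp add: evq_simps evq_mult evq_pvar ev_diverge qv_def)
  qed
  have z_over: "over {n..<n2} (z x)" for x
    unfolding z_def using P(1) Q(1) over_mono[OF C(2), of "{n..<n2}"] over_mono[OF Q(4), of "{n..<n2}"]
    by (intro over_simps over_mult) auto
  have \<mu>: "count \<mu> n = 1" "set_mset \<mu> \<inter> {n1..<n2} = {}"
    using C(3) P(1) by (auto simp: \<mu>_def count_eq_zero_iff)
  have pv: "cf (pvar n * C x) (add_mset n m0) = cf (C x) m0" for x m0
  proof -
    have "cf (pvar n * C x) (add_mset n m0) = (\<Sum>\<^sup>+ u. \<Sum>\<^sup>+ w. if u = {#n#} then if w = m0 then cf (C x) w else 0 else 0)"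
      unfolding cf_times padd_multiset_def by (intro nn_integral_cong) (auto simp: pvar_def)
    then show ?thesis by (simp only: csum_if csum_if_eq)
  qed
  have pv0: "n \<in># m0" if "cf (pvar n * C x) m0 \<noteq> 0" for x m0
    using that unfolding cf_times csum_neq_0_iff padd_multiset_def by (auto simp: pvar_def split: if_splits)
  have rig: "rigid n {n1..<n2} (z x)" for x
    unfolding rigid_def using pv0[of x] Q(4)[of x] by (auto simp: z_def over_def)
  have z0: "dpart {n1..<n2} {#} (z x) = scal ?h (D x)" for x
  proof (rule ser_eqI)
    fix s
    have "cf (pvar n * C x) s = 0" if "set_mset s \<subseteq> {n1..<n2}"
    proof (rule ccontr)
      assume "cf (pvar n * C x) s \<noteq> 0"
      then have "n \<in> {n1..<n2}" using pv0 that by blast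
      then show False using P(1) by simp
    qed
    moreover have "cf (D x) s = 0" if "\<not> set_mset s \<subseteq> {n1..<n2}" using Q(4)[of x] that by (auto simp: over_def)
    ultimately show "cf (dpart {n1..<n2} {#} (z x)) s = cf (scal ?h (D x)) s" by (auto simp: dpart_def z_def)
  qed
  \<comment> \<open>Only the guarded branch contains n. Whatever is left after \<mu> would be a
    monomial over both of the disjoint intervals, hence is empty; so the derivative is a constant,
    and it is nonzero only at a.\<close>
  have z1: "dpart {n1..<n2} \<mu> (z x) = (if x = a then scal (?h * \<kappa>) 1 else 0)" for x
  proof (rule ser_eqI)
    fix s
    have D0: "cf (D x) (\<mu> + s) = 0"
    proof (rule ccontr)
      assume "cf (D x) (\<mu> + s) \<noteq> 0"
      then have "set_mset (\<mu> + s) \<subseteq> {n1..<n2}" using Q(4)[of x] unfolding over_def by blast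
      then show False using P(1) by (simp add: \<mu>_def)
    qed
    have "cf (C x) (m + s) = 0" if sS: "set_mset s \<subseteq> {n1..<n2}" and s0: "s \<noteq> {#}"
    proof (rule ccontr)
      assume "cf (C x) (m + s) \<noteq> 0"
      then have "set_mset (m + s) \<subseteq> {Suc n..<n1}" using C(2)[of x] unfolding over_def by blast
      then have "set_mset s \<subseteq> {Suc n..<n1}" by simp
      moreover obtain e where "e \<in># s" using s0 by blast
      ultimately have "e \<in> {Suc n..<n1}" "e \<in> {n1..<n2}" using sS by blast+
      then show False by simp
    qed
    then show "cf (dpart {n1..<n2} \<mu> (z x)) s = cf (if x = a then scal (?h * \<kappa>) 1 else 0) s"
      using C(6)[of x] D0 by (auto simp: dpart_def z_def \<mu>_def pv cf_1 pemp_multiset_def)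
  qed
  have coeff: "cf (\<Prod>x\<in>#B. z x) (\<mu> + m') = (if B = mset (a # as) then K else 0)" for B
  proof -
    have "cf (\<Prod>x\<in>#B. z x) (\<mu> + m') = cf (dpart {n1..<n2} \<mu> (\<Prod>x\<in>#B. z x)) m'"
      using Q(5) by (simp add: dpart_def)
    also have "\<dots> = of_nat (count B a) * (?h * \<kappa>) * cf (\<Prod>x\<in>#B - {#a#}. scal ?h (D x)) m'"
      by (simp add: dpart_prod[OF \<mu> rig z0 z1])
    finally have eq: "cf (\<Prod>x\<in>#B. z x) (\<mu> + m') = of_nat (count B a) * (?h * \<kappa>) *
        (?h ^ size (B - {#a#}) * (if B - {#a#} = mset as then \<kappa>' else 0))" by (simp add: scal_prod Q(8))
    show ?thesis
    proof (cases "a \<in># B")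
      case True
      then obtain B' where "B = add_mset a B'" by (meson mset_add)
      then show ?thesis unfolding eq by (auto simp: K_def)
    next
      case False
      then have "count B a = 0" "B \<noteq> mset (a # as)" by (auto simp: not_in_iff)
      then show ?thesis unfolding eq by simp
    qed
  qed
  have "0 < K" "K < \<infinity>"
  proof -
    have mult: "0 < x * y \<and> x * y < \<infinity>" if "0 < x \<and> x < \<infinity>" "0 < y \<and> y < \<infinity>" for x y :: ennreal
      using that by (simp add: ennreal_zero_less_mult_iff ennreal_mult_less_top)
    have h: "0 < ?h \<and> ?h < \<infinity>" by (simp only: half ennreal_less_zero_iff infinity_ennreal_def ennreal_less_top) simp
    have pow: "0 < ?h ^ l \<and> ?h ^ l < \<infinity>" for l
    proof (induction l)
      case (Suc l)
      then show ?case unfolding power_Suc by (rule mult[OF h])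
    qed simp
    have k: "0 < \<kappa> \<and> \<kappa> < \<infinity>" "0 < \<kappa>' \<and> \<kappa>' < \<infinity>" using C(4,5) Q(6,7) by blast+
    have c: "0 < (of_nat (count (mset (a # as)) a) :: ennreal) \<and> (of_nat (count (mset (a # as)) a) :: ennreal) < \<infinity>"
      by (auto simp: of_nat_less_top simp del: of_nat_Suc)
    from mult[OF mult[OF c mult[OF h k(1)]] mult[OF pow k(2)]] show "0 < K" "K < \<infinity>" unfolding K_def by blast+
  qed
  moreover have "set_mset (\<mu> + m') \<subseteq> {n..<n2}" using C(3) Q(1,5) P(1) by (auto simp: \<mu>_def subset_iff)
  moreover have "n \<le> n2" using P(1) Q(1) by linarith
  moreover have "\<forall>q. valid q \<longrightarrow> [] \<turnstile> R q : \<sigma> \<and> (\<forall>x. ev (U (R q) x) [] = evq (qv q) (z x))" using R by blast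
  moreover have "\<forall>x. over {n..<n2} (z x)" using z_over by blast
  moreover have "\<forall>B. cf (\<Prod>x\<in>#B. z x) (\<mu> + m') = (if B = mset (a # as) then K else 0)" using coeff by blast
  ultimately show ?case by blast
qed

text \<open>The entry of \<open>Stop\<close> at a bag is the product of entries for which the
  mixture was designed.\<close>

lemma def_pos_bang:
  assumes "\<And>x. x \<in># B \<Longrightarrow> def_pos \<sigma> x" "gclosed \<sigma>"
  shows "def_pos (Pos (Bang \<sigma>)) (PBag B)"
  unfolding def_pos_def
proof (intro allI)
  fix n
  obtain as where as: "mset as = B" using ex_mset by blast
  have "\<And>x. x \<in> set as \<Longrightarrow> def_pos \<sigma> x" using assms(1) as by auto
  then obtain n1 P C m \<kappa> where P: "n \<le> n1"
    "\<forall>q. valid q \<longrightarrow> [] \<turnstile> P q : \<sigma> \<and> (\<forall>x. ev (U (P q) x) [] = evq (qv q) (C x))"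
    "\<And>x. over {n..<n1} (C x)" "set_mset m \<subseteq> {n..<n1}" "0 < \<kappa>" "\<kappa> < \<infinity>"
    "\<And>B'. cf (\<Prod>x\<in>#B'. C x) m = (if B' = B then \<kappa> else 0)"
    using def_mix[where as = as and \<sigma> = \<sigma> and n = n, OF _ assms(2)] unfolding as by blast
  have "isol n n1 (\<lambda>q B. \<Prod>x\<in>#B. ev (U (P q) x) []) B"
    by (rule isolI[where C = "\<lambda>B. \<Prod>x\<in>#B. C x" and m = m and \<kappa> = \<kappa>])
       (use P in \<open>auto simp: evq_prod intro: over_prod\<close>)
  then have "isol n n1 (\<lambda>q x. ev (U (Stop (P q)) x) []) (PBag B)"
    by (rule isol_inj) (auto simp: inj_def ev_prod_Nil ev_simps image_iff split: pt.split)
  then show "\<exists>n'\<ge>n. \<exists>P. (\<forall>q. valid q \<longrightarrow> [] \<turnstile> P q : Pos (Bang \<sigma>)) \<and> isol n n' (\<lambda>q x. ev (U (P q) x) []) (PBag B)"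
    using P(1,2) by (intro exI[of _ n1] conjI exI[of _ "\<lambda>q. Stop (P q)"]) (auto intro: typing.intros)
qed

text \<open>Induction on the bag: the variable is shared between a linear test, which consumes one
  element, and the test for the rest.\<close>

lemma def_test_bang:
  assumes "\<And>x. x \<in># B \<Longrightarrow> def_neg \<sigma> x \<and> gw \<sigma> x" "gclosed \<sigma>"
  shows "def_test (Bang \<sigma>) (PBag B)"
  using assms(1)
proof (induction B)
  case empty
  show ?case unfolding def_test_def
  proof (intro allI)
    fix n
    let ?T = "Lam (Bang \<sigma>) Unit"
    have "ev (U ?T (PPair x PStar)) [] = (if x = PBag {#} then 1 else 0)" for x
      unfolding ev_Lam by (auto simp: ev_simps pw_simps)
    then have "isol n n (\<lambda>q x. ev (U ?T (PPair x PStar)) []) (PBag {#})" by (simp only: isol_const)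
    moreover have "[] \<turnstile> ?T : Lolli (Bang \<sigma>) (Pos One)" using assms(2) by (auto intro: typing.intros)
    ultimately show "\<exists>n'\<ge>n. \<exists>T. (\<forall>q. valid q \<longrightarrow> [] \<turnstile> T q : Lolli (Bang \<sigma>) (Pos One)) \<and>
        isol n n' (\<lambda>q x. ev (U (T q) (PPair x PStar)) []) (PBag {#})"
      by (intro exI[of _ n] conjI exI[of _ "\<lambda>_. ?T"]) auto
  qed
next
  case (add a B)
  show ?case unfolding def_test_def
  proof (intro allI)
    fix n
    have "def_test (Bang \<sigma>) (PBag B)" using add by simp
    then obtain n1 T where T: "n \<le> n1" "\<forall>q. valid q \<longrightarrow> [] \<turnstile> T q : Lolli (Bang \<sigma>) (Pos One)"
      "isol n n1 (\<lambda>q x. ev (U (T q) (PPair x PStar)) []) (PBag B)"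
      unfolding def_test_def by blast
    have "def_neg \<sigma> a" using add.prems by simp
    then obtain n2 N where N: "n1 \<le> n2" "\<forall>q. valid q \<longrightarrow> [] \<turnstile> N q : Lolli (Bang \<sigma>) (Pos One) \<and>
         (\<forall>B. size B \<noteq> 1 \<longrightarrow> ev (U (N q) (PPair (PBag B) PStar)) [] = 0)"
      "isol n1 n2 (\<lambda>q x. ev (U (N q) (PPair (PBag {#x#}) PStar)) []) a"
      unfolding def_neg_def by blast
    let ?b = "\<lambda>q. seq (App (N q) (Var 0)) (App (T q) (Var (Suc 0)))"
    let ?T = "\<lambda>q. Lam (Bang \<sigma>) (?b q)"
    \<comment> \<open>The default \<open>PStar\<close> is not a bag, so a first component that is
      not a bag never contributes.\<close>
    let ?f = "\<lambda>(y, u). case y of PBag B \<Rightarrow> PBag (add_mset u B) | _ \<Rightarrow> PStar"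
    let ?G = "\<lambda>q (y, u). ev (U (T q) (PPair y PStar)) [] * ev (U (N q) (PPair (PBag {#u#}) PStar)) []"
    have b: "ev (U (?b q) PStar) [PBag D] = (\<Sum>\<^sup>+ p. if PBag D = ?f p then ?G q p else 0)" if q: "valid q" for q D
    proof -
      have ty: "[] \<turnstile> T q : Lolli (Bang \<sigma>) (Pos One)" "[] \<turnstile> N q : Lolli (Bang \<sigma>) (Pos One)"
        using T(2) N(2) q by auto
      let ?t = "\<lambda>y. ev (U (T q) (PPair y PStar)) []" and ?n = "\<lambda>z. ev (U (N q) (PPair z PStar)) []"
      have "ev (U (?b q) PStar) [PBag D] = (\<Sum>\<^sup>+ y. \<Sum>\<^sup>+ z. if padd y z (PBag D) then ?t y * ?n z else 0)"
        unfolding ev_seq ev_app_Var0[OF ty(2)] ev_app_Var1[OF ty(1)] ..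
      also have "\<dots> = (\<Sum>\<^sup>+ y. \<Sum>\<^sup>+ u. if padd y (PBag {#u#}) (PBag D) then ?t y * ?n (PBag {#u#}) else 0)"
      proof (rule nn_integral_cong, rule sum_reindex)
        fix y z assume z: "z \<notin> range (\<lambda>u. PBag {#u#})"
        show "(if padd y z (PBag D) then ?t y * ?n z else 0) = 0"
        proof (cases "\<exists>E. z = PBag E")
          case True
          then obtain E where E: "z = PBag E" by blast
          then have "size E \<noteq> 1" using z size_1_singleton_mset[of E] by auto
          then show ?thesis using N(2) q E by auto
        next
          case False
          then show ?thesis by (auto simp: padd_pt_simps)
        qed
      qed (auto simp: inj_def)
      also have "\<dots> = (\<Sum>\<^sup>+ y. \<Sum>\<^sup>+ u. if PBag D = ?f (y, u) then ?G q (y, u) else 0)"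
      proof (intro nn_integral_cong)
        fix y u
        have "padd y (PBag {#u#}) (PBag D) \<longleftrightarrow> PBag D = ?f (y, u)"
          by (auto simp: padd_pt_simps split: pt.split)
        then show "(if padd y (PBag {#u#}) (PBag D) then ?t y * ?n (PBag {#u#}) else 0) =
            (if PBag D = ?f (y, u) then ?G q (y, u) else 0)" by simp
      qed
      finally show ?thesis unfolding csum_pair .
    qed
    \<comment> \<open>\<open>?f\<close> is not injective, since different elements of a bag may be
      the one consumed; the isolating monomial still sees only the pair formed by
      \<open>PBag B\<close> and a.\<close>
    have "isol n n2 (\<lambda>q x. if pw (Bang \<sigma>) x then \<Sum>\<^sup>+ p. if x = ?f p then ?G q p else 0 else 0) (?f (PBag B, a))"
      by (rule isol_restrict[OF isol_push[OF isol_times[OF T(3) N(3) T(1) N(1)]]])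
         (use add.prems in \<open>auto simp: pw_simps\<close>)
    then have "isol n n2 (\<lambda>q x. ev (U (?T q) (PPair x PStar)) []) (?f (PBag B, a))"
    proof (rule isol_cong)
      fix q x assume "valid q"
      then show "ev (U (?T q) (PPair x PStar)) [] = (if pw (Bang \<sigma>) x then \<Sum>\<^sup>+ p. if x = ?f p then ?G q p else 0 else 0)"
        unfolding ev_Lam using b[of q] by (auto simp: pw_simps simp del: U.simps)
    qed
    moreover have "valid q \<Longrightarrow> [] \<turnstile> ?T q : Lolli (Bang \<sigma>) (Pos One)" for q
      using T(2) N(2) assms(2) by (intro typing.t_lam typing_seq) (auto intro: typing_rules)
    ultimately show "\<exists>n'\<ge>n. \<exists>T. (\<forall>q. valid q \<longrightarrow> [] \<turnstile> T q : Lolli (Bang \<sigma>) (Pos One)) \<and>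
        isol n n' (\<lambda>q x. ev (U (T q) (PPair x PStar)) []) (PBag (add_mset a B))"
      using T(1) N(1) by (intro exI[of _ n2] conjI exI[of _ ?T]) auto
  qed
qed

text \<open>The contravariance of \<open>Lolli\<close> forces values and tests to be treated
  together: a value at a function point contains a test of its argument, and a test of a function
  contains an argument for it.\<close>

theorem definability:
  "pw \<phi> a \<Longrightarrow> pclosed \<phi> \<longrightarrow> def_pos (Pos \<phi>) a \<and> def_test \<phi> a"
  "gw \<sigma> a \<Longrightarrow> gclosed \<sigma> \<longrightarrow> def_pos \<sigma> a \<and> def_neg \<sigma> a"
proof (induction rule: pw_gw.inducts)
  case w_one
  then show ?case using def_one by blast
next
  case (w_bang b \<sigma>)
  then show ?case using def_pos_bang def_test_bang by auto
next
  case (w_tensor \<phi> a \<psi> b)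
  then show ?case using def_pos_tensor def_test_tensor pw_gw.w_tensor by auto
next
  case (w_plus i \<phi> \<psi> a)
  have "pclosed (Plus \<phi> \<psi>) \<Longrightarrow> pclosed (sel i \<phi> \<psi>)" by (cases i) auto
  then show ?case using w_plus def_pos_plus def_test_plus pw_gw.w_plus by auto
next
  case (w_mu \<phi> a)
  then show ?case using def_pos_mu def_test_mu pclosed_unfold pw_gw.w_mu by blast
next
  case (w_pos \<phi> a)
  then show ?case using def_neg_pos by auto
next
  case (w_lolli \<phi> a \<sigma> b)
  then show ?case using def_pos_lolli def_neg_lolli by auto
qed

text \<open>Linearity of the test reduces the sum over bags to a sum over single points, so the
  observed probability is linear in the denotation of M.\<close>

lemma test_value:
  assumes T: "[] \<turnstile> T : Lolli (Bang \<sigma>) (Pos One)" and M: "[] \<turnstile> M : \<sigma>"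
    and lin: "\<And>B. size B \<noteq> 1 \<Longrightarrow> ev (U T (PPair (PBag B) PStar)) [] = 0"
  shows "Red_inf (App T (Stop M)) Unit = (\<Sum>\<^sup>+ x. ev (U T (PPair (PBag {#x#}) PStar)) [] * ev (U M x) [])"
    and "Red_inf (App T (Stop M)) Unit \<le> 1"
proof -
  have ty: "[] \<turnstile> App T (Stop M) : Pos One" using T M by (auto intro: typing.intros)
  then show "Red_inf (App T (Stop M)) Unit \<le> 1" by (simp only: adequacy ev_le_1)
  have "Red_inf (App T (Stop M)) Unit = (\<Sum>\<^sup>+ y. ev (U T (PPair y PStar)) [] * ev (U (Stop M) y) [])"
    unfolding adequacy[OF ty] by (rule ev_app_closed[OF T])
  also have "\<dots> = (\<Sum>\<^sup>+ x. ev (U T (PPair (PBag {#x#}) PStar)) [] * ev (U (Stop M) (PBag {#x#})) [])"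
  proof (rule sum_reindex)
    fix y assume y: "y \<notin> range (\<lambda>d. PBag {#d#})"
    show "ev (U T (PPair y PStar)) [] * ev (U (Stop M) y) [] = 0"
    proof (cases "\<exists>D. y = PBag D")
      case True
      then obtain D where D: "y = PBag D" by blast
      then have "size D \<noteq> 1" using y size_1_singleton_mset[of D] by auto
      then show ?thesis using lin D by auto
    next
      case False
      then show ?thesis by (auto simp: ev_simps split: pt.split)
    qed
  qed (auto simp: inj_def)
  finally show "Red_inf (App T (Stop M)) Unit = (\<Sum>\<^sup>+ x. ev (U T (PPair (PBag {#x#}) PStar)) [] * ev (U M x) [])"
    by simp
qed

theorem theorem5p3:
  fixes \<sigma> :: gty and M1 M2 :: tm and u1 u2 :: vec
  assumes "gclosed \<sigma>"
    and "[] \<turnstile> M1 : \<sigma>"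
    and "[] \<turnstile> M2 : \<sigma>"
    and "\<And>C. [] \<turnstile> C : Lolli (Bang \<sigma>) (Pos One) \<Longrightarrow>
           Red_inf (App C (Stop M1)) Unit = Red_inf (App C (Stop M2)) Unit"
    and "closed_denotes M1 \<sigma> u1"
    and "closed_denotes M2 \<sigma> u2"
  shows "u1 = u2"
proof
  fix a
  have u: "u1 = (\<lambda>x. ev (U M1 x) [])" "u2 = (\<lambda>x. ev (U M2 x) [])"
    using closed_denotes_ev assms(5,6) by blast+
  show "u1 a = u2 a"
  proof (cases "gw \<sigma> a")
    case False
    then have "u1 a = 0" "u2 a = 0"
      using ev_support[OF assms(2), of "[]" a] ev_support[OF assms(3), of "[]" a] by (auto simp: u)
    then show ?thesis by simp
  next
    case True
    then have "def_neg \<sigma> a" using definability(2) assms(1) by blast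
    then obtain n T where T: "\<forall>q. valid q \<longrightarrow> [] \<turnstile> T q : Lolli (Bang \<sigma>) (Pos One) \<and>
         (\<forall>B. size B \<noteq> 1 \<longrightarrow> ev (U (T q) (PPair (PBag B) PStar)) [] = 0)"
      "isol 0 n (\<lambda>q x. ev (U (T q) (PPair (PBag {#x#}) PStar)) []) a"
      unfolding def_neg_def by blast
    obtain C m \<kappa> where C: "\<And>q x. valid q \<Longrightarrow> ev (U (T q) (PPair (PBag {#x#}) PStar)) [] = evq (qv q) (C x)"
      "\<And>x. over {0..<n} (C x)" "set_mset m \<subseteq> {0..<n}" "0 < \<kappa>" "\<kappa> < \<infinity>" "\<And>x. cf (C x) m = (if x = a then \<kappa> else 0)"
      using isolE[OF T(2)] by blast
    \<comment> \<open>The observed probability as a series in the coin parameters, depending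
      linearly on the denotation.\<close>
    define h where "h u = isum (\<lambda>x. scal (u x) (C x))" for u :: vec
    have h: "Red_inf (App (T q) (Stop M)) Unit = evq (qv q) (h (\<lambda>x. ev (U M x) []))" "evq (qv q) (h (\<lambda>x. ev (U M x) [])) \<le> 1"
      if "valid q" "[] \<turnstile> M : \<sigma>" for q M
    proof -
      have Tq: "[] \<turnstile> T q : Lolli (Bang \<sigma>) (Pos One)" "\<And>B. size B \<noteq> 1 \<Longrightarrow> ev (U (T q) (PPair (PBag B) PStar)) [] = 0"
        using T(1) that(1) by auto
      have "Red_inf (App (T q) (Stop M)) Unit =
          (\<Sum>\<^sup>+ x. ev (U (T q) (PPair (PBag {#x#}) PStar)) [] * ev (U M x) [])"
        by (rule test_value(1)[OF Tq(1) that(2)]) (rule Tq(2))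
      then show "Red_inf (App (T q) (Stop M)) Unit = evq (qv q) (h (\<lambda>x. ev (U M x) []))"
        unfolding h_def evq_simps C(1)[OF that(1)] by (simp only: mult.commute)
      moreover have "Red_inf (App (T q) (Stop M)) Unit \<le> 1"
        by (rule test_value(2)[OF Tq(1) that(2)]) (rule Tq(2))
      ultimately show "evq (qv q) (h (\<lambda>x. ev (U M x) [])) \<le> 1" by simp
    qed
    have "h u1 = h u2"
    proof (rule pser_unique[of "{0..<n}"])
      show "over {0..<n} (h u1)" "over {0..<n} (h u2)"
        unfolding h_def using C(2) by (auto intro!: over_isum over_simps)
      show "evq (qv q) (h u1) = evq (qv q) (h u2)" if "valid q" for q
        using h(1)[OF that assms(2)] h(1)[OF that assms(3)] assms(4)[of "T q"] T(1) that by (simp add: u)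
      \<comment> \<open>With all parameters equal to 1 the series is still an observed probability,
        hence finite.\<close>
      have "valid (\<lambda>_. 1)" "qv (\<lambda>_. 1) = (\<lambda>_. 1)" by (auto simp: valid_def qv_def)
      then have "evq (\<lambda>_. 1) (h u1) \<le> 1" using h(2)[of "\<lambda>_. 1" M1] assms(2) by (simp add: u)
      then show "evq (\<lambda>_. 1) (h u1) < \<infinity>" by (simp add: le_less_trans)
    qed simp
    \<comment> \<open>At the isolating monomial only the series for the point a has a nonzero
      coefficient, so the entry at a can be read off up to the factor \<kappa>.\<close>
    moreover have "cf (h w) m = w a * \<kappa>" for w
    proof -
      have "cf (h w) m = (\<Sum>\<^sup>+ x. if x = a then w x * \<kappa> else 0)"
        unfolding h_def cf_isum by (intro nn_integral_cong) (simp add: C(6))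
      then show ?thesis by (simp only: csum_if_eq)
    qed
    ultimately have "\<kappa> * u1 a = \<kappa> * u2 a" by (metis mult.commute)
    then show ?thesis using C(4,5) by (auto simp: ennreal_mult_cancel_left)
  qed
qed

end
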